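(* Let $n \geq 2$, let $\Omega \subset \mathbf{R}^n$ be a bounded open set with smooth boundary, let $x_0 \in \partial\Omega$, and let $\Gamma = \partial\Omega \setminus V$ where $V$ is an open neighbourhood of $x_0$ in $\partial\Omega$. Then there exists $\delta > 0$ such that the following holds: if $f \in L^\infty(\Omega)$ satisfies $$\int_\Omega f\,u\,v\,dx = 0$$ for every pair of functions $u, v \in C^\infty(\overline{\Omega})$ which are harmonic in $\Omega$ and vanish on $\Gamma$, then $f = 0$ almost everywhere on $B(x_0,\delta) \cap \Omega$.
   Context: $B(x_0,\delta)$ denotes the open Euclidean ball of centre $x_0$ and radius $\delta$. Harmonic functions are allowed to be complex-valued. *)

theory Defs
  imports "HOL-Analysis.Analysis"
begin

definition partial_deriv :: "'n::finite \<Rightarrow> (real^'n \<Rightarrow> 'b::real_normed_vector) \<Rightarrow> real^'n \<Rightarrow> 'b" where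
  "partial_deriv i f x = frechet_derivative f (at x) (axis i 1)"

fun C_k_on :: "nat \<Rightarrow> (real^'n::finite) set \<Rightarrow> (real^'n \<Rightarrow> 'b::real_normed_vector) \<Rightarrow> bool" where
  "C_k_on 0 U f = continuous_on U f"
| "C_k_on (Suc k) U f = (continuous_on U f \<and> (\<forall>x\<in>U. f differentiable (at x)) \<and>
      (\<forall>i. C_k_on k U (partial_deriv i f)))"

definition smooth_on :: "(real^'n::finite) set \<Rightarrow> (real^'n \<Rightarrow> 'b::real_normed_vector) \<Rightarrow> bool" where
  "smooth_on U f = (\<forall>k. C_k_on k U f)"

definition laplacian :: "(real^'n::finite \<Rightarrow> 'b::real_normed_vector) \<Rightarrow> real^'n \<Rightarrow> 'b" where
  "laplacian f x = (\<Sum>i\<in>UNIV. partial_deriv i (partial_deriv i f) x)"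

definition smooth_boundary :: "(real^'n::finite) set \<Rightarrow> bool" where
  "smooth_boundary \<Omega> = (\<forall>p\<in>frontier \<Omega>. \<exists>U (\<phi> :: real^'n \<Rightarrow> real).
      open U \<and> p \<in> U \<and> smooth_on U \<phi> \<and> (\<forall>x\<in>U. x \<in> \<Omega> \<longleftrightarrow> \<phi> x < 0) \<and>
      (\<forall>x\<in>U. \<phi> x = 0 \<longrightarrow> frechet_derivative \<phi> (at x) \<noteq> (\<lambda>h. 0)))"

definition smooth_up_to_boundary :: "(real^'n::finite) set \<Rightarrow> (real^'n \<Rightarrow> 'b::real_normed_vector) \<Rightarrow> bool" where
  "smooth_up_to_boundary \<Omega> u = (\<exists>W. open W \<and> closure \<Omega> \<subseteq> W \<and> smooth_on W u)"

definition harmonic_on :: "(real^'n::finite) set \<Rightarrow> (real^'n \<Rightarrow> 'b::real_normed_vector) \<Rightarrow> bool" where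
  "harmonic_on \<Omega> u = (smooth_on \<Omega> u \<and> (\<forall>x\<in>\<Omega>. laplacian u x = 0))"

definition Linfty_on :: "(real^'n::finite) set \<Rightarrow> (real^'n \<Rightarrow> complex) \<Rightarrow> bool" where
  "Linfty_on \<Omega> f = (set_borel_measurable lebesgue \<Omega> f \<and>
      (\<exists>C. AE x in lebesgue. x \<in> \<Omega> \<longrightarrow> norm (f x) \<le> C))"

end

(*
Near x0 the domain lies outside a ball through x0; let Y be the inversion in that ball, moved so that
Y(x0) = 0. Then Y maps the domain into a ball {y. e . y <= - |y|^2 / (2 s)}. For null vectors z the Kelvin
transforms |x - c|^(2 - n) exp(z . Y) are harmonic, and for z near tau e they are exponentially small on
the boundary away from x0, so solving a Dirichlet problem turns them into admissible functions with an
exponentially small error. Every z near 2 tau e is a sum of two null vectors, whence the integral of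
F exp(z . Y), with F = f |x - c|^(4 - 2 n), is exponentially small. This survives multiplication by a
Gaussian in Y, and a three circles argument moves the decay to the Gaussian averages of F centred near 0,
which forces F = 0 near x0. The Dirichlet problem is solved by penalisation on the whole space: uniform
bounds for tangential and then normal derivatives, Seeley extension, and compactness.
*)
theory Submission
  imports Defs "HOL-Complex_Analysis.Complex_Analysis" "HOL-Probability.Probability"
begin

no_notation fps_nth (infixl "$" 75)

section \<open>Smooth functions\<close>

text \<open>Exponentials of null vectors are small on the boundary away from x0 only for a domain in
  a half space touched at x0; the inversion removes the need for convexity, and the constraint e . y
  <= - |y|^2 / (2 s) later pays for real perturbations of z. Admissible functions are smooth on a
  neighbourhood of the closure, so the Dirichlet solution needs bounds for all derivatives up to the
  boundary. The penalty k |grad fi|^2 flat(fi), with fi a defining function, is shaped for this: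
  divided by |grad fi|^2 it depends on fi alone, hence is constant along tangential fields, and
  tangential differentiation never releases an uncontrolled factor k. Inside the domain it is zero,
  so the equation itself yields the normal derivatives; outside it is so strong that the boundary
  values tend to 0. Decay is known only for z close to tau e, while localisation at a point p needs
  the parameter 2 tau p. The Gaussian makes the growth between the two at most exp(tau rho^2) with
  rho small, and completing the square at 2 tau p produces a Gaussian centred at p. No constant that
  enters the radius may depend on f.\<close>

lemma partial_deriv_eqI: "(f has_derivative f') (at x) ==> partial_deriv i f x = f' (axis i 1)"
unfolding partial_deriv_def by (metis frechet_derivative_at)

lemma partial_deriv_cong:
assumes "open U" "x \<in> U" "!!y. y \<in> U ==> f y = g y"
shows "partial_deriv i f x = partial_deriv i g x"
proof -
have "(f has_derivative f') (at x) \<longleftrightarrow> (g has_derivative f') (at x)" for f'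
 using has_derivative_transform_within_open[OF _ assms(1,2), of f f' UNIV g]
 has_derivative_transform_within_open[OF _ assms(1,2), of g f' UNIV f] assms(3) by auto
then show ?thesis by (simp add: partial_deriv_def frechet_derivative_def)
qed

lemma frechet_derivative_worksI:
"f differentiable F ==> (f has_derivative frechet_derivative f F) F"
using frechet_derivative_works by blast

lemma differentiable_cong_open:
assumes "open U" "x \<in> U" "!!y. y \<in> U ==> f y = g y" "f differentiable (at x)"
shows "g differentiable (at x)"
using assms(4) has_derivative_transform_within_open[OF _ assms(1,2), of f _ UNIV g] assms(3)
unfolding differentiable_def by auto

lemma has_derivative_partial_deriv:
fixes f :: "real^'n::finite => 'b::real_normed_vector"
assumes "f differentiable (at x)"
shows "(f has_derivative (%h. \<Sum>i\<in>UNIV. (h$i) *\<^sub>R partial_deriv i f x)) (at x)"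
proof -
let ?D = "frechet_derivative f (at x)"
have D: "(f has_derivative ?D) (at x)" using assms frechet_derivative_works by blast
then have lin: "linear ?D" using has_derivative_linear by blast
have "?D h = (\<Sum>i\<in>UNIV. (h$i) *\<^sub>R partial_deriv i f x)" for h
proof -
 have "h = (\<Sum>i\<in>UNIV. (h$i) *\<^sub>R axis i 1)"
 by (simp add: vec_eq_iff axis_def if_distrib cong: if_cong)
 then have "?D h = ?D (\<Sum>i\<in>UNIV. (h$i) *\<^sub>R axis i 1)" by simp
 also have "... = (\<Sum>i\<in>UNIV. (h$i) *\<^sub>R ?D (axis i 1))"
 using lin by (simp add: linear_sum linear_scale)
 finally show ?thesis by (simp add: partial_deriv_def)
qed
with D show ?thesis by (metis (no_types, lifting) ext)
qed

lemma has_vector_derivative_partial_deriv: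
fixes f :: "real^'n::finite => 'b::real_normed_vector"
assumes "f differentiable (at (x + t *\<^sub>R v))"
shows "((%t. f (x + t *\<^sub>R v)) has_vector_derivative
 (\<Sum>i\<in>UNIV. (v$i) *\<^sub>R partial_deriv i f (x + t *\<^sub>R v))) (at t)"
proof -
have "((%t. x + t *\<^sub>R v) has_derivative (%s. s *\<^sub>R v)) (at t)"
 by (auto intro!: derivative_eq_intros)
from has_derivative_compose[OF this has_derivative_partial_deriv[OF assms]]
show ?thesis
 unfolding has_vector_derivative_def by (simp add: scaleR_sum_right)
qed

lemma has_real_derivative_partial_deriv:
fixes f :: "real^'n::finite => real"
assumes "f differentiable (at (x + t *\<^sub>R v))"
shows "((%t. f (x + t *\<^sub>R v)) has_real_derivative
 (\<Sum>i\<in>UNIV. (v$i) * partial_deriv i f (x + t *\<^sub>R v))) (at t)"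
using has_vector_derivative_partial_deriv[OF assms]
by (simp add: has_real_derivative_iff_has_vector_derivative)

text \<open>Turns a one-variable computation along a coordinate line into a value of
  \<open>partial_deriv\<close>; differentiability is assumed because the line alone does not give
  it.\<close>

lemma partial_deriv_eq_vector_derivative:
fixes f :: "real^'n::finite => 'b::real_normed_vector"
assumes "f differentiable (at x)"
 and "((%t. f (x + t *\<^sub>R axis i 1)) has_vector_derivative d) (at 0)"
shows "partial_deriv i f x = d"
proof -
have *: "f differentiable (at (x + 0 *\<^sub>R axis i 1))" using assms by simp
have "(\<Sum>j\<in>UNIV. (axis i 1 $ j) *\<^sub>R partial_deriv j f x) = partial_deriv i f x"
 by (simp add: axis_def if_distrib[of "%c. c *\<^sub>R _"] cong: if_cong)
then have "((%t. f (x + t *\<^sub>R axis i 1)) has_vector_derivative partial_deriv i f x) (at 0)"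
 using has_vector_derivative_partial_deriv[OF *] by simp
then show ?thesis using assms(2) vector_derivative_unique_at by blast
qed

lemma partial_deriv_add:
"f differentiable (at x) ==> g differentiable (at x) ==>
 partial_deriv i (%x. f x + g x) x = partial_deriv i f x + partial_deriv i g x"
by (subst partial_deriv_eqI[OF has_derivative_add[OF frechet_derivative_worksI frechet_derivative_worksI]])
 (auto simp: partial_deriv_def)

lemma partial_deriv_bounded_linear:
assumes "bounded_linear h" "f differentiable (at x)"
shows "partial_deriv i (%x. h (f x)) x = h (partial_deriv i f x)"
using partial_deriv_eqI[OF bounded_linear.has_derivative[OF assms(1) frechet_derivative_worksI[OF assms(2)]]]
by (simp add: partial_deriv_def)

lemma partial_deriv_mult:
fixes f g :: "real^'n::finite => 'b::real_normed_algebra"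
assumes "f differentiable (at x)" "g differentiable (at x)"
shows "partial_deriv i (%x. f x * g x) x = partial_deriv i f x * g x + f x * partial_deriv i g x"
using partial_deriv_eqI[OF has_derivative_mult[OF frechet_derivative_worksI[OF assms(1)] frechet_derivative_worksI[OF assms(2)]]]
by (simp add: partial_deriv_def)

lemma partial_deriv_const [simp]: "partial_deriv i (%x. c) x = 0"
by (rule partial_deriv_eqI[of _ "%h. 0"]) auto

lemma partial_deriv_sum:
assumes "finite A" "!!a. a \<in> A ==> f a differentiable (at x)"
shows "partial_deriv i (%x. \<Sum>a\<in>A. f a x) x = (\<Sum>a\<in>A. partial_deriv i (f a) x)"
using assms by (induction A rule: finite_induct)
 (auto simp: partial_deriv_add[of _ _ "%x. sum (%a. f a x) _"])

lemma partial_deriv_real_compose: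
fixes f :: "real^'n::finite => real"
assumes "(h has_real_derivative h') (at (f x))" "f differentiable (at x)"
shows "(%x. h (f x)) differentiable (at x)"
 "partial_deriv i (%x. h (f x)) x = h' * partial_deriv i f x"
proof -
have *: "((%x. h (f x)) has_derivative (%y. h' * frechet_derivative f (at x) y)) (at x)"
 using has_derivative_compose[OF frechet_derivative_worksI[OF assms(2)], of h "(*) h'"] assms(1)
 by (auto simp: has_field_derivative_def)
then show "(%x. h (f x)) differentiable (at x)" by (auto simp: differentiable_def)
show "partial_deriv i (%x. h (f x)) x = h' * partial_deriv i f x"
 using partial_deriv_eqI[OF *] by (simp add: partial_deriv_def)
qed

lemma has_derivative_vec_components:
fixes T :: "real^'m::finite => real^'n::finite"
assumes "!!l. (%x. T x $ l) differentiable (at x)"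
shows "(T has_derivative (%h. \<chi> l. frechet_derivative (%x. T x $ l) (at x) h)) (at x)"
proof -
show ?thesis
 unfolding has_derivative_componentwise_within[of T]
 using frechet_derivative_worksI[OF assms]
 by (auto simp: Basis_vec_def inner_axis)
qed

lemma partial_deriv_compose:
fixes f :: "real^'n::finite => 'b::real_normed_vector" and T :: "real^'m::finite => real^'n"
assumes "f differentiable (at (T x))" "!!l. (%x. T x $ l) differentiable (at x)"
shows "(%x. f (T x)) differentiable (at x)"
 "partial_deriv i (%x. f (T x)) x = (\<Sum>l\<in>UNIV. partial_deriv i (%x. T x $ l) x *\<^sub>R partial_deriv l f (T x))"
proof -
note D = has_derivative_compose[OF has_derivative_vec_components[OF assms(2)] has_derivative_partial_deriv[OF assms(1)]]
show "(%x. f (T x)) differentiable (at x)" using D by (auto simp: differentiable_def)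
show "partial_deriv i (%x. f (T x)) x = (\<Sum>l\<in>UNIV. partial_deriv i (%x. T x $ l) x *\<^sub>R partial_deriv l f (T x))"
 using partial_deriv_eqI[OF D] by (simp add: partial_deriv_def)
qed

lemma partial_deriv_component [simp]:
"partial_deriv i (%x::real^'n::finite. x $ j) x = (if i = j then 1 else 0)"
by (subst partial_deriv_eqI[of _ "%h. h $ j"]) (auto simp: axis_def bounded_linear_imp_has_derivative bounded_linear_vec_nth)

lemma differentiable_component [simp]: "(%x::real^'n::finite. x $ j) differentiable (at x)"
using bounded_linear_imp_has_derivative[OF bounded_linear_vec_nth] by (auto simp: differentiable_def)

section \<open>Closure properties of the classes of k times and infinitely differentiable
  functions\<close>

lemma C_k_on_imp_continuous_on: "C_k_on k U f ==> continuous_on U f"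
by (cases k) auto

lemma C_k_on_SucD: "C_k_on (Suc k) U f ==> C_k_on k U f"
proof (induction k arbitrary: f)
case (Suc k)
then show ?case using C_k_on.simps(2) by metis
qed simp

lemma C_k_on_subset: "C_k_on k U f ==> V \<subseteq> U ==> C_k_on k V f"
by (induction k arbitrary: f) (auto intro: continuous_on_subset)

lemma C_k_on_cong:
assumes "open U" "!!x. x \<in> U ==> f x = g x" "C_k_on k U f"
shows "C_k_on k U g"
using assms(2,3)
proof (induction k arbitrary: f g)
case 0
then show ?case using continuous_on_cong by (metis C_k_on.simps(1))
next
case (Suc k)
have "C_k_on k U (partial_deriv i g)" for i
 using Suc.IH[of "partial_deriv i f" "partial_deriv i g"] Suc.prems
 partial_deriv_cong[OF assms(1), of _ f g i] by auto
moreover have "continuous_on U g" using Suc.prems continuous_on_cong by (metis C_k_on.simps(2))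
moreover have "g differentiable (at x)" if "x \<in> U" for x
 using differentiable_cong_open[OF assms(1) that, of f g] Suc.prems that by simp
ultimately show ?case by simp
qed

text \<open>Lets the partial derivatives be replaced by closed formulas \<open>g i\<close>, the
  usual step in the inductions on the order below. Openness matters since derivatives are taken in
  the whole space.\<close>

lemma C_k_on_SucI:
assumes "open U" "!!x. x \<in> U ==> f differentiable (at x)"
 and "!!i x. x \<in> U ==> partial_deriv i f x = g i x" "!!i. C_k_on k U (g i)"
shows "C_k_on (Suc k) U f"
proof -
have "C_k_on k U (partial_deriv i f)" for i
 using C_k_on_cong[OF assms(1) _ assms(4)[of i], of "partial_deriv i f"] assms(3) by simp
moreover have "continuous_on U f"
 using assms(1,2) by (simp add: continuous_at_imp_continuous_on differentiable_imp_continuous_within)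
ultimately show ?thesis using assms(2) by simp
qed

lemma C_k_on_const: "open U ==> C_k_on k U (%x. c)"
proof (induction k arbitrary: c)
case (Suc k)
show ?case by (rule C_k_on_SucI[where g="%i x. 0"]) (use Suc in auto)
qed simp

lemma C_k_on_add:
assumes "open U" "C_k_on k U f" "C_k_on k U g"
shows "C_k_on k U (%x. f x + g x)"
using assms(2,3)
proof (induction k arbitrary: f g)
case (Suc k)
show ?case
 by (rule C_k_on_SucI[OF assms(1), where g="%i x. partial_deriv i f x + partial_deriv i g x"])
 (use Suc in \<open>auto simp: partial_deriv_add\<close>)
qed (auto intro: continuous_intros)

lemma C_k_on_bounded_linear:
assumes "open U" "bounded_linear h" "C_k_on k U f"
shows "C_k_on k U (%x. h (f x))"
using assms(3)
proof (induction k arbitrary: f)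
case 0
then show ?case using bounded_linear.continuous_on[OF assms(2)] by auto
next
case (Suc k)
have "(%x. h (f x)) differentiable (at x)" if "f differentiable (at x)" for x
 using that bounded_linear.has_derivative[OF assms(2)] unfolding differentiable_def by blast
then show ?case
 by (intro C_k_on_SucI[OF assms(1), where g="%i x. h (partial_deriv i f x)"])
 (use Suc in \<open>auto simp: partial_deriv_bounded_linear[OF assms(2)]\<close>)
qed

lemma C_k_on_mult:
fixes f g :: "real^'n::finite => 'b::real_normed_algebra"
assumes "open U" "C_k_on k U f" "C_k_on k U g"
shows "C_k_on k U (%x. f x * g x)"
using assms(2,3)
proof (induction k arbitrary: f g)
case (Suc k)
have fg: "C_k_on k U f" "C_k_on k U g" using Suc.prems C_k_on_SucD by blast+
show ?case
 by (rule C_k_on_SucI[OF assms(1), where g="%i x. partial_deriv i f x * g x + f x * partial_deriv i g x"])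
 (use Suc fg in \<open>auto intro!: partial_deriv_mult C_k_on_add assms(1)\<close>)
qed (auto intro: continuous_intros)

lemma C_k_on_sum:
assumes "open U" "finite A" "!!a. a \<in> A ==> C_k_on k U (f a)"
shows "C_k_on k U (%x. \<Sum>a\<in>A. f a x)"
using assms(2,3) by (induction A rule: finite_induct) (auto intro: C_k_on_const C_k_on_add assms(1))

lemma C_k_on_inverse:
fixes f :: "real^'n::finite => real"
assumes "open U" "C_k_on k U f" "!!x. x \<in> U ==> f x ~= 0"
shows "C_k_on k U (%x. inverse (f x))"
using assms(2)
proof (induction k)
case 0
then show ?case using assms(3) by (auto intro: continuous_intros)
next
case (Suc k)
have inv: "C_k_on k U (%x. inverse (f x))" using Suc C_k_on_SucD by blast
have der: "(inverse has_real_derivative - (inverse (f x) * inverse (f x))) (at (f x))" if "x \<in> U" for x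
 using DERIV_inverse[of "f x"] assms(3)[OF that] by (simp add: power2_eq_square)
have "C_k_on k U (%x. (- 1) * (inverse (f x) * inverse (f x)) * partial_deriv i f x)" for i
 by (intro C_k_on_mult C_k_on_const assms inv) (use Suc in auto)
then show ?case
 by (intro C_k_on_SucI[OF assms(1), where g="%i x. (- 1) * (inverse (f x) * inverse (f x)) * partial_deriv i f x"])
 (use Suc in \<open>auto simp: partial_deriv_real_compose[OF der]\<close>)
qed

text \<open>Counterpart of \<open>C_k_on\<close> for outer functions on the whole line. The
  derivative is an existential witness, so a closed formula can be supplied directly.\<close>

fun smooth1 :: "nat => (real => real) => bool" where
"smooth1 0 h = continuous_on UNIV h"
| "smooth1 (Suc k) h = (\<exists>h'. (\<forall>t. (h has_real_derivative h' t) (at t)) & smooth1 k h')"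

lemma smooth1_continuous: "smooth1 k h ==> continuous_on UNIV h"
by (cases k) (auto intro!: continuous_at_imp_continuous_on intro: DERIV_isCont)

lemma C_k_on_smooth1:
fixes f :: "real^'n::finite => real"
assumes "open U" "C_k_on k U f" "smooth1 k h"
shows "C_k_on k U (%x. h (f x))"
using assms(2,3)
proof (induction k arbitrary: h)
case 0
then show ?case by (auto intro: continuous_on_compose2)
next
case (Suc k)
obtain h' where h': "!!t. (h has_real_derivative h' t) (at t)" "smooth1 k h'"
 using Suc.prems by auto
have "C_k_on k U f" using Suc C_k_on_SucD by blast
then have "C_k_on k U (%x. h' (f x))" using Suc.IH h' by blast
then show ?case
 by (intro C_k_on_SucI[OF assms(1), where g="%i x. h' (f x) * partial_deriv i f x"])
 (use Suc in \<open>auto simp: partial_deriv_real_compose[OF h'(1)] intro!: C_k_on_mult assms(1)\<close>)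
qed

lemma C_k_on_compose:
fixes f :: "real^'n::finite => real" and T :: "real^'m::finite => real^'n"
assumes "open U" "open V" "C_k_on k V f" "!!l. C_k_on k U (%x. T x $ l)" "!!x. x \<in> U ==> T x \<in> V"
shows "C_k_on k U (%x. f (T x))"
using assms(3,4)
proof (induction k arbitrary: f)
case 0
then have "continuous_on U (%x. \<chi> l. T x $ l)" by (intro continuous_on_vec_lambda) simp
then have "continuous_on U T" by simp
then show ?case using 0 assms(5) by (auto intro: continuous_on_compose2)
next
case (Suc k)
have T: "C_k_on k U (%x. T x $ l)" for l using Suc C_k_on_SucD by blast
have "C_k_on k U (%x. \<Sum>l\<in>UNIV. partial_deriv i (%x. T x $ l) x * partial_deriv l f (T x))" for i
proof (intro C_k_on_sum C_k_on_mult assms(1))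
 fix l
 show "C_k_on k U (partial_deriv i (%x. T x $ l))" using Suc.prems by auto
 show "C_k_on k U (%x. partial_deriv l f (T x))" by (rule Suc.IH[OF _ T]) (use Suc.prems in auto)
qed auto
then show ?case
 by (intro C_k_on_SucI[OF assms(1), where g="%i x. \<Sum>l\<in>UNIV. partial_deriv i (%x. T x $ l) x * partial_deriv l f (T x)"])
 (use Suc.prems assms(5) in \<open>auto simp: partial_deriv_compose[of f T]\<close>)
qed

lemma C_k_on_component: "open U ==> C_k_on k U (%x. x $ j)"
proof (cases k)
case (Suc m)
assume "open U"
then show ?thesis unfolding Suc
 by (intro C_k_on_SucI[where g="%i x. if i = j then 1 else 0"]) (auto intro: C_k_on_const)
qed (auto intro: continuous_intros)

lemma smooth_on_imp_differentiable: "smooth_on U f ==> x \<in> U ==> f differentiable (at x)"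
unfolding smooth_on_def using C_k_on.simps(2) by blast

lemma smooth_on_imp_continuous_on: "smooth_on U f ==> continuous_on U f"
unfolding smooth_on_def using C_k_on_imp_continuous_on by blast

lemma smooth_on_partial_deriv: "smooth_on U f ==> smooth_on U (partial_deriv i f)"
unfolding smooth_on_def by (metis C_k_on.simps(2))

lemma smooth_on_subset: "smooth_on U f ==> V \<subseteq> U ==> smooth_on V f"
unfolding smooth_on_def using C_k_on_subset by blast

lemma smooth_on_cong:
"open U ==> (!!x. x \<in> U ==> f x = g x) ==> smooth_on U f ==> smooth_on U g"
unfolding smooth_on_def using C_k_on_cong by blast

lemma smooth_on_const: "open U ==> smooth_on U (%x. c)"
unfolding smooth_on_def using C_k_on_const by blast

lemma smooth_on_add: "open U ==> smooth_on U f ==> smooth_on U g ==> smooth_on U (%x. f x + g x)"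
unfolding smooth_on_def using C_k_on_add by blast

lemma smooth_on_bounded_linear:
"open U ==> bounded_linear h ==> smooth_on U f ==> smooth_on U (%x. h (f x))"
unfolding smooth_on_def using C_k_on_bounded_linear by blast

lemma smooth_on_minus:
"open U ==> smooth_on U f ==> smooth_on U (%x. - f x)"
using smooth_on_bounded_linear[OF _ bounded_linear_minus[OF bounded_linear_ident]] by blast

lemma smooth_on_diff:
"open U ==> smooth_on U f ==> smooth_on U g ==> smooth_on U (%x. f x - g x)"
using smooth_on_add[of U f "%x. - g x"] smooth_on_minus[of U g] by simp

lemma smooth_on_mult:
fixes f g :: "real^'n::finite => 'b::real_normed_algebra"
shows "open U ==> smooth_on U f ==> smooth_on U g ==> smooth_on U (%x. f x * g x)"
unfolding smooth_on_def using C_k_on_mult by blast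

lemma smooth_on_sum:
"open U ==> finite A ==> (!!a. a \<in> A ==> smooth_on U (f a)) ==> smooth_on U (%x. \<Sum>a\<in>A. f a x)"
unfolding smooth_on_def using C_k_on_sum by blast

lemma smooth_on_inverse:
fixes f :: "real^'n::finite => real"
shows "open U ==> smooth_on U f ==> (!!x. x \<in> U ==> f x ~= 0) ==> smooth_on U (%x. inverse (f x))"
unfolding smooth_on_def using C_k_on_inverse by blast

lemma smooth_on_smooth1:
fixes f :: "real^'n::finite => real"
shows "open U ==> smooth_on U f ==> (!!k. smooth1 k h) ==> smooth_on U (%x. h (f x))"
unfolding smooth_on_def using C_k_on_smooth1 by blast

lemma smooth_on_compose:
fixes f :: "real^'n::finite => real" and T :: "real^'m::finite => real^'n"
shows "open U ==> open V ==> smooth_on V f ==> (!!l. smooth_on U (%x. T x $ l)) ==>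
 (!!x. x \<in> U ==> T x \<in> V) ==> smooth_on U (%x. f (T x))"
unfolding smooth_on_def using C_k_on_compose by blast

lemma smooth_on_component: "open U ==> smooth_on U (%x. x $ j)"
unfolding smooth_on_def using C_k_on_component by blast

lemma smooth_on_local:
fixes f :: "real^'n::finite => 'b::real_normed_vector"
assumes "!!x. x \<in> U ==> \<exists>V. open V & x \<in> V & smooth_on V f"
shows "smooth_on U f"
proof -
have "C_k_on k U g" if "!!x. x \<in> U ==> \<exists>V. open V & x \<in> V & smooth_on V g"
 for k and g :: "real^'n => 'b"
 using that
proof (induction k arbitrary: g)
 case 0
 have "continuous (at x) g" if "x \<in> U" for x
 using 0[OF that] smooth_on_imp_continuous_on continuous_on_eq_continuous_at by blast
 then show ?case by (simp add: continuous_at_imp_continuous_on)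
next
 case (Suc k)
 have "g differentiable (at x)" if "x \<in> U" for x
 using Suc.prems[OF that] smooth_on_imp_differentiable by blast
 moreover have "C_k_on k U (partial_deriv i g)" for i
 by (rule Suc.IH) (use Suc.prems smooth_on_partial_deriv in blast)
 ultimately show ?case
 by (simp add: continuous_at_imp_continuous_on differentiable_imp_continuous_within)
qed
then show ?thesis using assms unfolding smooth_on_def by blast
qed

text \<open>Induction on the order, with an invariant that survives each differentiation. It serves
  limits whose derivatives of all orders are known only as a family of limit functions.\<close>

lemma smooth_on_coinduct:
fixes f :: "real^'n::finite => 'b::real_normed_vector"
assumes "open U" "P f"
 and "!!f x. P f ==> x \<in> U ==> f differentiable (at x)"
 and "!!f i. P f ==> \<exists>g. P g & (\<forall>x\<in>U. partial_deriv i f x = g x)"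
shows "smooth_on U f"
proof -
have "P f ==> C_k_on k U f" for k f
proof (induction k arbitrary: f)
 case 0
 then show ?case using assms(3)
 by (simp add: continuous_at_imp_continuous_on differentiable_imp_continuous_within)
next
 case (Suc k)
 then obtain g where g: "!!i. P (g i)" "!!i x. x \<in> U ==> partial_deriv i f x = g i x"
 using assms(4) by metis
 show ?case by (rule C_k_on_SucI[OF assms(1), of f g]) (use g Suc assms(3) in auto)
qed
then show ?thesis using assms(2) unfolding smooth_on_def by blast
qed

text \<open>The head of the list is the outermost derivative, so induction on the list peels off the
  differentiation performed last.\<close>

primrec pd :: "'n::finite list => (real^'n => 'b::real_normed_vector) => real^'n => 'b" where
"pd [] f = f"
| "pd (i # I) f = partial_deriv i (pd I f)"

lemma pd_append: "pd (I @ J) f = pd I (pd J f)"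
by (induction I) auto

lemma smooth_on_pd: "smooth_on U f ==> smooth_on U (pd I f)"
by (induction I) (auto intro: smooth_on_partial_deriv)

lemma pd_cong: "open U ==> (!!x. x \<in> U ==> f x = g x) ==> x \<in> U ==> pd I f x = pd I g x"
by (induction I arbitrary: x) (auto intro: partial_deriv_cong)

section \<open>Symmetry of second derivatives\<close>

lemma mvt_partial_deriv:
fixes f :: "real^'n::finite => real"
assumes "0 < s" "!!t. 0 <= t ==> t <= s ==> f differentiable (at (x + t *\<^sub>R axis i 1))"
shows "\<exists>t. 0 < t & t < s & f (x + s *\<^sub>R axis i 1) - f x = s * partial_deriv i f (x + t *\<^sub>R axis i 1)"
proof -
have d: "((%t. f (x + t *\<^sub>R axis i 1)) has_real_derivative partial_deriv i f (x + t *\<^sub>R axis i 1)) (at t)"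
 if "0 <= t" "t <= s" for t
 using has_real_derivative_partial_deriv[OF assms(2)[OF that]]
 by (simp add: axis_def if_distrib[of "%c. c * _"] cong: if_cong)
show ?thesis using MVT2[of 0 s "%t. f (x + t *\<^sub>R axis i 1)" "%t. partial_deriv i f (x + t *\<^sub>R axis i 1)"] d assms(1)
 by auto
qed

text \<open>Two applications of the mean value theorem: to the increment of \<open>f\<close> in
  direction \<open>j\<close>, viewed along direction \<open>i\<close>, and then to
  \<open>partial_deriv i f\<close> along direction \<open>j\<close>.\<close>

lemma second_difference:
fixes f :: "real^'n::finite => real"
assumes "smooth_on (ball x r) f" "0 < s" "2 * s < r"
shows "\<exists>y\<in>cball x (2 * s). f (x + s *\<^sub>R axis i 1 + s *\<^sub>R axis j 1) - f (x + s *\<^sub>R axis i 1)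
 - f (x + s *\<^sub>R axis j 1) + f x = s * s * partial_deriv j (partial_deriv i f) y"
proof -
let ?e = "axis i 1 :: real^'n" and ?d = "axis j 1 :: real^'n"
have nrm: "norm (a *\<^sub>R ?e + b *\<^sub>R ?d) <= 2 * s" if "0 <= a" "a <= s" "0 <= b" "b <= s" for a b
 using norm_triangle_ineq[of "a *\<^sub>R ?e" "b *\<^sub>R ?d"] that by simp
have inb: "x + a *\<^sub>R ?e + b *\<^sub>R ?d \<in> ball x r" if "0 <= a" "a <= s" "0 <= b" "b <= s" for a b
 using nrm[OF that] assms(3)
 by (metis add.assoc add_diff_cancel_left' dist_commute dist_norm mem_ball order_le_less_trans)
define g where "g = (%y. f (y + s *\<^sub>R ?d) - f y)"
have T: "(%y::real^'n. (y + s *\<^sub>R ?d) $ l) differentiable (at z)" for l z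
 by (auto intro!: derivative_intros)
have dg: "(%y. f (y + s *\<^sub>R ?d)) differentiable (at (x + t *\<^sub>R ?e))"
 "partial_deriv i (%y. f (y + s *\<^sub>R ?d)) (x + t *\<^sub>R ?e) = partial_deriv i f (x + t *\<^sub>R ?e + s *\<^sub>R ?d)"
 "f differentiable (at (x + t *\<^sub>R ?e))"
 if "0 <= t" "t <= s" for t
proof -
 have D: "f differentiable (at (x + t *\<^sub>R ?e + s *\<^sub>R ?d))"
 using smooth_on_imp_differentiable[OF assms(1) inb[of t s]] that assms by simp
 have pT: "partial_deriv i (%y. y $ l + s * ?d $ l) z = (if i = l then 1 else 0)" for l z
 using partial_deriv_add[of "%y. y $ l" z "%y. s * ?d $ l" i] by simp
 show "(%y. f (y + s *\<^sub>R ?d)) differentiable (at (x + t *\<^sub>R ?e))"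
 "partial_deriv i (%y. f (y + s *\<^sub>R ?d)) (x + t *\<^sub>R ?e) = partial_deriv i f (x + t *\<^sub>R ?e + s *\<^sub>R ?d)"
 using partial_deriv_compose[of f "%y. y + s *\<^sub>R ?d", OF D T]
 by (simp_all add: pT if_distrib[of "%c. c * _"] cong: if_cong)
 show "f differentiable (at (x + t *\<^sub>R ?e))"
 using smooth_on_imp_differentiable[OF assms(1)] inb[of t 0] that assms by simp
qed
have gd: "g differentiable (at (x + t *\<^sub>R ?e))"
 "partial_deriv i g (x + t *\<^sub>R ?e) = partial_deriv i f (x + t *\<^sub>R ?e + s *\<^sub>R ?d) - partial_deriv i f (x + t *\<^sub>R ?e)"
 if "0 <= t" "t <= s" for t
proof -
 have m: "(%y. - f y) differentiable (at (x + t *\<^sub>R ?e))" using dg[OF that] by (auto intro: derivative_intros)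
 have "partial_deriv i (%y. - f y) (x + t *\<^sub>R ?e) = - partial_deriv i f (x + t *\<^sub>R ?e)"
 using partial_deriv_bounded_linear[OF bounded_linear_minus[OF bounded_linear_ident] dg(3)[OF that]] .
 then show "g differentiable (at (x + t *\<^sub>R ?e))"
 "partial_deriv i g (x + t *\<^sub>R ?e) = partial_deriv i f (x + t *\<^sub>R ?e + s *\<^sub>R ?d) - partial_deriv i f (x + t *\<^sub>R ?e)"
 using partial_deriv_add[OF dg(1)[OF that] m, of i] dg[OF that] unfolding g_def
 by (auto intro: derivative_intros)
qed
obtain t where t: "0 < t" "t < s" "g (x + s *\<^sub>R ?e) - g x = s * partial_deriv i g (x + t *\<^sub>R ?e)"
 using mvt_partial_deriv[of s g x i] gd(1) assms(2) by blast
have sm: "smooth_on (ball x r) (partial_deriv i f)" using assms(1) smooth_on_partial_deriv by blast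
have "partial_deriv i f differentiable (at (x + t *\<^sub>R ?e + u *\<^sub>R ?d))" if "0 <= u" "u <= s" for u
 using smooth_on_imp_differentiable[OF sm inb[of t u]] that t by simp
then obtain u where u: "0 < u" "u < s"
 "partial_deriv i f (x + t *\<^sub>R ?e + s *\<^sub>R ?d) - partial_deriv i f (x + t *\<^sub>R ?e)
 = s * partial_deriv j (partial_deriv i f) (x + t *\<^sub>R ?e + u *\<^sub>R ?d)"
 using mvt_partial_deriv[of s "partial_deriv i f" "x + t *\<^sub>R ?e" j] assms(2) by blast
have "x + t *\<^sub>R ?e + u *\<^sub>R ?d \<in> cball x (2 * s)"
 using nrm[of t u] t u
 by (metis add.assoc add_diff_cancel_left' dist_commute dist_norm less_imp_le mem_cball)
moreover have "f (x + s *\<^sub>R ?e + s *\<^sub>R ?d) - f (x + s *\<^sub>R ?e) - f (x + s *\<^sub>R ?d) + f x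
 = s * s * partial_deriv j (partial_deriv i f) (x + t *\<^sub>R ?e + u *\<^sub>R ?d)"
 using t u gd(2)[of t] unfolding g_def by (simp add: algebra_simps)
ultimately show ?thesis by blast
qed

text \<open>The second difference is symmetric in \<open>i\<close> and \<open>j\<close>, and divided
  by \<open>s * s\<close> it is a value of either mixed derivative at some point near
  \<open>x\<close>; continuity forces the two to agree.\<close>

lemma partial_deriv_commute:
fixes f :: "real^'n::finite => real"
assumes "open U" "x \<in> U" "smooth_on U f"
shows "partial_deriv i (partial_deriv j f) x = partial_deriv j (partial_deriv i f) x"
proof -
obtain r where r: "r > 0" "ball x r \<subseteq> U" using assms open_contains_ball by blast
then have sm: "smooth_on (ball x r) f" using assms smooth_on_subset by blast
let ?A = "partial_deriv j (partial_deriv i f)" and ?B = "partial_deriv i (partial_deriv j f)"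
have cont: "continuous (at x) ?A" "continuous (at x) ?B"
 using smooth_on_imp_continuous_on[OF smooth_on_partial_deriv[OF smooth_on_partial_deriv[OF sm]]] r
 by (auto simp: continuous_on_eq_continuous_at)
show ?thesis
proof (rule ccontr)
 assume ne: "?B x ~= ?A x"
 define e where "e = \<bar>?B x - ?A x\<bar> / 2"
 have e: "e > 0" using ne by (simp add: e_def)
 obtain d1 where d1: "d1 > 0" "!!y. dist y x < d1 ==> abs (?A y - ?A x) < e"
 using cont(1) e by (metis continuous_at_eps_delta dist_real_def)
 obtain d2 where d2: "d2 > 0" "!!y. dist y x < d2 ==> \<bar>?B y - ?B x\<bar> < e"
 using cont(2) e by (metis continuous_at_eps_delta dist_real_def)
 \<comment> \<open>Division by 3 keeps the closed ball of radius \<open>2 * s\<close> inside the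
   domain and inside both continuity neighbourhoods.\<close>
 define s where "s = min r (min d1 d2) / 3"
 have s: "0 < s" "2 * s < r" "2 * s < d1" "2 * s < d2" using r d1 d2 by (auto simp: s_def)
 obtain y where y: "y \<in> cball x (2 * s)" "f (x + s *\<^sub>R axis i 1 + s *\<^sub>R axis j 1) - f (x + s *\<^sub>R axis i 1)
 - f (x + s *\<^sub>R axis j 1) + f x = s * s * ?A y"
 using second_difference[OF sm s(1,2)] by blast
 obtain z where z: "z \<in> cball x (2 * s)" "f (x + s *\<^sub>R axis j 1 + s *\<^sub>R axis i 1) - f (x + s *\<^sub>R axis j 1)
 - f (x + s *\<^sub>R axis i 1) + f x = s * s * ?B z"
 using second_difference[OF sm s(1,2)] by blast
 have "x + s *\<^sub>R axis j 1 + s *\<^sub>R axis i 1 = x + s *\<^sub>R axis i 1 + s *\<^sub>R axis j 1"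
 by (simp add: algebra_simps)
 from z(2)[unfolded this] y(2) have "s * s * ?A y = s * s * ?B z" by linarith
 then have "?A y = ?B z" using s by simp
 moreover have "\<bar>?A y - ?A x\<bar> < e" using d1(2)[of y] y s by (simp add: dist_commute)
 moreover have "\<bar>?B z - ?B x\<bar> < e" using d2(2)[of z] z s by (simp add: dist_commute)
 ultimately show False unfolding e_def by argo
qed
qed

section \<open>Families of functions with uniformly bounded derivatives\<close>

fun CB :: "nat => (real^'n::finite) set => ('k => real^'n => real) => bool" where
"CB 0 U F = (\<exists>C. \<forall>k. \<forall>x\<in>U. \<bar>F k x\<bar> <= C)"
| "CB (Suc m) U F = ((\<exists>C. \<forall>k. \<forall>x\<in>U. \<bar>F k x\<bar> <= C) & (\<forall>k. \<forall>x\<in>U. F k differentiable (at x)) &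
 (\<forall>i. CB m U (%k. partial_deriv i (F k))))"

text \<open>Boundedness of all derivatives on \<open>U\<close>, uniform in the index
  \<open>k\<close>. A single function is a family over \<open>unit\<close>; constant families over
  other index types let fixed coefficients multiply sequences.\<close>

definition Cb :: "(real^'n::finite) set => ('k => real^'n => real) => bool" where
"Cb U F = (\<forall>m. CB m U F)"

lemma CB_bound: "CB m U F ==> \<exists>C>0. \<forall>k. \<forall>x\<in>U. \<bar>F k x\<bar> <= C"
proof -
assume "CB m U F"
then obtain C where "\<forall>k. \<forall>x\<in>U. \<bar>F k x\<bar> <= C" by (cases m) auto
then have "\<forall>k. \<forall>x\<in>U. \<bar>F k x\<bar> <= max C 1" by (meson le_max_iff_disj order_trans)
then show ?thesis by (intro exI[of _ "max C 1"]) auto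
qed

lemma CB_SucD: "CB (Suc m) U F ==> CB m U F"
proof (induction m arbitrary: F)
case (Suc m)
have *: "CB (Suc m) U (%k. partial_deriv i (F k))" for i using Suc.prems unfolding CB.simps(2)[of "Suc m"] by blast
show ?case unfolding CB.simps(2)[of m] using Suc.prems Suc.IH[OF *] by (auto simp del: CB.simps(1))
qed simp

lemma CB_subset: "CB m U F ==> V \<subseteq> U ==> CB m V F"
proof (induction m arbitrary: F)
case 0 then show ?case unfolding CB.simps by blast
next
case (Suc m)
have "CB m V (%k. partial_deriv i (F k))" for i
 using Suc.IH[of "%k. partial_deriv i (F k)"] Suc.prems unfolding CB.simps by blast
then show ?case using Suc.prems unfolding CB.simps by blast
qed

lemma CB_reindex: "CB m U F ==> CB m U (%k. F (r k))"
proof (induction m arbitrary: F)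
case (Suc m)
have "CB m U (%k. partial_deriv i (F (r k)))" for i
 using Suc.IH[of "%k. partial_deriv i (F k)"] Suc.prems by simp
then show ?case using Suc.prems by auto
qed auto

lemma CB_cong:
assumes "open U" "!!k x. x \<in> U ==> F k x = G k x" "CB m U F"
shows "CB m U G"
using assms(2,3)
proof (induction m arbitrary: F G)
case 0 then show ?case by auto
next
case (Suc m)
have "CB m U (%k. partial_deriv i (G k))" for i
 by (rule Suc.IH[of "%k. partial_deriv i (F k)"])
 (use Suc.prems in \<open>auto intro: partial_deriv_cong[OF assms(1)]\<close>)
moreover have "G k differentiable (at x)" if "x \<in> U" for k x
 using differentiable_cong_open[OF assms(1) that, of "F k" "G k"] Suc.prems that by simp
ultimately show ?case using Suc.prems by auto
qed

lemma CB_SucI: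
assumes "open U" "CB 0 U F" "!!k x. x \<in> U ==> F k differentiable (at x)"
 and "!!i k x. x \<in> U ==> partial_deriv i (F k) x = G i k x" "!!i. CB m U (G i)"
shows "CB (Suc m) U F"
proof -
have "CB m U (%k. partial_deriv i (F k))" for i
 by (rule CB_cong[OF assms(1) _ assms(5)[of i]]) (use assms(4) in simp)
then show ?thesis using assms(2,3) by simp
qed

lemma CB_0: "CB m U F ==> CB 0 U F" using CB_bound by fastforce

lemma CB_const:
assumes "open U" "!!k. \<bar>c k\<bar> <= C"
shows "CB m U (%k x. c k)"
using assms(2)
proof (induction m arbitrary: c C)
case (Suc k)
have "CB 0 U (%k x. c k)" using Suc.prems by auto
then show ?case by (rule CB_SucI[OF assms(1), where G="%i k x. 0"]) (use Suc.IH[of "%k. 0" 0] in auto)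
qed auto

lemma CB_add:
assumes "open U" "CB m U F" "CB m U G"
shows "CB m U (%k x. F k x + G k x)"
using assms(2,3)
proof (induction m arbitrary: F G)
case 0
then obtain C D where "\<forall>k. \<forall>x\<in>U. \<bar>F k x\<bar> <= C" "\<forall>k. \<forall>x\<in>U. \<bar>G k x\<bar> <= D" by auto
then have "\<forall>k. \<forall>x\<in>U. \<bar>F k x + G k x\<bar> <= C + D" by (meson abs_triangle_ineq add_mono order_trans)
then show ?case by auto
next
case (Suc m)
have "CB 0 U F" "CB 0 U G" using Suc.prems CB_0 by blast+
then obtain C D where "\<forall>k. \<forall>x\<in>U. \<bar>F k x\<bar> <= C" "\<forall>k. \<forall>x\<in>U. \<bar>G k x\<bar> <= D" by auto
then have "\<forall>k. \<forall>x\<in>U. \<bar>F k x + G k x\<bar> <= C + D" by (meson abs_triangle_ineq add_mono order_trans)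
then have "CB 0 U (%k x. F k x + G k x)" by auto
then show ?case
 by (rule CB_SucI[OF assms(1), where G="%i k x. partial_deriv i (F k) x + partial_deriv i (G k) x"])
 (use Suc in \<open>auto simp: partial_deriv_add\<close>)
qed

lemma CB_mult_bound:
assumes "CB m U F" "CB m U G"
shows "CB 0 U (%k x. F k x * G k x)"
proof -
obtain C where C: "C > 0" "\<forall>k. \<forall>x\<in>U. \<bar>F k x\<bar> <= C" using CB_bound[OF assms(1)] by blast
obtain D where "D > 0" "\<forall>k. \<forall>x\<in>U. \<bar>G k x\<bar> <= D" using CB_bound[OF assms(2)] by blast
with C have "\<forall>k. \<forall>x\<in>U. \<bar>F k x * G k x\<bar> <= C * D" unfolding abs_mult by (meson abs_ge_zero less_imp_le mult_mono)
then show ?thesis by auto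
qed

lemma CB_mult:
assumes "open U" "CB m U F" "CB m U G"
shows "CB m U (%k x. F k x * G k x)"
using assms(2,3)
proof (induction m arbitrary: F G)
{ case 0 then show ?case using CB_mult_bound by blast }
{ case (Suc m)
 have FG: "CB m U F" "CB m U G" using Suc.prems CB_SucD by blast+
 show ?case
 by (rule CB_SucI[OF assms(1) CB_mult_bound[OF FG], where G="%i k x. partial_deriv i (F k) x * G k x + F k x * partial_deriv i (G k) x"])
 (use Suc FG in \<open>auto simp: partial_deriv_mult intro!: CB_add assms(1)\<close>) }
qed

lemma CB_sum:
assumes "open U" "finite A" "!!a. a \<in> A ==> CB m U (F a)"
shows "CB m U (%k x. \<Sum>a\<in>A. F a k x)"
using assms(2,3)
proof (induction A rule: finite_induct)
case empty
show ?case using CB_const[OF assms(1), of "%k. 0" 0] by simp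
qed (auto intro: CB_add assms(1))

lemma CB_cmult: "open U ==> CB m U F ==> CB m U (%k x. c * F k x)"
using CB_mult[of U m "%k x. c" F] CB_const[of U "%k. c" "\<bar>c\<bar>" m] by simp

lemma CB_inverse:
assumes "open U" "CB m U F" "0 < c" "!!k x. x \<in> U ==> c <= \<bar>F k x\<bar>"
shows "CB m U (%k x. inverse (F k x))"
using assms(2)
proof (induction m)
have b: "\<bar>inverse (F k x)\<bar> <= inverse c" if "x \<in> U" for k x
 using assms(3) assms(4)[OF that] by (simp add: le_imp_inverse_le)
{ case 0 show ?case using b by auto }
{ case (Suc m)
 have FG: "CB m U F" using Suc.prems CB_SucD by blast
 have der: "(inverse has_real_derivative - (inverse (F k x) * inverse (F k x))) (at (F k x))" if "x \<in> U" for k x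
 using DERIV_inverse[of "F k x"] assms(3) assms(4)[OF that, of k] by (simp add: power2_eq_square abs_if split: if_splits)
 have "CB m U (%k x. (- 1) * (inverse (F k x) * inverse (F k x)) * partial_deriv i (F k) x)" for i
 by (intro CB_mult CB_cmult assms Suc.IH FG) (use Suc in auto)
 moreover have "CB 0 U (%k x. inverse (F k x))" using b by auto
 ultimately show ?case
 by (intro CB_SucI[OF assms(1), where G="%i k x. (- 1) * (inverse (F k x) * inverse (F k x)) * partial_deriv i (F k) x"])
 (use Suc.prems in \<open>auto simp: partial_deriv_real_compose[OF der]\<close>) }
qed

lemma CB_smooth1:
assumes "open U" "CB m U F" "smooth1 m h"
shows "CB m U (%k x. h (F k x))"
using assms(2,3)
proof (induction m arbitrary: h)
have b: "CB 0 U (%k x. h (F k x))" if F: "CB m U F" and "smooth1 m h" for h m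
proof -
 obtain C where C: "C > 0" "\<forall>k. \<forall>x\<in>U. \<bar>F k x\<bar> <= C" using CB_bound[OF F] by auto
 have "compact (h ` {-C..C})"
 using smooth1_continuous[OF that(2)] by (intro compact_continuous_image) (auto intro: continuous_on_subset)
 then obtain B where "\<forall>y\<in>h ` {-C..C}. \<bar>y\<bar> <= B" using compact_imp_bounded bounded_iff by (metis real_norm_def)
 moreover have "F k x \<in> {-C..C}" if "x \<in> U" for k x
 proof -
 have "\<bar>F k x\<bar> <= C" using C that by blast
 then show ?thesis by auto
 qed
 ultimately have "\<forall>k. \<forall>x\<in>U. \<bar>h (F k x)\<bar> <= B" by blast
 then show ?thesis by auto
qed
{ case 0 then show ?case using b by blast }
{ case (Suc m)
 obtain h' where h': "!!t. (h has_real_derivative h' t) (at t)" "smooth1 m h'"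
 using Suc.prems by auto
 have "CB m U F" using Suc CB_SucD by blast
 then have "CB m U (%k x. h' (F k x))" using Suc.IH h' by blast
 then show ?case
 by (intro CB_SucI[OF assms(1) b[OF Suc.prems], where G="%i k x. h' (F k x) * partial_deriv i (F k) x"])
 (use Suc.prems in \<open>auto simp: partial_deriv_real_compose[OF h'(1)] intro!: CB_mult assms(1)\<close>) }
qed

text \<open>One order is lost because order 0 of \<open>CB\<close> asks for boundedness only, and
  continuity has to come from differentiability.\<close>

lemma CB_imp_C_k_on: "open U ==> CB (Suc m) U F ==> C_k_on m U (F k)"
proof (induction m arbitrary: F)
case 0
then show ?case by (simp add: continuous_at_imp_continuous_on differentiable_imp_continuous_within)
next
case (Suc m)
have "C_k_on m U (partial_deriv i (F k))" for i
 using Suc.IH[of "%k. partial_deriv i (F k)"] Suc.prems by simp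
then show ?case using Suc.prems by (intro C_k_on_SucI[where g="%i. partial_deriv i (F k)"]) auto
qed

lemma Cb_imp_smooth_on: "open U ==> Cb U F ==> smooth_on U (F k)"
unfolding Cb_def smooth_on_def by (metis CB_imp_C_k_on)

lemma Cb_bound: "Cb U F ==> \<exists>C>0. \<forall>k. \<forall>x\<in>U. \<bar>F k x\<bar> <= C"
unfolding Cb_def using CB_bound by blast

lemma Cb_partial_deriv: "Cb U F ==> Cb U (%k. partial_deriv i (F k))"
unfolding Cb_def by (metis CB.simps(2))

lemma Cb_pd: "Cb U F ==> Cb U (%k. pd I (F k))"
by (induction I) (auto dest: Cb_partial_deriv)

lemma Cb_subset: "Cb U F ==> V \<subseteq> U ==> Cb V F" unfolding Cb_def using CB_subset by blast
lemma Cb_reindex: "Cb U F ==> Cb U (%k. F (r k))" unfolding Cb_def using CB_reindex by blast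
lemma Cb_const: "open U ==> Cb U (%k x. c)"
by (auto simp: Cb_def intro: CB_const[of _ "%k. c" "\<bar>c\<bar>"])
lemma Cb_add: "open U ==> Cb U F ==> Cb U G ==> Cb U (%k x. F k x + G k x)"
unfolding Cb_def using CB_add by blast
lemma Cb_mult: "open U ==> Cb U F ==> Cb U G ==> Cb U (%k x. F k x * G k x)"
unfolding Cb_def using CB_mult by blast
lemma Cb_cmult: "open U ==> Cb U F ==> Cb U (%k x. c * F k x)"
unfolding Cb_def using CB_cmult by blast
lemma Cb_minus: "open U ==> Cb U F ==> Cb U (%k x. - F k x)"
using Cb_cmult[of U F "-1"] by simp
lemma Cb_diff: "open U ==> Cb U F ==> Cb U G ==> Cb U (%k x. F k x - G k x)"
using Cb_add[of U F "%k x. - G k x"] Cb_minus[of U G] by simp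
lemma Cb_sum: "open U ==> finite A ==> (!!a. a \<in> A ==> Cb U (F a)) ==> Cb U (%k x. \<Sum>a\<in>A. F a k x)"
unfolding Cb_def using CB_sum by blast
lemma Cb_inverse: "open U ==> Cb U F ==> 0 < c ==> (!!k x. x \<in> U ==> c <= \<bar>F k x\<bar>) ==> Cb U (%k x. inverse (F k x))"
unfolding Cb_def using CB_inverse by blast
lemma Cb_smooth1: "open U ==> Cb U F ==> (!!m. smooth1 m h) ==> Cb U (%k x. h (F k x))"
unfolding Cb_def using CB_smooth1 by blast

lemma CbI_pd:
fixes F :: "'k => real^'n::finite => real"
assumes "!!k. smooth_on U (F k)" "!!I. \<exists>C. \<forall>k. \<forall>x\<in>U. \<bar>pd I (F k) x\<bar> <= C"
shows "Cb U F"
proof -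
have "CB m U G" if "!!k. smooth_on U (G k)" "!!I. \<exists>C. \<forall>k. \<forall>x\<in>U. \<bar>pd I (G k) x\<bar> <= C"
 for m and G :: "'k => real^'n => real"
 using that
proof (induction m arbitrary: G)
 case 0
 then show ?case using 0(2)[of "[]"] by simp
next
 case (Suc m)
 have "CB m U (%k. partial_deriv i (G k))" for i
 proof (rule Suc.IH)
 show "\<exists>C. \<forall>k. \<forall>x\<in>U. \<bar>pd I (partial_deriv i (G k)) x\<bar> <= C" for I
 using Suc.prems(2)[of "I @ [i]"] by (simp add: pd_append)
 qed (use Suc.prems smooth_on_partial_deriv in blast)
 moreover have "\<exists>C. \<forall>k. \<forall>x\<in>U. \<bar>G k x\<bar> <= C" using Suc.prems(2)[of "[]"] by simp
 ultimately show ?case using smooth_on_imp_differentiable[OF Suc.prems(1)] by simp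
qed
then show ?thesis using assms unfolding Cb_def by simp
qed

lemma smooth_on_imp_Cb:
assumes "smooth_on W f" "compact K" "K \<subseteq> W" "U \<subseteq> K"
shows "Cb U (%k. f)"
proof (rule CbI_pd)
show "smooth_on U f" using assms smooth_on_subset by blast
fix I
have "continuous_on K (pd I f)"
 using smooth_on_imp_continuous_on[OF smooth_on_pd[OF assms(1)]] assms(3) continuous_on_subset by blast
then have "bounded (pd I f ` K)" using assms(2) compact_continuous_image compact_imp_bounded by blast
then obtain C where "\<forall>y\<in>pd I f ` K. \<bar>y\<bar> <= C" unfolding bounded_iff by auto
then show "\<exists>C. \<forall>k. \<forall>x\<in>U. \<bar>pd I f x\<bar> <= C" using assms(4) by blast
qed

declare CB.simps [simp del]

text \<open>A quadratic remainder is a pointwise inequality, so unlike differentiability it passes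
  to pointwise limits. In this form derivatives of limits, and derivatives at the reflecting
  hypersurface, are obtained.\<close>

lemma has_derivative_quadratic:
fixes f :: "real^'n::finite => real"
assumes "0 < r" and b: "!!y. y \<in> ball x r ==> \<bar>f y - f x - (\<Sum>i\<in>UNIV. (y - x) $ i * d i)\<bar> <= C * (norm (y - x))\<^sup>2"
shows "(f has_derivative (%h. \<Sum>i\<in>UNIV. h $ i * d i)) (at x)"
proof -
have lin: "bounded_linear (%h::real^'n. \<Sum>i\<in>UNIV. h $ i * d i)"
 by (intro bounded_linear_sum bounded_linear_mult_const bounded_linear_vec_nth)
have "((%y. \<bar>C\<bar> * norm (y - x)) \<longlongrightarrow> \<bar>C\<bar> * norm (x - x)) (at x)"
 by (intro tendsto_intros)
then have z: "((%y. \<bar>C\<bar> * norm (y - x)) \<longlongrightarrow> 0) (at x)" by simp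
have "((%y. norm (f y - f x - (\<Sum>i\<in>UNIV. (y - x) $ i * d i)) / norm (y - x)) \<longlongrightarrow> 0) (at x)"
proof (rule tendsto_sandwich[OF _ _ tendsto_const z])
 show "\<forall>\<^sub>F y in at x. norm (f y - f x - (\<Sum>i\<in>UNIV. (y - x) $ i * d i)) / norm (y - x) <= \<bar>C\<bar> * norm (y - x)"
 proof -
 have "\<forall>\<^sub>F y in at x. y \<in> ball x r - {x}"
 using assms(1) by (simp add: eventually_at) (metis dist_commute)
 then show ?thesis
 proof eventually_elim
 case (elim y)
 then have "norm (f y - f x - (\<Sum>i\<in>UNIV. (y - x) $ i * d i)) <= \<bar>C\<bar> * norm (y - x) * norm (y - x)"
 using order_trans[OF b[of y] mult_right_mono[OF abs_ge_self[of C], of "(norm (y - x))\<^sup>2"]]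
 by (simp add: power2_eq_square mult.assoc)
 then show ?case using elim by (simp add: divide_le_eq)
 qed
 qed
qed auto
then show ?thesis using lin by (simp add: has_derivative_iff_norm)
qed

text \<open>Mean value theorem along the segment. One constant serves all \<open>k\<close>, and the
  condition on the segment takes the place of convexity of \<open>U\<close>.\<close>

lemma Cb_lipschitz:
fixes F :: "'k => real^'n::finite => real"
assumes "Cb U F"
shows "\<exists>C>0. \<forall>k x y. closed_segment x y \<subseteq> U --> \<bar>F k y - F k x\<bar> <= C * norm (y - x)"
proof -
have "\<exists>C>0. \<forall>k. \<forall>x\<in>U. \<bar>partial_deriv i (F k) x\<bar> <= C" for i
 using Cb_bound[OF Cb_partial_deriv[OF assms]] .
then obtain C where C: "!!i. C i > 0" "!!i k x. x \<in> U ==> \<bar>partial_deriv i (F k) x\<bar> <= C i" by metis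
have pos: "(\<Sum>i\<in>UNIV. C i) > 0" using C by (simp add: sum_pos)
have "\<bar>F k y - F k x\<bar> <= (\<Sum>i\<in>UNIV. C i) * norm (y - x)" if seg: "closed_segment x y \<subseteq> U" for k x y
proof -
 have inU: "x + t *\<^sub>R (y - x) \<in> U" if "0 <= t" "t <= 1" for t
 proof -
 have "x + t *\<^sub>R (y - x) = (1 - t) *\<^sub>R x + t *\<^sub>R y" by (simp add: algebra_simps)
 then have "x + t *\<^sub>R (y - x) \<in> closed_segment x y" using that by (auto simp: in_segment)
 then show ?thesis using seg by blast
 qed
 have "F k differentiable (at (x + t *\<^sub>R (y - x)))" if "0 <= t" "t <= 1" for t
 using assms inU[OF that] unfolding Cb_def by (metis CB.simps(2))
 then have "!!t. 0 <= t ==> t <= 1 ==> ((%t. F k (x + t *\<^sub>R (y - x))) has_real_derivative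
 (\<Sum>i\<in>UNIV. ((y - x)$i) * partial_deriv i (F k) (x + t *\<^sub>R (y - x)))) (at t)"
 using has_real_derivative_partial_deriv by blast
 from MVT2[OF _ this, of 0 1] obtain t where t: "0 < t" "t < 1"
 "F k y - F k x = (\<Sum>i\<in>UNIV. ((y - x)$i) * partial_deriv i (F k) (x + t *\<^sub>R (y - x)))" by auto
 have "\<bar>((y - x)$i) * partial_deriv i (F k) (x + t *\<^sub>R (y - x))\<bar> <= norm (y - x) * C i" for i
 unfolding abs_mult using C(2)[OF inU, of t i k] t component_le_norm_cart[of "y - x" i]
 by (intro mult_mono) auto
 then have "\<bar>F k y - F k x\<bar> <= (\<Sum>i\<in>UNIV. norm (y - x) * C i)"
 unfolding t by (intro order_trans[OF sum_abs] sum_mono) blast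
 then show ?thesis by (simp add: sum_distrib_right mult.commute)
qed
then show ?thesis using pos by blast
qed

lemma Cb_taylor:
fixes F :: "'k => real^'n::finite => real"
assumes "Cb U F"
shows "\<exists>C>0. \<forall>k x y. closed_segment x y \<subseteq> U -->
 \<bar>F k y - F k x - (\<Sum>i\<in>UNIV. (y - x) $ i * partial_deriv i (F k) x)\<bar> <= C * (norm (y - x))\<^sup>2"
proof -
have "\<exists>C>0. \<forall>k x y. closed_segment x y \<subseteq> U --> \<bar>partial_deriv i (F k) y - partial_deriv i (F k) x\<bar> <= C * norm (y - x)" for i
 using Cb_lipschitz[OF Cb_partial_deriv[OF assms]] .
then obtain C where C: "!!i. C i > 0" "!!i k x y. closed_segment x y \<subseteq> U ==>
 \<bar>partial_deriv i (F k) y - partial_deriv i (F k) x\<bar> <= C i * norm (y - x)" by metis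
have pos: "(\<Sum>i\<in>UNIV. C i) > 0" using C by (simp add: sum_pos)
have "\<bar>F k y - F k x - (\<Sum>i\<in>UNIV. (y - x) $ i * partial_deriv i (F k) x)\<bar> <= (\<Sum>i\<in>UNIV. C i) * (norm (y - x))\<^sup>2"
 if seg: "closed_segment x y \<subseteq> U" for k x y
proof -
 have inS: "x + t *\<^sub>R (y - x) \<in> closed_segment x y" if "0 <= t" "t <= 1" for t
 proof -
 have "x + t *\<^sub>R (y - x) = (1 - t) *\<^sub>R x + t *\<^sub>R y" by (simp add: algebra_simps)
 then show ?thesis using that by (auto simp: in_segment)
 qed
 have "F k differentiable (at (x + t *\<^sub>R (y - x)))" if "0 <= t" "t <= 1" for t
 using assms inS[OF that] seg unfolding Cb_def by (metis CB.simps(2) subsetD)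
 then have "!!t. 0 <= t ==> t <= 1 ==> ((%t. F k (x + t *\<^sub>R (y - x))) has_real_derivative
 (\<Sum>i\<in>UNIV. ((y - x)$i) * partial_deriv i (F k) (x + t *\<^sub>R (y - x)))) (at t)"
 using has_real_derivative_partial_deriv by blast
 from MVT2[OF _ this, of 0 1] obtain t where t: "0 < t" "t < 1"
 "F k y - F k x = (\<Sum>i\<in>UNIV. ((y - x)$i) * partial_deriv i (F k) (x + t *\<^sub>R (y - x)))" by auto
 let ?z = "x + t *\<^sub>R (y - x)"
 have "closed_segment x ?z \<subseteq> U"
 using seg inS[of t] t subset_closed_segment[of x ?z x y] by auto
 moreover have nz: "norm (?z - x) <= norm (y - x)" using t by (simp add: mult_left_le_one_le)
 ultimately have D: "\<bar>partial_deriv i (F k) ?z - partial_deriv i (F k) x\<bar> <= C i * norm (y - x)" for i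
 using C(2)[of x ?z i k] mult_left_mono[OF nz, of "C i"] C(1)[of i] by linarith
 have "\<bar>((y - x)$i) * (partial_deriv i (F k) ?z - partial_deriv i (F k) x)\<bar> <= norm (y - x) * (C i * norm (y - x))" for i
 unfolding abs_mult using D component_le_norm_cart[of "y - x" i] by (intro mult_mono) auto
 then have "\<bar>\<Sum>i\<in>UNIV. ((y - x)$i) * (partial_deriv i (F k) ?z - partial_deriv i (F k) x)\<bar> <= (\<Sum>i\<in>UNIV. norm (y - x) * (C i * norm (y - x)))"
 by (intro order_trans[OF sum_abs] sum_mono) blast
 moreover have "F k y - F k x - (\<Sum>i\<in>UNIV. (y - x) $ i * partial_deriv i (F k) x) =
 (\<Sum>i\<in>UNIV. ((y - x)$i) * (partial_deriv i (F k) ?z - partial_deriv i (F k) x))"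
 unfolding t by (simp add: right_diff_distrib sum_subtractf)
 moreover have "(\<Sum>i\<in>UNIV. norm (y - x) * (C i * norm (y - x))) = (\<Sum>i\<in>UNIV. C i) * (norm (y - x))\<^sup>2"
 by (simp add: sum_distrib_right power2_eq_square algebra_simps)
 ultimately show ?thesis by simp
qed
then show ?thesis using pos by blast
qed

lemma closed_segment_subset_ball: "(y::'a::real_normed_vector) \<in> ball x r ==> closed_segment x y \<subseteq> ball x r"
using closed_segment_subset[of x "ball x r" y] convex_ball[of x r] zero_le_dist[of x y]
by (simp del: zero_le_dist)

text \<open>Arzela-Ascoli for all derivatives at once. A diagonal subsequence converges on a
  countable dense set for every multi-index; uniform Lipschitz bounds carry the convergence to all
  of \<open>U\<close>, and uniform Taylor bounds identify the limit of a derivative with the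
  derivative of the limit.\<close>

lemma Cb_convergent_subsequence:
fixes F :: "nat => real^'n::finite => real"
assumes "open U" "Cb U F"
shows "\<exists>r v. strict_mono r & Cb U (%_::unit. v) & (\<forall>I. \<forall>x\<in>U. (%k. pd I (F (r k)) x) \<longlonglongrightarrow> pd I v x)"
proof -
obtain D where D: "countable D" "D \<subseteq> U" "U \<subseteq> closure D" using separable by blast
have "countable (lists (UNIV :: 'n set))" by (intro countable_lists countable_finite finite)
then have "countable (UNIV :: 'n list set)" by simp
then have cS: "countable ((UNIV :: 'n list set) \<times> D)" using D by blast
have "\<exists>B>0. \<forall>k. \<forall>x\<in>U. \<bar>pd I (F k) x\<bar> <= B" for I
 using Cb_bound[OF Cb_pd[OF assms(2)]] .
then obtain B where B: "!!I. B I > 0" "!!I k x. x \<in> U ==> \<bar>pd I (F k) x\<bar> <= B I" by metis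
\<comment> \<open>Dividing by \<open>B I\<close> brings the derivatives of all orders under the
  single bound 1 that the selection principle asks for.\<close>
have "norm (case p of (I, x) => pd I (F n) x / B I) <= 1" if "p \<in> UNIV \<times> D" for n p
 using that B(1) B(2) D(2) by (auto simp: abs_divide abs_of_pos[OF B(1)] divide_le_eq)
then obtain r where r: "strict_mono (r :: nat => nat)" "!!p. p \<in> UNIV \<times> D ==> \<exists>l. (%n. (case p of (I, x) => pd I (F (r n)) x / B I)) \<longlonglongrightarrow> l"
 using function_convergent_subsequence[OF cS, of "%n p. case p of (I, x) => pd I (F n) x / B I" 1] by blast
have cD: "convergent (%n. pd I (F (r n)) d)" if dD: "d \<in> D" for I d
proof -
 obtain l where "(%n. pd I (F (r n)) d / B I) \<longlonglongrightarrow> l" using r(2)[of "(I, d)"] dD by auto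
 from tendsto_mult_right[OF this, of "B I"] show ?thesis using B(1)[of I] by (auto simp: convergent_def)
qed
have conv: "convergent (%n. pd I (F (r n)) x)" if x: "x \<in> U" for I x
proof -
 obtain rh where rh: "rh > 0" "ball x rh \<subseteq> U" using assms(1) x open_contains_ball by blast
 obtain L where L: "L > 0" "!!k x y. closed_segment x y \<subseteq> U ==> \<bar>pd I (F k) y - pd I (F k) x\<bar> <= L * norm (y - x)"
 using Cb_lipschitz[OF Cb_pd[OF assms(2)], of I] by blast
 have "Cauchy (%n. pd I (F (r n)) x)"
 proof (rule metric_CauchyI)
 fix e :: real assume e: "e > 0"
 \<comment> \<open>Within distance \<open>s\<close> the values change by less than e/4, so two such
   changes and a Cauchy error of e/4 stay below e.\<close>
 define s where "s = min rh (e / (4 * L))"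
 have "s > 0" using rh e L by (simp add: s_def)
 then obtain d where d: "d \<in> D" "dist d x < s" using D(3) x closure_approachable by (metis subsetD)
 have "closed_segment x d \<subseteq> U"
 using closed_segment_subset_ball[of d x rh] d rh by (auto simp: s_def dist_commute)
 then have near: "\<bar>pd I (F k) d - pd I (F k) x\<bar> < e / 4" for k
 proof -
 have "L * norm (d - x) < L * (e / (4 * L))" using d(2) L by (intro mult_strict_left_mono) (auto simp: s_def dist_norm)
 also have "... = e / 4" using L by simp
 finally show ?thesis using L(2)[of x d k] \<open>closed_segment x d \<subseteq> U\<close> by linarith
 qed
 have "Cauchy (%n. pd I (F (r n)) d)" using cD[OF d(1)] convergent_Cauchy by blast
 then obtain M where M: "!!m n. m >= M ==> n >= M ==> dist (pd I (F (r m)) d) (pd I (F (r n)) d) < e / 4"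
 using e by (metis metric_CauchyD zero_less_divide_iff zero_less_numeral)
 have "dist (pd I (F (r m)) x) (pd I (F (r n)) x) < e" if "m >= M" "n >= M" for m n
 using M[OF that] near[of "r m"] near[of "r n"] unfolding dist_real_def by linarith
 then show "\<exists>M. \<forall>m\<ge>M. \<forall>n\<ge>M. dist (pd I (F (r m)) x) (pd I (F (r n)) x) < e" by blast
 qed
 then show ?thesis by (simp add: Cauchy_convergent)
qed
define V where "V I x = lim (%n. pd I (F (r n)) x)" for I x
have V: "(%n. pd I (F (r n)) x) \<longlonglongrightarrow> V I x" if "x \<in> U" for I x
 using conv[OF that] unfolding V_def by (simp add: convergent_LIMSEQ_iff)
have der: "(V I has_derivative (%h. \<Sum>i\<in>UNIV. h $ i * V (i # I) x)) (at x)" if x: "x \<in> U" for I x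
proof -
 obtain rh where rh: "rh > 0" "ball x rh \<subseteq> U" using assms(1) x open_contains_ball by blast
 obtain L where L: "L > 0" "!!k x y. closed_segment x y \<subseteq> U ==>
 \<bar>pd I (F k) y - pd I (F k) x - (\<Sum>i\<in>UNIV. (y - x) $ i * partial_deriv i (pd I (F k)) x)\<bar> <= L * (norm (y - x))\<^sup>2"
 using Cb_taylor[OF Cb_pd[OF assms(2)], of I] by blast
 show ?thesis
 proof (rule has_derivative_quadratic[OF rh(1), where C=L])
 fix y assume y: "y \<in> ball x rh"
 have seg: "closed_segment x y \<subseteq> U" using closed_segment_subset_ball[OF y] rh by blast
 have "(%n. \<bar>pd I (F (r n)) y - pd I (F (r n)) x - (\<Sum>i\<in>UNIV. (y - x) $ i * pd (i # I) (F (r n)) x)\<bar>)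
 \<longlonglongrightarrow> \<bar>V I y - V I x - (\<Sum>i\<in>UNIV. (y - x) $ i * V (i # I) x)\<bar>"
 using y rh x by (intro tendsto_intros V) auto
 then show "\<bar>V I y - V I x - (\<Sum>i\<in>UNIV. (y - x) $ i * V (i # I) x)\<bar> <= L * (norm (y - x))\<^sup>2"
 by (rule LIMSEQ_le_const2) (use L(2)[OF seg] in auto)
 qed
qed
have pV: "partial_deriv i (V I) x = V (i # I) x" if "x \<in> U" for i I x
 using partial_deriv_eqI[OF der[OF that]] by (simp add: axis_def if_distrib[of "%c. c * _"] cong: if_cong)
have pdV: "pd I (V []) x = V I x" if "x \<in> U" for I x
 using that
proof (induction I arbitrary: x)
 case (Cons i I)
 have "partial_deriv i (pd I (V [])) x = partial_deriv i (V I) x"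
 by (rule partial_deriv_cong[OF assms(1) Cons.prems]) (rule Cons.IH)
 then show ?case using pV[OF Cons.prems] by simp
qed simp
have "smooth_on U (V [])"
proof (rule smooth_on_coinduct[OF assms(1), where P="%f. \<exists>I. f = V I"])
 show "!!f x. \<exists>I. f = V I ==> x \<in> U ==> f differentiable at x"
 using der differentiable_def by blast
 show "\<exists>g. (\<exists>I. g = V I) & (\<forall>x\<in>U. partial_deriv i f x = g x)" if "\<exists>I. f = V I" for f i
 using that pV by blast
qed blast
moreover have "\<bar>pd I (V []) x\<bar> <= B I" if "x \<in> U" for I x
 unfolding pdV[OF that]
 by (rule LIMSEQ_le_const2[OF tendsto_rabs[OF V[OF that]]]) (use B(2)[OF that] in blast)
ultimately have "Cb U (%_::unit. V [])" by (intro CbI_pd) auto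
then show ?thesis using r(1) V pdV by (intro exI[of _ r] exI[of _ "V []"]) simp
qed

lemma laplacian_eq_pd: "laplacian f x = (\<Sum>i\<in>UNIV. pd [i, i] f x)"
by (simp add: laplacian_def)

lemma translate_derivatives:
fixes f :: "real^'n::finite => real"
assumes "smooth_on UNIV f"
shows "smooth_on UNIV (%x. f (x + a))" "partial_deriv i (%x. f (x + a)) x = partial_deriv i f (x + a)"
proof -
have sT: "smooth_on UNIV (%x::real^'n. (x + a) $ l)" for l
 by (simp add: smooth_on_add smooth_on_component smooth_on_const)
show "smooth_on UNIV (%x. f (x + a))"
 by (rule smooth_on_compose[OF open_UNIV open_UNIV assms]) (use sT in auto)
have pT: "partial_deriv i (%y. y $ l + a $ l) z = (if i = l then 1 else 0)" for l and z :: "real^'n"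
 using partial_deriv_add[of "%y. y $ l" z "%y. a $ l" i] by simp
show "partial_deriv i (%x. f (x + a)) x = partial_deriv i f (x + a)"
 using partial_deriv_compose(2)[of f "%x. x + a" x i] smooth_on_imp_differentiable[OF assms]
 smooth_on_imp_differentiable[OF sT]
 by (simp add: pT if_distrib[of "%c. c * _"] cong: if_cong)
qed

text \<open>Maclaurin expansions to third order in +h and -h: the first-order terms cancel and only
  the third-derivative remainders are left.\<close>

lemma second_difference_quotient:
fixes F :: "'k => real^'n::finite => real"
assumes "Cb UNIV F"
shows "\<exists>C>0. \<forall>k x i h. 0 < h -->
 \<bar>F k (x + h *\<^sub>R axis i 1) + F k (x - h *\<^sub>R axis i 1) - 2 * F k x - h\<^sup>2 * pd [i, i] (F k) x\<bar> <= C * h ^ 3"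
proof -
have "\<exists>C>0. \<forall>k. \<forall>x\<in>UNIV. \<bar>pd [i, i, i] (F k) x\<bar> <= C" for i
 using Cb_bound[OF Cb_pd[OF assms]] .
then obtain C where C: "!!i. C i > 0" "!!i k x. \<bar>pd [i, i, i] (F k) x\<bar> <= C i" by (metis UNIV_I)
have pos: "(\<Sum>i\<in>UNIV. C i) > 0" using C by (simp add: sum_pos)
have "\<bar>F k (x + h *\<^sub>R axis i 1) + F k (x - h *\<^sub>R axis i 1) - 2 * F k x - h\<^sup>2 * pd [i, i] (F k) x\<bar> <= (\<Sum>i\<in>UNIV. C i) * h ^ 3"
 if h: "0 < h" for k x i h
proof -
 define g where "g m t = pd (replicate m i) (F k) (x + t *\<^sub>R axis i 1)" for m t
 have d: "DERIV (g m) t :> g (Suc m) t" for m t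
 proof -
 have "pd (replicate m i) (F k) differentiable (at (x + t *\<^sub>R axis i 1))"
 using smooth_on_imp_differentiable[OF smooth_on_pd[OF Cb_imp_smooth_on[OF open_UNIV assms]]] by blast
 from has_real_derivative_partial_deriv[OF this] show ?thesis
 unfolding g_def by (simp add: axis_def if_distrib[of "%c. c * _"] cong: if_cong)
 qed
 have mac: "\<exists>t. g 0 s = g 0 0 + g 1 0 * s + g 2 0 / 2 * s\<^sup>2 + g 3 t / 6 * s ^ 3" for s
 proof -
 obtain t where "g 0 s = (\<Sum>m<3. g m 0 / fact m * s ^ m) + g 3 t / fact 3 * s ^ 3"
 using Maclaurin_all_le[of g "g 0" s 3] d by blast
 then show ?thesis by (intro exI[of _ t]) (simp add: numeral_eq_Suc)
 qed
 obtain t1 where t1: "g 0 h = g 0 0 + g 1 0 * h + g 2 0 / 2 * h\<^sup>2 + g 3 t1 / 6 * h ^ 3" using mac by blast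
 obtain t2 where t2: "g 0 (-h) = g 0 0 + g 1 0 * (-h) + g 2 0 / 2 * (-h)\<^sup>2 + g 3 t2 / 6 * (-h) ^ 3" using mac by blast
 have "F k (x + h *\<^sub>R axis i 1) + F k (x - h *\<^sub>R axis i 1) - 2 * F k x - h\<^sup>2 * pd [i, i] (F k) x
 = g 0 h + g 0 (-h) - 2 * g 0 0 - h\<^sup>2 * g 2 0"
 by (simp add: g_def numeral_eq_Suc)
 also have "... = (g 3 t1 - g 3 t2) / 6 * h ^ 3" unfolding t1 t2 by (simp add: field_simps power3_eq_cube power2_eq_square)
 finally have e: "F k (x + h *\<^sub>R axis i 1) + F k (x - h *\<^sub>R axis i 1) - 2 * F k x - h\<^sup>2 * pd [i, i] (F k) x = (g 3 t1 - g 3 t2) / 6 * h ^ 3" .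
 have g3: "\<bar>g 3 t\<bar> <= C i" for t using C(2)[of i k] by (simp add: g_def numeral_eq_Suc)
 have "\<bar>g 3 t1 - g 3 t2\<bar> <= 6 * C i" using g3[of t1] g3[of t2] C(1)[of i] by linarith
 then have "\<bar>(g 3 t1 - g 3 t2) / 6\<bar> <= C i" by (simp add: abs_divide)
 also have "C i <= (\<Sum>i\<in>UNIV. C i)" using C(1) by (intro member_le_sum) (auto simp: less_imp_le)
 finally show ?thesis unfolding e abs_mult using h by (simp add: mult_right_mono)
qed
then show ?thesis using pos by blast
qed

section \<open>The equation $-\Delta u + W u = f$ on the whole space\<close>

text \<open>Off-diagonal part of the difference Laplacian of step \<open>h\<close>;
  \<open>diag_weight\<close> is the diagonal part. The scheme is imposed at every point of the space
  rather than on a lattice, so that it commutes with partial derivatives.\<close>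

definition nbr_sum :: "real => (real^'n::finite => real) => real^'n => real" where
"nbr_sum h g x = (\<Sum>i\<in>UNIV. g (x + h *\<^sub>R axis i 1) + g (x - h *\<^sub>R axis i 1)) / h\<^sup>2"

definition mesh :: "nat => real" where "mesh N = 1 / real (Suc N)"

definition diag_weight :: "'n::finite itself => nat => real" where
"diag_weight _ N = 2 * real CARD('n) / (mesh N)\<^sup>2"

lemma mesh_pos: "mesh N > 0" by (simp add: mesh_def)

lemma mesh_tendsto: "mesh \<longlonglongrightarrow> 0"
unfolding mesh_def using LIMSEQ_inverse_real_of_nat by (simp add: inverse_eq_divide)

lemma diag_weight_pos: "diag_weight TYPE('n::finite) N > 0"
using mesh_pos[of N] by (simp add: diag_weight_def)

lemma nbr_sum_mono: "(!!x. g x <= k x) ==> nbr_sum h g x <= nbr_sum h k x"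
unfolding nbr_sum_def by (intro divide_right_mono sum_mono add_mono) auto

lemma nbr_sum_abs: "\<bar>nbr_sum h g x\<bar> <= nbr_sum h (%x. \<bar>g x\<bar>) x"
unfolding nbr_sum_def abs_divide
by (auto intro!: divide_right_mono order_trans[OF sum_abs] sum_mono order_trans[OF abs_triangle_ineq])

lemma nbr_sum_cmult: "nbr_sum h (%x. c * g x) x = c * nbr_sum h g x"
unfolding nbr_sum_def by (simp add: sum_distrib_left[symmetric] distrib_left[symmetric])

lemma nbr_sum_diff: "nbr_sum h (%x. f x - g x) x = nbr_sum h f x - nbr_sum h g x"
unfolding nbr_sum_def by (simp add: diff_divide_distrib[symmetric] sum_subtractf[symmetric] algebra_simps)

lemma smooth_on_nbr_sum:
fixes g :: "real^'n::finite => real"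
assumes "smooth_on UNIV g"
shows "smooth_on UNIV (nbr_sum h g)" "partial_deriv i (nbr_sum h g) x = nbr_sum h (partial_deriv i g) x"
proof -
have s: "smooth_on UNIV (%x. g (x + h *\<^sub>R axis j 1) + g (x - h *\<^sub>R axis j 1))" for j
 using translate_derivatives(1)[OF assms, of "h *\<^sub>R axis j 1"]
 translate_derivatives(1)[OF assms, of "- (h *\<^sub>R axis j 1)"] smooth_on_add by force
have sS: "smooth_on UNIV (%x. (\<Sum>j\<in>UNIV. g (x + h *\<^sub>R axis j 1) + g (x - h *\<^sub>R axis j 1)))"
 by (rule smooth_on_sum) (use s in auto)
have e: "nbr_sum h g = (%x. (\<Sum>j\<in>UNIV. g (x + h *\<^sub>R axis j 1) + g (x - h *\<^sub>R axis j 1)) * (1 / h\<^sup>2))"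
 by (auto simp: nbr_sum_def)
show "smooth_on UNIV (nbr_sum h g)" unfolding e
 by (intro smooth_on_mult sS smooth_on_const open_UNIV)
have p: "partial_deriv i (%x. g (x + h *\<^sub>R axis j 1) + g (x - h *\<^sub>R axis j 1)) x
 = partial_deriv i g (x + h *\<^sub>R axis j 1) + partial_deriv i g (x - h *\<^sub>R axis j 1)" for j
proof -
 have d: "(%x. g (x + a)) differentiable (at x)" for a
 using smooth_on_imp_differentiable[OF translate_derivatives(1)[OF assms]] by blast
 show ?thesis
 using partial_deriv_add[OF d[of "h *\<^sub>R axis j 1"] d[of "- (h *\<^sub>R axis j 1)"], of i]
 translate_derivatives(2)[OF assms, of i "h *\<^sub>R axis j 1" x]
 translate_derivatives(2)[OF assms, of i "- (h *\<^sub>R axis j 1)" x] by simp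
qed
have "partial_deriv i (%x. (\<Sum>j\<in>UNIV. g (x + h *\<^sub>R axis j 1) + g (x - h *\<^sub>R axis j 1))) x
 = (\<Sum>j\<in>UNIV. partial_deriv i g (x + h *\<^sub>R axis j 1) + partial_deriv i g (x - h *\<^sub>R axis j 1))"
 by (subst partial_deriv_sum) (auto simp: p intro: smooth_on_imp_differentiable[OF s])
then show "partial_deriv i (nbr_sum h g) x = nbr_sum h (partial_deriv i g) x"
 unfolding e
 by (subst partial_deriv_mult) (auto simp: nbr_sum_def intro: smooth_on_imp_differentiable[OF sS])
qed

lemma discrete_laplacian_approx:
fixes F :: "'k => real^'n::finite => real"
assumes "Cb UNIV F"
shows "\<exists>C>0. \<forall>k x N. \<bar>nbr_sum (mesh N) (F k) x - diag_weight TYPE('n) N * F k x - laplacian (F k) x\<bar> <= C * mesh N"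
proof -
obtain C where C: "C > 0" "!!k x i h. 0 < h ==>
 \<bar>F k (x + h *\<^sub>R axis i 1) + F k (x - h *\<^sub>R axis i 1) - 2 * F k x - h\<^sup>2 * pd [i, i] (F k) x\<bar> <= C * h ^ 3"
 using second_difference_quotient[OF assms] by blast
have "\<bar>nbr_sum h (F k) x - diag_weight TYPE('n) N * F k x - laplacian (F k) x\<bar> <= (real CARD('n) * C) * h"
 if h: "h = mesh N" for k x N h
proof -
 have hp: "h > 0" using h mesh_pos by simp
 let ?q = "%i. F k (x + h *\<^sub>R axis i 1) + F k (x - h *\<^sub>R axis i 1) - 2 * F k x - h\<^sup>2 * pd [i, i] (F k) x"
 have "nbr_sum h (F k) x - diag_weight TYPE('n) N * F k x - laplacian (F k) x = (\<Sum>i\<in>UNIV. ?q i) / h\<^sup>2"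
 unfolding nbr_sum_def diag_weight_def laplacian_eq_pd h[symmetric] using hp
 by (simp add: sum_subtractf sum_distrib_left[symmetric] diff_divide_distrib)
 moreover have "\<bar>\<Sum>i\<in>UNIV. ?q i\<bar> <= (\<Sum>i\<in>(UNIV::'n set). C * h ^ 3)"
 by (intro order_trans[OF sum_abs] sum_mono C hp)
 then have "\<bar>\<Sum>i\<in>UNIV. ?q i\<bar> / h\<^sup>2 <= (real CARD('n) * C) * h" using hp
 by (simp add: divide_le_eq power3_eq_cube power2_eq_square mult_ac)
 ultimately show ?thesis by (simp add: abs_divide)
qed
then show ?thesis using C by (intro exI[of _ "real CARD('n) * C"]) auto
qed

text \<open>The strict excess \<open>de\<close> absorbs the consistency error, which is of the order
  of the mesh uniformly in \<open>x\<close>.\<close>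

lemma discrete_supersolution:
fixes S W c :: "real^'n::finite => real"
assumes "Cb UNIV (%_::unit. S)" "de > 0" "!!x. c x + de <= - laplacian S x + W x * S x"
shows "\<exists>N0. \<forall>N\<ge>N0. \<forall>x. c x <= (diag_weight TYPE('n) N + W x) * S x - nbr_sum (mesh N) S x"
proof -
obtain C where C: "C > 0" "!!x N. \<bar>nbr_sum (mesh N) S x - diag_weight TYPE('n) N * S x - laplacian S x\<bar> <= C * mesh N"
 using discrete_laplacian_approx[OF assms(1)] by auto
have "(%N. C * mesh N) \<longlonglongrightarrow> C * 0" by (intro tendsto_intros mesh_tendsto)
then have "eventually (%N. C * mesh N < de) sequentially" using assms(2) by (simp add: order_tendstoD)
then obtain N0 where N0: "!!N. N >= N0 ==> C * mesh N < de" unfolding eventually_sequentially by blast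
have "c x <= (diag_weight TYPE('n) N + W x) * S x - nbr_sum (mesh N) S x" if "N >= N0" for N x
 using N0[OF that] C(2)[of N x] assms(3)[of x] by (simp add: distrib_right)
then show ?thesis by blast
qed

text \<open>The derivatives of a solution of the difference scheme solve the same scheme with a right
hand side of lower order, so all of them are controlled by one supersolution.\<close>

lemma scheme_CB:
fixes W rh :: "real^'n::finite => real" and g :: "nat \<times> nat => real^'n => real"
assumes W: "Cb UNIV (%_::unit. W)" "!!x. W x >= 0"
 and rh: "!!x. rh x >= 0" "!!x. rh x <= B"
 "!!N x. 1 <= (diag_weight TYPE('n) (M + N) + W x) * rh x - nbr_sum (mesh (M + N)) rh x"
 and "!!p. smooth_on UNIV (g p)" "!!N x. g (N, 0) x = 0"
 and "!!N j x. (diag_weight TYPE('n) (M + N) + W x) * g (N, Suc j) x = nbr_sum (mesh (M + N)) (g (N, j)) x + R (N, j) x"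
 and "CB m UNIV R"
shows "CB m UNIV g"
using assms(6-9)
proof (induction m arbitrary: g R)
case (0 g R)
obtain C where C: "C > 0" "!!p x. \<bar>R p x\<bar> <= C" using CB_bound[OF 0(4)] by auto
\<comment> \<open>Comparison along the iteration: as \<open>rh\<close> is a discrete supersolution
  with right hand side 1, the function \<open>C * rh\<close> dominates every iterate, whatever
  \<open>N\<close> and \<open>j\<close> are.\<close>
have "\<bar>g (N, j) x\<bar> <= C * rh x" for N j x
proof (induction j arbitrary: x)
 case 0
 then show ?case using \<open>!!N x. g (N, 0) x = 0\<close> rh C by simp
next
 case (Suc j)
 let ?d = "diag_weight TYPE('n) (M + N) + W x"
 have d: "?d > 0" using diag_weight_pos W(2) by (metis add_pos_nonneg)
 have "?d * \<bar>g (N, Suc j) x\<bar> = \<bar>nbr_sum (mesh (M + N)) (g (N, j)) x + R (N, j) x\<bar>"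
 using 0(3)[of N x j] d by (metis abs_mult abs_of_pos)
 also have "... <= nbr_sum (mesh (M + N)) (%x. C * rh x) x + C"
 using nbr_sum_abs[of "mesh (M + N)" "g (N, j)" x] nbr_sum_mono[of "%x. \<bar>g (N, j) x\<bar>" "%x. C * rh x" "mesh (M + N)" x, OF Suc] C(2)[of "(N, j)" x]
 by linarith
 also have "... = C * (nbr_sum (mesh (M + N)) rh x + 1)" by (simp add: nbr_sum_cmult distrib_left)
 also have "... <= C * (?d * rh x)" using rh(3)[of N x] C by (intro mult_left_mono) auto
 finally have "?d * \<bar>g (N, Suc j) x\<bar> <= ?d * (C * rh x)" by (simp add: mult.left_commute)
 then show ?case using d by simp
qed
then have "\<bar>g p x\<bar> <= C * B" for p x
 using mult_left_mono[OF rh(2)[of x], of C] C by (metis less_imp_le order_trans surj_pair)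
then show ?case by (auto simp: CB.simps)
next
case (Suc m g R)
have gm: "CB m UNIV g" using Suc.IH[OF Suc.prems(1-3) CB_SucD[OF Suc.prems(4)]] .
have W': "CB m UNIV (%p. partial_deriv i W)" for i
 using CB_reindex[of m UNIV "%_::unit. partial_deriv i W" "%p. ()"] Cb_partial_deriv[OF W(1), of i] by (simp add: Cb_def)
have "CB m UNIV (%p. partial_deriv i (g p))" for i
\<comment> \<open>Differentiating the scheme moves the derivative of \<open>W\<close> to the right,
  multiplied by the next iterate; being already bounded up to order \<open>m\<close>, this product
  is an admissible remainder.\<close>
proof (rule Suc.IH[where R="%p x. partial_deriv i (R p) x - partial_deriv i W x * g (fst p, Suc (snd p)) x"])
 show "smooth_on UNIV (partial_deriv i (g p))" for p using smooth_on_partial_deriv Suc.prems(1) by blast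
 have "g (N, 0) = (%x. 0)" for N using Suc.prems(2) by auto
 then show "partial_deriv i (g (N, 0)) x = 0" for N x by simp
 have Rd: "R p differentiable (at x)" for p x using Suc.prems(4) unfolding CB.simps by blast
 have Wd: "W differentiable (at x)" for x
 using smooth_on_imp_differentiable[OF Cb_imp_smooth_on[OF open_UNIV W(1)]] by blast
 show "(diag_weight TYPE('n) (M + N) + W x) * partial_deriv i (g (N, Suc j)) x =
 nbr_sum (mesh (M + N)) (partial_deriv i (g (N, j))) x +
 (partial_deriv i (R (N, j)) x - partial_deriv i W x * g (fst (N, j), Suc (snd (N, j))) x)" for N j x
 proof -
 let ?d = "%x. diag_weight TYPE('n) (M + N) + W x"
 have dd: "?d differentiable (at x)" using Wd by (auto intro: derivative_intros)
 have pd: "partial_deriv i ?d x = partial_deriv i W x"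
 using partial_deriv_add[of "%x. diag_weight TYPE('n) (M + N)" x W i] Wd by simp
 have gd: "g (N, Suc j) differentiable (at x)" using smooth_on_imp_differentiable Suc.prems(1) by blast
 have nd: "nbr_sum (mesh (M + N)) (g (N, j)) differentiable (at x)"
 using smooth_on_imp_differentiable[OF smooth_on_nbr_sum(1)[OF Suc.prems(1)]] by blast
 have "partial_deriv i (%x. ?d x * g (N, Suc j) x) x = partial_deriv i (%x. nbr_sum (mesh (M + N)) (g (N, j)) x + R (N, j) x) x"
 using Suc.prems(3) by simp
 then show ?thesis
 unfolding partial_deriv_mult[OF dd gd] partial_deriv_add[OF nd Rd] smooth_on_nbr_sum(2)[OF Suc.prems(1)] pd
 by simp
 qed
 have "CB m UNIV (%p. g (fst p, Suc (snd p)))" using CB_reindex[OF gm, of "%p. (fst p, Suc (snd p))"] .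
 from CB_add[OF open_UNIV _ CB_cmult[OF open_UNIV CB_mult[OF open_UNIV W' this], of "-1"]]
 show "CB m UNIV (%p x. partial_deriv i (R p) x - partial_deriv i W x * g (fst p, Suc (snd p)) x)"
 using Suc.prems(4) by (simp add: CB.simps(2))
qed
then show ?case
 using CB_0[OF gm] smooth_on_imp_differentiable[OF Suc.prems(1)] by (simp add: CB.simps)
qed

text \<open>Jacobi iteration for the difference scheme. All iterates for all fine meshes have
  uniformly bounded derivatives, and on each mesh the iteration contracts, so an iterate with
  residual at most the mesh can be picked; a subsequence of these converges to a solution. A strict
  supersolution \<open>S\<close> dominates all iterates on fine meshes, hence also the limit; later
  one \<open>S\<close> serves all penalties.\<close>

lemma helmholtz_solve:
fixes W f rh :: "real^'n::finite => real"
assumes W: "Cb UNIV (%_::unit. W)" "!!x. W x >= 0" and f: "Cb UNIV (%_::unit. f)"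
 and rh: "Cb UNIV (%_::unit. rh)" "!!x. rh x >= 0" "!!x. 2 <= - laplacian rh x + W x * rh x"
shows "\<exists>u. Cb UNIV (%_::unit. u) & (\<forall>x. - laplacian u x + W x * u x = f x) &
 (\<forall>S de. Cb UNIV (%_::unit. S) --> de > 0 --> (\<forall>x. S x >= 0) -->
 (\<forall>x. \<bar>f x\<bar> + de <= - laplacian S x + W x * S x) --> (\<forall>x. \<bar>u x\<bar> <= S x))"
proof -
let ?dw = "diag_weight TYPE('n)"
\<comment> \<open>The 2 in the hypothesis on \<open>rh\<close> splits into the 1 required by the
  scheme and a 1 that pays for the consistency error.\<close>
obtain N0 where N0: "!!N x. N >= N0 ==> 1 <= (?dw N + W x) * rh x - nbr_sum (mesh N) rh x"
 using discrete_supersolution[OF rh(1), of 1 "%x. 1" W] rh(3) by (metis (full_types) one_add_one zero_less_one)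
obtain B where B: "B > 0" "!!x. \<bar>rh x\<bar> <= B" using Cb_bound[OF rh(1)] by auto
obtain Bf where Bf: "Bf > 0" "!!x. \<bar>f x\<bar> <= Bf" using Cb_bound[OF f] by auto
obtain BW where BW: "BW > 0" "!!x. \<bar>W x\<bar> <= BW" using Cb_bound[OF W(1)] by auto
have sW: "smooth_on UNIV W" and sf: "smooth_on UNIV f" by (rule Cb_imp_smooth_on[OF open_UNIV W(1)], rule Cb_imp_smooth_on[OF open_UNIV f])
have dpos: "?dw N + W x > 0" for N x using diag_weight_pos W(2) by (metis add_pos_nonneg)
define T where "T N = rec_nat (%x. 0) (%j g x. (f x + nbr_sum (mesh N) g x) * inverse (?dw N + W x))" for N
have T0: "T N 0 x = 0" for N x by (simp add: T_def)
have TS: "T N (Suc j) = (%x. (f x + nbr_sum (mesh N) (T N j) x) * inverse (?dw N + W x))" for N j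
 by (simp add: T_def)
have smT: "smooth_on UNIV (T N j)" for N j
proof (induction j)
 case 0
 have "T N 0 = (%x. 0)" by (simp add: T_def)
 then show ?case using smooth_on_const[OF open_UNIV] by metis
next
 case (Suc j)
 have ne: "?dw N + W x ~= 0" for x using dpos[of N x] by simp
 show ?case unfolding TS
 by (intro smooth_on_mult smooth_on_add smooth_on_inverse smooth_on_const open_UNIV sf sW smooth_on_nbr_sum(1) Suc ne)
qed
have eqT: "(?dw N + W x) * T N (Suc j) x = nbr_sum (mesh N) (T N j) x + f x" for N j x
 using dpos[of N x] by (simp add: TS field_simps)
have CT: "Cb UNIV (%p. T (N0 + fst p) (snd p))"
 unfolding Cb_def
proof
 fix m
 have "CB m UNIV (%p::nat\<times>nat. f)"
 using CB_reindex[of m UNIV "%_::unit. f" "%p. ()"] f by (simp add: Cb_def)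
 note fm = this
 show "CB m UNIV (%p. T (N0 + fst p) (snd p))"
 proof (rule scheme_CB[OF W rh(2), where g="%p. T (N0 + fst p) (snd p)" and R="%p. f" and M=N0 and B=B])
 show "rh x <= B" for x using B(2)[of x] by linarith
 show "1 <= (?dw (N0 + N) + W x) * rh x - nbr_sum (mesh (N0 + N)) rh x" for N x
 by (rule N0) simp
 show "smooth_on UNIV (T (N0 + fst p) (snd p))" for p :: "nat \<times> nat" by (rule smT)
 show "T (N0 + fst (N, 0)) (snd (N, 0)) x = 0" for N x by (simp add: T0)
 show "(?dw (N0 + N) + W x) * T (N0 + fst (N, Suc j)) (snd (N, Suc j)) x =
 nbr_sum (mesh (N0 + N)) (T (N0 + fst (N, j)) (snd (N, j))) x + f x" for N j x
 by (simp only: fst_conv snd_conv eqT)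
 qed (rule fm)
qed
define D where "D N j x = T N (Suc j) x - T N j x" for N j x
have eqD: "(?dw N + W x) * D N (Suc j) x = nbr_sum (mesh N) (D N j) x" for N j x
 unfolding D_def[abs_def] nbr_sum_diff right_diff_distrib eqT by simp
have res: "\<exists>j. \<forall>x. \<bar>(?dw N + W x) * D N j x\<bar> <= mesh N" if N: "N >= N0" for N
proof -
 \<comment> \<open>By the bound \<open>dle\<close> below, (diagonal + W) rh <= 1/q, so the scheme
   inequality for \<open>rh\<close> becomes nbr_sum rh <= (1 - q) (diagonal + W) rh: the increments
   shrink by 1 - q when measured against \<open>rh\<close>. The ratio depends on \<open>N\<close>,
   which is harmless since only existence of a good \<open>j\<close> is needed.\<close>
 define q where "q = 1 / ((?dw N + BW) * B)"
 have p0: "?dw N + BW > 0" by (rule add_pos_pos[OF diag_weight_pos BW(1)])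
 have npos: "nbr_sum (mesh N) rh x >= 0" for x
 using nbr_sum_mono[of "%x. 0" rh "mesh N" x] rh(2) by (simp add: nbr_sum_def)
 have dle: "(?dw N + W x) * rh x <= (?dw N + BW) * B" for x
 using BW(2)[of x] B(2)[of x] rh(2)[of x] dpos[of N x] by (intro mult_mono) (auto simp: abs_le_iff)
 have q: "0 < q" "q <= 1"
 using p0 B N0[OF N, of 0] dle[of 0] npos[of 0] by (auto simp: q_def)
 have contr: "nbr_sum (mesh N) rh x <= (1 - q) * ((?dw N + W x) * rh x)" for x
 proof -
 have "q * ((?dw N + W x) * rh x) <= 1" using dle[of x] p0 B by (simp add: q_def divide_le_eq)
 then show ?thesis using N0[OF N, of x] by (simp add: left_diff_distrib)
 qed
 have "\<bar>D N j x\<bar> <= (1 - q) ^ j * (Bf * rh x)" for j x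
 proof (induction j arbitrary: x)
 case 0
 have "(?dw N + W x) * D N 0 x = f x" using eqT[of N x 0] T0 unfolding D_def by (simp add: nbr_sum_def)
 then have "(?dw N + W x) * \<bar>D N 0 x\<bar> = \<bar>f x\<bar>" using dpos[of N x] by (metis abs_mult abs_of_pos)
 also have "... <= Bf * 1" using Bf by simp
 also have "... <= Bf * ((?dw N + W x) * rh x)" using N0[OF N, of x] npos[of x] Bf(1) by (intro mult_left_mono) auto
 finally have "(?dw N + W x) * \<bar>D N 0 x\<bar> <= (?dw N + W x) * (Bf * rh x)" by (simp add: mult.left_commute)
 then show ?case using dpos[of N x] by simp
 next
 case (Suc j)
 let ?c = "(1 - q) ^ j * Bf"
 have c: "?c >= 0" using q Bf by simp
 have "(?dw N + W x) * \<bar>D N (Suc j) x\<bar> = \<bar>nbr_sum (mesh N) (D N j) x\<bar>"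
 using eqD[of N x j] dpos[of N x] by (metis abs_mult abs_of_pos)
 also have "... <= nbr_sum (mesh N) (%x. ?c * rh x) x"
 using nbr_sum_abs[of "mesh N" "D N j" x] nbr_sum_mono[of "%x. \<bar>D N j x\<bar>" "%x. ?c * rh x" "mesh N" x] Suc
 by (simp add: mult.assoc)
 also have "... <= ?c * ((1 - q) * ((?dw N + W x) * rh x))"
 unfolding nbr_sum_cmult using contr[of x] c by (intro mult_left_mono)
 finally have "(?dw N + W x) * \<bar>D N (Suc j) x\<bar> <= (?dw N + W x) * ((1 - q) ^ Suc j * (Bf * rh x))"
 by (simp add: mult_ac)
 then show ?case using dpos[of N x] by simp
 qed
 then have bd: "\<bar>(?dw N + W x) * D N j x\<bar> <= (1 - q) ^ j * (Bf * ((?dw N + BW) * B))" for j x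
 proof -
 have "\<bar>(?dw N + W x) * D N j x\<bar> <= (?dw N + W x) * ((1 - q) ^ j * (Bf * rh x))"
 unfolding abs_mult abs_of_pos[OF dpos] using dpos[of N x] \<open>\<bar>D N j x\<bar> <= _\<close> by (intro mult_left_mono) auto
 also have "... = (1 - q) ^ j * (Bf * ((?dw N + W x) * rh x))" by (simp add: mult_ac)
 also have "... <= (1 - q) ^ j * (Bf * ((?dw N + BW) * B))"
 using dle[of x] q Bf by (intro mult_left_mono) auto
 finally show ?thesis .
 qed
 have "(%j. (1 - q) ^ j * (Bf * ((?dw N + BW) * B))) \<longlonglongrightarrow> 0 * (Bf * ((?dw N + BW) * B))"
 using q by (intro tendsto_intros LIMSEQ_realpow_zero) auto
 then have "eventually (%j. (1 - q) ^ j * (Bf * ((?dw N + BW) * B)) < mesh N) sequentially"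
 using mesh_pos[of N] by (simp add: order_tendstoD)
 then obtain j where "(1 - q) ^ j * (Bf * ((?dw N + BW) * B)) < mesh N" by (auto simp: eventually_sequentially)
 then show ?thesis using bd by (meson less_imp_le order_trans)
qed
then obtain J where J: "!!N x. N >= N0 ==> \<bar>(?dw N + W x) * D N (J N) x\<bar> <= mesh N" by metis
define v where "v N = T (N0 + N) (J (N0 + N))" for N
have Cv: "Cb UNIV v" using Cb_reindex[OF CT, of "%N. (N, J (N0 + N))"] by (simp add: v_def[abs_def])
obtain C where C: "C > 0" "!!k x N. \<bar>nbr_sum (mesh N) (v k) x - ?dw N * v k x - laplacian (v k) x\<bar> <= C * mesh N"
 using discrete_laplacian_approx[OF Cv] by blast
have eqv: "\<bar>- laplacian (v N) x + W x * v N x - f x\<bar> <= (C + 1) * mesh (N0 + N)" for N x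
proof -
 have "(?dw (N0 + N) + W x) * D (N0 + N) (J (N0 + N)) x = nbr_sum (mesh (N0 + N)) (v N) x + f x - (?dw (N0 + N) + W x) * v N x"
 unfolding D_def right_diff_distrib eqT v_def by simp
 then show ?thesis
 using J[of "N0 + N" x] C(2)[of "N0 + N" N x] by (simp add: distrib_right abs_le_iff)
qed
obtain r u where ru: "strict_mono r" "Cb UNIV (%_::unit. u)" "!!I x. (%k. pd I (v (r k)) x) \<longlonglongrightarrow> pd I u x"
 using Cb_convergent_subsequence[OF open_UNIV Cv] by auto
have u0: "(%k. v (r k) x) \<longlonglongrightarrow> u x" for x using ru(3)[of "[]"] by simp
have m0: "(%k. mesh (N0 + r k)) \<longlonglongrightarrow> 0"
 using LIMSEQ_subseq_LIMSEQ[OF LIMSEQ_ignore_initial_segment[OF mesh_tendsto, of N0] ru(1)] by (simp add: o_def add.commute)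
have "- laplacian u x + W x * u x - f x = 0" for x
proof -
 have "(%k. \<bar>- laplacian (v (r k)) x + W x * v (r k) x - f x\<bar>) \<longlonglongrightarrow> \<bar>- laplacian u x + W x * u x - f x\<bar>"
 unfolding laplacian_eq_pd by (intro tendsto_intros ru(3) u0)
 moreover have "(%k. (C + 1) * mesh (N0 + r k)) \<longlonglongrightarrow> (C + 1) * 0" by (intro tendsto_intros m0)
 ultimately have "\<bar>- laplacian u x + W x * u x - f x\<bar> <= (C + 1) * 0"
 by (rule LIMSEQ_le) (use eqv in auto)
 then show ?thesis by simp
qed
moreover have "\<bar>u x\<bar> <= S x"
 if S: "Cb UNIV (%_::unit. S)" "de > 0" "!!x. S x >= 0" "!!x. \<bar>f x\<bar> + de <= - laplacian S x + W x * S x" for S de x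
proof -
 obtain N1 where N1: "!!N x. N >= N1 ==> \<bar>f x\<bar> <= (?dw N + W x) * S x - nbr_sum (mesh N) S x"
 using discrete_supersolution[OF S(1,2), of "%x. \<bar>f x\<bar>" W] S(4) by blast
 have TSb: "\<bar>T N j x\<bar> <= S x" if N: "N >= N1" for N j x
 proof (induction j arbitrary: x)
 case 0 then show ?case using S(3) T0 by simp
 next
 case (Suc j)
 have "(?dw N + W x) * \<bar>T N (Suc j) x\<bar> = \<bar>nbr_sum (mesh N) (T N j) x + f x\<bar>"
 using eqT[of N x j] dpos[of N x] by (metis abs_mult abs_of_pos)
 also have "... <= nbr_sum (mesh N) S x + \<bar>f x\<bar>"
 using nbr_sum_abs[of "mesh N" "T N j" x] nbr_sum_mono[of "%x. \<bar>T N j x\<bar>" S "mesh N" x, OF Suc] by linarith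
 also have "... <= (?dw N + W x) * S x" using N1[OF N, of x] by linarith
 finally show ?case using dpos[of N x] by simp
 qed
 have "\<exists>K. \<forall>k\<ge>K. \<bar>v (r k) x\<bar> <= S x"
 proof (intro exI[of _ N1] allI impI)
 fix k assume "k >= N1"
 then have "N0 + r k >= N1" using seq_suble[OF ru(1), of k] by linarith
 then show "\<bar>v (r k) x\<bar> <= S x" unfolding v_def by (rule TSb)
 qed
 then show ?thesis by (rule LIMSEQ_le_const2[OF tendsto_rabs[OF u0]])
qed
ultimately show ?thesis using ru(2) by (intro exI[of _ u]) (auto simp: diff_eq_eq)
qed

section \<open>Cutoff functions\<close>

lemma smooth1_SucD: "smooth1 (Suc k) h ==> smooth1 k h"
proof (induction k arbitrary: h)
case 0 then show ?case by (auto intro!: continuous_at_imp_continuous_on intro: DERIV_isCont)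
next
case (Suc k) then show ?case by (metis smooth1.simps(2))
qed

lemma smooth1_SucI:
"(!!t. (h has_real_derivative h' t) (at t)) ==> smooth1 k h' ==> smooth1 (Suc k) h"
by auto

lemma smooth1_const: "smooth1 k (%t. c)"
proof (induction k arbitrary: c)
case (Suc k)
then show ?case by (auto intro!: exI[of _ "%t. 0"])
qed simp

lemma smooth1_id: "smooth1 k (%t. t)"
proof (cases k)
case (Suc m)
then show ?thesis using smooth1_const[of m 1] by (auto intro!: exI[of _ "%t. 1"] derivative_eq_intros)
qed simp

lemma smooth1_add: "smooth1 k f ==> smooth1 k g ==> smooth1 k (%t. f t + g t)"
proof (induction k arbitrary: f g)
case (Suc k)
then obtain f' g' where "\<forall>t. (f has_real_derivative f' t) (at t)" "smooth1 k f'"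
 "\<forall>t. (g has_real_derivative g' t) (at t)" "smooth1 k g'" by auto
then show ?case using Suc.IH[of f' g'] by (auto intro!: exI[of _ "%t. f' t + g' t"] DERIV_add)
qed (auto intro: continuous_intros)

lemma smooth1_mult: "smooth1 k f ==> smooth1 k g ==> smooth1 k (%t. f t * g t)"
proof (induction k arbitrary: f g)
case (Suc k)
then obtain f' g' where d: "!!t. (f has_real_derivative f' t) (at t)" "smooth1 k f'"
 "!!t. (g has_real_derivative g' t) (at t)" "smooth1 k g'" by auto
have "smooth1 k (%t. f' t * g t + g' t * f t)"
 using Suc.IH[of f' g] Suc.IH[of g' f] d smooth1_SucD[OF Suc.prems(1)] smooth1_SucD[OF Suc.prems(2)] smooth1_add by blast
then show ?case by (rule smooth1_SucI[OF DERIV_mult[OF d(1,3)]])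
qed (auto intro: continuous_intros)

lemma smooth1_inverse: "smooth1 k f ==> (!!t. f t ~= 0) ==> smooth1 k (%t. inverse (f t))"
proof (induction k)
case (Suc k)
then obtain f' where d: "!!t. (f has_real_derivative f' t) (at t)" "smooth1 k f'" by auto
have i: "smooth1 k (%t. inverse (f t))" using Suc smooth1_SucD by blast
have "smooth1 k (%t. (-1) * (f' t * (inverse (f t) * inverse (f t))))"
 by (intro smooth1_mult smooth1_const i d)
moreover have "((%t. inverse (f t)) has_real_derivative (-1) * (f' t * (inverse (f t) * inverse (f t)))) (at t)" for t
 using DERIV_inverse_fun[OF d(1) Suc.prems(2), of t] by (simp add: power2_eq_square)
ultimately show ?case by (intro smooth1_SucI[where h'="%t. (-1) * (f' t * (inverse (f t) * inverse (f t)))"])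
qed (auto intro: continuous_intros)

lemma smooth1_affine: "smooth1 k f ==> smooth1 k (%t. f (a * t + b))"
proof (induction k arbitrary: f)
case 0 then show ?case by (auto intro!: continuous_on_compose2[of UNIV f] continuous_intros)
next
case (Suc k)
then obtain f' where d: "!!t. (f has_real_derivative f' t) (at t)" "smooth1 k f'" by auto
have "smooth1 k (%t. f' (a * t + b) * a)" by (intro smooth1_mult smooth1_const Suc.IH d)
moreover have "((%t. f (a * t + b)) has_real_derivative f' (a * t + b) * a) (at t)" for t
 by (rule DERIV_chain2[OF d(1)]) (auto intro!: derivative_eq_intros)
ultimately show ?case by (intro smooth1_SucI[where h'="%t. f' (a * t + b) * a"])
qed

text \<open>The functions p(1/t) exp(-1/t) form a class closed under differentiation, so smoothness
  at 0 needs a single differentiation step.\<close>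

definition flat_exp :: "real poly => real => real" where
"flat_exp p t = (if t <= 0 then 0 else poly p (1 / t) * exp (- (1 / t)))"

text \<open>A single term of the exponential series gives s^i exp(-s) <= i!, and a polynomial is a
  finite sum of such powers.\<close>

lemma poly_exp_bound: "\<exists>C. \<forall>s\<ge>0. \<bar>poly p s\<bar> * exp (- s) <= (C::real)"
proof -
have pw: "s ^ i * exp (- s) <= fact i" if "s >= 0" for s :: real and i
proof -
 have "(%n. s ^ n /\<^sub>R fact n) sums exp s" by (rule exp_converges)
 then have "(\<Sum>n\<in>{i}. s ^ n /\<^sub>R fact n) <= exp s"
 using that by (simp only: sums_iff) (intro sum_le_suminf[THEN order_trans], auto)
 then have "s ^ i <= fact i * exp s" by (simp add: field_simps)
 then show ?thesis by (simp add: exp_minus field_simps)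
qed
have "\<bar>poly p s\<bar> * exp (- s) <= (\<Sum>i\<le>degree p. \<bar>coeff p i\<bar> * fact i)" if s: "s >= 0" for s :: real
proof -
 have "\<bar>poly p s\<bar> <= (\<Sum>i\<le>degree p. \<bar>coeff p i\<bar> * s ^ i)"
 unfolding poly_altdef using s by (intro order_trans[OF sum_abs]) (simp add: abs_mult)
 then have "\<bar>poly p s\<bar> * exp (- s) <= (\<Sum>i\<le>degree p. \<bar>coeff p i\<bar> * s ^ i) * exp (- s)"
 by (rule mult_right_mono) simp
 also have "... <= (\<Sum>i\<le>degree p. \<bar>coeff p i\<bar> * fact i)"
 unfolding sum_distrib_right mult.assoc by (intro sum_mono mult_left_mono pw s) auto
 finally show ?thesis .
qed
then show ?thesis by blast
qed

lemma flat_exp_derivative: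
"(flat_exp p has_real_derivative flat_exp ([:0, 0, 1:] * (p - pderiv p)) t) (at t)"
proof -
consider "t < 0" | "t > 0" | "t = 0" by linarith
then show ?thesis
proof cases
 case 1
 have "((%t. 0::real) has_real_derivative flat_exp ([:0, 0, 1:] * (p - pderiv p)) t) (at t)"
 using 1 by (simp add: flat_exp_def)
 then show ?thesis
 by (rule has_field_derivative_transform_within_open[where S="{..<0}"]) (use 1 in \<open>auto simp: flat_exp_def\<close>)
next
 case 2
 have "((%t. poly p (1 / t) * exp (- (1 / t))) has_real_derivative flat_exp ([:0, 0, 1:] * (p - pderiv p)) t) (at t)"
 using 2 by (auto intro!: derivative_eq_intros poly_DERIV[THEN DERIV_chain2] simp: flat_exp_def field_simps power2_eq_square)
 then show ?thesis
 by (rule has_field_derivative_transform_within_open[where S="{0<..}"]) (use 2 in \<open>auto simp: flat_exp_def\<close>)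
next
 case 3
 \<comment> \<open>The extra factor s^2 in front of \<open>p\<close>, taken at s = 1/h, turns the
   difference quotient at 0 into a quantity bounded by C |h|.\<close>
 obtain C where C: "!!s. s >= 0 ==> \<bar>poly ([:0, 0, 1:] * p) s\<bar> * exp (- s) <= C"
 using poly_exp_bound by blast
 have C0: "C >= 0" using C[of 0] by simp
 have b: "\<bar>flat_exp p h / h\<bar> <= C * \<bar>h\<bar>" if "h ~= 0" for h
 proof (cases "h < 0")
 case True then show ?thesis using C0 mult_nonneg_nonneg[of C "- h"] by (simp add: flat_exp_def)
 next
 case False
 then have h: "h > 0" using that by simp
 have "\<bar>poly p (1 / h)\<bar> * exp (- (1 / h)) * (1 / h) * (1 / h) <= C"
 using C[of "1 / h"] h by (simp add: abs_mult field_simps)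
 then have "\<bar>poly p (1 / h)\<bar> * exp (- (1 / h)) <= C * (h * h)" using h by (simp add: field_simps)
 then show ?thesis using h by (simp add: flat_exp_def abs_mult field_simps)
 qed
 have "((%h. C * \<bar>h\<bar>) \<longlongrightarrow> C * \<bar>0\<bar>) (at 0)" by (intro tendsto_intros)
 then have z: "((%h. C * \<bar>h\<bar>) \<longlongrightarrow> 0) (at 0)" by simp
 have "((%h. flat_exp p h / h) \<longlongrightarrow> 0) (at 0)"
 proof (rule Lim_null_comparison[where g="%h. C * \<bar>h\<bar>"])
 show "\<forall>\<^sub>F h in at 0. norm (flat_exp p h / h) <= C * \<bar>h\<bar>"
 unfolding eventually_at_filter real_norm_def by (intro always_eventually allI impI b)
 qed (rule z)
 then show ?thesis using 3 by (simp add: DERIV_def flat_exp_def)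
qed
qed

lemma smooth1_flat_exp: "smooth1 k (flat_exp p)"
proof (induction k arbitrary: p)
case 0
show ?case by (auto intro!: continuous_at_imp_continuous_on intro: DERIV_isCont[OF flat_exp_derivative])
next
case (Suc k)
then show ?case using flat_exp_derivative by (metis smooth1.simps(2))
qed

definition flat :: "real => real" where "flat = flat_exp 1"

lemma flat_pos: "flat t > 0 \<longleftrightarrow> t > 0" and flat_zero: "t <= 0 ==> flat t = 0" and flat_nonneg: "flat t >= 0"
and flat_le_1: "flat t <= 1" and smooth1_flat: "smooth1 k flat"
using smooth1_flat_exp[of k 1] by (auto simp: flat_def flat_exp_def)

definition step :: "real => real" where "step t = flat t * inverse (flat t + flat (1 - t))"

lemma step_denom: "flat t + flat (1 - t) > 0"
using flat_pos[of t] flat_pos[of "1 - t"] flat_nonneg[of t] flat_nonneg[of "1 - t"] by linarith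

lemma smooth1_step: "smooth1 k step"
proof -
have "smooth1 k (%t. flat (- 1 * t + 1))" by (intro smooth1_affine smooth1_flat)
then have "smooth1 k (%t. flat (1 - t))" by (simp add: algebra_simps)
then have "smooth1 k (%t. flat t * inverse (flat t + flat (1 - t)))"
 by (intro smooth1_mult smooth1_inverse smooth1_add smooth1_flat less_imp_neq[OF step_denom, symmetric])
then show ?thesis by (simp add: step_def[abs_def])
qed

lemma step_zero: "t <= 0 ==> step t = 0" and step_one: "t >= 1 ==> step t = 1"
and step_nonneg: "step t >= 0" and step_le_1: "step t <= 1" and step_pos: "t > 0 ==> step t > 0"
proof -
show "t <= 0 ==> step t = 0" by (simp add: step_def flat_zero)
show "t >= 1 ==> step t = 1" using flat_pos[of t] by (simp add: step_def flat_zero[of "1 - t"])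
show "step t >= 0" using step_denom[of t] flat_nonneg[of t] by (simp add: step_def)
show "step t <= 1" using step_denom[of t] flat_nonneg[of "1 - t"] by (simp add: step_def divide_inverse[symmetric])
show "t > 0 ==> step t > 0" using step_denom[of t] flat_pos[of t] by (simp add: step_def)
qed

lemma smooth_on_norm_sq: "open U ==> smooth_on U (%x::real^'n::finite. (norm (x - p))\<^sup>2)"
proof -
assume U: "open U"
have "(norm (x - p))\<^sup>2 = (\<Sum>i\<in>UNIV. (x $ i - p $ i) * (x $ i - p $ i))" for x :: "real^'n"
 unfolding dot_square_norm[symmetric] inner_vec_def by simp
then show ?thesis
 using smooth_on_sum[OF U, of UNIV "%i x. (x $ i - p $ i) * (x $ i - p $ i)"]
 by (simp add: smooth_on_mult smooth_on_diff smooth_on_component smooth_on_const U)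
qed

section \<open>Laplacians of products and interior maxima\<close>

lemma laplacian_cong:
assumes "open U" "x \<in> U" "!!y. y \<in> U ==> f y = g y"
shows "laplacian f x = laplacian g x"
unfolding laplacian_def
by (intro sum.cong refl partial_deriv_cong[OF assms(1,2)] partial_deriv_cong[OF assms(1)] assms(3))

lemma laplacian_add:
assumes "open U" "x \<in> U" "smooth_on U f" "smooth_on U g"
shows "laplacian (%x. f x + g x) x = laplacian f x + laplacian g x"
proof -
have "partial_deriv i (partial_deriv i (%x. f x + g x)) x = partial_deriv i (%x. partial_deriv i f x + partial_deriv i g x) x" for i
 by (rule partial_deriv_cong[OF assms(1,2)], rule partial_deriv_add) (use assms smooth_on_imp_differentiable in blast)+
also have "... i = partial_deriv i (partial_deriv i f) x + partial_deriv i (partial_deriv i g) x" for i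
 by (rule partial_deriv_add) (use assms smooth_on_imp_differentiable smooth_on_partial_deriv in blast)+
finally show ?thesis by (simp add: laplacian_def sum.distrib)
qed

lemma laplacian_sum:
fixes f :: "'a => real^'n::finite => 'b::real_normed_vector"
assumes "open U" "x \<in> U" "finite A" "!!a. a \<in> A ==> smooth_on U (f a)"
shows "laplacian (%x. \<Sum>a\<in>A. f a x) x = (\<Sum>a\<in>A. laplacian (f a) x)"
using assms(3,4)
proof (induction A rule: finite_induct)
case empty
have "partial_deriv i (%x::real^'n. 0::'b) = (%x. 0)" for i by auto
then show ?case by (simp add: laplacian_def)
next
case (insert a A)
then show ?case using laplacian_add[OF assms(1,2), of "f a" "%x. \<Sum>a\<in>A. f a x"] smooth_on_sum[OF assms(1), of A f] by simp
qed

lemma laplacian_mult: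
fixes f g :: "real^'n::finite => 'b::real_normed_algebra"
assumes "open U" "x \<in> U" "smooth_on U f" "smooth_on U g"
shows "laplacian (%x. f x * g x) x = laplacian f x * g x + f x * laplacian g x
 + (\<Sum>i\<in>UNIV. partial_deriv i f x * partial_deriv i g x + partial_deriv i f x * partial_deriv i g x)"
proof -
note d = smooth_on_imp_differentiable
have *: "partial_deriv i (partial_deriv i (%x. f x * g x)) x = partial_deriv i (%x. partial_deriv i f x * g x + f x * partial_deriv i g x) x" for i
 by (rule partial_deriv_cong[OF assms(1,2)], rule partial_deriv_mult) (use assms d in blast)+
have **: "partial_deriv i (%x. partial_deriv i f x * g x + f x * partial_deriv i g x) x =
 (partial_deriv i (partial_deriv i f) x * g x + partial_deriv i f x * partial_deriv i g x)
 + (partial_deriv i f x * partial_deriv i g x + f x * partial_deriv i (partial_deriv i g) x)" for i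
proof -
 have s: "smooth_on U (partial_deriv i f)" "smooth_on U (partial_deriv i g)" using assms smooth_on_partial_deriv by blast+
 have m: "smooth_on U (%x. partial_deriv i f x * g x)" "smooth_on U (%x. f x * partial_deriv i g x)"
 using s assms smooth_on_mult by blast+
 show ?thesis
 unfolding partial_deriv_add[OF d[OF m(1) assms(2)] d[OF m(2) assms(2)]]
 partial_deriv_mult[OF d[OF s(1) assms(2)] d[OF assms(4,2)]]
 partial_deriv_mult[OF d[OF assms(3,2)] d[OF s(2) assms(2)]] ..
qed
show ?thesis unfolding laplacian_def * **
 by (simp add: sum.distrib sum_distrib_left sum_distrib_right algebra_simps)
qed

lemma laplacian_const [simp]: "laplacian (%x::real^'n::finite. c) x = 0"
proof -
have "partial_deriv i (%x::real^'n. c) = (%x. 0)" for i by auto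
then show ?thesis by (simp add: laplacian_def)
qed

lemma laplacian_cmult:
fixes f :: "real^'n::finite => 'b::real_normed_algebra"
assumes "open U" "x \<in> U" "smooth_on U f"
shows "laplacian (%x. c * f x) x = c * laplacian f x"
using laplacian_mult[OF assms(1,2) smooth_on_const[OF assms(1), of c] assms(3)] by simp

lemma norm_sq_derivatives:
"partial_deriv i (%x::real^'n::finite. (norm (x - p))\<^sup>2) x = 2 * (x $ i - p $ i)"
"laplacian (%x::real^'n::finite. (norm (x - p))\<^sup>2) x = 2 * real CARD('n)"
proof -
have 1: "partial_deriv i (%x::real^'n::finite. (norm (x - p))\<^sup>2) x = 2 * (x $ i - p $ i)" for i x
proof (rule partial_deriv_eq_vector_derivative)
 show "(%x. (norm (x - p))\<^sup>2) differentiable at x"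
 using smooth_on_imp_differentiable[OF smooth_on_norm_sq[OF open_UNIV]] by blast
 have "(norm (x + t *\<^sub>R axis i 1 - p))\<^sup>2 = (norm (x - p))\<^sup>2 + 2 * t * (x $ i - p $ i) + t\<^sup>2" for t
 proof -
 have e: "x + t *\<^sub>R axis i 1 - p = (x - p) + t *\<^sub>R axis i 1" by simp
 show ?thesis unfolding e power2_norm_eq_inner
 by (simp add: inner_add_left inner_add_right inner_axis inner_axis' power2_eq_square algebra_simps inner_commute)
 qed
 then show "((%t. (norm (x + t *\<^sub>R axis i 1 - p))\<^sup>2) has_vector_derivative 2 * (x $ i - p $ i)) (at 0)"
 unfolding has_real_derivative_iff_has_vector_derivative[symmetric]
 by (auto intro!: derivative_eq_intros)
qed
show "partial_deriv i (%x::real^'n::finite. (norm (x - p))\<^sup>2) x = 2 * (x $ i - p $ i)" by (rule 1)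
have "partial_deriv i (%x::real^'n::finite. 2 * (x $ i - p $ i)) x = 2" for i
proof (rule partial_deriv_eq_vector_derivative)
 show "(%x::real^'n. 2 * (x $ i - p $ i)) differentiable at x"
 using smooth_on_imp_differentiable[OF smooth_on_mult[OF open_UNIV smooth_on_const[OF open_UNIV]
 smooth_on_diff[OF open_UNIV smooth_on_component[OF open_UNIV] smooth_on_const[OF open_UNIV]]]] by blast
 show "((%t. 2 * ((x + t *\<^sub>R axis i 1) $ i - p $ i)) has_vector_derivative 2) (at 0)"
 unfolding has_real_derivative_iff_has_vector_derivative[symmetric]
 by (auto intro!: derivative_eq_intros)
qed
then show "laplacian (%x::real^'n::finite. (norm (x - p))\<^sup>2) x = 2 * real CARD('n)"
 unfolding laplacian_def 1[abs_def] by simp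
qed

text \<open>If a pure second derivative were positive, the first derivative, which vanishes at the
  maximum, would be positive just to the right of it, and the mean value theorem would produce a
  larger value.\<close>

lemma laplacian_at_max:
fixes f :: "real^'n::finite => real"
assumes "open U" "x \<in> U" "smooth_on U f" "!!y. y \<in> U ==> f y <= f x"
shows "laplacian f x <= 0"
proof -
have "partial_deriv i (partial_deriv i f) x <= 0" for i
proof (rule ccontr)
 assume "~ ?thesis"
 then have pos: "partial_deriv i (partial_deriv i f) x > 0" by simp
 obtain r where r: "r > 0" "ball x r \<subseteq> U" using assms open_contains_ball by blast
 have inU: "x + t *\<^sub>R axis i 1 \<in> U" if "\<bar>t\<bar> < r" for t
 using that r by (auto simp: dist_norm subset_iff)
 define g where "g t = f (x + t *\<^sub>R axis i 1)" for t
 define g' where "g' t = partial_deriv i f (x + t *\<^sub>R axis i 1)" for t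
 have d: "(g has_real_derivative g' t) (at t)" if "\<bar>t\<bar> < r" for t
 using has_real_derivative_partial_deriv[OF smooth_on_imp_differentiable[OF assms(3) inU[OF that]]]
 by (simp add: g_def[abs_def] g'_def axis_def if_distrib[of "%c. c * _"] cong: if_cong)
 have d2: "(g' has_real_derivative partial_deriv i (partial_deriv i f) x) (at 0)"
 using has_real_derivative_partial_deriv[OF smooth_on_imp_differentiable[OF smooth_on_partial_deriv[OF assms(3)]], of x 0 "axis i 1"] assms(2)
 by (simp add: g'_def[abs_def] axis_def if_distrib[of "%c. c * _"] cong: if_cong)
 have mx: "g t <= g 0" if "\<bar>t\<bar> < r" for t using assms(4)[OF inU[OF that]] by (simp add: g_def)
 have g0: "g' 0 = 0"
 by (rule DERIV_local_max[OF d, of 0 r]) (use r mx in auto)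
 obtain e where e: "e > 0" "!!h. 0 < h ==> h < e ==> g' 0 < g' (0 + h)"
 using DERIV_pos_inc_right[OF d2 pos] by blast
 define s where "s = min e r / 2"
 have s: "0 < s" "s < e" "s < r" using e r by (auto simp: s_def)
 obtain t where t: "0 < t" "t < s" "g s - g 0 = (s - 0) * g' t"
 using MVT2[of 0 s g g'] d s by force
 have "g' t > 0" using e(2)[of t] t s g0 by simp
 then have "g s > g 0" using t s by (metis diff_gt_0_iff_gt diff_zero mult_pos_pos)
 then show False using mx[of s] s by simp
qed
then show ?thesis unfolding laplacian_def by (simp add: sum_nonpos)
qed

text \<open>Adding a small multiple d of |x|^2 makes the Laplacian strictly positive, which excludes
  an interior maximum. The choice d B^2 = e makes the loss equal to the prescribed error.\<close>

lemma maximum_principle: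
fixes w :: "real^'n::finite => real"
assumes "bounded \<Omega>" "open \<Omega>" "continuous_on (closure \<Omega>) w" "smooth_on \<Omega> w"
 and "!!x. x \<in> \<Omega> ==> laplacian w x = 0" "!!x. x \<in> frontier \<Omega> ==> w x <= m" "x \<in> \<Omega>"
shows "w x <= m"
proof (rule field_le_epsilon)
fix e :: real assume e: "e > 0"
obtain B where B: "B > 0" "!!y. y \<in> closure \<Omega> ==> norm y <= B"
 using assms(1) bounded_closure bounded_pos by metis
define d where "d = e / B\<^sup>2"
have d: "d > 0" using e B by (simp add: d_def)
define f where "f y = w y + d * (norm (y - 0))\<^sup>2" for y
have sq: "(norm y)\<^sup>2 <= B\<^sup>2" if "y \<in> closure \<Omega>" for y using B(2)[OF that] by (simp add: power_mono)
have cmp: "compact (closure \<Omega>)" using assms(1) by simp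
have "continuous_on (closure \<Omega>) f" unfolding f_def by (intro continuous_intros assms(3))
then obtain z where z: "z \<in> closure \<Omega>" "!!y. y \<in> closure \<Omega> ==> f y <= f z"
 using continuous_attains_sup[OF cmp, of f] assms(7) closure_subset by blast
have "z \<notin> \<Omega>"
proof
 assume zO: "z \<in> \<Omega>"
 have sm: "smooth_on \<Omega> (%y. d * (norm (y - 0))\<^sup>2)"
 by (intro smooth_on_mult smooth_on_const smooth_on_norm_sq assms)
 have "laplacian f z = 2 * d * real CARD('n)"
 unfolding f_def using laplacian_add[OF assms(2) zO assms(4) sm] assms(5)[OF zO]
 laplacian_cmult[OF assms(2) zO smooth_on_norm_sq[OF assms(2)], of d 0] norm_sq_derivatives(2)[of 0 z] by simp
 moreover have "laplacian f z <= 0"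
 proof (rule laplacian_at_max[OF assms(2) zO])
 show "smooth_on \<Omega> f" unfolding f_def by (rule smooth_on_add[OF assms(2,4) sm])
 show "!!y. y \<in> \<Omega> ==> f y <= f z" using z(2) closure_subset by blast
 qed
 ultimately show False using d by (simp add: mult_le_0_iff)
qed
then have "z \<in> frontier \<Omega>" using z(1) assms(2) by (simp add: frontier_def interior_open)
then have "f z <= m + d * B\<^sup>2" using assms(6)[of z] sq[OF z(1)] d unfolding f_def by (simp add: add_mono)
moreover have "w x <= f x" using d by (simp add: f_def)
moreover have "f x <= f z" using z(2) assms(7) closure_subset by blast
moreover have "d * B\<^sup>2 = e" using B by (simp add: d_def)
ultimately show "w x <= m + e" by linarith
qed

section \<open>Bernstein's method\<close>

definition gradsq :: "(real^'n::finite => real) => real^'n => real" where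
"gradsq f x = (\<Sum>i\<in>UNIV. (partial_deriv i f x)\<^sup>2)"

lemma gradsq_nonneg: "gradsq f x >= 0"
unfolding gradsq_def by (simp add: sum_nonneg)

lemma laplacian_square:
fixes f :: "real^'n::finite => real"
assumes "open U" "x \<in> U" "smooth_on U f"
shows "laplacian (%x. f x * f x) x = 2 * f x * laplacian f x + 2 * gradsq f x"
using laplacian_mult[OF assms assms(3)]
by (simp add: gradsq_def power2_eq_square sum_distrib_left)

lemma young_ineq: "2 * \<bar>a * b\<bar> <= c * a\<^sup>2 + b\<^sup>2 / c" if "c > 0" for a b c :: real
proof -
have "0 <= (c * \<bar>a\<bar> - \<bar>b\<bar>)\<^sup>2 / c" using that by simp
also have "... = c * a\<^sup>2 - 2 * \<bar>a * b\<bar> + b\<^sup>2 / c"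
 using that by (simp add: power2_eq_square field_simps abs_mult)
finally show ?thesis by simp
qed

text \<open>The cross term of cutoff and gradient is absorbed into half of the gradient term by
  Cauchy-Schwarz. The zeroth-order coefficient \<open>ka\<close> enters only through 2 ka h^2 >= 0,
  which is dropped, so the bound does not see the size of \<open>ka\<close>.\<close>

lemma laplacian_cutoff_square:
fixes h :: "real^'n::finite => real"
assumes "smooth_on (ball p R) h" "x \<in> ball p R" "norm (x - p) <= r" "0 < r" "ka >= 0" "m > 0"
defines "eta \<equiv> %x. r\<^sup>2 - (norm (x - p))\<^sup>2"
shows "laplacian (%x. (eta x * h x) * (eta x * h x)) x >=
 (eta x)\<^sup>2 * gradsq h x - (60 * real CARD('n) * r\<^sup>2) * (h x)\<^sup>2
 - (eta x)\<^sup>2 * (m * (h x)\<^sup>2 + (laplacian h x - ka * h x)\<^sup>2 / m)"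
proof -
let ?U = "ball p R" and ?n = "real CARD('n)"
note op = open_ball[of p R]
have seta: "smooth_on ?U eta" unfolding eta_def by (intro smooth_on_diff smooth_on_const smooth_on_norm_sq op)
have e: "eta = (%x. r\<^sup>2 + (-1) * (norm (x - p))\<^sup>2)" by (auto simp: eta_def)
have sm: "smooth_on ?U (%x. (-1) * (norm (x - p))\<^sup>2)" by (intro smooth_on_mult smooth_on_const smooth_on_norm_sq op)
have leta: "laplacian eta x = - 2 * ?n"
 unfolding e using laplacian_add[OF op assms(2) smooth_on_const[OF op, of "r\<^sup>2"] sm]
 laplacian_cmult[OF op assms(2) smooth_on_norm_sq[OF op, of p], of "-1"] norm_sq_derivatives(2)[of p x] by simp
have peta: "partial_deriv i eta x = - 2 * (x $ i - p $ i)" for i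
proof -
 have d: "(%x. (norm (x - p))\<^sup>2) differentiable (at x)"
 using smooth_on_imp_differentiable[OF smooth_on_norm_sq[OF op] assms(2)] .
 have d2: "(%x. (-1) * (norm (x - p))\<^sup>2) differentiable (at x)"
 using smooth_on_imp_differentiable[OF sm assms(2)] .
 show ?thesis unfolding e
 using partial_deriv_add[of "%x. r\<^sup>2" x "%x. (-1) * (norm (x - p))\<^sup>2" i, OF _ d2] norm_sq_derivatives(1)[of i p x]
 partial_deriv_mult[of "%x. -1" x "%x. (norm (x - p))\<^sup>2" i, OF _ d] by simp
qed
have setah: "smooth_on ?U (%x. eta x * h x)" by (rule smooth_on_mult[OF op seta assms(1)])
have eta: "0 <= eta x" "eta x <= r\<^sup>2" using assms(3,4) by (auto simp: eta_def power_mono)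
define D where "D = (\<Sum>i\<in>UNIV. partial_deriv i eta x * partial_deriv i h x)"
define N where "N = (\<Sum>i\<in>UNIV. (partial_deriv i eta x)\<^sup>2)"
have Nr: "N <= 4 * r\<^sup>2"
proof -
 have "N = 4 * (norm (x - p))\<^sup>2"
 unfolding N_def peta power2_norm_eq_inner inner_vec_def by (simp add: power2_eq_square sum_distrib_left algebra_simps)
 then show ?thesis using assms(3,4) by (simp add: power_mono)
qed
have N0: "N >= 0" unfolding N_def by (simp add: sum_nonneg)
have g: "gradsq (%x. eta x * h x) x = (eta x)\<^sup>2 * gradsq h x + 2 * eta x * h x * D + (h x)\<^sup>2 * N"
proof -
 have "partial_deriv i (%x. eta x * h x) x = partial_deriv i eta x * h x + eta x * partial_deriv i h x" for i
 using partial_deriv_mult smooth_on_imp_differentiable seta assms(1,2) by blast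
 then show ?thesis unfolding gradsq_def D_def N_def
 by (simp add: power2_eq_square sum_distrib_left sum.distrib algebra_simps)
qed
have l: "laplacian (%x. eta x * h x) x = - 2 * ?n * h x + eta x * laplacian h x + 2 * D"
 using laplacian_mult[OF op assms(2) seta assms(1)] leta unfolding D_def by (simp add: sum.distrib sum_distrib_left)
have L: "laplacian (%x. (eta x * h x) * (eta x * h x)) x
 = 2 * (eta x)\<^sup>2 * gradsq h x + 8 * (eta x * h x) * D + 2 * (h x)\<^sup>2 * N + 2 * (eta x)\<^sup>2 * (h x * laplacian h x) - 4 * ?n * eta x * (h x)\<^sup>2"
 unfolding laplacian_square[OF op assms(2) setah] g l by (simp add: power2_eq_square algebra_simps)
have Dsq: "D\<^sup>2 <= N * gradsq h x"
 unfolding D_def N_def gradsq_def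
 using Cauchy_Schwarz_ineq[of "\<chi> i. partial_deriv i eta x" "\<chi> i. partial_deriv i h x"]
 by (simp add: inner_vec_def power2_eq_square)
have "8 * \<bar>eta x * h x * D\<bar> <= (eta x)\<^sup>2 * gradsq h x + 16 * (h x)\<^sup>2 * N"
proof (rule power2_le_imp_le)
 let ?a = "(eta x)\<^sup>2 * gradsq h x" and ?b = "16 * (h x)\<^sup>2 * N"
 have "(8 * \<bar>eta x * h x * D\<bar>)\<^sup>2 = 64 * ((eta x)\<^sup>2 * (h x)\<^sup>2 * D\<^sup>2)" by (simp add: power_mult_distrib)
 also have "... <= 64 * ((eta x)\<^sup>2 * (h x)\<^sup>2 * (N * gradsq h x))" using Dsq by (intro mult_left_mono) auto
 also have "... = 4 * (?a * ?b)" by simp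
 also have "... <= (?a + ?b)\<^sup>2" using zero_le_power2[of "?a - ?b"] by (simp add: power2_eq_square algebra_simps)
 finally show "(8 * \<bar>eta x * h x * D\<bar>)\<^sup>2 <= (?a + ?b)\<^sup>2" .
 show "0 <= ?a + ?b" using gradsq_nonneg[of h x] N0 by simp
qed
then have 1: "8 * (eta x * h x) * D >= - ((eta x)\<^sup>2 * gradsq h x) - 16 * (h x)\<^sup>2 * N"
 by (simp add: abs_le_iff mult.assoc)
\<comment> \<open>Of 16 N, the part 2 N is available in the expansion and 14 N <= 56 r^2; together
  with the 4 n r^2 from the Laplacian of \<open>eta\<close> this is the origin of the constant
  60.\<close>
have 2: "16 * (h x)\<^sup>2 * N <= 56 * r\<^sup>2 * (h x)\<^sup>2 + 2 * (h x)\<^sup>2 * N"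
 using mult_left_mono[OF Nr, of "14 * (h x)\<^sup>2"] by (simp add: algebra_simps)
have 3: "4 * ?n * eta x * (h x)\<^sup>2 <= 4 * ?n * r\<^sup>2 * (h x)\<^sup>2"
 using eta by (intro mult_right_mono mult_left_mono) auto
have "?n >= 1" by (simp add: Suc_leI)
then have 4: "56 * r\<^sup>2 * (h x)\<^sup>2 <= 56 * ?n * r\<^sup>2 * (h x)\<^sup>2" by (intro mult_right_mono) auto
have "2 * (h x * laplacian h x) >= - (m * (h x)\<^sup>2 + (laplacian h x - ka * h x)\<^sup>2 / m)"
proof -
 have "2 * (h x * laplacian h x) = 2 * ka * (h x)\<^sup>2 + 2 * (h x * (laplacian h x - ka * h x))"
 by (simp add: power2_eq_square algebra_simps)
 moreover have "2 * ka * (h x)\<^sup>2 >= 0" using assms(5) by simp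
 ultimately show ?thesis using young_ineq[OF assms(6), of "h x" "laplacian h x - ka * h x"] by linarith
qed
from mult_left_mono[OF this, of "(eta x)\<^sup>2"]
have 5: "2 * (eta x)\<^sup>2 * (h x * laplacian h x) >= - ((eta x)\<^sup>2 * (m * (h x)\<^sup>2 + (laplacian h x - ka * h x)\<^sup>2 / m))"
 by (simp add: algebra_simps)
have 6: "(60 * ?n * r\<^sup>2) * (h x)\<^sup>2 = 56 * ?n * r\<^sup>2 * (h x)\<^sup>2 + 4 * ?n * r\<^sup>2 * (h x)\<^sup>2"
 by (simp add: algebra_simps)
have 7: "2 * (eta x)\<^sup>2 * gradsq h x = (eta x)\<^sup>2 * gradsq h x + (eta x)\<^sup>2 * gradsq h x" by simp
show ?thesis unfolding L 6 7 using 1 2 3 4 5 by linarith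
qed

text \<open>The auxiliary function is $\eta^2 \sum_b h_b^2 + K \sum_a g_a^2$: at an interior maximum its
Laplacian is nonpositive, which bounds the gradients of the $g_a$ there.\<close>

lemma bernstein:
fixes A :: "'a set" and B :: "'b set"
assumes "finite A" "finite B" "0 < r" "r < R" "0 < C" "0 < M"
shows "\<exists>K. \<forall>p (g :: 'a => real^'n::finite => real) h ka.
 (\<forall>a\<in>A. smooth_on (ball p R) (g a)) & (\<forall>b\<in>B. smooth_on (ball p R) (h b)) &
 (\<forall>x\<in>cball p r. ka x >= (0::real)) & (\<forall>a\<in>A. \<forall>x\<in>cball p r. \<bar>g a x\<bar> <= M) &
 (\<forall>a\<in>A. \<forall>x\<in>cball p r. (laplacian (g a) x - ka x * g a x)\<^sup>2 <= C * (1 + (\<Sum>a\<in>A. gradsq (g a) x))) &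
 (\<forall>b\<in>B. \<forall>x\<in>cball p r. (laplacian (h b) x - ka x * h b x)\<^sup>2 <= C * (1 + (\<Sum>a\<in>A. gradsq (g a) x) + (\<Sum>b\<in>B. gradsq (h b) x))) &
 (\<forall>b\<in>B. \<forall>x\<in>cball p r. (h b x)\<^sup>2 <= C * (1 + (\<Sum>a\<in>A. gradsq (g a) x))) -->
 (\<forall>b\<in>B. \<forall>x\<in>cball p (r / 2). \<bar>h b x\<bar> <= K)"
proof -
let ?n = "real CARD('n)" and ?a = "real (card A) + 1" and ?b = "real (card B) + 1"
\<comment> \<open>\<open>c2\<close> is the loss in the Laplacian of the cutoff part of the auxiliary
  function and \<open>c3\<close> that of the sum of the squares of the \<open>g a\<close>. The
  weight \<open>K0 = c2 + 1\<close> is just enough for the gain in the gradients to beat the loss,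
  which leaves at most \<open>S0\<close> for their sum at an interior maximum.\<close>
define c2 where "c2 = 60 * ?n * r\<^sup>2 * (?b * C) + r ^ 4 * (C * ?b * (?b * C) + 1)"
define c3 where "c3 = 1 + ?a * (M\<^sup>2 * (C * ?a))"
define K0 where "K0 = c2 + 1"
define S0 where "S0 = c2 + K0 * c3"
define Wm where "Wm = r ^ 4 * (?b * (C * (1 + S0))) + K0 * (?a * M\<^sup>2)"
\<comment> \<open>On the half ball the cutoff satisfies eta^2 >= (3/4 r^2)^2 = 9/16 r^4.\<close>
define K where "K = sqrt (Wm / (9 / 16 * r ^ 4))"
have c2: "c2 >= 0" using assms by (simp add: c2_def)
have c3: "c3 >= 1" using assms by (simp add: c3_def)
have K0: "K0 >= 1" using c2 by (simp add: K0_def)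
have S0: "S0 >= 0" using c2 c3 K0 by (simp add: S0_def)
show ?thesis
proof (intro exI[of _ K] allI impI ballI, elim conjE)
 fix p and g :: "'a => real^'n => real" and h :: "'b => real^'n => real" and ka b0 x0
 assume sg: "\<forall>a\<in>A. smooth_on (ball p R) (g a)" and sh: "\<forall>b\<in>B. smooth_on (ball p R) (h b)"
 and ka: "\<forall>x\<in>cball p r. ka x >= (0::real)" and gM: "\<forall>a\<in>A. \<forall>x\<in>cball p r. \<bar>g a x\<bar> <= M"
 and gR: "\<forall>a\<in>A. \<forall>x\<in>cball p r. (laplacian (g a) x - ka x * g a x)\<^sup>2 <= C * (1 + (\<Sum>a\<in>A. gradsq (g a) x))"
 and hR: "\<forall>b\<in>B. \<forall>x\<in>cball p r. (laplacian (h b) x - ka x * h b x)\<^sup>2 <= C * (1 + (\<Sum>a\<in>A. gradsq (g a) x) + (\<Sum>b\<in>B. gradsq (h b) x))"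
 and hC: "\<forall>b\<in>B. \<forall>x\<in>cball p r. (h b x)\<^sup>2 <= C * (1 + (\<Sum>a\<in>A. gradsq (g a) x))"
 and b0: "b0 \<in> B" and x0: "x0 \<in> cball p (r / 2)"
 define eta where "eta x = r\<^sup>2 - (norm (x - p))\<^sup>2" for x
 define SA where "SA x = (\<Sum>a\<in>A. gradsq (g a) x)" for x
 define SB where "SB x = (\<Sum>b\<in>B. gradsq (h b) x)" for x
 define w1 where "w1 x = (\<Sum>b\<in>B. (eta x * h b x) * (eta x * h b x))" for x
 define w2 where "w2 x = (\<Sum>a\<in>A. g a x * g a x)" for x
 define w where "w x = w1 x + K0 * w2 x" for x
 note op = open_ball[of p R]
 have sub: "cball p r \<subseteq> ball p R" using assms(4) by auto
 have SA0: "SA x >= 0" and SB0: "SB x >= 0" for x unfolding SA_def SB_def by (simp_all add: sum_nonneg gradsq_nonneg)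
 have seta: "smooth_on (ball p R) eta"
 unfolding eta_def[abs_def] by (intro smooth_on_diff smooth_on_const smooth_on_norm_sq op)
 have sw1b: "smooth_on (ball p R) (%x. (eta x * h b x) * (eta x * h b x))" if "b \<in> B" for b
 using that sh by (intro smooth_on_mult seta op) auto
 have sw2a: "smooth_on (ball p R) (%x. g a x * g a x)" if "a \<in> A" for a
 using that sg by (intro smooth_on_mult op) auto
 have sw1: "smooth_on (ball p R) w1" unfolding w1_def[abs_def] by (rule smooth_on_sum[OF op assms(2) sw1b])
 have sw2: "smooth_on (ball p R) w2" unfolding w2_def[abs_def] by (rule smooth_on_sum[OF op assms(1) sw2a])
 have skw2: "smooth_on (ball p R) (%x. K0 * w2 x)" by (intro smooth_on_mult smooth_on_const op sw2)
 have sw: "smooth_on (ball p R) w" unfolding w_def[abs_def] by (rule smooth_on_add[OF op sw1 skw2])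
 have w2M: "w2 x <= ?a * M\<^sup>2" if "x \<in> cball p r" for x
 proof -
 have "w2 x <= (\<Sum>a\<in>A. M\<^sup>2)"
 unfolding w2_def power2_eq_square[symmetric]
 using gM[rule_format, OF _ that] assms(6) by (intro sum_mono) (simp add: abs_le_square_iff[symmetric])
 then show ?thesis by (simp add: distrib_right add_increasing2)
 qed
 have hT: "(\<Sum>b\<in>B. (h b x)\<^sup>2) <= ?b * (C * (1 + SA x))" if "x \<in> cball p r" for x
 proof -
 have "(\<Sum>b\<in>B. (h b x)\<^sup>2) <= (\<Sum>b\<in>B. C * (1 + SA x))"
 using hC that unfolding SA_def by (intro sum_mono) auto
 also have "... <= ?b * (C * (1 + SA x))" using assms SA0[of x] by (simp add: distrib_right)
 finally show ?thesis .
 qed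
 have eta: "0 <= eta x" "eta x <= r\<^sup>2" if "x \<in> cball p r" for x
 using that assms by (auto simp: eta_def dist_norm norm_minus_commute power_mono)
 have eta2: "(eta x)\<^sup>2 <= r ^ 4" if "x \<in> cball p r" for x
 using power_mono[OF eta(2)[OF that] eta(1)[OF that], of 2] by simp
 have low: "laplacian w x >= - c2 * (1 + SA x) + K0 * (SA x - c3)" if x: "x \<in> cball p r" for x
 proof -
 have xR: "x \<in> ball p R" using x sub by blast
 have cancelB: "C * t / (C * ?b) = t / ?b" and cancelA: "C * t / (C * ?a) = t / ?a" for t
 using assms(5) by simp_all
 \<comment> \<open>Young's inequality is used with weight \<open>C * ?b\<close>: the residuals of
   all \<open>h b\<close> then add up to at most 1 + SA + SB, and the contribution of SB is
   cancelled by the gradient term that the cutoff estimate has kept.\<close>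
 have Cb: "C * ?b > 0" and Ca: "C * ?a > 0" using assms by (simp_all add: add_nonneg_pos)
 have "laplacian w1 x = (\<Sum>b\<in>B. laplacian (%x. (eta x * h b x) * (eta x * h b x)) x)"
 unfolding w1_def[abs_def] by (rule laplacian_sum[OF op xR assms(2) sw1b])
 also have "... >= (\<Sum>b\<in>B. (eta x)\<^sup>2 * gradsq (h b) x - (60 * ?n * r\<^sup>2) * (h b x)\<^sup>2
 - (eta x)\<^sup>2 * ((C * ?b) * (h b x)\<^sup>2 + (C * (1 + SA x + SB x)) / (C * ?b)))"
 proof (rule sum_mono)
 fix b assume b: "b \<in> B"
 have "laplacian (%x. (eta x * h b x) * (eta x * h b x)) x >= (eta x)\<^sup>2 * gradsq (h b) x - (60 * ?n * r\<^sup>2) * (h b x)\<^sup>2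
 - (eta x)\<^sup>2 * ((C * ?b) * (h b x)\<^sup>2 + (laplacian (h b) x - ka x * h b x)\<^sup>2 / (C * ?b))"
 unfolding eta_def[abs_def]
 by (rule laplacian_cutoff_square) (use sh b xR x ka assms Cb in \<open>auto simp: dist_norm norm_minus_commute\<close>)
 moreover have "(laplacian (h b) x - ka x * h b x)\<^sup>2 / (C * ?b) <= (C * (1 + SA x + SB x)) / (C * ?b)"
 using hR b x Cb unfolding SA_def SB_def by (intro divide_right_mono) auto
 then have "(eta x)\<^sup>2 * ((C * ?b) * (h b x)\<^sup>2 + (laplacian (h b) x - ka x * h b x)\<^sup>2 / (C * ?b))
 <= (eta x)\<^sup>2 * ((C * ?b) * (h b x)\<^sup>2 + (C * (1 + SA x + SB x)) / (C * ?b))"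
 by (intro mult_left_mono add_left_mono) auto
 ultimately show "(eta x)\<^sup>2 * gradsq (h b) x - (60 * ?n * r\<^sup>2) * (h b x)\<^sup>2
 - (eta x)\<^sup>2 * ((C * ?b) * (h b x)\<^sup>2 + (C * (1 + SA x + SB x)) / (C * ?b))
 <= laplacian (%x. (eta x * h b x) * (eta x * h b x)) x" by linarith
 qed
 also have "(\<Sum>b\<in>B. (eta x)\<^sup>2 * gradsq (h b) x - (60 * ?n * r\<^sup>2) * (h b x)\<^sup>2
 - (eta x)\<^sup>2 * ((C * ?b) * (h b x)\<^sup>2 + (C * (1 + SA x + SB x)) / (C * ?b)))
 = (eta x)\<^sup>2 * SB x - (60 * ?n * r\<^sup>2) * (\<Sum>b\<in>B. (h b x)\<^sup>2)
 - (eta x)\<^sup>2 * ((C * ?b) * (\<Sum>b\<in>B. (h b x)\<^sup>2) + real (card B) * ((1 + SA x + SB x) / ?b))"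
 unfolding cancelB by (simp add: SB_def sum_subtractf sum.distrib sum_distrib_left[symmetric])
 finally have 1: "laplacian w1 x >= (eta x)\<^sup>2 * SB x - (60 * ?n * r\<^sup>2) * (\<Sum>b\<in>B. (h b x)\<^sup>2)
 - (eta x)\<^sup>2 * ((C * ?b) * (\<Sum>b\<in>B. (h b x)\<^sup>2) + real (card B) * ((1 + SA x + SB x) / ?b))" .
 have fr: "real (card B) * ((1 + SA x + SB x) / ?b) <= 1 + SA x + SB x"
 using SA0[of x] SB0[of x] by (simp add: field_simps)
 have "(60 * ?n * r\<^sup>2) * (\<Sum>b\<in>B. (h b x)\<^sup>2) <= (60 * ?n * r\<^sup>2) * (?b * (C * (1 + SA x)))"
 by (intro mult_left_mono hT x) auto
 moreover have "(eta x)\<^sup>2 * ((C * ?b) * (\<Sum>b\<in>B. (h b x)\<^sup>2) + real (card B) * ((1 + SA x + SB x) / ?b))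
 <= (eta x)\<^sup>2 * ((C * ?b) * (?b * (C * (1 + SA x))) + (1 + SA x + SB x))"
 using Cb by (intro mult_left_mono add_mono fr hT x) auto
 moreover have "(eta x)\<^sup>2 * ((C * ?b) * (?b * (C * (1 + SA x))) + (1 + SA x + SB x))
 = (eta x)\<^sup>2 * ((C * ?b * (?b * C) + 1) * (1 + SA x)) + (eta x)\<^sup>2 * SB x" by (simp add: algebra_simps)
 moreover have "(eta x)\<^sup>2 * ((C * ?b * (?b * C) + 1) * (1 + SA x)) <= r ^ 4 * ((C * ?b * (?b * C) + 1) * (1 + SA x))"
 using assms SA0[of x] by (intro mult_right_mono eta2 x) auto
 ultimately have "laplacian w1 x >= - ((60 * ?n * r\<^sup>2) * (?b * (C * (1 + SA x)))) - r ^ 4 * ((C * ?b * (?b * C) + 1) * (1 + SA x))"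
 using 1 by linarith
 also have "- ((60 * ?n * r\<^sup>2) * (?b * (C * (1 + SA x)))) - r ^ 4 * ((C * ?b * (?b * C) + 1) * (1 + SA x)) = - c2 * (1 + SA x)"
 unfolding c2_def by (simp add: algebra_simps)
 finally have l1: "laplacian w1 x >= - c2 * (1 + SA x)" .
 have "laplacian w2 x = (\<Sum>a\<in>A. laplacian (%x. g a x * g a x) x)"
 unfolding w2_def[abs_def] by (rule laplacian_sum[OF op xR assms(1) sw2a])
 also have "... >= (\<Sum>a\<in>A. 2 * gradsq (g a) x - ((C * ?a) * M\<^sup>2 + (C * (1 + SA x)) / (C * ?a)))"
 proof (rule sum_mono)
 fix a assume a: "a \<in> A"
 have "2 * (g a x * laplacian (g a) x) = 2 * ka x * (g a x)\<^sup>2 + 2 * (g a x * (laplacian (g a) x - ka x * g a x))"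
 by (simp add: power2_eq_square algebra_simps)
 moreover have "2 * ka x * (g a x)\<^sup>2 >= 0" using ka x by simp
 moreover have "2 * \<bar>g a x * (laplacian (g a) x - ka x * g a x)\<bar> <= (C * ?a) * (g a x)\<^sup>2 + (laplacian (g a) x - ka x * g a x)\<^sup>2 / (C * ?a)"
 by (rule young_ineq[OF Ca])
 moreover have "(laplacian (g a) x - ka x * g a x)\<^sup>2 / (C * ?a) <= (C * (1 + SA x)) / (C * ?a)"
 using gR a x Ca unfolding SA_def by (intro divide_right_mono) auto
 moreover have "(C * ?a) * (g a x)\<^sup>2 <= (C * ?a) * M\<^sup>2"
 using gM[rule_format, OF a x] Ca assms(6) by (intro mult_left_mono) (auto simp: abs_le_square_iff[symmetric])
 ultimately show "2 * gradsq (g a) x - ((C * ?a) * M\<^sup>2 + (C * (1 + SA x)) / (C * ?a)) <= laplacian (%x. g a x * g a x) x"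
 using laplacian_square[OF op xR, of "g a"] sg a by simp
 qed
 also have "(\<Sum>a\<in>A. 2 * gradsq (g a) x - ((C * ?a) * M\<^sup>2 + (C * (1 + SA x)) / (C * ?a)))
 = 2 * SA x - real (card A) * ((C * ?a) * M\<^sup>2) - real (card A) * ((1 + SA x) / ?a)"
 unfolding cancelA by (simp add: SA_def sum_subtractf sum.distrib sum_distrib_left[symmetric] distrib_left[of "real (card A)"])
 finally have 2: "laplacian w2 x >= 2 * SA x - real (card A) * ((C * ?a) * M\<^sup>2) - real (card A) * ((1 + SA x) / ?a)" .
 have "real (card A) * ((1 + SA x) / ?a) <= 1 + SA x" using SA0[of x] by (simp add: field_simps)
 moreover have "real (card A) * ((C * ?a) * M\<^sup>2) <= ?a * (M\<^sup>2 * (C * ?a))" using Ca by (simp add: distrib_right)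
 ultimately have "laplacian w2 x >= SA x - c3" using 2 unfolding c3_def by linarith
 then have "K0 * laplacian w2 x >= K0 * (SA x - c3)" using K0 by (intro mult_left_mono) auto
 moreover have "laplacian w x = laplacian w1 x + K0 * laplacian w2 x"
 unfolding w_def[abs_def] using laplacian_add[OF op xR sw1 skw2] laplacian_cmult[OF op xR sw2] by simp
 ultimately show ?thesis using l1 by linarith
 qed
 have "continuous_on (cball p r) w"
 using smooth_on_imp_continuous_on[OF sw] sub continuous_on_subset by blast
 then obtain z where z: "z \<in> cball p r" "!!y. y \<in> cball p r ==> w y <= w z"
 using continuous_attains_sup[of "cball p r" w] assms(3) by force
 have w1e: "w1 x = (eta x)\<^sup>2 * (\<Sum>b\<in>B. (h b x)\<^sup>2)" for x
 unfolding w1_def by (simp add: sum_distrib_left power2_eq_square mult_ac)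
 have wz: "w z <= Wm"
 proof (cases "norm (z - p) < r")
 case True
 then have zb: "z \<in> ball p r" by (simp add: dist_norm norm_minus_commute)
 have "laplacian w z <= 0"
 using laplacian_at_max[of "ball p r" z w] zb z(2) smooth_on_subset[OF sw, of "ball p r"] sub by force
 then have "K0 * (SA z - c3) <= c2 * (1 + SA z)" using low[OF z(1)] by linarith
 then have SAz: "SA z <= S0" unfolding S0_def K0_def by (simp add: algebra_simps)
 have "w1 z <= r ^ 4 * (?b * (C * (1 + S0)))"
 proof -
 have "(\<Sum>b\<in>B. (h b z)\<^sup>2) <= ?b * (C * (1 + SA z))" by (rule hT[OF z(1)])
 also have "... <= ?b * (C * (1 + S0))" using SAz assms(5) by (intro mult_left_mono) auto
 finally show ?thesis unfolding w1e using eta2[OF z(1)] by (intro mult_mono) (auto simp: sum_nonneg)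
 qed
 moreover have "K0 * w2 z <= K0 * (?a * M\<^sup>2)" using w2M[OF z(1)] K0 by (intro mult_left_mono) auto
 ultimately show ?thesis unfolding w_def Wm_def by linarith
 next
 \<comment> \<open>On the sphere the cutoff vanishes, so only the functions \<open>g a\<close>,
   bounded by \<open>M\<close>, contribute.\<close>
 case False
 then have "eta z = 0" using z(1) by (simp add: eta_def dist_norm norm_minus_commute)
 then have "w1 z = 0" by (simp add: w1e)
 moreover have "K0 * w2 z <= K0 * (?a * M\<^sup>2)" using w2M[OF z(1)] K0 by (intro mult_left_mono) auto
 moreover have "r ^ 4 * (?b * (C * (1 + S0))) >= 0" using assms S0 by simp
 ultimately show ?thesis unfolding w_def Wm_def by linarith
 qed
 have x0r: "x0 \<in> cball p r" using x0 assms(3) by auto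
 have "w1 x0 <= Wm"
 proof -
 have "w2 x0 >= 0" unfolding w2_def by (simp add: sum_nonneg)
 then have "w1 x0 <= w x0" using K0 by (simp add: w_def)
 then show ?thesis using z(2)[OF x0r] wz by linarith
 qed
 moreover have "(9 / 16 * r ^ 4) * (h b0 x0)\<^sup>2 <= w1 x0"
 proof -
 have "(norm (x0 - p))\<^sup>2 <= (r / 2)\<^sup>2" using x0 by (intro power_mono) (auto simp: dist_norm norm_minus_commute)
 then have "eta x0 >= 3 / 4 * r\<^sup>2" unfolding eta_def by (simp add: power_divide)
 then have "(eta x0)\<^sup>2 >= (3 / 4 * r\<^sup>2)\<^sup>2" by (intro power_mono) auto
 then have "(eta x0)\<^sup>2 >= 9 / 16 * r ^ 4" by (simp add: power_mult_distrib power_divide)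
 moreover have "(h b0 x0)\<^sup>2 <= (\<Sum>b\<in>B. (h b x0)\<^sup>2)" using b0 assms(2) by (intro member_le_sum) auto
 ultimately show ?thesis unfolding w1e by (intro mult_mono) auto
 qed
 ultimately have "(h b0 x0)\<^sup>2 <= Wm / (9 / 16 * r ^ 4)" using assms(3) by (simp add: field_simps)
 then show "\<bar>h b0 x0\<bar> <= K" unfolding K_def by (rule real_le_rsqrt[of "\<bar>h b0 x0\<bar>", simplified])
qed
qed

section \<open>Vector fields adapted to the level sets of a function\<close>

definition vfield :: "('n::finite => real^'n => real) => (real^'n => real) => real^'n => real" where
"vfield b f x = (\<Sum>i\<in>UNIV. b i x * partial_deriv i f x)"

lemma vfield_cong: "open U ==> x \<in> U ==> (!!y. y \<in> U ==> f y = g y) ==> vfield b f x = vfield b g x"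
unfolding vfield_def using partial_deriv_cong[of U x f g] by simp

lemma smooth_on_vfield:
"open U ==> (!!i. smooth_on U (b i)) ==> smooth_on U f ==> smooth_on U (vfield b f)"
unfolding vfield_def[abs_def]
by (intro smooth_on_sum smooth_on_mult) (auto intro: smooth_on_partial_deriv)

lemma Cb_vfield:
"open U ==> (!!i. Cb U (%_::'k. b i)) ==> Cb U F ==> Cb U (%k::'k. vfield b (F k))"
unfolding vfield_def[abs_def] by (intro Cb_sum Cb_mult Cb_partial_deriv) auto

lemma vfield_add:
assumes "open U" "x \<in> U" "smooth_on U f" "smooth_on U g"
shows "vfield b (%x. f x + g x) x = vfield b f x + vfield b g x"
unfolding vfield_def
using partial_deriv_add[OF smooth_on_imp_differentiable[OF assms(3,2)] smooth_on_imp_differentiable[OF assms(4,2)]]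
by (simp add: distrib_left sum.distrib)

lemma vfield_mult:
assumes "open U" "x \<in> U" "smooth_on U f" "smooth_on U g"
shows "vfield b (%x. f x * g x) x = vfield b f x * g x + f x * vfield b g x"
unfolding vfield_def
using partial_deriv_mult[OF smooth_on_imp_differentiable[OF assms(3,2)] smooth_on_imp_differentiable[OF assms(4,2)]]
by (simp add: distrib_left sum.distrib sum_distrib_left sum_distrib_right mult_ac)

lemma vfield_sum:
assumes "open U" "x \<in> U" "finite A" "!!a. a \<in> A ==> smooth_on U (f a)"
shows "vfield b (%x. \<Sum>a\<in>A. f a x) x = (\<Sum>a\<in>A. vfield b (f a) x)"
proof -
have "partial_deriv i (%x. \<Sum>a\<in>A. f a x) x = (\<Sum>a\<in>A. partial_deriv i (f a) x)" for i
 using partial_deriv_sum[OF assms(3), of f x i] smooth_on_imp_differentiable[OF assms(4) assms(2)] by blast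
then show ?thesis unfolding vfield_def by (simp add: sum_distrib_left sum.swap[of _ A])
qed

lemma vfield_square_le: "(vfield b f x)\<^sup>2 <= (\<Sum>i\<in>UNIV. (b i x)\<^sup>2) * gradsq f x"
unfolding vfield_def gradsq_def
using Cauchy_Schwarz_ineq[of "\<chi> i. b i x" "\<chi> i. partial_deriv i f x"]
by (simp add: inner_vec_def power2_eq_square)

text \<open>Annihilates \<open>fi\<close>, whereas \<open>transversal\<close> maps \<open>fi\<close>
  to 1. Where the derivative of \<open>fi\<close> in direction \<open>nu\<close> is nonzero, the two
  kinds are the coordinate fields for the coordinates in which \<open>x $ nu\<close> is replaced by
  \<open>fi\<close>, which is why all of them commute. The tangential field with
  \<open>a = nu\<close> is zero there.\<close>

definition tangential :: "(real^'n::finite => real) => 'n => 'n => (real^'n => real) => real^'n => real" where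
"tangential fi nu a = vfield (%i x. (if i = a then 1 else 0) - (if i = nu then partial_deriv a fi x * inverse (partial_deriv nu fi x) else 0))"

definition transversal :: "(real^'n::finite => real) => 'n => (real^'n => real) => real^'n => real" where
"transversal fi nu = vfield (%i x. if i = nu then inverse (partial_deriv nu fi x) else 0)"

primrec tangentials :: "(real^'n::finite => real) => 'n => 'n list => (real^'n => real) => real^'n => real" where
"tangentials fi nu [] f = f"
| "tangentials fi nu (a # I) f = tangential fi nu a (tangentials fi nu I f)"

lemma tangential_eq: "tangential fi nu a f x = partial_deriv a f x - partial_deriv a fi x * inverse (partial_deriv nu fi x) * partial_deriv nu f x"
unfolding tangential_def vfield_def by (simp add: left_diff_distrib sum_subtractf if_distrib[of "%c. c * _"] cong: if_cong)

lemma transversal_eq: "transversal fi nu f x = inverse (partial_deriv nu fi x) * partial_deriv nu f x"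
unfolding transversal_def vfield_def by (simp add: if_distrib[of "%c. c * _"] cong: if_cong)

text \<open>The span over the bounded coefficient functions of @G@ and the constants: remainder terms live here.\<close>

inductive span_on :: "(real^'n::finite) set => ('k => real^'n => real) set => ('k => real^'n => real) => bool"
for U G where
coef: "Cb U c ==> span_on U G c"
| gen: "Cb U c ==> g \<in> G ==> span_on U G (%k x. c k x * g k x)"
| add: "span_on U G R ==> span_on U G S ==> span_on U G (%k x. R k x + S k x)"
| cong: "span_on U G R ==> (!!k x. x \<in> U ==> R k x = S k x) ==> span_on U G S"

lemma span_on_mono: "span_on U G R ==> G \<subseteq> G' ==> span_on U G' R"
by (induction rule: span_on.induct) (auto intro: span_on.intros)

lemma span_on_gen: "open U ==> g \<in> G ==> span_on U G g"
using span_on.gen[OF Cb_const[of U 1], of g G] by simp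

lemma span_on_mult:
assumes "open U" "Cb U c" "span_on U G R"
shows "span_on U G (%k x. c k x * R k x)"
using assms(3)
proof (induction rule: span_on.induct)
case (coef d) then show ?case by (intro span_on.coef Cb_mult assms)
next
case (gen d g)
then show ?case using span_on.gen[OF Cb_mult[OF assms(1,2) gen(1)] gen(2)] by (simp add: mult.assoc)
next
case (add R S)
then show ?case using span_on.add[OF add(3,4)] by (simp add: distrib_left)
next
case (cong R S)
show ?case by (rule span_on.cong[OF cong.IH]) (simp add: cong.hyps)
qed

lemma span_on_sum:
assumes "open U" "finite A" "!!a. a \<in> A ==> span_on U G (R a)"
shows "span_on U G (%k x. \<Sum>a\<in>A. R a k x)"
using assms(2,3) by (induction A rule: finite_induct) (auto intro: span_on.intros Cb_const assms(1))

lemma span_on_diff: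
assumes "open U" "span_on U G R" "span_on U G S"
shows "span_on U G (%k x. R k x - S k x)"
using span_on.add[OF assms(2) span_on_mult[OF assms(1) Cb_const[OF assms(1), of "-1"] assms(3)]] by simp

lemma span_on_smooth:
assumes "open U" "span_on U G R" "!!g k. g \<in> G ==> smooth_on U (g k)"
shows "smooth_on U (R k)"
using assms(2)
proof (induction rule: span_on.induct)
case (cong R S) then show ?case using smooth_on_cong[OF assms(1)] by blast
qed (auto intro: Cb_imp_smooth_on smooth_on_mult smooth_on_add assms)

text \<open>By the Leibniz rule it is enough that the field maps each generator into the larger
  span; derivatives of the coefficients stay bounded because \<open>Cb\<close> controls all
  orders.\<close>

lemma span_on_vfield:
assumes "open U" "span_on U G R" "!!g k. g \<in> G ==> smooth_on U (g k)"
 and "!!i. Cb U (%_::'k. b i)" "G \<subseteq> G'"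
 and "!!g. g \<in> G ==> span_on U G' (%k::'k. vfield b (g k))"
shows "span_on U G' (%k. vfield b (R k))"
using assms(2)
proof (induction rule: span_on.induct)
case (coef c) then show ?case by (intro span_on.coef Cb_vfield assms)
next
case (gen c g)
have "span_on U G' (%k x. vfield b (c k) x * g k x + c k x * vfield b (g k) x)"
 using gen assms by (intro span_on.add span_on.gen span_on_mult Cb_vfield) auto
then show ?case
 by (rule span_on.cong) (use vfield_mult[OF assms(1)] Cb_imp_smooth_on[OF assms(1) gen(1)] assms(3)[OF gen(2)] in simp)
next
case (add R S)
have "smooth_on U (R k)" for k by (rule span_on_smooth[OF assms(1) add.hyps(1)]) (rule assms(3))
moreover have "smooth_on U (S k)" for k by (rule span_on_smooth[OF assms(1) add.hyps(2)]) (rule assms(3))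
ultimately show ?case
 by (intro span_on.cong[OF span_on.add[OF add.IH]]) (simp add: vfield_add[OF assms(1)])
next
case (cong R S)
show ?case by (rule span_on.cong[OF cong.IH]) (rule vfield_cong[OF assms(1)], use cong.hyps in auto)
qed

lemma span_on_bounded:
assumes "span_on U G R" "D \<subseteq> U" "!!g. g \<in> G ==> \<exists>C. \<forall>k. \<forall>x\<in>D. \<bar>g k x\<bar> <= C"
shows "\<exists>C. \<forall>k. \<forall>x\<in>D. \<bar>R k x\<bar> <= C"
using assms(1)
proof (induction rule: span_on.induct)
case (coef c) then show ?case using Cb_bound[of U c] assms(2) by (meson subsetD)
next
case (gen c g)
obtain C1 where "C1 > 0" "\<forall>k. \<forall>x\<in>U. \<bar>c k x\<bar> <= C1" using Cb_bound[OF gen(1)] by blast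
moreover obtain C2 where "\<forall>k. \<forall>x\<in>D. \<bar>g k x\<bar> <= C2" using assms(3)[OF gen(2)] by blast
ultimately have "\<forall>k. \<forall>x\<in>D. \<bar>c k x * g k x\<bar> <= C1 * C2"
 unfolding abs_mult using assms(2) by (intro allI ballI mult_mono) auto
then show ?case by blast
next
case (add R S)
then obtain C1 C2 where "\<forall>k. \<forall>x\<in>D. \<bar>R k x\<bar> <= C1" "\<forall>k. \<forall>x\<in>D. \<bar>S k x\<bar> <= C2" by blast
then have "\<forall>k. \<forall>x\<in>D. \<bar>R k x + S k x\<bar> <= C1 + C2" by (meson abs_triangle_ineq add_mono order_trans)
then show ?case by blast
next
case (cong R S) then show ?case using assms(2) by (metis subsetD)
qed

section \<open>The commuting frame and the Laplacian expressed in it\<close>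

locale adapted_fields =
fixes U :: "(real^'n::finite) set" and fi :: "real^'n => real" and nu :: 'n and c0 :: real
assumes opU: "open U" and phi: "Cb U (%_::unit. fi)" and c0: "0 < c0"
 and lower: "!!x. x \<in> U ==> c0 <= \<bar>partial_deriv nu fi x\<bar>"
begin

abbreviation "X \<equiv> tangential fi nu"
abbreviation "Y \<equiv> transversal fi nu"
abbreviation "Xs \<equiv> tangentials fi nu"
abbreviation "inv_nu \<equiv> %x. inverse (partial_deriv nu fi x)"

lemma Cb_phi: "Cb U (%_::'k. fi)" by (rule Cb_reindex[OF phi])
lemma Cb_dphi: "Cb U (%_::'k. partial_deriv i fi)" by (rule Cb_partial_deriv[OF Cb_phi])
lemma Cb_inv: "Cb U (%_::'k. inv_nu)" by (rule Cb_inverse[OF opU Cb_dphi c0 lower])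
lemma smooth_phi: "smooth_on U fi" using Cb_imp_smooth_on[OF opU phi] .
lemma smooth_inv: "smooth_on U inv_nu" using Cb_imp_smooth_on[OF opU Cb_inv[where 'k=unit]] .

lemma Cb_tangential_coeff:
"Cb U (%_::'k. %x. (if i = a then 1 else 0) - (if i = nu then partial_deriv a fi x * inv_nu x else 0))"
proof (rule Cb_diff[OF opU])
show "Cb U (%_::'k. %x. if i = a then 1 else 0)" by (cases "i = a") (auto intro: Cb_const opU)
show "Cb U (%_::'k. %x. if i = nu then partial_deriv a fi x * inv_nu x else 0)"
 using Cb_mult[OF opU Cb_dphi Cb_inv] by (cases "i = nu") (auto intro: Cb_const opU)
qed
lemma Cb_transversal_coeff: "Cb U (%_::'k. %x. if i = nu then inv_nu x else 0)"
by (cases "i = nu") (auto intro!: Cb_const Cb_inv opU)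

lemma smooth_X: "smooth_on U f ==> smooth_on U (X a f)"
unfolding tangential_def
by (rule smooth_on_vfield[OF opU Cb_imp_smooth_on[OF opU Cb_tangential_coeff[where 'k=unit]]])
lemma smooth_Y: "smooth_on U f ==> smooth_on U (Y f)"
unfolding transversal_def
by (rule smooth_on_vfield[OF opU Cb_imp_smooth_on[OF opU Cb_transversal_coeff[where 'k=unit]]])
lemma smooth_Xs: "smooth_on U f ==> smooth_on U (Xs I f)"
by (induction I) (auto intro: smooth_X)

lemma X_cong: "x \<in> U ==> (!!y. y \<in> U ==> f y = g y) ==> X a f x = X a g x"
unfolding tangential_def by (rule vfield_cong[OF opU])
lemma Y_cong: "x \<in> U ==> (!!y. y \<in> U ==> f y = g y) ==> Y f x = Y g x"
unfolding transversal_def by (rule vfield_cong[OF opU])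
lemma X_add: "x \<in> U ==> smooth_on U f ==> smooth_on U g ==> X a (%x. f x + g x) x = X a f x + X a g x"
unfolding tangential_def by (rule vfield_add[OF opU])
lemma Y_add: "x \<in> U ==> smooth_on U f ==> smooth_on U g ==> Y (%x. f x + g x) x = Y f x + Y g x"
unfolding transversal_def by (rule vfield_add[OF opU])
lemma X_mult: "x \<in> U ==> smooth_on U f ==> smooth_on U g ==> X a (%x. f x * g x) x = X a f x * g x + f x * X a g x"
unfolding tangential_def by (rule vfield_mult[OF opU])
lemma Y_mult: "x \<in> U ==> smooth_on U f ==> smooth_on U g ==> Y (%x. f x * g x) x = Y f x * g x + f x * Y g x"
unfolding transversal_def by (rule vfield_mult[OF opU])
lemma X_sum: "x \<in> U ==> finite A ==> (!!c. c \<in> A ==> smooth_on U (f c)) ==> X a (%x. \<Sum>c\<in>A. f c x) x = (\<Sum>c\<in>A. X a (f c) x)"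
unfolding tangential_def by (rule vfield_sum[OF opU])
lemma Y_sum: "x \<in> U ==> finite A ==> (!!c. c \<in> A ==> smooth_on U (f c)) ==> Y (%x. \<Sum>c\<in>A. f c x) x = (\<Sum>c\<in>A. Y (f c) x)"
unfolding transversal_def by (rule vfield_sum[OF opU])

lemma Cb_X: "Cb U (F::'k => _) ==> Cb U (%k. X a (F k))"
unfolding tangential_def by (rule Cb_vfield[OF opU Cb_tangential_coeff])
lemma Cb_Y: "Cb U (F::'k => _) ==> Cb U (%k. Y (F k))"
unfolding transversal_def by (rule Cb_vfield[OF opU Cb_transversal_coeff])

lemma nonzero: "x \<in> U ==> partial_deriv nu fi x ~= 0" using lower c0 by fastforce

lemma deriv_inv:
assumes "x \<in> U"
shows "partial_deriv j inv_nu x = - (inv_nu x * inv_nu x * partial_deriv j (partial_deriv nu fi) x)"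
proof -
have "(inverse has_real_derivative - (inv_nu x * inv_nu x)) (at (partial_deriv nu fi x))"
 using DERIV_inverse[OF nonzero[OF assms]] by (simp add: power2_eq_square)
from partial_deriv_real_compose(2)[OF this smooth_on_imp_differentiable[OF smooth_on_partial_deriv[OF smooth_phi] assms]]
show ?thesis by simp
qed

lemma deriv_transversal:
assumes "x \<in> U" "smooth_on U f"
shows "partial_deriv j (Y f) x = - (inv_nu x * inv_nu x * partial_deriv j (partial_deriv nu fi) x) * partial_deriv nu f x
 + inv_nu x * partial_deriv j (partial_deriv nu f) x"
proof -
have "Y f = (%x. inv_nu x * partial_deriv nu f x)" by (auto simp: transversal_eq)
then show ?thesis
 using partial_deriv_mult[OF smooth_on_imp_differentiable[OF smooth_inv assms(1)]
 smooth_on_imp_differentiable[OF smooth_on_partial_deriv[OF assms(2)] assms(1)], of j nu]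
 by (simp add: deriv_inv[OF assms(1)])
qed

lemma deriv_tangential:
assumes "x \<in> U" "smooth_on U f"
shows "partial_deriv j (X a f) x = partial_deriv j (partial_deriv a f) x
 - (partial_deriv j (partial_deriv a fi) x * inv_nu x * partial_deriv nu f x
 + partial_deriv a fi x * (- (inv_nu x * inv_nu x * partial_deriv j (partial_deriv nu fi) x)) * partial_deriv nu f x
 + partial_deriv a fi x * inv_nu x * partial_deriv j (partial_deriv nu f) x)"
proof -
have e: "X a f = (%x. partial_deriv a f x + (-1) * (partial_deriv a fi x * Y f x))"
 by (auto simp: tangential_eq transversal_eq)
have s1: "smooth_on U (partial_deriv a f)" "smooth_on U (partial_deriv a fi)" "smooth_on U (Y f)"
 using assms smooth_phi smooth_Y smooth_on_partial_deriv by blast+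
have s2: "smooth_on U (%x. partial_deriv a fi x * Y f x)" by (intro smooth_on_mult opU s1)
have s3: "smooth_on U (%x. (-1) * (partial_deriv a fi x * Y f x))" by (intro smooth_on_mult smooth_on_const opU s1)
note d = smooth_on_imp_differentiable[OF _ assms(1)]
have "partial_deriv j (X a f) x = partial_deriv j (partial_deriv a f) x
 - (partial_deriv j (partial_deriv a fi) x * Y f x + partial_deriv a fi x * partial_deriv j (Y f) x)"
 unfolding e partial_deriv_add[OF d[OF s1(1)] d[OF s3]]
 partial_deriv_mult[OF d[OF smooth_on_const[OF opU]] d[OF s2]] partial_deriv_mult[OF d[OF s1(2)] d[OF s1(3)]]
 by simp
then show ?thesis unfolding deriv_transversal[OF assms] transversal_eq by (simp add: algebra_simps)
qed

lemma tangential_commute: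
assumes "x \<in> U" "smooth_on U f"
shows "X a (X b f) x = X b (X a f) x"
unfolding tangential_eq[of fi nu a "X b f"] tangential_eq[of fi nu b "X a f"] deriv_tangential[OF assms]
using partial_deriv_commute[OF opU assms(1) assms(2)] partial_deriv_commute[OF opU assms(1) smooth_phi]
by (simp add: algebra_simps)

lemma tangential_transversal:
assumes "x \<in> U" "smooth_on U f"
shows "X a (Y f) x = Y (X a f) x"
unfolding tangential_eq[of fi nu a "Y f"] transversal_eq[of fi nu "X a f"] deriv_tangential[OF assms] deriv_transversal[OF assms]
using partial_deriv_commute[OF opU assms(1) assms(2), of a nu] partial_deriv_commute[OF opU assms(1) smooth_phi, of a nu]
by (simp add: algebra_simps)

abbreviation "q \<equiv> %x. inverse (gradsq fi x)"
abbreviation "cross a \<equiv> %x. 2 * q x * partial_deriv a fi x"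
abbreviation "first \<equiv> %x. q x * laplacian fi x"

text \<open>The Laplacian divided by |grad fi|^2, written in the frame. The division normalises the
  coefficient of \<open>Y (Y f)\<close> to 1.\<close>

definition Lop :: "(real^'n => real) => real^'n => real" where
"Lop f x = Y (Y f) x + (\<Sum>a\<in>UNIV. cross a x * Y (X a f) x) + (\<Sum>a\<in>UNIV. q x * X a (X a f) x) + first x * Y f x"

lemma gradsq_lower: "x \<in> U ==> c0\<^sup>2 <= gradsq fi x"
proof -
assume x: "x \<in> U"
have "c0\<^sup>2 <= (partial_deriv nu fi x)\<^sup>2" using lower[OF x] c0 by (metis abs_le_square_iff abs_of_pos)
also have "... <= gradsq fi x" unfolding gradsq_def by (rule member_le_sum) auto
finally show ?thesis .
qed

lemma Cb_gradsq: "Cb U (%_::'k. gradsq fi)"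
unfolding gradsq_def[abs_def] power2_eq_square by (intro Cb_sum Cb_mult Cb_dphi opU finite)
lemma Cb_q: "Cb U (%_::'k. q)"
by (rule Cb_inverse[OF opU Cb_gradsq, of "c0\<^sup>2"]) (use c0 gradsq_lower in fastforce)+
lemma Cb_cross: "Cb U (%_::'k. cross a)"
by (intro Cb_mult Cb_const Cb_q Cb_dphi opU)
lemma Cb_first: "Cb U (%_::'k. first)"
unfolding laplacian_def[abs_def] by (intro Cb_mult Cb_q Cb_sum Cb_partial_deriv Cb_phi opU finite)

text \<open>Each pure second derivative is expanded by means of d_a = X a + (d_a fi) Y; summed over
  a, the squares of d_a fi give \<open>gradsq fi\<close>.\<close>

lemma laplacian_Lop:
assumes "x \<in> U" "smooth_on U f"
shows "laplacian f x = gradsq fi x * Lop f x"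
proof -
have g: "gradsq fi x ~= 0" using gradsq_lower[OF assms(1)] c0 by auto
have t: "partial_deriv a (partial_deriv a f) x = X a (X a f) x + 2 * partial_deriv a fi x * Y (X a f) x
 + (partial_deriv a fi x)\<^sup>2 * Y (Y f) x + partial_deriv a (partial_deriv a fi) x * Y f x" for a
 unfolding tangential_eq[of fi nu a "X a f"] transversal_eq[of fi nu "X a f"] transversal_eq[of fi nu "Y f"]
 deriv_tangential[OF assms] deriv_transversal[OF assms]
 using partial_deriv_commute[OF opU assms(1) assms(2), of a nu] partial_deriv_commute[OF opU assms(1) smooth_phi, of a nu]
 by (simp add: transversal_eq algebra_simps power2_eq_square)
have "gradsq fi x * Lop f x = gradsq fi x * Y (Y f) x + (\<Sum>a\<in>UNIV. (gradsq fi x * q x) * (2 * partial_deriv a fi x * Y (X a f) x))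
 + (\<Sum>a\<in>UNIV. (gradsq fi x * q x) * X a (X a f) x) + (gradsq fi x * q x) * laplacian fi x * Y f x"
 unfolding Lop_def by (simp add: sum_distrib_left algebra_simps)
also have "gradsq fi x * q x = 1" using g by simp
finally show ?thesis
 unfolding laplacian_def[of f] t by (simp add: sum.distrib gradsq_def laplacian_def sum_distrib_right)
qed

text \<open>The fields commute and \<open>Y (Y f)\<close> carries the constant coefficient 1, so the
  commutator with \<open>X b\<close> contains no second derivative in the transversal
  direction.\<close>

lemma Lop_tangential:
assumes "x \<in> U" "smooth_on U f"
shows "Lop (X b f) x = X b (Lop f) x - ((\<Sum>a\<in>UNIV. X b (cross a) x * Y (X a f) x)
 + (\<Sum>a\<in>UNIV. X b q x * X a (X a f) x) + X b first x * Y f x)"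
proof -
note sf = assms(2)
have sX: "smooth_on U (X a f)" "smooth_on U (X a (X a f))" "smooth_on U (Y (X a f))" for a
 using sf smooth_X smooth_Y by blast+
have sY: "smooth_on U (Y f)" "smooth_on U (Y (Y f))" using sf smooth_Y by blast+
have sc: "smooth_on U (cross a)" for a using Cb_imp_smooth_on[OF opU Cb_cross[where 'k=unit]] .
have sq: "smooth_on U q" using Cb_imp_smooth_on[OF opU Cb_q[where 'k=unit]] .
have s1: "smooth_on U first" using Cb_imp_smooth_on[OF opU Cb_first[where 'k=unit]] .
have A1: "smooth_on U (%x. cross a x * Y (X a f) x)" for a by (rule smooth_on_mult[OF opU sc sX(3)])
have A2: "smooth_on U (%x. q x * X a (X a f) x)" for a by (rule smooth_on_mult[OF opU sq sX(2)])
have A3: "smooth_on U (%x. first x * Y f x)" by (rule smooth_on_mult[OF opU s1 sY(1)])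
have B1: "smooth_on U (%x. \<Sum>a\<in>UNIV. cross a x * Y (X a f) x)" by (rule smooth_on_sum[OF opU finite A1])
have B2: "smooth_on U (%x. \<Sum>a\<in>UNIV. q x * X a (X a f) x)" by (rule smooth_on_sum[OF opU finite A2])
have e1: "X b (Y (Y f)) x = Y (Y (X b f)) x"
 using tangential_transversal[OF assms(1) sY(1)] Y_cong[OF assms(1) tangential_transversal[OF _ sf]] by simp
have e2: "X b (Y (X a f)) x = Y (X a (X b f)) x" for a
 using tangential_transversal[OF assms(1) sX(1)] Y_cong[OF assms(1) tangential_commute[OF _ sf]] by simp
have e3: "X b (X a (X a f)) x = X a (X a (X b f)) x" for a
 using tangential_commute[OF assms(1) sX(1), of b a] X_cong[OF assms(1) tangential_commute[OF _ sf]] by simp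
have e4: "X b (Y f) x = Y (X b f) x" using tangential_transversal[OF assms] .
have g1: "X b (%x. \<Sum>a\<in>UNIV. cross a x * Y (X a f) x) x = (\<Sum>a\<in>UNIV. X b (%x. cross a x * Y (X a f) x) x)"
 by (rule X_sum[OF assms(1) finite A1])
have g2: "X b (%x. \<Sum>a\<in>UNIV. q x * X a (X a f) x) x = (\<Sum>a\<in>UNIV. X b (%x. q x * X a (X a f) x) x)"
 by (rule X_sum[OF assms(1) finite A2])
have "X b (Lop f) x = X b (Y (Y f)) x + (\<Sum>a\<in>UNIV. X b (%x. cross a x * Y (X a f) x) x)
 + (\<Sum>a\<in>UNIV. X b (%x. q x * X a (X a f) x) x) + X b (%x. first x * Y f x) x"
 unfolding Lop_def[abs_def]
 using X_add[OF assms(1) smooth_on_add[OF opU smooth_on_add[OF opU sY(2) B1] B2] A3]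
 X_add[OF assms(1) smooth_on_add[OF opU sY(2) B1] B2] X_add[OF assms(1) sY(2) B1]
 g1 g2 by simp
also have "... = Y (Y (X b f)) x + (\<Sum>a\<in>UNIV. X b (cross a) x * Y (X a f) x + cross a x * Y (X a (X b f)) x)
 + (\<Sum>a\<in>UNIV. X b q x * X a (X a f) x + q x * X a (X a (X b f)) x) + (X b first x * Y f x + first x * Y (X b f) x)"
 unfolding X_mult[OF assms(1) sc sX(3)] X_mult[OF assms(1) sq sX(2)] X_mult[OF assms(1) s1 sY(1)] e1 e2 e3 e4 ..
finally show ?thesis unfolding Lop_def[of "X b f"] by (simp add: sum.distrib)
qed

end

section \<open>A priori bounds for the penalised equation\<close>

text \<open>The penalty \<open>ka\<close> may be unbounded in \<open>k\<close>; what matters is that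
  it is nonnegative and constant along the tangential fields. The aim is bounds that are uniform in
  \<open>k\<close>.\<close>

locale penalised_solutions = adapted_fields U fi nu c0
for U :: "(real^'n::finite) set" and fi nu c0 +
fixes u :: "'k => real^'n => real" and ka :: "'k => real^'n => real" and F :: "real^'n => real"
assumes smooth_u: "smooth_on U (u k)" and smooth_kappa: "smooth_on U (ka k)"
 and kappa_nonneg: "x \<in> U ==> ka k x >= 0"
 and X_kappa: "x \<in> U ==> tangential fi nu a (ka k) x = 0"
 and Cb_F: "Cb U (%_::'k. F)"
 and equation: "x \<in> U ==> laplacian (u k) x = gradsq fi x * ka k x * u k x + F x"
begin

text \<open>The derivatives that are controlled by \<open>u\<close> and the full gradients of the
  tangential derivatives of order at most \<open>m\<close>.\<close>

definition gens :: "nat => ('k => real^'n => real) set" where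
"gens m = {%k. Xs I (u k) |I. length I <= Suc m} \<union> {%k. Y (Xs I (u k)) |I. length I <= m}"

lemma gens_smooth: "g \<in> gens m ==> smooth_on U (g k)"
by (auto simp: gens_def intro: smooth_Xs smooth_Y smooth_u)

lemma gens_mono: "gens m \<subseteq> gens (Suc m)"
unfolding gens_def by force

lemma span_Xs: "length I <= Suc m ==> span_on U (gens m) (%k. Xs I (u k))"
by (rule span_on_gen[OF opU]) (auto simp: gens_def)

lemma span_YXs: "length I <= m ==> span_on U (gens m) (%k. Y (Xs I (u k)))"
by (rule span_on_gen[OF opU]) (auto simp: gens_def)

lemma span_X:
assumes "span_on U (gens m) R"
shows "span_on U (gens (Suc m)) (%k. X a (R k))"
unfolding tangential_def
proof (rule span_on_vfield[OF opU assms])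
show "smooth_on U (g k)" if "g \<in> gens m" for g k by (rule gens_smooth[OF that])
show "Cb U (%_::'k. %x. (if i = a then 1 else 0) - (if i = nu then partial_deriv a fi x * inv_nu x else 0))" for i
 by (rule Cb_tangential_coeff)
show "gens m \<subseteq> gens (Suc m)" by (rule gens_mono)
next
fix g assume "g \<in> gens m"
then consider I where "g = (%k. Xs I (u k))" "length I <= Suc m" | I where "g = (%k. Y (Xs I (u k)))" "length I <= m"
 unfolding gens_def by blast
then have "span_on U (gens (Suc m)) (%k. X a (g k))"
proof cases
 case 1
 then show ?thesis using span_Xs[of "a # I" "Suc m"] by simp
next
 case 2
 have "span_on U (gens (Suc m)) (%k. Y (X a (Xs I (u k))))" using span_YXs[of "a # I" "Suc m"] 2 by simp
 then show ?thesis unfolding 2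
 by (rule span_on.cong) (simp add: tangential_transversal smooth_Xs smooth_u)
qed
then show "span_on U (gens (Suc m)) (%k. vfield (%i x. (if i = a then 1 else 0) - (if i = nu then partial_deriv a fi x * inv_nu x else 0)) (g k))"
 unfolding tangential_def .
qed

lemma Lop_u:
assumes x: "x \<in> U"
shows "Lop (u k) x = ka k x * u k x + q x * F x"
proof -
have g: "gradsq fi x > 0" using gradsq_lower[OF x] c0 by (meson order_less_le_trans zero_less_power)
have "gradsq fi x * Lop (u k) x = gradsq fi x * ka k x * u k x + F x"
 using laplacian_Lop[OF x smooth_u] equation[OF x] by simp
then show ?thesis using g by (simp add: field_simps)
qed

text \<open>Tangential differentiation passes through \<open>ka\<close>, and the commutator with
  \<open>Lop\<close> produces only terms with at most one \<open>Y\<close>. So every tangential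
  derivative solves the same penalised equation, with a remainder of controlled type.\<close>

lemma Lop_Xs:
"\<exists>R. span_on U (gens (length I)) R & (\<forall>k. \<forall>x\<in>U. Lop (Xs I (u k)) x = ka k x * Xs I (u k) x + R k x)"
proof (induction I)
case Nil
have "Cb U (%_::'k. %x. q x * F x)" by (intro Cb_mult opU Cb_q Cb_F)
then show ?case using Lop_u by (intro exI[of _ "%k x. q x * F x"]) (auto intro: span_on.coef)
next
case (Cons b I)
then obtain R where R: "span_on U (gens (length I)) R"
 "!!k x. x \<in> U ==> Lop (Xs I (u k)) x = ka k x * Xs I (u k) x + R k x" by blast
let ?f = "%k. Xs I (u k)" and ?G = "gens (Suc (length I))"
have sf: "smooth_on U (?f k)" for k using smooth_Xs smooth_u by blast
have sR: "smooth_on U (R k)" for k by (rule span_on_smooth[OF opU R(1)]) (rule gens_smooth)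
define S where "S = (%k x. X b (R k) x - ((\<Sum>a\<in>UNIV. X b (cross a) x * Y (X a (?f k)) x)
 + (\<Sum>a\<in>UNIV. X b q x * X a (X a (?f k)) x) + X b first x * Y (?f k) x))"
have "span_on U ?G (%k. Y (X a (?f k)))" for a using span_YXs[of "a # I"] by simp
moreover have "span_on U ?G (%k. X a (X a (?f k)))" for a using span_Xs[of "a # a # I"] by simp
moreover have "span_on U ?G (%k. Y (?f k))" using span_YXs[of I] by simp
ultimately have "span_on U ?G S" unfolding S_def
 by (intro span_on_diff span_on.add span_on_sum span_on_mult span_X[OF R(1)] Cb_X Cb_cross Cb_q Cb_first opU finite)
moreover have "Lop (Xs (b # I) (u k)) x = ka k x * Xs (b # I) (u k) x + S k x" if x: "x \<in> U" for k x
proof -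
 have "X b (Lop (?f k)) x = X b (%x. ka k x * ?f k x + R k x) x" by (rule X_cong[OF x R(2)])
 also have "... = ka k x * X b (?f k) x + X b (R k) x"
 using X_add[OF x smooth_on_mult[OF opU smooth_kappa sf] sR] X_mult[OF x smooth_kappa sf] X_kappa[OF x] by simp
 finally show ?thesis using Lop_tangential[OF x sf] unfolding S_def by simp
qed
ultimately show ?case by (intro exI[of _ S]) simp
qed

text \<open>Each generator is \<open>u\<close> itself or one field applied to some
  \<open>Xs I\<close> with \<open>length I <= m\<close>, so its square is at most a constant times a
  bounded quantity or a squared gradient.\<close>

lemma span_square_bound:
assumes "span_on U (gens m) R" "D \<subseteq> U" "!!k x. x \<in> D ==> \<bar>u k x\<bar> <= M"
shows "\<exists>C>0. \<forall>k. \<forall>x\<in>D. (R k x)\<^sup>2 <= C * (1 + (\<Sum>I\<in>{I. length I <= m}. gradsq (Xs I (u k)) x))"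
proof -
let ?S = "%k x. \<Sum>I\<in>{I::'n list. length I <= m}. gradsq (Xs I (u k)) x"
have fin: "finite {I::'n list. length I <= m}" using finite_lists_length_le[of "UNIV::'n set" m] by simp
have S0: "?S k x >= 0" for k x by (simp add: sum_nonneg gradsq_nonneg)
have Smem: "gradsq (Xs I (u k)) x <= ?S k x" if "length I <= m" for I k x
 by (rule member_le_sum[of I _ "%I. gradsq (Xs I (u k)) x"]) (use that fin gradsq_nonneg in auto)
have cb: "\<exists>C. \<forall>x\<in>U. (\<Sum>i\<in>UNIV. (b i x)\<^sup>2) <= C" if "!!i. Cb U (%_::'k. b i)" for b :: "'n => real^'n => real"
proof -
 have "Cb U (%_::'k. %x. \<Sum>i\<in>UNIV. (b i x)\<^sup>2)" unfolding power2_eq_square by (intro Cb_sum Cb_mult that opU finite)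
 from Cb_bound[OF this] show ?thesis by (meson abs_le_D1)
qed
have vf: "\<exists>C>0. \<forall>k. \<forall>x\<in>D. (vfield b (Xs I (u k)) x)\<^sup>2 <= C * (1 + ?S k x)"
 if len: "length I <= m" and cbb: "!!i. Cb U (%_::'k. b i)" for b I
proof -
 obtain C where C: "\<forall>x\<in>U. (\<Sum>i\<in>UNIV. (b i x)\<^sup>2) <= C" using cb[of b, OF cbb] by blast
 have "(vfield b (Xs I (u k)) x)\<^sup>2 <= max C 1 * (1 + ?S k x)" if x: "x \<in> D" for k x
 proof -
 have "(vfield b (Xs I (u k)) x)\<^sup>2 <= (\<Sum>i\<in>UNIV. (b i x)\<^sup>2) * gradsq (Xs I (u k)) x" by (rule vfield_square_le)
 also have "... <= max C 1 * (1 + ?S k x)"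
 using C x assms(2) Smem[OF len, of k x] gradsq_nonneg[of "Xs I (u k)" x]
 by (intro mult_mono) (auto simp: le_max_iff_disj)
 finally show ?thesis .
 qed
 then show ?thesis by (intro exI[of _ "max C 1"]) auto
qed
have g: "\<exists>C>0. \<forall>k. \<forall>x\<in>D. (g k x)\<^sup>2 <= C * (1 + ?S k x)" if "g \<in> gens m" for g
proof -
 have "g = u | (\<exists>a I. g = (%k. X a (Xs I (u k))) & length I <= m) | (\<exists>I. g = (%k. Y (Xs I (u k))) & length I <= m)"
 using that unfolding gens_def
 proof (elim UnE CollectE exE conjE)
 fix I assume g: "g = (%k. Xs I (u k))" "length I <= Suc m"
 show ?thesis
 proof (cases I)
 case (Cons a J)
 then have "g = (%k. X a (Xs J (u k)))" "length J <= m" using g by auto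
 then show ?thesis by blast
 qed (use g in auto)
 qed blast
 then consider "g = u" | a I where "g = (%k. X a (Xs I (u k)))" "length I <= m" | I where "g = (%k. Y (Xs I (u k)))" "length I <= m"
 by blast
 then show ?thesis
 proof cases
 case 1
 have "(g k x)\<^sup>2 <= (M\<^sup>2 + 1) * (1 + ?S k x)" if "x \<in> D" for k x
 proof -
 have "(g k x)\<^sup>2 <= M\<^sup>2" using assms(3)[OF that, of k] 1 by (metis abs_ge_zero power2_abs power_mono)
 also have "... <= (M\<^sup>2 + 1) * (1 + ?S k x)" using S0[of k x] by (simp add: distrib_left distrib_right add_nonneg_nonneg)
 finally show ?thesis .
 qed
 moreover have "M\<^sup>2 + 1 > 0" by (simp add: add_nonneg_pos)
 ultimately show ?thesis by blast
 next
 case (2 a I)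
 then show ?thesis using vf[OF 2(2) Cb_tangential_coeff[of _ a]] by (simp add: tangential_def)
 next
 case (3 I)
 then show ?thesis using vf[OF 3(2) Cb_transversal_coeff] by (simp add: transversal_def)
 qed
qed
show ?thesis using assms(1)
proof (induction rule: span_on.induct)
 case (coef c)
 obtain C where C: "C > 0" "\<forall>k. \<forall>x\<in>U. \<bar>c k x\<bar> <= C" using Cb_bound[OF coef] by blast
 have "(c k x)\<^sup>2 <= C\<^sup>2 * (1 + ?S k x)" if "x \<in> D" for k x
 proof -
 have "(c k x)\<^sup>2 <= C\<^sup>2" using C that assms(2) by (metis abs_ge_zero power2_abs power_mono subsetD)
 then show ?thesis using S0[of k x] by (simp add: distrib_left add_increasing2)
 qed
 then show ?case using C(1) by (intro exI[of _ "C\<^sup>2"]) auto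
next
 case (gen c h)
 obtain C where C: "C > 0" "\<forall>k. \<forall>x\<in>U. \<bar>c k x\<bar> <= C" using Cb_bound[OF gen(1)] by blast
 obtain B where B: "B > 0" "\<forall>k. \<forall>x\<in>D. (h k x)\<^sup>2 <= B * (1 + ?S k x)" using g[OF gen(2)] by blast
 have "(c k x * h k x)\<^sup>2 <= C\<^sup>2 * B * (1 + ?S k x)" if "x \<in> D" for k x
 proof -
 have "(c k x)\<^sup>2 <= C\<^sup>2" using C that assms(2) by (metis abs_ge_zero power2_abs power_mono subsetD)
 then have "(c k x)\<^sup>2 * (h k x)\<^sup>2 <= C\<^sup>2 * (B * (1 + ?S k x))" using B(2) that by (intro mult_mono) auto
 then show ?thesis by (simp add: power_mult_distrib mult.assoc)
 qed
 then show ?case using C(1) B(1) by (intro exI[of _ "C\<^sup>2 * B"]) auto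
next
 case (add R S)
 obtain A where A: "A > 0" "\<forall>k. \<forall>x\<in>D. (R k x)\<^sup>2 <= A * (1 + ?S k x)" using add.IH(1) by blast
 obtain B where B: "B > 0" "\<forall>k. \<forall>x\<in>D. (S k x)\<^sup>2 <= B * (1 + ?S k x)" using add.IH(2) by blast
 have "(R k x + S k x)\<^sup>2 <= (2 * A + 2 * B) * (1 + ?S k x)" if "x \<in> D" for k x
 proof -
 have "(R k x + S k x)\<^sup>2 <= 2 * (R k x)\<^sup>2 + 2 * (S k x)\<^sup>2"
 using zero_le_power2[of "R k x - S k x"] by (simp add: power2_eq_square algebra_simps)
 also have "... <= 2 * (A * (1 + ?S k x)) + 2 * (B * (1 + ?S k x))" using A B that by (intro add_mono mult_left_mono) auto
 finally show ?thesis by (simp add: distrib_right mult.assoc)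
 qed
 then show ?case using A(1) B(1) by (intro exI[of _ "2 * A + 2 * B"]) auto
next
 case (cong R S)
 obtain C where C: "C > 0" "!!k x. x \<in> D ==> (R k x)\<^sup>2 <= C * (1 + ?S k x)" using cong.IH by blast
 have "(S k x)\<^sup>2 <= C * (1 + ?S k x)" if "x \<in> D" for k x
 proof -
 have "R k x = S k x" using cong.hyps(2) that assms(2) by blast
 then show ?thesis using C(2)[OF that, of k] by simp
 qed
 then show ?case using C(1) by blast
qed
qed

text \<open>Bernstein's method with the derivatives of order at most \<open>m\<close> as the
  functions already bounded and those of order \<open>Suc m\<close> as the ones to be bounded; the
  latter are in turn controlled by gradients of the former. Each order costs a little of the
  radius.\<close>

lemma tangential_bounds:
assumes "ball p R0 \<subseteq> U" "!!k x. x \<in> ball p R0 ==> \<bar>u k x\<bar> <= M"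
shows "rh < R0 ==> \<exists>K>0. \<forall>I k. \<forall>x\<in>ball p rh. length I <= m --> \<bar>Xs I (u k) x\<bar> <= K"
proof (induction m arbitrary: rh)
case 0
have "\<bar>u k x\<bar> <= \<bar>M\<bar> + 1" if "x \<in> ball p rh" for k x
 using assms(2)[of x k] that 0 by force
then show ?case by (intro exI[of _ "\<bar>M\<bar> + 1"]) auto
next
case (Suc m)
show ?case
proof (cases "rh > 0")
 case False
 then have "ball p rh = {}" by (simp add: ball_empty)
 then show ?thesis by (intro exI[of _ 1]) (simp only: ball_empty, simp)
next
 case True
 \<comment> \<open>The lower orders are bounded on the larger radius \<open>rh'\<close>; Bernstein's
   lemma works on balls of radius \<open>s\<close> centred in \<open>ball p rh\<close>.\<close>
 define rh' where "rh' = (rh + R0) / 2"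
 define s where "s = (rh' - rh) / 2"
 have r: "rh' < R0" "0 < s" "s < (rh' - rh)" using Suc.prems by (auto simp: rh'_def s_def)
 obtain K where K: "K > 0" "!!I k x. x \<in> ball p rh' ==> length I <= m ==> \<bar>Xs I (u k) x\<bar> <= K"
 using Suc.IH[OF r(1)] by blast
 let ?D = "ball p rh'"
 let ?A = "{I::'n list. length I <= m}" and ?B = "{I::'n list. length I = Suc m}"
 let ?S = "%k x. \<Sum>I\<in>?A. gradsq (Xs I (u k)) x" and ?T = "%k x. \<Sum>I\<in>?B. gradsq (Xs I (u k)) x"
 have fin: "finite ?A" "finite ?B" using finite_lists_length_le[of "UNIV::'n set" m] finite_lists_length_eq[of "UNIV::'n set" "Suc m"] by simp_all
 have DU: "?D \<subseteq> U" using assms(1) r by (meson less_imp_le order_trans subset_ball)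
 have uM: "\<bar>u k x\<bar> <= M" if "x \<in> ?D" for k x using assms(2) that r(1) by auto
 have S0: "?S k x >= 0" and T0: "?T k x >= 0" for k x by (simp_all add: sum_nonneg gradsq_nonneg)
 obtain Cg where Cg: "Cg > 0" "!!x. x \<in> U ==> \<bar>gradsq fi x\<bar> <= Cg" using Cb_bound[OF Cb_gradsq[where 'k=unit]] by auto
 have E: "\<exists>C>0. \<forall>k. \<forall>x\<in>?D. (laplacian (Xs I (u k)) x - (gradsq fi x * ka k x) * Xs I (u k) x)\<^sup>2
 <= C * (1 + (\<Sum>J\<in>{J. length J <= length I}. gradsq (Xs J (u k)) x))" for I
 proof -
 obtain R where R: "span_on U (gens (length I)) R" "!!k x. x \<in> U ==> Lop (Xs I (u k)) x = ka k x * Xs I (u k) x + R k x"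
 using Lop_Xs by blast
 obtain C where C: "C > 0" "!!k x. x \<in> ?D ==> (R k x)\<^sup>2 <= C * (1 + (\<Sum>J\<in>{J. length J <= length I}. gradsq (Xs J (u k)) x))"
 using span_square_bound[OF R(1) DU uM] by blast
 have "(laplacian (Xs I (u k)) x - (gradsq fi x * ka k x) * Xs I (u k) x)\<^sup>2
 <= Cg\<^sup>2 * C * (1 + (\<Sum>J\<in>{J. length J <= length I}. gradsq (Xs J (u k)) x))" if x: "x \<in> ?D" for k x
 proof -
 have xU: "x \<in> U" using x DU by blast
 have "laplacian (Xs I (u k)) x - (gradsq fi x * ka k x) * Xs I (u k) x = gradsq fi x * R k x"
 using laplacian_Lop[OF xU smooth_Xs[OF smooth_u]] R(2)[OF xU] by (simp add: algebra_simps)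
 moreover have "(gradsq fi x)\<^sup>2 <= Cg\<^sup>2" using Cg(2)[OF xU] by (metis abs_ge_zero power2_abs power_mono)
 ultimately show ?thesis using C(2)[OF x, of k]
 by (simp add: power_mult_distrib mult.assoc mult_mono)
 qed
 then show ?thesis using Cg(1) C(1) by (intro exI[of _ "Cg\<^sup>2 * C"]) auto
 qed
 then obtain Ce where Ce: "!!I. Ce I > 0" "!!I k x. x \<in> ?D ==> (laplacian (Xs I (u k)) x - (gradsq fi x * ka k x) * Xs I (u k) x)\<^sup>2
 <= Ce I * (1 + (\<Sum>J\<in>{J. length J <= length I}. gradsq (Xs J (u k)) x))" by metis
 have "\<exists>C>0. \<forall>k. \<forall>x\<in>?D. (Xs I (u k) x)\<^sup>2 <= C * (1 + ?S k x)" if "length I = Suc m" for I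
 using span_square_bound[OF span_Xs[of I m] DU uM] that by simp
 then obtain Cf where Cf: "!!I. length I = Suc m ==> Cf I > 0" "!!I k x. length I = Suc m ==> x \<in> ?D ==> (Xs I (u k) x)\<^sup>2 <= Cf I * (1 + ?S k x)" by metis
 define C where "C = (\<Sum>I\<in>?A. Ce I) + (\<Sum>I\<in>?B. Ce I) + (\<Sum>I\<in>?B. Cf I) + 1"
 have nn: "(\<Sum>I\<in>?A. Ce I) >= 0" "(\<Sum>I\<in>?B. Ce I) >= 0" "(\<Sum>I\<in>?B. Cf I) >= 0"
 using Ce(1) Cf(1) by (auto intro!: sum_nonneg simp: less_imp_le)
 have CA: "Ce I <= C" if "I \<in> ?A" for I
 using member_le_sum[of I ?A Ce] that fin nn Ce(1) by (simp add: C_def less_imp_le)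
 have CB: "Ce I <= C" "Cf I <= C" if "I \<in> ?B" for I
 using member_le_sum[of I ?B Ce] member_le_sum[of I ?B Cf] that fin nn Ce(1) Cf(1) by (simp_all add: C_def less_imp_le)
 have Cp: "C > 0" using nn by (simp add: C_def)
 have mono: "(\<Sum>J\<in>{J. length J <= length I}. gradsq (Xs J (u k)) x) <= ?S k x" if "I \<in> ?A" for I k x
 using that fin gradsq_nonneg by (intro sum_mono2) auto
 have split: "(\<Sum>J\<in>{J. length J <= length I}. gradsq (Xs J (u k)) x) = ?S k x + ?T k x" if "I \<in> ?B" for I k x
 proof -
 have "{J::'n list. length J <= length I} = ?A \<union> ?B" using that by auto
 then show ?thesis using fin by (simp add: sum.union_disjoint disjoint_iff)
 qed
 obtain K' where K': "\<forall>p (g :: 'n list => real^'n => real) (h :: 'n list => real^'n => real) ka.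
 (\<forall>a\<in>?A. smooth_on (ball p (rh' - rh)) (g a)) & (\<forall>b\<in>?B. smooth_on (ball p (rh' - rh)) (h b)) &
 (\<forall>x\<in>cball p s. ka x >= (0::real)) & (\<forall>a\<in>?A. \<forall>x\<in>cball p s. \<bar>g a x\<bar> <= K) &
 (\<forall>a\<in>?A. \<forall>x\<in>cball p s. (laplacian (g a) x - ka x * g a x)\<^sup>2 <= C * (1 + (\<Sum>a\<in>?A. gradsq (g a) x))) &
 (\<forall>b\<in>?B. \<forall>x\<in>cball p s. (laplacian (h b) x - ka x * h b x)\<^sup>2 <= C * (1 + (\<Sum>a\<in>?A. gradsq (g a) x) + (\<Sum>b\<in>?B. gradsq (h b) x))) &
 (\<forall>b\<in>?B. \<forall>x\<in>cball p s. (h b x)\<^sup>2 <= C * (1 + (\<Sum>a\<in>?A. gradsq (g a) x))) -->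
 (\<forall>b\<in>?B. \<forall>x\<in>cball p (s / 2). \<bar>h b x\<bar> <= K')"
 using bernstein[OF fin r(2,3) Cp K(1)] by blast
 have bd: "\<bar>Xs I (u k) x\<bar> <= K'" if x: "x \<in> ball p rh" and I: "I \<in> ?B" for I k x
 proof -
 have sub: "ball x (rh' - rh) \<subseteq> ?D" using x by (auto simp: subset_iff dist_norm) (smt (verit) dist_norm dist_triangle)
 have sub2: "cball x s \<subseteq> ?D" using sub r(3) by force
 have "\<forall>b\<in>?B. \<forall>y\<in>cball x (s / 2). \<bar>Xs b (u k) y\<bar> <= K'"
 \<comment> \<open>Both function families are the same map from lists to tangential derivatives,
   read over the two index sets, and the potential is \<open>gradsq fi * ka\<close>. The bound
   \<open>K'\<close> was fixed before the centre and \<open>k\<close>, which makes it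
   uniform.\<close>
 proof (rule K'[THEN spec[of _ x], THEN spec[of _ "%I. Xs I (u k)"], THEN spec[of _ "%I. Xs I (u k)"],
 THEN spec[of _ "%x. gradsq fi x * ka k x"], THEN mp], intro conjI ballI)
 show "smooth_on (ball x (rh' - rh)) (Xs I (u k))" for I
 using smooth_on_subset[OF smooth_Xs[OF smooth_u]] sub DU by blast
 show "smooth_on (ball x (rh' - rh)) (Xs I (u k))" for I
 using smooth_on_subset[OF smooth_Xs[OF smooth_u]] sub DU by blast
 fix y assume "y \<in> cball x s"
 then have y: "y \<in> ?D" using sub2 by blast
 then have yU: "y \<in> U" using DU by blast
 show "0 <= gradsq fi y * ka k y" by (intro mult_nonneg_nonneg gradsq_nonneg kappa_nonneg[OF yU])
 show "\<bar>Xs a (u k) y\<bar> <= K" if "a \<in> ?A" for a using K(2)[OF y] that by simp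
 show "(laplacian (Xs a (u k)) y - gradsq fi y * ka k y * Xs a (u k) y)\<^sup>2 <= C * (1 + ?S k y)" if a: "a \<in> ?A" for a
 proof -
 have "Ce a * (1 + (\<Sum>J\<in>{J. length J <= length a}. gradsq (Xs J (u k)) y)) <= C * (1 + ?S k y)"
 using CA[OF a] mono[OF a, of k y] Ce(1)[of a] by (intro mult_mono) (auto simp: add_nonneg_nonneg sum_nonneg gradsq_nonneg Cp less_imp_le)
 then show ?thesis using Ce(2)[OF y, of a k] by linarith
 qed
 show "(laplacian (Xs b (u k)) y - gradsq fi y * ka k y * Xs b (u k) y)\<^sup>2 <= C * (1 + ?S k y + ?T k y)" if b: "b \<in> ?B" for b
 proof -
 have "Ce b * (1 + (\<Sum>J\<in>{J. length J <= length b}. gradsq (Xs J (u k)) y)) <= C * (1 + ?S k y + ?T k y)"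
 unfolding split[OF b] using CB(1)[OF b] S0[of k y] T0[of k y] by (simp add: add.assoc mult_right_mono)
 then show ?thesis using Ce(2)[OF y, of b k] by linarith
 qed
 show "(Xs b (u k) y)\<^sup>2 <= C * (1 + ?S k y)" if b: "b \<in> ?B" for b
 proof -
 have "Cf b * (1 + ?S k y) <= C * (1 + ?S k y)" using CB(2)[OF b] S0[of k y] by (intro mult_right_mono) auto
 then show ?thesis using Cf(2)[OF _ y, of b k] b by fastforce
 qed
 qed
 then show ?thesis using I r(2) by auto
 qed
 have "\<bar>Xs I (u k) x\<bar> <= K + \<bar>K'\<bar>" if "x \<in> ball p rh" "length I <= Suc m" for I k x
 proof (cases "length I <= m")
 case True
 have "x \<in> ?D" using that(1) Suc.prems by (auto simp: rh'_def)
 then show ?thesis using K(2)[of x I k] True by linarith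
 next
 case False
 then show ?thesis using bd[OF that(1), of I k] that(2) K(1) by force
 qed
 then show ?thesis using K(1) by (intro exI[of _ "K + \<bar>K'\<bar>"]) auto
qed
qed

end

section \<open>Normal derivatives inside the domain\<close>

lemma (in adapted_fields) partial_deriv_decompose:
"partial_deriv i f x = X i f x + partial_deriv i fi x * Y f x"
by (simp add: tangential_eq transversal_eq)

context penalised_solutions
begin

definition tgens :: "('k => real^'n => real) set" where
"tgens = range (%I k. Xs I (u k))"

definition agens :: "('k => real^'n => real) set" where
"agens = range (%I k. Xs I (u k)) \<union> range (%I k. Y (Xs I (u k)))"

lemma smooth_Xs_u: "smooth_on U (Xs I (u k))"
by (rule smooth_Xs[OF smooth_u])

lemma tgens_X:
assumes "span_on U tgens R"
shows "span_on U tgens (%k. X a (R k))"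
proof -
have "span_on U tgens (%k. X a (g k))" if g: "g \<in> tgens" for g
proof -
 obtain I where "g = (%k. Xs I (u k))" using g by (auto simp: tgens_def)
 then have "(%k. X a (g k)) = (%k. Xs (a # I) (u k))" by simp
 also have "... \<in> tgens" unfolding tgens_def by blast
 finally show ?thesis by (rule span_on_gen[OF opU])
qed
then show ?thesis unfolding tangential_def
 by (intro span_on_vfield[OF opU assms _ Cb_tangential_coeff order_refl])
 (auto simp: tgens_def smooth_Xs_u)
qed

lemma tgens_gen: "span_on U tgens (%k. Xs I (u k))"
by (rule span_on_gen[OF opU]) (auto simp: tgens_def)

lemma agens_gen: "span_on U agens (%k. Xs I (u k))" "span_on U agens (%k. Y (Xs I (u k)))"
by (rule span_on_gen[OF opU], auto simp: agens_def)+

lemma agens_smooth: "g \<in> agens ==> smooth_on U (g k)"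
by (auto simp: agens_def smooth_Xs_u smooth_Y)

lemma agens_X:
assumes "span_on U agens R"
shows "span_on U agens (%k. X a (R k))"
proof -
have "span_on U agens (%k. X a (g k))" if g: "g \<in> agens" for g
proof -
 consider I where "g = (%k. Xs I (u k))" | I where "g = (%k. Y (Xs I (u k)))" using g by (auto simp: agens_def)
 then show ?thesis
 proof cases
 case (1 I)
 then show ?thesis using agens_gen(1)[of "a # I"] by simp
 next
 case (2 I)
 show ?thesis unfolding 2
 by (rule span_on.cong[OF agens_gen(2)[of "a # I"]]) (simp add: tangential_transversal smooth_Xs_u)
 qed
qed
then show ?thesis unfolding tangential_def
 by (intro span_on_vfield[OF opU assms _ Cb_tangential_coeff order_refl]) (auto simp: agens_smooth)
qed

text \<open>Where the penalty vanishes, the equation expresses \<open>Y (Y f)\<close> through terms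
  with at most one \<open>Y\<close>; thus the span is closed under the transversal field as
  well.\<close>

lemma agens_Y:
assumes "span_on U agens R" and ka0: "!!k x. x \<in> U ==> ka k x = 0"
shows "span_on U agens (%k. Y (R k))"
proof -
have "span_on U agens (%k. Y (g k))" if g: "g \<in> agens" for g
proof -
 consider I where "g = (%k. Xs I (u k))" | I where "g = (%k. Y (Xs I (u k)))" using g by (auto simp: agens_def)
 then show ?thesis
 proof cases
 case (1 I)
 then show ?thesis using agens_gen(2)[of I] by simp
 next
 case (2 I)
 obtain R where R: "span_on U (gens (length I)) R" "!!k x. x \<in> U ==> Lop (Xs I (u k)) x = ka k x * Xs I (u k) x + R k x"
 using Lop_Xs by blast
 have "gens (length I) \<subseteq> agens" unfolding gens_def agens_def by blast
 then have R': "span_on U agens R" using span_on_mono[OF R(1)] by blast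
 define S where "S = (%k x. R k x - ((\<Sum>a\<in>UNIV. cross a x * Y (Xs (a # I) (u k)) x)
 + (\<Sum>a\<in>UNIV. q x * Xs (a # a # I) (u k) x) + first x * Y (Xs I (u k)) x))"
 have S: "span_on U agens S" unfolding S_def
 by (intro span_on_diff span_on.add span_on_sum span_on_mult R' agens_gen Cb_cross Cb_q Cb_first opU finite)
 show ?thesis unfolding 2
 by (rule span_on.cong[OF S]) (use R(2) ka0 in \<open>simp add: S_def Lop_def algebra_simps\<close>)
 qed
qed
then show ?thesis unfolding transversal_def
 by (intro span_on_vfield[OF opU assms(1) _ Cb_transversal_coeff order_refl]) (auto simp: agens_smooth)
qed

text \<open>The flux @h@ of the equation in the transversal direction: its transversal derivative only
involves tangential derivatives of the solution.\<close>

definition flux :: "'k => real^'n => real" where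
"flux k x = Y (u k) x + ((\<Sum>a\<in>UNIV. cross a x * X a (u k) x) + first x * u k x)"

lemma smooth_cross: "smooth_on U (cross a)" using Cb_imp_smooth_on[OF opU Cb_cross[where 'k=unit]] .
lemma smooth_first: "smooth_on U first" using Cb_imp_smooth_on[OF opU Cb_first[where 'k=unit]] .

lemma flux_Xs: "\<exists>S. span_on U tgens S & (\<forall>k. \<forall>x\<in>U. Xs I (flux k) x = Y (Xs I (u k)) x + S k x)"
proof (induction I)
case Nil
have "span_on U tgens (%k x. (\<Sum>a\<in>UNIV. cross a x * X a (u k) x) + first x * u k x)"
 using tgens_gen[of "[_]"] tgens_gen[of "[]"]
 by (intro span_on.add span_on_sum span_on_mult Cb_cross Cb_first opU finite) auto
then show ?case
 by (intro exI[of _ "%k x. (\<Sum>a\<in>UNIV. cross a x * X a (u k) x) + first x * u k x"]) (simp add: flux_def)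
next
case (Cons b I)
then obtain S where S: "span_on U tgens S" "!!k x. x \<in> U ==> Xs I (flux k) x = Y (Xs I (u k)) x + S k x" by blast
have sS: "smooth_on U (S k)" for k by (rule span_on_smooth[OF opU S(1)]) (auto simp: tgens_def smooth_Xs_u)
have "Xs (b # I) (flux k) x = Y (Xs (b # I) (u k)) x + X b (S k) x" if x: "x \<in> U" for k x
proof -
 have "X b (Xs I (flux k)) x = X b (%x. Y (Xs I (u k)) x + S k x) x" by (rule X_cong[OF x S(2)])
 also have "... = X b (Y (Xs I (u k))) x + X b (S k) x" by (rule X_add[OF x smooth_Y[OF smooth_Xs_u] sS])
 also have "X b (Y (Xs I (u k))) x = Y (X b (Xs I (u k))) x" by (rule tangential_transversal[OF x smooth_Xs_u])
 finally show ?thesis by simp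
qed
then show ?case using tgens_X[OF S(1)] by blast
qed

lemma smooth_flux: "smooth_on U (flux k)"
unfolding flux_def[abs_def]
by (intro smooth_on_add smooth_on_sum smooth_on_mult smooth_Y smooth_X smooth_u smooth_cross smooth_first opU finite)

text \<open>Applied to the flux, \<open>Y\<close> reproduces \<open>Lop (u k)\<close> up to the
  purely tangential second derivatives and terms in which \<open>Y\<close> hits a coefficient; no
  transversal derivative of the solution is left over.\<close>

lemma Y_flux0: "\<exists>S. span_on U tgens S & (\<forall>k. \<forall>x\<in>U. Y (flux k) x = ka k x * u k x + S k x)"
proof -
define S where "S = (%k x. q x * F x - (\<Sum>a\<in>UNIV. q x * Xs [a, a] (u k) x) + ((\<Sum>a\<in>UNIV. Y (cross a) x * Xs [a] (u k) x) + Y first x * Xs [] (u k) x))"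
have S: "span_on U tgens S" unfolding S_def
 by (intro span_on.add span_on_diff span_on_sum span_on_mult tgens_gen span_on.coef Cb_mult Cb_q Cb_F Cb_Y Cb_cross Cb_first opU finite)
have "Y (flux k) x = ka k x * u k x + S k x" if x: "x \<in> U" for k x
proof -
 have s1: "smooth_on U (%x. cross a x * X a (u k) x)" for a
 by (intro smooth_on_mult smooth_X smooth_u smooth_cross opU)
 have s2: "smooth_on U (%x. \<Sum>a\<in>UNIV. cross a x * X a (u k) x)" by (intro smooth_on_sum s1 opU finite)
 have s3: "smooth_on U (%x. first x * u k x)" by (intro smooth_on_mult smooth_u smooth_first opU)
 have e: "Y (%x. \<Sum>a\<in>UNIV. cross a x * X a (u k) x) x = (\<Sum>a\<in>UNIV. Y (%x. cross a x * X a (u k) x) x)"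
 by (rule Y_sum[OF x finite s1])
 have "Y (flux k) x = Y (Y (u k)) x + ((\<Sum>a\<in>UNIV. Y (%x. cross a x * X a (u k) x) x) + Y (%x. first x * u k x) x)"
 unfolding flux_def[abs_def] using Y_add[OF x smooth_Y[OF smooth_u] smooth_on_add[OF opU s2 s3]] Y_add[OF x s2 s3] e by simp
 also have "... = Y (Y (u k)) x + ((\<Sum>a\<in>UNIV. Y (cross a) x * X a (u k) x + cross a x * Y (X a (u k)) x) + (Y first x * u k x + first x * Y (u k) x))"
 unfolding Y_mult[OF x smooth_cross smooth_X[OF smooth_u]] Y_mult[OF x smooth_first smooth_u] ..
 also have "... = Lop (u k) x - (\<Sum>a\<in>UNIV. q x * X a (X a (u k)) x) + ((\<Sum>a\<in>UNIV. Y (cross a) x * X a (u k) x) + Y first x * u k x)"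
 unfolding Lop_def by (simp add: sum.distrib)
 finally show ?thesis using Lop_u[OF x] by (simp add: S_def)
qed
then show ?thesis using S by (intro exI[of _ S]) simp
qed

lemma Y_flux:
assumes ka0: "!!k x. x \<in> U ==> ka k x = 0"
shows "\<exists>S. span_on U tgens S & (\<forall>k. \<forall>x\<in>U. Y (Xs I (flux k)) x = S k x)"
proof (induction I)
case Nil
show ?case using Y_flux0 ka0 by fastforce
next
case (Cons b I)
then obtain S where S: "span_on U tgens S" "!!k x. x \<in> U ==> Y (Xs I (flux k)) x = S k x" by blast
have "Y (Xs (b # I) (flux k)) x = X b (S k) x" if x: "x \<in> U" for k x
 using tangential_transversal[OF x smooth_Xs[OF smooth_flux], of b I k] X_cong[OF x S(2)] by simp
then show ?case using tgens_X[OF S(1)] by blast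
qed

text \<open>A tangential derivative is bounded, so on a segment of length \<open>l\<close> the mean
  value theorem yields a point where its \<open>Y\<close>-derivative, and hence the corresponding
  derivative of the flux, is bounded. The latter has bounded slope along the segment and is
  therefore bounded at \<open>x\<close>, and with it the \<open>Y\<close>-derivative. Closure of
  \<open>agens\<close> under all fields then covers every partial derivative.\<close>

lemma normal_bounds:
assumes ka0: "!!k x. x \<in> U ==> ka k x = 0"
 and tb: "!!I. \<exists>C. \<forall>k. \<forall>x\<in>U. \<bar>Xs I (u k) x\<bar> <= C"
 and D: "D \<subseteq> U" "0 < l"
 and seg: "!!x. x \<in> D ==> \<exists>z t0. 0 <= t0 & t0 <= l & x = z + t0 *\<^sub>R axis nu 1 & (\<forall>t. 0 <= t --> t <= l --> z + t *\<^sub>R axis nu 1 \<in> U)"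
shows "\<exists>C. \<forall>k. \<forall>x\<in>D. \<bar>pd I (u k) x\<bar> <= C"
proof -
have tbd: "\<exists>C. \<forall>k. \<forall>x\<in>U. \<bar>R k x\<bar> <= C" if R: "span_on U tgens R" for R
 by (rule span_on_bounded[OF R order_refl]) (use tb in \<open>auto simp: tgens_def\<close>)
obtain Cp where Cp: "Cp > 0" "!!x. x \<in> U ==> \<bar>partial_deriv nu fi x\<bar> <= Cp" using Cb_bound[OF Cb_dphi[where 'k=unit]] by blast
have yb: "\<exists>C. \<forall>k. \<forall>x\<in>D. \<bar>Y (Xs I (u k)) x\<bar> <= C" for I
proof -
 obtain S where S: "span_on U tgens S" "!!k x. x \<in> U ==> Xs I (flux k) x = Y (Xs I (u k)) x + S k x" using flux_Xs by blast
 obtain T where T: "span_on U tgens T" "!!k x. x \<in> U ==> Y (Xs I (flux k)) x = T k x" using Y_flux[OF ka0] by blast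
 obtain BS where BS: "!!k x. x \<in> U ==> \<bar>S k x\<bar> <= BS" using tbd[OF S(1)] by blast
 obtain BT where BT: "!!k x. x \<in> U ==> \<bar>T k x\<bar> <= BT" using tbd[OF T(1)] by blast
 obtain B where B: "!!k x. x \<in> U ==> \<bar>Xs I (u k) x\<bar> <= B" using tb by blast
 have dY: "partial_deriv nu f x = partial_deriv nu fi x * Y f x" if "x \<in> U" for f x
 using nonzero[OF that] by (simp add: transversal_eq)
 have "\<bar>Y (Xs I (u k)) x\<bar> <= (2 * B / l / c0 + BS) + l * (Cp * BT) + BS" if x: "x \<in> D" for k x
 proof -
 obtain z t0 where z: "0 <= t0" "t0 <= l" "x = z + t0 *\<^sub>R axis nu 1" "!!t. 0 <= t ==> t <= l ==> z + t *\<^sub>R axis nu 1 \<in> U"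
 using seg[OF x] by blast
 let ?p = "%t. z + t *\<^sub>R axis nu 1" and ?g = "Xs I (u k)" and ?H = "Xs I (flux k)"
 have xU: "x \<in> U" using x D by blast
 obtain t where t: "0 < t" "t < l" "?g (?p l) - ?g z = l * partial_deriv nu ?g (?p t)"
 using mvt_partial_deriv[of l ?g z nu] smooth_on_imp_differentiable[OF smooth_Xs_u] z(4) D(2) by blast
 have tU: "?p t \<in> U" using z(4) t by simp
 have "\<bar>?g (?p l) - ?g z\<bar> <= 2 * B" using B[OF z(4)[of l], of k] B[OF z(4)[of 0], of k] D(2) by simp
 then have "l * \<bar>partial_deriv nu ?g (?p t)\<bar> <= 2 * B" unfolding t(3) abs_mult using D(2) by simp
 then have "\<bar>partial_deriv nu ?g (?p t)\<bar> <= 2 * B / l" using D(2) by (simp add: field_simps)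
 moreover have "c0 * \<bar>Y ?g (?p t)\<bar> <= \<bar>partial_deriv nu ?g (?p t)\<bar>"
 unfolding dY[OF tU, of ?g] abs_mult by (rule mult_right_mono[OF lower[OF tU]]) simp
 ultimately have "c0 * \<bar>Y ?g (?p t)\<bar> <= 2 * B / l" by linarith
 then have "\<bar>Y ?g (?p t)\<bar> <= 2 * B / l / c0" unfolding pos_le_divide_eq[OF c0] by (simp add: mult.commute)
 then have Ht: "\<bar>?H (?p t)\<bar> <= 2 * B / l / c0 + BS" using S(2)[OF tU, of k] BS[OF tU, of k] by linarith
 have dH: "((%s. ?H (?p s)) has_real_derivative partial_deriv nu ?H (?p s)) (at s)" if "s \<in> {0..l}" for s
 proof -
 have "?p s \<in> U" using z(4) that by simp
 from has_real_derivative_partial_deriv[OF smooth_on_imp_differentiable[OF smooth_Xs[OF smooth_flux] this]]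
 show ?thesis by (simp add: axis_def if_distrib[of "%c. c * _"] cong: if_cong)
 qed
 have dHb: "norm (partial_deriv nu ?H (?p s)) <= Cp * BT" if "s \<in> {0..l}" for s
 proof -
 have sU: "?p s \<in> U" using z(4) that by simp
 have "\<bar>Y ?H (?p s)\<bar> <= BT" unfolding T(2)[OF sU] by (rule BT[OF sU])
 then show ?thesis unfolding dY[OF sU, of ?H] real_norm_def abs_mult using Cp(2)[OF sU] by (intro mult_mono) auto
 qed
 have "norm (?H (?p t0) - ?H (?p t)) <= (Cp * BT) * norm (t0 - t)"
 by (rule field_differentiable_bound[of "{0..l}" "%s. ?H (?p s)" "%s. partial_deriv nu ?H (?p s)"])
 (use dH dHb z t in \<open>auto intro: has_field_derivative_at_within\<close>)
 also have "... <= (Cp * BT) * l"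
 using z t dHb[of t] by (intro mult_left_mono) (auto intro: order_trans[OF norm_ge_zero])
 finally have "\<bar>?H x - ?H (?p t)\<bar> <= l * (Cp * BT)" using z(3) by (simp add: mult.commute)
 then show ?thesis using Ht S(2)[OF xU, of k] BS[OF xU, of k] by linarith
 qed
 then show ?thesis by blast
qed
have ag: "\<exists>C. \<forall>k. \<forall>x\<in>D. \<bar>g k x\<bar> <= C" if "g \<in> agens" for g
proof -
 have "(\<exists>I. g = (%k. Xs I (u k))) | (\<exists>I. g = (%k. Y (Xs I (u k))))" using that by (auto simp: agens_def)
 then show ?thesis using tb yb D(1) by (metis (no_types, lifting) subsetD)
qed
have "span_on U agens (%k. pd I (u k))"
proof (induction I)
 case Nil then show ?case using agens_gen(1)[of "[]"] by simp
next
 case (Cons i I)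
 have "span_on U agens (%k x. X i (pd I (u k)) x + partial_deriv i fi x * Y (pd I (u k)) x)"
 by (intro span_on.add span_on_mult agens_X agens_Y Cons Cb_dphi opU ka0)
 then show ?case by (rule span_on.cong) (simp add: partial_deriv_decompose[symmetric])
qed
then show ?thesis by (rule span_on_bounded[OF _ D(1) ag])
qed

end

section \<open>Extension of smooth functions across the boundary\<close>

text \<open>Power series coefficients of the entire function given by the product over j >= 0 of (1
  - z / 2^j), whose zeros are the powers 2^m.\<close>

primrec seeley_aux :: "nat => real" where
"seeley_aux 0 = 1"
| "seeley_aux (Suc j) = - seeley_aux j * (2 / (2 ^ Suc j - 1))"

lemma seeley_aux_summable: "summable (%j. \<bar>seeley_aux j\<bar> * R ^ j)" if R: "R >= 0"
proof -
obtain M where M: "2 * R + 1 < 2 ^ M" using real_arch_pow[of 2 "2 * R + 1"] by auto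
show ?thesis
proof (rule summable_ratio_test[of "1 / 2" "Suc M"])
fix j assume j: "j >= Suc M"
have "(2::real) ^ Suc M <= 2 ^ Suc j" using j by (intro power_increasing) auto
then have "4 * R + 2 < 2 ^ Suc j" using M unfolding power_Suc by linarith
then have "2 * R / (2 ^ Suc j - 1) <= 1 / 2" using R by (simp add: divide_le_eq)
have p: "(2::real) ^ Suc j - 1 > 0" using \<open>4 * R + 2 < 2 ^ Suc j\<close> R by linarith
have "norm (\<bar>seeley_aux (Suc j)\<bar> * R ^ Suc j) = (2 * R / (2 ^ Suc j - 1)) * (\<bar>seeley_aux j\<bar> * R ^ j)"
 using R p by (simp add: abs_mult abs_divide del: power_Suc) (simp add: field_simps)
also have "... <= (1 / 2) * (\<bar>seeley_aux j\<bar> * R ^ j)"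
 using R by (intro mult_right_mono \<open>2 * R / (2 ^ Suc j - 1) <= 1 / 2\<close>) auto
finally show "norm (\<bar>seeley_aux (Suc j)\<bar> * R ^ Suc j) <= 1 / 2 * norm (\<bar>seeley_aux j\<bar> * R ^ j)"
 using R by simp
qed simp
qed

lemma seeley_aux_summable': "summable (%j. seeley_aux j * z ^ j)"
by (rule summable_rabs_cancel) (use seeley_aux_summable[of "\<bar>z\<bar>"] in \<open>simp add: abs_mult power_abs\<close>)

definition seeley_fun :: "real => real" where "seeley_fun z = (\<Sum>j. seeley_aux j * z ^ j)"

lemma seeley_fun_eq: "seeley_fun z = (1 - z) * seeley_fun (z / 2)"
proof -
have s: "(%j. seeley_aux j * (z / 2) ^ j) sums seeley_fun (z / 2)"
 unfolding seeley_fun_def by (rule summable_sums[OF seeley_aux_summable'])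
have s2: "(%j. z * (seeley_aux j * (z / 2) ^ j)) sums (z * seeley_fun (z / 2))" by (rule sums_mult[OF s])
have "(%j. case j of 0 => 0 | Suc i => z * (seeley_aux i * (z / 2) ^ i)) sums (z * seeley_fun (z / 2) + 0)"
 using sums_Suc[of "%j. case j of 0 => 0 | Suc i => z * (seeley_aux i * (z / 2) ^ i)"] s2 by fastforce
from sums_diff[OF s this]
have "(%j. seeley_aux j * (z / 2) ^ j - (case j of 0 => 0 | Suc i => z * (seeley_aux i * (z / 2) ^ i))) sums ((1 - z) * seeley_fun (z / 2))"
 by (simp add: algebra_simps)
moreover have "seeley_aux j * (z / 2) ^ j - (case j of 0 => 0 | Suc i => z * (seeley_aux i * (z / 2) ^ i)) = seeley_aux j * z ^ j" for j
proof (cases j)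
 case (Suc i)
 have "(2::real) * 2 ^ i > 1" using one_le_power[of "2::real" i] by linarith
 then have "(2::real) * 2 ^ i - 1 ~= 0" by simp
 then show ?thesis unfolding Suc by (simp add: power_divide divide_simps) (simp add: algebra_simps)
qed simp
ultimately have "(%j. seeley_aux j * z ^ j) sums ((1 - z) * seeley_fun (z / 2))" by simp
then show ?thesis unfolding seeley_fun_def by (simp add: sums_iff)
qed

lemma seeley_fun_pow: "seeley_fun (2 ^ m) = 0"
proof (induction m)
case 0 then show ?case using seeley_fun_eq[of 1] by simp
next
case (Suc m) then show ?case using seeley_fun_eq[of "2 ^ Suc m"] by simp
qed

text \<open>A zero at 1/2 would propagate through the functional equation to all powers of 1/2,
  against continuity and the value 1 at 0.\<close>

lemma seeley_fun_half: "seeley_fun (1 / 2) ~= 0"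
proof
assume z: "seeley_fun (1 / 2) = 0"
have "seeley_fun ((1 / 2) ^ Suc N) = 0" for N
proof (induction N)
 case (Suc N)
 have "(1 - (1 / 2) ^ Suc N) ~= (0::real)" using power_Suc_less_one[of "1/2::real" N] by simp
 then show ?case using Suc seeley_fun_eq[of "(1 / 2) ^ Suc N"] by simp
qed (use z in simp)
moreover have "(%N. seeley_fun ((1 / 2) ^ Suc N)) \<longlonglongrightarrow> seeley_fun 0"
proof (rule isCont_tendsto_compose[of 0 seeley_fun "%N. (1 / 2) ^ Suc N"])
 show "isCont seeley_fun 0" unfolding seeley_fun_def[abs_def]
 by (rule isCont_powser[of _ 1]) (use seeley_aux_summable'[of 1] in auto)
 show "(%N. (1 / 2) ^ Suc N) \<longlonglongrightarrow> (0::real)" by (rule LIMSEQ_Suc) (rule LIMSEQ_realpow_zero, auto)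
qed
ultimately have "seeley_fun 0 = 0" by (simp add: LIMSEQ_const_iff)
moreover have "seeley_fun 0 = 1" unfolding seeley_fun_def by (simp add: powser_zero)
ultimately show False by simp
qed

text \<open>With f the function above and a_j its coefficient times 2^(-j) / f(1/2), the moment of
  order m is f(2^m / 2) / f(1/2): m = 0 is the normalisation, and the other arguments are zeros of
  f.\<close>

lemma seeley_sequence:
"\<exists>a::nat => real. (\<forall>m. summable (%j. \<bar>a j\<bar> * 2 ^ (j * m))) & (\<forall>m. (%j. a j * 2 ^ (j * m)) sums (if m = 0 then 1 else 0))"
proof -
define a where "a j = seeley_aux j * (1 / 2) ^ j / seeley_fun (1 / 2)" for j
have e: "(1 / 2) ^ j * 2 ^ (j * m) = ((2 ^ m / 2) :: real) ^ j" for j m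
 by (simp add: power_mult[symmetric] power_divide mult.commute)
have "summable (%j. \<bar>seeley_aux j\<bar> * (2 ^ m / 2) ^ j * (1 / \<bar>seeley_fun (1 / 2)\<bar>))" for m
 by (intro summable_mult2 seeley_aux_summable) simp
moreover have "\<bar>a j\<bar> * 2 ^ (j * m) = \<bar>seeley_aux j\<bar> * (2 ^ m / 2) ^ j * (1 / \<bar>seeley_fun (1 / 2)\<bar>)" for j m
 unfolding a_def e[symmetric] by (simp add: abs_mult abs_divide)
ultimately have 1: "summable (%j. \<bar>a j\<bar> * 2 ^ (j * m))" for m by simp
have "(%j. seeley_aux j * (2 ^ m / 2) ^ j * (1 / seeley_fun (1 / 2))) sums (seeley_fun (2 ^ m / 2) * (1 / seeley_fun (1 / 2)))" for m
 unfolding seeley_fun_def[of "2 ^ m / 2"] by (intro sums_mult2 summable_sums seeley_aux_summable')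
moreover have "a j * 2 ^ (j * m) = seeley_aux j * (2 ^ m / 2) ^ j * (1 / seeley_fun (1 / 2))" for j m
 unfolding a_def e[symmetric] by simp
moreover have "seeley_fun (2 ^ m / 2) * (1 / seeley_fun (1 / 2)) = (if m = 0 then 1 else 0)" for m
 using seeley_fun_half seeley_fun_pow by (cases m) auto
ultimately have "(%j. a j * 2 ^ (j * m)) sums (if m = 0 then 1 else 0)" for m by simp
then show ?thesis using 1 by blast
qed

section \<open>Extension by infinitely many weighted reflections\<close>

locale reflection =
fixes fi :: "real^'n::finite => real" and W :: "(real^'n) set" and N :: "'n => real^'n => real"
 and a :: "nat => real" and de :: real
assumes opW: "open W" and phi: "Cb UNIV (%_::unit. fi)" and NC: "!!l. Cb UNIV (%_::unit. N l)" and de: "de > 0"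
 and a_summable: "!!m. summable (%j. \<bar>a j\<bar> * 2 ^ (j * m))"
 and a_sums: "!!m. (%j. a j * 2 ^ (j * m)) sums (if m = 0 then 1 else 0)"
 and inside: "!!x t. x \<in> W ==> 0 <= fi x ==> fi x <= t ==> 0 < t ==> t <= de ==> fi (x - t *\<^sub>R (\<chi> l. N l x)) < 0"
begin

text \<open>\<open>N\<close> is scaled so that moving back by any \<open>t\<close> between
  \<open>fi x\<close> and \<open>de\<close> ends where \<open>fi\<close> is negative. The extension
  uses t = 2^j fi(x), which is never below fi(x).\<close>

definition refl :: "real => real^'n => real^'n" where "refl t x = x - t *\<^sub>R (\<chi> l. N l x)"

definition profile :: "(real => real) => bool" where
"profile psi = ((\<forall>k. smooth1 k psi) & (\<forall>t>de. psi t = 0))"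

lemma profile_deriv:
assumes "profile psi"
shows "(psi has_real_derivative deriv psi t) (at t)" "profile (deriv psi)"
proof -
have d: "(psi has_real_derivative deriv psi t) (at t) & smooth1 k (deriv psi)" for k t
proof -
 have "smooth1 (Suc k) psi" using assms by (auto simp: profile_def)
 then obtain h' where h': "!!t. (psi has_real_derivative h' t) (at t)" "smooth1 k h'" by auto
 then have "deriv psi = h'" using DERIV_imp_deriv by blast
 then show ?thesis using h' by simp
qed
have "deriv psi t = 0" if "t > de" for t
proof -
 have "((%t. 0) has_real_derivative 0) (at t)" by simp
 then have "(psi has_real_derivative 0) (at t)"
 by (rule has_field_derivative_transform_within_open[of _ _ _ "{de<..}"]) (use that assms in \<open>auto simp: profile_def\<close>)
 then show ?thesis by (rule DERIV_imp_deriv)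
qed
with d show "(psi has_real_derivative deriv psi t) (at t)" "profile (deriv psi)" by (auto simp: profile_def)
qed

lemma profile_mult_id: "profile psi ==> profile (%t. t * psi t)"
by (auto simp: profile_def intro: smooth1_mult smooth1_id)

lemma profile_bounded: "profile psi ==> \<exists>B>0. \<forall>t\<ge>0. \<bar>psi t\<bar> <= B"
proof -
assume p: "profile psi"
then have "continuous_on {0..de} psi" using smooth1_continuous[of 0 psi] continuous_on_subset by (auto simp: profile_def)
then have "bounded (psi ` {0..de})" using compact_continuous_image compact_imp_bounded by blast
then obtain B where "\<forall>y\<in>psi ` {0..de}. norm y <= B" unfolding bounded_iff by blast
then have B: "!!t. t \<in> {0..de} ==> \<bar>psi t\<bar> <= B" by auto
have "\<bar>psi t\<bar> <= \<bar>B\<bar> + 1" if "t >= 0" for t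
 using B[of t] that p by (cases "t <= de") (auto simp: profile_def)
then show ?thesis by (intro exI[of _ "\<bar>B\<bar> + 1"]) auto
qed

text \<open>A summand of some derivative of the extension: \<open>m\<close> counts the factors 2^j
  produced by differentiation, \<open>psi\<close> is a cutoff in t or a derivative of one, and
  \<open>c\<close> is a coefficient.\<close>

definition rterm :: "nat => (real => real) => (real^'n => real) => (real^'n => real) => nat => real^'n => real" where
"rterm m psi c v j x = (a j * 2 ^ (j * m)) * (psi (2 ^ j * fi x) * (c x * v (refl (2 ^ j * fi x) x)))"

text \<open>The value on \<open>fi <= 0\<close> is what the moment conditions make of the series on
  the hypersurface: the full term for m = 0 and nothing for m > 0.\<close>

definition ext :: "nat => (real => real) => (real^'n => real) => (real^'n => real) => real^'n => real" where
"ext m psi c v x = (if fi x <= 0 then (if m = 0 then psi 0 * (c x * v x) else 0) else (\<Sum>j. rterm m psi c v j x))"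

lemma smooth_phi: "smooth_on UNIV fi" by (rule Cb_imp_smooth_on[OF open_UNIV phi])
lemma smooth_N: "smooth_on UNIV (N l)" by (rule Cb_imp_smooth_on[OF open_UNIV NC])

lemma rterm_zero: "profile psi ==> de < 2 ^ j * fi x ==> rterm m psi c v j x = 0"
by (simp add: rterm_def profile_def)

text \<open>With \<open>fi x\<close> bounded away from 0 the cutoff kills all but finitely many
  reflections; the same \<open>J\<close> works for all such points, so the series may be
  differentiated termwise there.\<close>

lemma ext_finite:
assumes "profile psi" "0 < e" "e < fi x" "de < 2 ^ J * e"
shows "ext m psi c v x = (\<Sum>j<J. rterm m psi c v j x)"
proof -
have "rterm m psi c v j x = 0" if "j \<notin> {..<J}" for j
proof (rule rterm_zero[OF assms(1)])
 have "(2::real) ^ J <= 2 ^ j" using that by (intro power_increasing) auto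
 then have "2 ^ J * e <= 2 ^ j * fi x" using assms by (intro mult_mono) auto
 then show "de < 2 ^ j * fi x" using assms by linarith
qed
then have "(\<Sum>j. rterm m psi c v j x) = (\<Sum>j<J. rterm m psi c v j x)" by (intro suminf_finite) auto
then show ?thesis using assms by (simp add: ext_def)
qed

text \<open>Terms of this shape reproduce themselves: a derivative that falls on
  \<open>2 ^ j * fi x\<close> raises \<open>m\<close> by one, and one that falls on \<open>N\<close>
  leaves a factor t = 2^j fi(x), which is absorbed into \<open>psi\<close>.\<close>

lemma rterm_deriv:
assumes p: "profile psi" and c: "c differentiable (at x)" and v: "smooth_on UNIV v"
shows "rterm m psi c v j differentiable (at x)"
 "partial_deriv i (rterm m psi c v j) x = rterm (Suc m) (deriv psi) (%x. partial_deriv i fi x * c x) v j x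
 + rterm m psi (partial_deriv i c) v j x + rterm m psi c (partial_deriv i v) j x
 - (\<Sum>l\<in>UNIV. rterm (Suc m) psi (%x. partial_deriv i fi x * N l x * c x) (partial_deriv l v) j x
 + rterm m (%t. t * psi t) (%x. partial_deriv i (N l) x * c x) (partial_deriv l v) j x)"
proof -
let ?t = "%x. 2 ^ j * fi x"
note dfi = smooth_on_imp_differentiable[OF smooth_phi UNIV_I, of x]
note dN = smooth_on_imp_differentiable[OF smooth_N UNIV_I, of _ x]
have dt: "?t differentiable (at x)" using dfi by (auto intro: derivative_intros)
have pt: "partial_deriv i ?t x = 2 ^ j * partial_deriv i fi x"
 using partial_deriv_mult[of "%x. 2 ^ j" x fi i] dfi by simp
note p1 = partial_deriv_real_compose[OF profile_deriv(1)[OF p] dt]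
have T: "(%x. refl (?t x) x $ l) = (%x. x $ l + (-1) * (?t x * N l x))" for l
 by (auto simp: refl_def)
have dtN: "(%x. ?t x * N l x) differentiable (at x)" for l using dt dN by (auto intro: derivative_intros)
have dtN': "(%x. (-1) * (?t x * N l x)) differentiable (at x)" for l using dtN by (auto intro: derivative_intros)
have dT: "(%x. refl (?t x) x $ l) differentiable (at x)" for l
 unfolding T by (rule differentiable_add[OF differentiable_component dtN'])
have pT: "partial_deriv i (%x. refl (?t x) x $ l) x
 = (if i = l then 1 else 0) - (2 ^ j * partial_deriv i fi x * N l x + 2 ^ j * fi x * partial_deriv i (N l) x)" for l
 unfolding T partial_deriv_add[OF differentiable_component dtN']
 partial_deriv_mult[OF differentiable_const dtN] partial_deriv_mult[OF dt dN] pt by simp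
have vd: "v differentiable (at (refl (?t x) x))" using smooth_on_imp_differentiable[OF v] by blast
note p3 = partial_deriv_compose[of v "%x. refl (?t x) x" x, OF vd dT]
have d23: "(%x. c x * v (refl (?t x) x)) differentiable (at x)" using c p3(1) by (auto intro: derivative_intros)
have d123: "(%x. psi (?t x) * (c x * v (refl (?t x) x))) differentiable (at x)" using p1(1) d23 by (auto intro: derivative_intros)
have e: "rterm m psi c v j = (%x. (a j * 2 ^ (j * m)) * (psi (?t x) * (c x * v (refl (?t x) x))))"
 by (auto simp: rterm_def)
show "rterm m psi c v j differentiable (at x)" unfolding e using d123 by (auto intro: derivative_intros)
have S: "(\<Sum>l\<in>UNIV. partial_deriv i (%x. refl (?t x) x $ l) x *\<^sub>R partial_deriv l v (refl (?t x) x))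
 = partial_deriv i v (refl (?t x) x) - (\<Sum>l\<in>UNIV. 2 ^ j * partial_deriv i fi x * N l x * partial_deriv l v (refl (?t x) x)
 + 2 ^ j * fi x * partial_deriv i (N l) x * partial_deriv l v (refl (?t x) x))"
 unfolding pT by (simp add: left_diff_distrib distrib_right sum_subtractf if_distrib[of "%c. c * _"] cong: if_cong)
have pw: "(2::real) ^ (j * Suc m) = 2 ^ (j * m) * 2 ^ j" by (simp add: power_add)
show "partial_deriv i (rterm m psi c v j) x = rterm (Suc m) (deriv psi) (%x. partial_deriv i fi x * c x) v j x
 + rterm m psi (partial_deriv i c) v j x + rterm m psi c (partial_deriv i v) j x
 - (\<Sum>l\<in>UNIV. rterm (Suc m) psi (%x. partial_deriv i fi x * N l x * c x) (partial_deriv l v) j x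
 + rterm m (%t. t * psi t) (%x. partial_deriv i (N l) x * c x) (partial_deriv l v) j x)"
 unfolding e partial_deriv_mult[OF differentiable_const d123] partial_deriv_mult[OF p1(1) d23] partial_deriv_mult[OF c p3(1)]
 p1(2) p3(2) S pt unfolding rterm_def pw
 by (simp add: sum_distrib_left sum.distrib algebra_simps)
qed

text \<open>The moment conditions on @a@ cancel the terms of order at most one at the hypersurface.\<close>

lemma ext_second_order:
assumes p: "profile psi" and c: "continuous (at x0) c" and v: "smooth_on UNIV v"
shows "\<exists>C r. r > 0 & (\<forall>x\<in>ball x0 r. 0 < fi x -->
 \<bar>ext m psi c v x - (if m = 0 then psi 0 * (c x * v x) else 0)\<bar> <= C * (fi x)\<^sup>2)"
proof -
let ?Nv = "%x. (\<chi> l. N l x) :: real^'n"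
define H0 where "H0 x t = psi t * v (refl t x)" for x t
define D1 where "D1 x t = (\<Sum>l\<in>UNIV. - N l x * partial_deriv l v (refl t x))" for x t
define D2 where "D2 x t = (\<Sum>l\<in>UNIV. - N l x * (\<Sum>k\<in>UNIV. - N k x * partial_deriv k (partial_deriv l v) (refl t x)))" for x t
define H1 where "H1 x t = deriv psi t * v (refl t x) + psi t * D1 x t" for x t
define H2 where "H2 x t = deriv (deriv psi) t * v (refl t x) + deriv psi t * D1 x t + (deriv psi t * D1 x t + psi t * D2 x t)" for x t
have dv: "((%t. w (refl t x)) has_real_derivative (\<Sum>l\<in>UNIV. - N l x * partial_deriv l w (refl t x))) (at t)"
 if "smooth_on UNIV w" for w x t
 using has_real_derivative_partial_deriv[of w x t "- ?Nv x"] smooth_on_imp_differentiable[OF that]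
 by (simp add: refl_def)
have sl: "smooth_on UNIV (partial_deriv l v)" for l using v smooth_on_partial_deriv by blast
have dD1: "(D1 x has_real_derivative D2 x t) (at t)" for x t
 unfolding D1_def[abs_def] D2_def by (intro DERIV_sum DERIV_cmult dv sl)
have dv1: "((%t. v (refl t x)) has_real_derivative D1 x t) (at t)" for x t
 unfolding D1_def by (rule dv[OF v])
have d0: "(H0 x has_real_derivative H1 x t) (at t)" for x t
 unfolding H0_def[abs_def] H1_def using DERIV_mult[OF profile_deriv(1)[OF p] dv1] by (simp add: mult.commute)
have d1: "(H1 x has_real_derivative H2 x t) (at t)" for x t
 unfolding H1_def[abs_def] H2_def
 using DERIV_add[OF DERIV_mult[OF profile_deriv(1)[OF profile_deriv(2)[OF p]] dv1[of x t]] DERIV_mult[OF profile_deriv(1)[OF p] dD1[of x t]]]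
 by (simp add: mult.commute)
have cp: "continuous_on A psi" "continuous_on A (deriv psi)" "continuous_on A (deriv (deriv psi))" for A
 using p profile_deriv(2) smooth1_continuous[of 0] continuous_on_subset[OF _ subset_UNIV] unfolding profile_def by meson+
have cN: "continuous_on A (N l)" for A l using smooth_on_imp_continuous_on[OF smooth_N] continuous_on_subset by blast
let ?K = "cball x0 1 \<times> {0..de}"
have cNf: "continuous_on ?K (%z. N l (fst z))" for l
 by (intro continuous_on_compose2[OF cN[of UNIV]] continuous_intros) auto
have cr: "continuous_on ?K (%z. refl (snd z) (fst z))"
 unfolding refl_def by (intro continuous_intros cNf)
have cw: "continuous_on ?K (%z. w (refl (snd z) (fst z)))" if "smooth_on UNIV w" for w
 by (rule continuous_on_compose2[OF smooth_on_imp_continuous_on[OF that] cr]) auto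
have cpf: "continuous_on ?K (%z. psi (snd z))" "continuous_on ?K (%z. deriv psi (snd z))" "continuous_on ?K (%z. deriv (deriv psi) (snd z))"
 by (intro continuous_on_compose2[OF cp(1)[of UNIV]] continuous_on_compose2[OF cp(2)[of UNIV]] continuous_on_compose2[OF cp(3)[of UNIV]] continuous_intros; simp)+
have "continuous_on ?K (%z. H2 (fst z) (snd z))"
 unfolding H2_def D1_def D2_def
 by (intro continuous_intros cw cNf cpf v sl smooth_on_partial_deriv)
moreover have "compact ?K" by (intro compact_Times) auto
ultimately have "bounded ((%z. H2 (fst z) (snd z)) ` ?K)" using compact_continuous_image compact_imp_bounded by blast
then obtain B where B: "!!x t. x \<in> cball x0 1 ==> t \<in> {0..de} ==> \<bar>H2 x t\<bar> <= B"
 unfolding bounded_iff by fastforce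
have B0: "B >= 0" using B[of x0 0] de by (auto intro: order_trans[OF abs_ge_zero])
have H2b: "\<bar>H2 x t\<bar> <= B" if "x \<in> cball x0 1" "t >= 0" for x t
proof (cases "t <= de")
 case False
 then have "psi t = 0" "deriv psi t = 0" "deriv (deriv psi) t = 0"
 using p profile_deriv(2)[OF p] profile_deriv(2)[OF profile_deriv(2)[OF p]] by (auto simp: profile_def)
 then show ?thesis using B0 by (simp add: H2_def)
qed (use B that in auto)
\<comment> \<open>The same constant \<open>B\<close> serves all t > 0, because \<open>H2\<close>
  vanishes beyond t = de.\<close>
have tay: "\<bar>H0 x t - H0 x 0 - t * H1 x 0\<bar> <= B * t\<^sup>2" if x: "x \<in> cball x0 1" and t: "t > 0" for x t
proof -
 define df where "df n = (if n = 0 then H0 x else if n = 1 then H1 x else H2 x)" for n :: nat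
 have "\<exists>s>0. s < t & H0 x t = (\<Sum>n<2. df n 0 / fact n * t ^ n) + df 2 s / fact 2 * t ^ 2"
 by (rule Maclaurin[OF t]) (use d0 d1 in \<open>auto simp: df_def less_2_cases_iff\<close>)
 then obtain s where s: "s > 0" "H0 x t = H0 x 0 + H1 x 0 * t + H2 x s / 2 * t\<^sup>2"
 by (auto simp: df_def numeral_2_eq_2)
 have "\<bar>H0 x t - H0 x 0 - t * H1 x 0\<bar> = \<bar>H2 x s\<bar> / 2 * t\<^sup>2" unfolding s(2) by (simp add: abs_mult mult.commute)
 also have "... <= B * t\<^sup>2" using H2b[OF x, of s] s(1) by (intro mult_right_mono) auto
 finally show ?thesis .
qed
obtain r0 where r0: "r0 > 0" "!!x. dist x x0 < r0 ==> \<bar>c x - c x0\<bar> < 1"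
 using c zero_less_one unfolding continuous_at_eps_delta dist_real_def by metis
define Bc where "Bc = \<bar>c x0\<bar> + 1"
define C where "C = Bc * (\<Sum>j. (\<bar>a j\<bar> * 2 ^ (j * (m + 2))) * B)"
have bnd: "\<bar>ext m psi c v x - (if m = 0 then psi 0 * (c x * v x) else 0)\<bar> <= C * (fi x)\<^sup>2"
 if x: "x \<in> ball x0 (min r0 1)" and px: "0 < fi x" for x
proof -
 have xc: "x \<in> cball x0 1" using x by auto
 have cx: "\<bar>c x\<bar> <= Bc" using r0(2)[of x] x by (auto simp: Bc_def dist_commute)
 let ?A = "%j. a j * 2 ^ (j * m)"
 obtain J where J: "de < 2 ^ J * (fi x / 2)"
 using real_arch_pow[of 2 "2 * de / fi x"] px by (auto simp: field_simps)
 have fin: "ext m psi c v x = (\<Sum>j<J. rterm m psi c v j x)" by (rule ext_finite[OF p _ _ J]) (use px in auto)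
 have rt: "rterm m psi c v j x = c x * (?A j * H0 x (2 ^ j * fi x))" for j
 by (simp add: rterm_def H0_def)
 have sz: "rterm m psi c v j x = 0" if "j \<notin> {..<J}" for j
 proof (rule rterm_zero[OF p])
 have "(2::real) ^ J <= 2 ^ j" using that by (intro power_increasing) auto
 then have "2 ^ J * (fi x / 2) <= 2 ^ j * fi x" using px by (intro mult_mono) auto
 then show "de < 2 ^ j * fi x" using J by linarith
 qed
 have s0: "(%j. rterm m psi c v j x) sums ext m psi c v x"
 unfolding fin by (rule sums_finite) (use sz in auto)
 have s1: "(%j. c x * (?A j * H0 x 0)) sums (c x * ((if m = 0 then 1 else 0) * H0 x 0))"
 by (intro sums_mult sums_mult2 a_sums)
 have "(%j. c x * ((a j * 2 ^ (j * Suc m)) * (fi x * H1 x 0))) sums (c x * ((if Suc m = 0 then 1 else 0) * (fi x * H1 x 0)))"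
 by (rule sums_mult, rule sums_mult2, rule a_sums)
 then have s2: "(%j. c x * (?A j * (2 ^ j * fi x * H1 x 0))) sums 0"
 by (simp add: power_add mult_ac)
 \<comment> \<open>Subtracting the moments of order \<open>m\<close> and \<open>Suc m\<close> leaves
   Taylor remainders of size B (2^j fi(x))^2, which are summable thanks to the absolute moment of
   order \<open>m + 2\<close>.\<close>
 have s3: "(%j. c x * (?A j * (H0 x (2 ^ j * fi x) - H0 x 0 - 2 ^ j * fi x * H1 x 0))) sums
 (ext m psi c v x - (if m = 0 then psi 0 * (c x * v x) else 0))"
 proof -
 have e: "c x * ((if m = 0 then 1 else 0) * H0 x 0) = (if m = 0 then psi 0 * (c x * v x) else 0)"
 by (simp add: H0_def refl_def)
 show ?thesis using sums_diff[OF sums_diff[OF s0 s1] s2] unfolding rt e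
 by (simp add: right_diff_distrib)
 qed
 have tb: "norm (c x * (?A j * (H0 x (2 ^ j * fi x) - H0 x 0 - 2 ^ j * fi x * H1 x 0)))
 <= Bc * ((\<bar>a j\<bar> * 2 ^ (j * (m + 2))) * B) * (fi x)\<^sup>2" for j
 proof -
 have "\<bar>H0 x (2 ^ j * fi x) - H0 x 0 - 2 ^ j * fi x * H1 x 0\<bar> <= B * (2 ^ j * fi x)\<^sup>2"
 using tay[OF xc, of "2 ^ j * fi x"] px by simp
 then have "norm (c x * (?A j * (H0 x (2 ^ j * fi x) - H0 x 0 - 2 ^ j * fi x * H1 x 0)))
 <= Bc * ((\<bar>a j\<bar> * 2 ^ (j * m)) * (B * (2 ^ j * fi x)\<^sup>2))"
 unfolding real_norm_def abs_mult using cx by (intro mult_mono) (auto simp: Bc_def)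
 also have "... = Bc * ((\<bar>a j\<bar> * 2 ^ (j * (m + 2))) * B) * (fi x)\<^sup>2"
 proof -
 have "(2::real) ^ (j * (m + 2)) = 2 ^ (j * m) * (2 ^ j * 2 ^ j)"
 by (simp only: power_add[symmetric]) (simp add: algebra_simps)
 then show ?thesis by (simp only: power2_eq_square mult_ac)
 qed
 finally show ?thesis .
 qed
 have sm: "summable (%j. Bc * ((\<bar>a j\<bar> * 2 ^ (j * (m + 2))) * B) * (fi x)\<^sup>2)"
 by (intro summable_mult summable_mult2 a_summable)
 have "norm (\<Sum>j. c x * (?A j * (H0 x (2 ^ j * fi x) - H0 x 0 - 2 ^ j * fi x * H1 x 0)))
 <= (\<Sum>j. Bc * ((\<bar>a j\<bar> * 2 ^ (j * (m + 2))) * B) * (fi x)\<^sup>2)"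
 by (rule norm_suminf_le[OF tb sm])
 also have "(\<Sum>j. Bc * ((\<bar>a j\<bar> * 2 ^ (j * (m + 2))) * B) * (fi x)\<^sup>2) = C * (fi x)\<^sup>2"
 unfolding C_def
 by (subst suminf_mult2[symmetric], intro summable_mult summable_mult2 a_summable,
 subst suminf_mult, intro summable_mult2 a_summable, rule refl)
 finally show ?thesis using s3 by (simp add: sums_iff)
qed
show ?thesis by (intro exI[of _ C] exI[of _ "min r0 1"]) (use bnd r0 in auto)
qed

end

context reflection
begin

text \<open>Inside, the extension is an explicit smooth function \<open>s\<close>; strictly outside
  it is locally a finite sum. On the hypersurface it differs from \<open>s\<close> by O(fi^2), so it
  has the derivative of \<open>s\<close> there.\<close>

lemma ext_deriv:
assumes p: "profile psi" and c: "Cb W (%_::unit. c)" and v: "smooth_on UNIV v" and x: "x \<in> W"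
shows "ext m psi c v differentiable (at x)" (is ?A)
 "partial_deriv i (ext m psi c v) x = ext (Suc m) (deriv psi) (%x. partial_deriv i fi x * c x) v x
 + ext m psi (partial_deriv i c) v x + ext m psi c (partial_deriv i v) x
 - (\<Sum>l\<in>UNIV. ext (Suc m) psi (%x. partial_deriv i fi x * N l x * c x) (partial_deriv l v) x
 + ext m (%t. t * psi t) (%x. partial_deriv i (N l) x * c x) (partial_deriv l v) x)" (is "_ = ?rhs x")
proof -
have sc: "smooth_on W c" by (rule Cb_imp_smooth_on[OF opW c])
have sv: "smooth_on W v" using v smooth_on_subset by blast
have cfi: "continuous_on UNIV fi" by (rule smooth_on_imp_continuous_on[OF smooth_phi])
have opp: "open {y. fi y < r}" "open {y. r < fi y}" for r
 using cfi by (auto intro: open_Collect_less continuous_on_const)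
define s where "s y = (if m = 0 then psi 0 else 0) * (c y * v y)" for y
have cd: "c differentiable (at x)" and vd: "v differentiable (at x)"
 using smooth_on_imp_differentiable sc sv x by blast+
have cvd: "(%y. c y * v y) differentiable (at x)" using cd vd by (rule differentiable_mult)
have sd: "s differentiable (at x)" unfolding s_def[abs_def] using differentiable_mult[OF differentiable_const cvd] .
have ps: "partial_deriv i s x = (if m = 0 then psi 0 else 0) * (partial_deriv i c x * v x + c x * partial_deriv i v x)"
 unfolding s_def[abs_def] partial_deriv_mult[OF differentiable_const cvd] partial_deriv_mult[OF cd vd] by simp
have ext_s: "ext m psi c v y = s y" if "fi y <= 0" for y using that by (simp add: ext_def s_def)
\<comment> \<open>Terms of level \<open>Suc m\<close> are zero here by definition and
  \<open>t * psi t\<close> vanishes at t = 0, so only the product rule for \<open>c\<close> and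
  \<open>v\<close> remains.\<close>
have rhs: "?rhs x = partial_deriv i s x" if "fi x <= 0"
 unfolding ps using that by (simp add: ext_def distrib_left)
consider "fi x < 0" | "fi x = 0" | "fi x > 0" by linarith
then have "ext m psi c v differentiable (at x) & partial_deriv i (ext m psi c v) x = ?rhs x"
proof cases
 case 1
 have e: "s y = ext m psi c v y" if "y \<in> {y. fi y < 0}" for y using ext_s that by simp
 have "ext m psi c v differentiable (at x)"
 using differentiable_cong_open[OF opp(1) _ e sd] 1 by simp
 moreover have "partial_deriv i s x = partial_deriv i (ext m psi c v) x"
 using partial_deriv_cong[OF opp(1) _ e] 1 by simp
 ultimately show ?thesis using rhs 1 by simp
next
 case 2
 have "continuous (at x) c" using cd by (rule differentiable_imp_continuous_within)
 from ext_second_order[OF p this v, of m] obtain C r where Cr: "r > 0"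
 "!!y. y \<in> ball x r ==> 0 < fi y ==> \<bar>ext m psi c v y - (if m = 0 then psi 0 * (c y * v y) else 0)\<bar> <= C * (fi y)\<^sup>2" by blast
 obtain L where L: "L > 0" "!!y. \<bar>fi y - fi x\<bar> <= L * norm (y - x)"
 using Cb_lipschitz[OF phi] by (metis subset_UNIV)
 define n where "n y = ext m psi c v y - s y" for y
 have nx: "n x = 0" using 2 ext_s by (simp add: n_def)
 have "(n has_derivative (%h. \<Sum>i\<in>UNIV. h $ i * 0)) (at x)"
 proof (rule has_derivative_quadratic[OF Cr(1), where C="\<bar>C\<bar> * L\<^sup>2"])
 fix y assume y: "y \<in> ball x r"
 have "\<bar>n y\<bar> <= \<bar>C\<bar> * L\<^sup>2 * (norm (y - x))\<^sup>2"
 proof (cases "fi y <= 0")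
 case True
 then have "n y = 0" using ext_s by (simp add: n_def)
 then show ?thesis by simp
 next
 case False
 have "n y = ext m psi c v y - (if m = 0 then psi 0 * (c y * v y) else 0)" by (simp add: n_def s_def)
 then have "\<bar>n y\<bar> <= C * (fi y)\<^sup>2" using Cr(2)[OF y] False by linarith
 also have "... <= \<bar>C\<bar> * (fi y)\<^sup>2" by (intro mult_right_mono) auto
 also have "(fi y)\<^sup>2 <= (L * norm (y - x))\<^sup>2" using L(2)[of y] L(1) 2 by (simp add: abs_le_square_iff[symmetric] abs_mult)
 then have "\<bar>C\<bar> * (fi y)\<^sup>2 <= \<bar>C\<bar> * (L * norm (y - x))\<^sup>2" by (intro mult_left_mono) auto
 finally show ?thesis by (simp add: power_mult_distrib mult.assoc)
 qed
 then show "\<bar>n y - n x - (\<Sum>i\<in>UNIV. (y - x) $ i * 0)\<bar> <= \<bar>C\<bar> * L\<^sup>2 * (norm (y - x))\<^sup>2" by (simp add: nx)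
 qed
 then have n0: "(n has_derivative (%h. 0)) (at x)" by simp
 have nd: "n differentiable (at x)" using n0 by (auto simp: differentiable_def)
 have "ext m psi c v = (%y. s y + n y)" by (auto simp: n_def)
 then have "ext m psi c v differentiable (at x)" "partial_deriv i (ext m psi c v) x = partial_deriv i s x + partial_deriv i n x"
 using differentiable_add[OF sd nd] partial_deriv_add[OF sd nd] by simp_all
 then show ?thesis using rhs 2 partial_deriv_eqI[OF n0, of i] by simp
next
 case 3
 define e where "e = fi x / 2"
 have e: "0 < e" "e < fi x" using 3 by (auto simp: e_def)
 obtain J where J: "de < 2 ^ J * e" using real_arch_pow[of 2 "de / e"] e by (auto simp: field_simps)
 have fin: "ext m' psi' c' v' y = (\<Sum>j<J. rterm m' psi' c' v' j y)" if "profile psi'" "y \<in> {y. e < fi y}" for m' psi' c' v' y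
 by (rule ext_finite[OF that(1) e(1) _ J]) (use that in simp)
 have xe: "x \<in> {y. e < fi y}" using e by simp
 note rd = rterm_deriv[OF p cd v]
 have "(%y. \<Sum>j<J. rterm m psi c v j y) differentiable (at x)" by (rule differentiable_sum) (auto intro: rd)
 then have A: "ext m psi c v differentiable (at x)"
 using differentiable_cong_open[OF opp(2) xe, of "%y. \<Sum>j<J. rterm m psi c v j y" "ext m psi c v"] fin[OF p, of _ m c v] by simp
 have "partial_deriv i (ext m psi c v) x = partial_deriv i (%y. \<Sum>j<J. rterm m psi c v j y) x"
 by (rule partial_deriv_cong[OF opp(2) xe fin[OF p]])
 also have "... = (\<Sum>j<J. partial_deriv i (rterm m psi c v j) x)"
 by (rule partial_deriv_sum) (auto intro: rd)
 also have "... = ?rhs x"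
 unfolding rd(2) fin[OF p xe] fin[OF profile_deriv(2)[OF p] xe] fin[OF profile_mult_id[OF p] xe]
 by (simp add: sum.distrib sum_subtractf sum.swap[of _ "{..<J}" UNIV])
 finally show ?thesis using A by blast
qed
then show ?A "partial_deriv i (ext m psi c v) x = ?rhs x" by blast+
qed

text \<open>All reflected points that matter have \<open>fi\<close> negative, so only the bound on
  the inner values of \<open>v\<close> enters; points of the hypersurface inherit it by continuity
  along a reflection path.\<close>

lemma ext_bounded:
assumes p: "profile psi" and c: "Cb W (%_::unit. c)"
 and v: "!!k x. fi x < 0 ==> \<bar>v k x\<bar> <= B" "!!k. smooth_on UNIV (v k)"
shows "\<exists>C. \<forall>k. \<forall>x\<in>W. \<bar>ext m psi c (v k) x\<bar> <= C"
proof -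
obtain Bp where Bp: "Bp > 0" "!!t. t >= 0 ==> \<bar>psi t\<bar> <= Bp" using profile_bounded[OF p] by blast
obtain Bc where Bc: "Bc > 0" "!!x. x \<in> W ==> \<bar>c x\<bar> <= Bc" using Cb_bound[OF c] by blast
define B' where "B' = \<bar>B\<bar>"
have vB: "\<bar>v k x\<bar> <= B'" if "fi x < 0" for k x using v(1)[OF that, of k] by (simp add: B'_def)
have B'0: "B' >= 0" by (simp add: B'_def)
have vB0: "\<bar>v k x\<bar> <= B'" if x: "x \<in> W" "fi x <= 0" for k x
proof (cases "fi x < 0")
 case False
 then have z: "fi x = 0" using x by simp
 have lim: "((%t. \<bar>v k (refl t x)\<bar>) \<longlongrightarrow> \<bar>v k (refl 0 x)\<bar>) (at_right 0)"
 proof (intro tendsto_rabs)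
 have cv: "isCont (v k) y" for y
 using smooth_on_imp_continuous_on[OF v(2)] by (simp add: continuous_on_eq_continuous_at)
 have cr: "((%t. refl t x) \<longlongrightarrow> refl 0 x) (at_right 0)" unfolding refl_def by (intro tendsto_intros)
 show "((%t. v k (refl t x)) \<longlongrightarrow> v k (refl 0 x)) (at_right 0)"
 by (rule isCont_tendsto_compose[OF cv cr])
 qed
 have "eventually (%t. \<bar>v k (refl t x)\<bar> <= B') (at_right 0)"
 unfolding eventually_at_right_field
 by (rule exI[of _ de]) (use de inside[OF x(1)] z vB in \<open>auto simp: refl_def\<close>)
 then have "\<bar>v k (refl 0 x)\<bar> <= B'" by (rule tendsto_upperbound[OF lim]) simp
 then show ?thesis by (simp add: refl_def)
qed (use vB in blast)
define C where "C = (\<Sum>j. (\<bar>a j\<bar> * 2 ^ (j * m)) * (Bp * (Bc * B')))"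
have sm: "summable (%j. (\<bar>a j\<bar> * 2 ^ (j * m)) * (Bp * (Bc * B')))" by (intro summable_mult2 a_summable)
have "\<bar>ext m psi c (v k) x\<bar> <= max C (Bp * (Bc * B'))" if x: "x \<in> W" for k x
proof (cases "fi x <= 0")
 case True
 have "\<bar>psi 0 * (c x * v k x)\<bar> <= Bp * (Bc * B')" unfolding abs_mult
 using Bp Bc x B'0 vB0[OF x True] by (intro mult_mono mult_nonneg_nonneg) auto
 moreover have "0 <= Bp * (Bc * B')" using Bp Bc B'0 by simp
 ultimately show ?thesis using True by (auto simp: ext_def le_max_iff_disj)
next
 case False
 have t: "norm (rterm m psi c (v k) j x) <= (\<bar>a j\<bar> * 2 ^ (j * m)) * (Bp * (Bc * B'))" for j
 proof (cases "2 ^ j * fi x <= de")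
 case True
 have "fi x <= 2 ^ j * fi x" using False by simp
 then have "fi (refl (2 ^ j * fi x) x) < 0"
 unfolding refl_def using inside[OF x _ _ _ True] False by simp
 then have "\<bar>v k (refl (2 ^ j * fi x) x)\<bar> <= B'" by (rule vB)
 then show ?thesis unfolding rterm_def real_norm_def abs_mult using Bp Bc x B'0 False
 by (intro mult_mono mult_nonneg_nonneg) auto
 next
 case False
 then have "rterm m psi c (v k) j x = 0" using rterm_zero[OF p] by simp
 then show ?thesis using Bp Bc B'0 by simp
 qed
 have "\<bar>\<Sum>j. rterm m psi c (v k) j x\<bar> <= C"
 using norm_suminf_le[OF t sm] unfolding C_def by simp
 then show ?thesis using False by (simp add: ext_def)
qed
then show ?thesis by blast
qed

text \<open>Contains the extension and, by \<open>ext_deriv\<close>, its partial derivatives up to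
  equality on \<open>W\<close>; the index stays visible because the bounds have to be uniform in
  it.\<close>

inductive ext_class :: "('k => real^'n => real) => ('k => real^'n => real) => bool" for u where
base: "profile psi ==> Cb W (%_::unit. c) ==> ext_class u (%k. ext m psi c (pd I (u k)))"
| add: "ext_class u R ==> ext_class u S ==> ext_class u (%k x. R k x + S k x)"
| neg: "ext_class u R ==> ext_class u (%k x. - R k x)"

lemma ext_class_sum: "finite A ==> A ~= {} ==> (!!l. l \<in> A ==> ext_class u (R l)) ==> ext_class u (%k x. \<Sum>l\<in>A. R l k x)"
by (induction A rule: finite_ne_induct) (auto intro: ext_class.add)

lemma ext_class_props:
assumes "ext_class u R"
 and u: "!!k. smooth_on UNIV (u k)" "!!I. \<exists>B. \<forall>k x. fi x < 0 --> \<bar>pd I (u k) x\<bar> <= B"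
shows "(\<forall>k. \<forall>x\<in>W. R k differentiable (at x)) & (\<exists>C. \<forall>k. \<forall>x\<in>W. \<bar>R k x\<bar> <= C) &
 (\<forall>i. \<exists>S. ext_class u S & (\<forall>k. \<forall>x\<in>W. partial_deriv i (R k) x = S k x))"
using assms(1)
proof (induction rule: ext_class.induct)
case (base psi c m I)
have sm: "smooth_on UNIV (pd I (u k))" for k using u(1) smooth_on_pd by blast
obtain B where B: "!!k x. fi x < 0 ==> \<bar>pd I (u k) x\<bar> <= B" using u(2) by blast
note ed = ext_deriv[OF base sm]
have "\<exists>S. ext_class u S & (\<forall>k. \<forall>x\<in>W. partial_deriv i (ext m psi c (pd I (u k))) x = S k x)" for i
proof -
 define S where "S = (%k x. ext (Suc m) (deriv psi) (%x. partial_deriv i fi x * c x) (pd I (u k)) x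
 + ext m psi (partial_deriv i c) (pd I (u k)) x + ext m psi c (pd (i # I) (u k)) x
 + - (\<Sum>l\<in>UNIV. ext (Suc m) psi (%x. partial_deriv i fi x * N l x * c x) (pd (l # I) (u k)) x
 + ext m (%t. t * psi t) (%x. partial_deriv i (N l) x * c x) (pd (l # I) (u k)) x))"
 have c1: "Cb W (%_::unit. partial_deriv i fi)" "Cb W (%_::unit. N l)" "Cb W (%_::unit. partial_deriv i (N l))" for l
 using Cb_subset[OF _ subset_UNIV] Cb_partial_deriv phi NC by blast+
 have "ext_class u S" unfolding S_def
 by (intro ext_class.add ext_class.neg ext_class_sum ext_class.base profile_deriv(2) profile_mult_id base Cb_mult Cb_partial_deriv c1 opW) auto
 moreover have "partial_deriv i (ext m psi c (pd I (u k))) x = S k x" if "x \<in> W" for k x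
 using ed(2)[OF that] by (simp add: S_def)
 ultimately show ?thesis by blast
qed
moreover have "\<exists>C. \<forall>k. \<forall>x\<in>W. \<bar>ext m psi c (pd I (u k)) x\<bar> <= C"
 by (rule ext_bounded[OF base, where v="%k. pd I (u k)" and B=B]) (use B sm in auto)
ultimately show ?case using ed(1) by blast
next
case (add R S)
obtain C1 where C1: "!!k x. x \<in> W ==> \<bar>R k x\<bar> <= C1" using add.IH(1) by blast
obtain C2 where C2: "!!k x. x \<in> W ==> \<bar>S k x\<bar> <= C2" using add.IH(2) by blast
have "\<bar>R k x + S k x\<bar> <= C1 + C2" if "x \<in> W" for k x using C1[OF that, of k] C2[OF that, of k] by linarith
moreover have "\<exists>T. ext_class u T & (\<forall>k. \<forall>x\<in>W. partial_deriv i (%x. R k x + S k x) x = T k x)" for i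
proof -
 obtain T1 where T1: "ext_class u T1" "!!k x. x \<in> W ==> partial_deriv i (R k) x = T1 k x" using add.IH(1) by blast
 obtain T2 where T2: "ext_class u T2" "!!k x. x \<in> W ==> partial_deriv i (S k) x = T2 k x" using add.IH(2) by blast
 show ?thesis using ext_class.add[OF T1(1) T2(1)] T1(2) T2(2) add.IH
 by (intro exI[of _ "%k x. T1 k x + T2 k x"]) (simp add: partial_deriv_add)
qed
moreover have "(%x. R k x + S k x) differentiable (at x)" if "x \<in> W" for k x
 using add.IH that by (intro differentiable_add) auto
ultimately show ?case by blast
next
case (neg R)
have "\<exists>T. ext_class u T & (\<forall>k. \<forall>x\<in>W. partial_deriv i (%x. - R k x) x = T k x)" for i
proof -
 obtain T1 where T1: "ext_class u T1" "!!k x. x \<in> W ==> partial_deriv i (R k) x = T1 k x" using neg.IH by blast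
 have "partial_deriv i (%x. - R k x) x = - partial_deriv i (R k) x" if "x \<in> W" for k x
 using partial_deriv_bounded_linear[OF bounded_linear_minus[OF bounded_linear_ident]] neg.IH that by blast
 then show ?thesis using ext_class.neg[OF T1(1)] T1(2) by (intro exI[of _ "%k x. - T1 k x"]) simp
qed
moreover have "(%x. - R k x) differentiable (at x)" if "x \<in> W" for k x
 using neg.IH that by (intro differentiable_minus) auto
ultimately show ?case using neg.IH by simp
qed

lemma ext_class_Cb:
assumes "ext_class u R"
 and u: "!!k. smooth_on UNIV (u k)" "!!I. \<exists>B. \<forall>k x. fi x < 0 --> \<bar>pd I (u k) x\<bar> <= B"
shows "Cb W R"
proof -
have "CB m W R" if "ext_class u R" for m R
 using that
proof (induction m arbitrary: R)
 case 0
 then show ?case using ext_class_props[OF 0 u] by (simp add: CB.simps)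
next
 case (Suc m)
 note pr = ext_class_props[OF Suc.prems u]
 from pr obtain S where S: "!!i. ext_class u (S i)" "!!i k x. x \<in> W ==> partial_deriv i (R k) x = S i k x" by metis
 show ?case by (rule CB_SucI[OF opW _ _ S(2) Suc.IH[OF S(1)]]) (use pr in \<open>auto simp: CB.simps\<close>)
qed
then show ?thesis using assms(1) by (simp add: Cb_def)
qed

end

text \<open>Each \<open>u k\<close> is smooth everywhere, but its derivatives are bounded uniformly
  in \<open>k\<close> only where \<open>fi\<close> is negative. Reflection replaces the outer values
  by others computed from inside, which makes the family bounded across the boundary.\<close>

lemma smooth_extension:
fixes fi :: "real^'n::finite => real" and u :: "'k => real^'n => real"
assumes phi: "Cb UNIV (%_::unit. fi)" and "bounded {x. fi x < 0}"
 and grad: "!!x. x \<in> frontier {x. fi x < 0} ==> gradsq fi x > 0"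
 and u: "!!k. smooth_on UNIV (u k)" "!!I. \<exists>B. \<forall>k x. fi x < 0 --> \<bar>pd I (u k) x\<bar> <= B"
shows "\<exists>W E. open W & closure {x. fi x < 0} \<subseteq> W & Cb W E & (\<forall>k x. fi x <= 0 --> E k x = u k x)"
proof -
let ?O = "{x. fi x < 0}"
have cfi: "continuous_on UNIV fi" by (rule smooth_on_imp_continuous_on[OF Cb_imp_smooth_on[OF open_UNIV phi]])
have opO: "open ?O" using cfi by (intro open_Collect_less continuous_on_const)
have Cg: "Cb UNIV (%_::unit. gradsq fi)" unfolding gradsq_def[abs_def] power2_eq_square
 by (intro Cb_sum Cb_mult Cb_partial_deriv phi open_UNIV finite)
have cg: "continuous_on UNIV (gradsq fi)" by (rule smooth_on_imp_continuous_on[OF Cb_imp_smooth_on[OF open_UNIV Cg]])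
have "compact (frontier ?O)" using assms(2) by (simp add: compact_frontier_bounded)
then have "\<exists>g0>0. \<forall>x\<in>frontier ?O. g0 < gradsq fi x"
proof (cases "frontier ?O = {}")
 case False
 then obtain z where z: "z \<in> frontier ?O" "!!y. y \<in> frontier ?O ==> gradsq fi z <= gradsq fi y"
 using continuous_attains_inf[OF \<open>compact (frontier ?O)\<close>, of "gradsq fi"] continuous_on_subset[OF cg] by blast
 have "gradsq fi z / 2 < gradsq fi y" if "y \<in> frontier ?O" for y using z(2)[OF that] grad[OF z(1)] by linarith
 then show ?thesis using grad[OF z(1)] by (intro exI[of _ "gradsq fi z / 2"]) auto
qed (auto intro: exI[of _ 1])
then obtain g0 where g0: "g0 > 0" "!!x. x \<in> frontier ?O ==> g0 < gradsq fi x" by blast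
define W where "W = ?O \<union> {x. g0 < gradsq fi x}"
have opW: "open W" unfolding W_def by (rule open_Un[OF opO open_Collect_less[OF continuous_on_const cg]])
have cW: "closure ?O \<subseteq> W" using g0(2) closure_subset[of ?O] interior_open[OF opO] unfolding W_def frontier_def by fastforce
obtain C where C: "C > 0" "!!x y. \<bar>fi y - fi x - (\<Sum>i\<in>UNIV. (y - x) $ i * partial_deriv i fi x)\<bar> <= C * (norm (y - x))\<^sup>2"
 using Cb_taylor[OF phi] by (metis subset_UNIV)
\<comment> \<open>Since L g0 = 2 and C L t <= 1/4 for t <= de, Taylor's formula gives fi(x - t N) <=
  fi(x) - (3/2) t < 0 whenever fi(x) <= t.\<close>
define L where "L = 2 / g0"
define de where "de = 1 / (4 * C * L)"
define N where "N l x = L * partial_deriv l fi x" for l x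
have L: "L > 0" using g0 by (simp add: L_def)
have de: "de > 0" using C L by (simp add: de_def)
have NC: "Cb UNIV (%_::unit. N l)" for l
 unfolding N_def[abs_def] by (intro Cb_mult Cb_const Cb_partial_deriv phi open_UNIV)
obtain a :: "nat => real" where a: "!!m. summable (%j. \<bar>a j\<bar> * 2 ^ (j * m))" "!!m. (%j. a j * 2 ^ (j * m)) sums (if m = 0 then 1 else 0)"
 using seeley_sequence by blast
have ins: "fi (x - t *\<^sub>R (\<chi> l. N l x)) < 0" if x: "x \<in> W" "0 <= fi x" "fi x <= t" "0 < t" "t <= de" for x t
proof -
 have g: "g0 < gradsq fi x" using x by (simp add: W_def)
 let ?y = "x - t *\<^sub>R (\<chi> l. N l x)"
 have s: "(\<Sum>i\<in>UNIV. (?y - x) $ i * partial_deriv i fi x) = - (t * L * gradsq fi x)"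
 by (simp add: N_def gradsq_def sum_distrib_left sum_negf[symmetric] power2_eq_square mult_ac)
 have "(norm (\<chi> l. N l x))\<^sup>2 = L\<^sup>2 * gradsq fi x"
 unfolding power2_norm_eq_inner inner_vec_def gradsq_def N_def by (simp add: power2_eq_square sum_distrib_left mult_ac)
 then have n: "(norm (?y - x))\<^sup>2 = t\<^sup>2 * (L\<^sup>2 * gradsq fi x)" by (simp add: power_mult_distrib)
 have "fi ?y <= fi x - t * L * gradsq fi x + C * (t\<^sup>2 * (L\<^sup>2 * gradsq fi x))"
 using C(2)[of ?y x] unfolding s n by linarith
 also have "... = fi x - (t * L * gradsq fi x) * (1 - C * L * t)" by (simp add: power2_eq_square algebra_simps)
 also have "C * L * t <= 1 / 4"
 using x(5) C(1) L by (simp add: de_def field_simps)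
 then have "(t * L * gradsq fi x) * (1 - C * L * t) >= (t * L * g0) * (3 / 4)"
 using x(4) L g g0(1) by (intro mult_mono) auto
 then have "fi x - (t * L * gradsq fi x) * (1 - C * L * t) <= fi x - t * (3 / 2)" using g0(1) by (simp add: L_def)
 finally show ?thesis using x by linarith
qed
interpret reflection fi W N a de
 by unfold_locales (use opW phi NC de a ins in auto)
define cut where "cut t = step ((-1 / de) * t + 1)" for t
have "!!k. smooth1 k (%t. step ((-1 / de) * t + 1))" by (rule smooth1_affine[OF smooth1_step])
then have pc: "profile cut"
 unfolding profile_def cut_def[abs_def] using de by (auto simp: field_simps intro!: step_zero)
have c1: "cut 0 = 1" by (simp add: cut_def step_one)
define E where "E k = ext 0 cut (%x. 1) (u k)" for k
have "ext_class u (%k. ext 0 cut (%x. 1) (pd [] (u k)))" by (intro ext_class.base pc Cb_const opW)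
then have "ext_class u E" by (simp add: E_def[abs_def])
then have "Cb W E" by (rule ext_class_Cb[OF _ u])
moreover have "E k x = u k x" if "fi x <= 0" for k x using that c1 by (simp add: E_def ext_def)
ultimately show ?thesis using opW cW by blast
qed

section \<open>The boundary values of the penalised solutions\<close>

lemma flat_mono: "s <= t ==> flat s <= flat t"
proof -
assume st: "s <= t"
show ?thesis
proof (cases "s <= 0")
 case True then show ?thesis using flat_nonneg[of t] flat_zero[of s] by simp
next
 case False
 then have "1 / t <= 1 / s" using st by (intro divide_left_mono) auto
 then show ?thesis using False st by (simp add: flat_def flat_exp_def)
qed
qed

text \<open>Along an outward normal line the solution @g@ and the flux @h@ satisfy such a system. If @g@
were not small at the boundary, the large zeroth order term would blow up @h@ and then @g@.\<close>

lemma ode_boundary_decay: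
fixes c0 C0 B H M l e :: real
assumes "0 < c0" "c0 <= C0" "0 <= B" "0 <= H" "0 <= M" "0 < l" "0 < e"
shows "\<exists>K. \<forall>k\<ge>K. \<forall>g h ka alf b1 b2.
 (\<forall>t\<in>{0..l}. (g has_real_derivative alf t * (h t - b1 t)) (at t)) &
 (\<forall>t\<in>{0..l}. (h has_real_derivative alf t * (ka t * g t + b2 t)) (at t)) &
 (\<forall>t\<in>{0..l}. c0 <= alf t & alf t <= C0 & \<bar>b1 t\<bar> <= B & \<bar>b2 t\<bar> <= B & \<bar>g t\<bar> <= M & real k * flat (c0 * t) <= ka t) &
 - H <= h 0 --> g 0 <= e"
proof -
\<comment> \<open>As long as \<open>g\<close> is nonnegative, \<open>h\<close> drops by at most C0 B
  l. Hence h >= - Q1, and \<open>g\<close> falls with speed at most \<open>Q\<close>; the length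
  \<open>t0\<close> is such that \<open>g\<close> cannot fall from e to e/2 on [0, t0].\<close>
define Q1 where "Q1 = H + C0 * B * l"
define Q where "Q = C0 * (Q1 + B) + 1"
define t0 where "t0 = min l (e / (4 * Q))"
define f0 where "f0 = flat (c0 * (t0 / 3))"
have C0: "C0 > 0" using assms by linarith
have Q1: "Q1 >= 0" using assms C0 by (simp add: Q1_def)
have Q: "Q > 0" using assms C0 Q1 by (simp add: Q_def add_nonneg_pos)
have t0: "0 < t0" "t0 <= l" "t0 * Q <= e / 4"
proof -
 show "0 < t0" "t0 <= l" using assms Q by (simp_all add: t0_def)
 have "t0 * Q <= e / (4 * Q) * Q" using Q by (intro mult_right_mono) (auto simp: t0_def)
 then show "t0 * Q <= e / 4" using Q by simp
qed
have f0: "f0 > 0" using t0 assms by (simp add: f0_def flat_pos)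
\<comment> \<open>On the middle third of [0, t0] the penalty raises \<open>h\<close> by at least k q
  minus a bounded amount. Once k q >= R, the difference \<open>h - b1\<close> is so large on the
  last third that \<open>g\<close> grows by 2 M + 1, more than |g| <= M permits.\<close>
define R where "R = B + 3 * (2 * M + 1) / (t0 * c0) + Q1 + C0 * B * l + C0 * B * l"
define q where "q = t0 / 3 * (c0 * f0 * (e / 2))"
have q: "q > 0" using t0 f0 assms by (simp add: q_def)
obtain K :: nat where K: "R / q <= real K" using real_arch_simple by blast
show ?thesis
proof (intro exI[of _ K] allI impI, elim conjE, rule ccontr)
 fix k g h ka alf b1 b2
 assume k: "k >= K" and dg: "\<forall>t\<in>{0..l}. (g has_real_derivative alf t * (h t - b1 t)) (at t)"
 and dh: "\<forall>t\<in>{0..l}. (h has_real_derivative alf t * (ka t * g t + b2 t)) (at t)"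
 and bd: "\<forall>t\<in>{0..l}. c0 <= alf t & alf t <= C0 & \<bar>b1 t\<bar> <= B & \<bar>b2 t\<bar> <= B & \<bar>g t\<bar> <= M & real k * flat (c0 * t) <= ka t"
 and h0: "- H <= h 0" and g0: "~ g 0 <= e"
 have k0: "ka t >= 0" if "t \<in> {0..l}" for t
 using bd that flat_nonneg[of "c0 * t"] by (meson mult_nonneg_nonneg of_nat_0_le_iff order_trans)
 have hmvt: "\<exists>z>a. z < b & h b - h a = (b - a) * (alf z * (ka z * g z + b2 z))" if "0 <= a" "a < b" "b <= l" for a b
 using MVT2[OF that(2), of h "%z. alf z * (ka z * g z + b2 z)"] dh that by force
 have gmvt: "\<exists>z>a. z < b & g b - g a = (b - a) * (alf z * (h z - b1 z))" if "0 <= a" "a < b" "b <= l" for a b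
 using MVT2[OF that(2), of g "%z. alf z * (h z - b1 z)"] dg that by force
 have prodlow: "alf z * y >= - (C0 * Y)" if "z \<in> {0..l}" "y >= - Y" "Y >= 0" for z y Y
 proof -
 have "c0 <= alf z" "alf z <= C0" using bd that(1) by blast+
 then have "alf z * (- Y) >= C0 * (- Y)" using that(3) by (intro mult_right_mono_neg) auto
 moreover have "alf z * y >= alf z * (- Y)" using \<open>c0 <= alf z\<close> assms(1) that(2) by (intro mult_left_mono) auto
 ultimately show ?thesis by simp
 qed
 have hinc: "h b - h a >= - (C0 * B * l)" if ab: "0 <= a" "a <= b" "b <= l" and pos: "!!z. a < z ==> z < b ==> g z >= 0" for a b
 proof (cases "a = b")
 case True then show ?thesis using assms C0 by simp
 next
 case False
 then obtain z where z: "a < z" "z < b" "h b - h a = (b - a) * (alf z * (ka z * g z + b2 z))" using hmvt[of a b] ab by auto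
 have zl: "z \<in> {0..l}" using z ab by auto
 have "ka z * g z + b2 z >= - B" using bd zl k0[OF zl] pos[OF z(1,2)] by (smt (verit) mult_nonneg_nonneg)
 then have "alf z * (ka z * g z + b2 z) >= - (C0 * B)" by (rule prodlow[OF zl _ assms(3)])
 then have "(b - a) * (alf z * (ka z * g z + b2 z)) >= (b - a) * (- (C0 * B))" using ab by (intro mult_left_mono) auto
 moreover have "(b - a) * (C0 * B) <= l * (C0 * B)" using ab assms C0 by (intro mult_right_mono) auto
 ultimately show ?thesis unfolding z(3) by (simp add: mult.commute)
 qed
 have gpos: "g t > e / 2" if t: "t \<in> {0..t0}" for t
 proof (rule ccontr)
 assume "~ ?thesis"
 have cg: "continuous_on {0..t0} g" using dg t0 by (intro continuous_at_imp_continuous_on ballI DERIV_isCont) auto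
 define Z where "Z = {0..t0} \<inter> g -` {..e / 2}"
 have "closed Z" unfolding Z_def
 by (rule continuous_closed_preimage[OF cg]) auto
 moreover have "bounded Z" unfolding Z_def by (rule bounded_subset[of "{0..t0}"]) auto
 ultimately have "compact Z" by (simp add: compact_eq_bounded_closed)
 moreover have "Z ~= {}" using t \<open>~ g t > e / 2\<close> by (auto simp: Z_def)
 ultimately obtain ta where ta: "ta \<in> Z" "!!z. z \<in> Z ==> ta <= z" using compact_attains_inf by metis
 have tar: "0 <= ta" "ta <= t0" "g ta <= e / 2" using ta(1) by (auto simp: Z_def)
 have before: "g z >= 0" if "0 <= z" "z < ta" for z
 using ta(2)[of z] that tar assms(7) by (force simp: Z_def)
 have "ta ~= 0" using tar g0 assms(7) by auto
 then obtain z where z: "0 < z" "z < ta" "g ta - g 0 = ta * (alf z * (h z - b1 z))" using gmvt[of 0 ta] tar t0 by auto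
 have zl: "z \<in> {0..l}" using z tar t0 by auto
 have "h z - h 0 >= - (C0 * B * l)" by (rule hinc) (use z zl before in auto)
 then have "h z - b1 z >= - (Q1 + B)" using h0 bd zl unfolding Q1_def by (smt (verit))
 then have "alf z * (h z - b1 z) >= - (C0 * (Q1 + B))" using Q1 assms(3) by (intro prodlow[OF zl]) auto
 then have "alf z * (h z - b1 z) >= - Q" by (simp add: Q_def)
 then have "ta * (alf z * (h z - b1 z)) >= ta * (- Q)" using tar by (intro mult_left_mono) auto
 moreover have "ta * Q <= t0 * Q" using tar Q by (intro mult_right_mono) auto
 ultimately have "g ta - g 0 >= - (e / 4)" using t0(3) z(3) by simp
 then show False using tar(3) g0 assms(7) by linarith
 qed
 let ?a = "t0 / 3" and ?b = "2 * t0 / 3"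
 have ab: "0 <= ?a" "?a < ?b" "?b < t0" "?b <= l" "?b - ?a = t0 / 3" "t0 - ?b = t0 / 3" using t0 by auto
 have gn: "g z >= 0" if "0 <= z" "z <= t0" for z using gpos[of z] that assms(7) by simp
 have ha: "h ?a - h 0 >= - (C0 * B * l)" by (rule hinc) (use ab gn in auto)
 obtain z where z: "?a < z" "z < ?b" "h ?b - h ?a = (t0 / 3) * (alf z * (ka z * g z + b2 z))" using hmvt[of ?a ?b] ab by auto
 have zl: "z \<in> {0..l}" "z \<in> {0..t0}" using z ab t0 by auto
 have "real k * f0 <= ka z"
 proof -
 have "f0 <= flat (c0 * z)" unfolding f0_def using z assms(1) by (intro flat_mono mult_left_mono) auto
 then have "real k * f0 <= real k * flat (c0 * z)" by (intro mult_left_mono) auto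
 then show ?thesis using bd zl by (meson order_trans)
 qed
 then have kg: "real k * f0 * (e / 2) <= ka z * g z" using gpos[OF zl(2)] f0 k0[OF zl(1)] assms(7) by (intro mult_mono) auto
 have "alf z * (ka z * g z) >= c0 * (real k * f0 * (e / 2))"
 proof (rule mult_mono[OF _ kg])
 show "c0 <= alf z" using bd zl by blast
 then show "0 <= alf z" using assms(1) by linarith
 show "0 <= real k * f0 * (e / 2)" using f0 assms(7) by simp
 qed
 moreover have "\<bar>b2 z\<bar> <= B" using bd zl by blast
 then have "alf z * b2 z >= - (C0 * B)" using assms(3) by (intro prodlow zl) auto
 ultimately have "alf z * (ka z * g z + b2 z) >= c0 * (real k * f0 * (e / 2)) - C0 * B" by (simp add: distrib_left)
 then have "(t0 / 3) * (alf z * (ka z * g z + b2 z)) >= (t0 / 3) * (c0 * (real k * f0 * (e / 2)) - C0 * B)"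
 using t0 by (intro mult_left_mono) auto
 moreover have "(t0 / 3) * (C0 * B) <= l * (C0 * B)" using t0 C0 assms by (intro mult_right_mono) auto
 ultimately have hb: "h ?b - h ?a >= real k * q - C0 * B * l" unfolding z(3) q_def by (simp add: algebra_simps)
 have kq: "R <= real k * q"
 proof -
 have "R / q <= real k" using K k by linarith
 then show ?thesis using q by (simp add: divide_le_eq)
 qed
 have hs: "h s - b1 s >= 3 * (2 * M + 1) / (t0 * c0)" if s: "?b < s" "s < t0" for s
 proof -
 have "h s - h ?b >= - (C0 * B * l)" by (rule hinc) (use ab s gn t0 in auto)
 moreover have "b1 s <= B" using bd s t0 by (auto simp: abs_le_iff)
 ultimately show ?thesis using ha hb kq h0 unfolding R_def Q1_def by linarith
 qed
 obtain s where s: "?b < s" "s < t0" "g t0 - g ?b = (t0 / 3) * (alf s * (h s - b1 s))" using gmvt[of ?b t0] ab t0 by auto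
 have sl: "s \<in> {0..l}" using s t0 ab by auto
 have "c0 * (3 * (2 * M + 1) / (t0 * c0)) <= alf s * (h s - b1 s)"
 proof (rule mult_mono[OF _ hs[OF s(1,2)]])
 show "c0 <= alf s" using bd sl by blast
 then show "0 <= alf s" using assms(1) by linarith
 show "0 <= 3 * (2 * M + 1) / (t0 * c0)" using assms t0 by simp
 qed
 then have "(t0 / 3) * (c0 * (3 * (2 * M + 1) / (t0 * c0))) <= g t0 - g ?b"
 unfolding s(3) using t0 by (intro mult_left_mono) auto
 moreover have "(t0 / 3) * (c0 * (3 * (2 * M + 1) / (t0 * c0))) = 2 * M + 1" using t0 assms(1) by simp
 ultimately have "g t0 - g ?b >= 2 * M + 1" by linarith
 moreover have "\<bar>g t0\<bar> <= M" "\<bar>g ?b\<bar> <= M" using bd t0 ab by auto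
 ultimately show False by linarith
qed
qed

text \<open>Along the outward coordinate line through \<open>p\<close> the equations for the
  \<open>Y\<close>-derivatives of the solution and of the flux become the system of
  \<open>ode_boundary_decay\<close>; its factor \<open>alf\<close> is the derivative of
  \<open>fi\<close> along the line.\<close>

lemma (in penalised_solutions) boundary_decay:
assumes tb: "!!I. \<exists>C. \<forall>k. \<forall>x\<in>U. \<bar>Xs I (u k) x\<bar> <= C"
 and l: "0 < l" "si = 1 | si = -1" and seg: "!!t. 0 <= t ==> t <= l ==> p + t *\<^sub>R (si *\<^sub>R axis nu 1) \<in> U"
 and sgn: "!!x. x \<in> U ==> si * partial_deriv nu fi x >= c0"
 and kap: "!!k t. 0 <= t ==> t <= l ==> real (idx k) * flat (c0 * t) <= ka k (p + t *\<^sub>R (si *\<^sub>R axis nu 1))"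
 and pb: "!!k. \<bar>partial_deriv nu (u k) p\<bar> <= Cn" and e: "0 < e"
shows "\<exists>K. \<forall>k. idx k >= K --> \<bar>u k p\<bar> <= e"
proof -
let ?p = "%t. p + t *\<^sub>R (si *\<^sub>R axis nu 1)"
have pU: "p \<in> U" using seg[of 0] l(1) by simp
have tbd: "\<exists>C\<ge>0. \<forall>k. \<forall>x\<in>U. \<bar>R k x\<bar> <= C" if R: "span_on U tgens R" for R
proof -
 obtain C where "\<forall>k. \<forall>x\<in>U. \<bar>R k x\<bar> <= C"
 using span_on_bounded[OF R order_refl] tb unfolding tgens_def by blast
 then show ?thesis by (meson abs_ge_self abs_ge_zero order_trans)
qed
obtain S where S: "span_on U tgens S" "!!k x. x \<in> U ==> Xs [] (flux k) x = Y (Xs [] (u k)) x + S k x" using flux_Xs[of "[]"] by blast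
obtain T where T: "span_on U tgens T" "!!k x. x \<in> U ==> Y (flux k) x = ka k x * u k x + T k x" using Y_flux0 by blast
obtain BS where BS: "BS >= 0" "!!k x. x \<in> U ==> \<bar>S k x\<bar> <= BS" using tbd[OF S(1)] by blast
obtain BT where BT: "BT >= 0" "!!k x. x \<in> U ==> \<bar>T k x\<bar> <= BT" using tbd[OF T(1)] by blast
obtain M where M: "M >= 0" "!!k x. x \<in> U ==> \<bar>u k x\<bar> <= M" using tbd[OF tgens_gen[of "[]"]] by auto
obtain C0 where C0: "C0 > 0" "!!x. x \<in> U ==> \<bar>partial_deriv nu fi x\<bar> <= C0" using Cb_bound[OF Cb_dphi[where 'k=unit]] by blast
define B where "B = max BS BT"
define H where "H = \<bar>Cn\<bar> / c0 + BS"
let ?alf = "%t. si * partial_deriv nu fi (?p t)"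
have sq: "si * si = 1" "\<bar>si\<bar> = 1" using l(2) by auto
have alpha: "c0 <= ?alf t" "?alf t <= C0" if "0 <= t" "t <= l" for t
 using sgn[OF seg[OF that]] C0(2)[OF seg[OF that]] sq(2) abs_le_D1[of "?alf t" C0] by (auto simp: abs_mult)
have c0C0: "c0 <= C0" using alpha[of 0] l(1) by linarith
have B: "B >= 0" using BS by (simp add: B_def)
have H: "H >= 0" using BS c0 by (simp add: H_def)
have dY: "partial_deriv nu f x = partial_deriv nu fi x * Y f x" if "x \<in> U" for f x
 using nonzero[OF that] by (simp add: transversal_eq)
have der: "((%t. f (?p t)) has_real_derivative ?alf t * Y f (?p t)) (at t)" if f: "smooth_on U f" and t: "0 <= t" "t <= l" for f t
proof -
 have 1: "((%t. f (?p t)) has_real_derivative (\<Sum>i\<in>UNIV. (si *\<^sub>R axis nu 1) $ i * partial_deriv i f (?p t))) (at t)"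
 by (rule has_real_derivative_partial_deriv[OF smooth_on_imp_differentiable[OF f seg[OF t]]])
 have 2: "(\<Sum>i\<in>UNIV. (si *\<^sub>R axis nu 1) $ i * partial_deriv i f (?p t)) = si * partial_deriv nu f (?p t)"
 by (simp add: axis_def if_distrib[of "%c. _ * c"] if_distrib[of "%c. c * _"] cong: if_cong)
 have 3: "si * partial_deriv nu f (?p t) = ?alf t * Y f (?p t)" unfolding dY[OF seg[OF t], of f] by (rule mult.assoc[symmetric])
 show ?thesis using 1 unfolding 2 3 .
qed
have h0: "\<bar>flux k p\<bar> <= H" for k
proof -
 have "c0 * \<bar>Y (u k) p\<bar> <= \<bar>partial_deriv nu (u k) p\<bar>"
 unfolding dY[OF pU, of "u k"] abs_mult by (rule mult_right_mono[OF lower[OF pU]]) simp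
 then have "c0 * \<bar>Y (u k) p\<bar> <= \<bar>Cn\<bar>" using pb[of k] by linarith
 then have "\<bar>Y (u k) p\<bar> <= \<bar>Cn\<bar> / c0" unfolding pos_le_divide_eq[OF c0] by (simp add: mult.commute)
 then show ?thesis using S(2)[OF pU, of k] BS(2)[OF pU, of k] by (simp add: H_def)
qed
obtain K where K: "\<forall>k\<ge>K. \<forall>g h ka alf b1 b2.
 (\<forall>t\<in>{0..l}. (g has_real_derivative alf t * (h t - b1 t)) (at t)) &
 (\<forall>t\<in>{0..l}. (h has_real_derivative alf t * (ka t * g t + b2 t)) (at t)) &
 (\<forall>t\<in>{0..l}. c0 <= alf t & alf t <= C0 & \<bar>b1 t\<bar> <= B & \<bar>b2 t\<bar> <= B & \<bar>g t\<bar> <= M & real k * flat (c0 * t) <= ka t) &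
 - H <= h 0 --> g 0 <= e"
 using ode_boundary_decay[OF c0 c0C0 B H M(1) l(1) e] by blast
\<comment> \<open>The system is linear, so the one-sided estimate applies to the solution and to its
  negative.\<close>
have "s * u k p <= e" if k: "idx k >= K" and s: "s = 1 | s = -1" for k s
proof -
 have "s * u k (?p 0) <= e"
 proof (rule K[rule_format, OF k, of "%t. s * u k (?p t)" ?alf "%t. s * flux k (?p t)" "%t. s * S k (?p t)" "%t. ka k (?p t)" "%t. s * T k (?p t)"], intro conjI ballI)
 fix t assume "t \<in> {0..l}"
 then have t: "0 <= t" "t <= l" by auto
 note tU = seg[OF t]
 have "Y (u k) (?p t) = flux k (?p t) - S k (?p t)" using S(2)[OF tU, of k] by simp
 then show "((%t. s * u k (?p t)) has_real_derivative ?alf t * (s * flux k (?p t) - s * S k (?p t))) (at t)"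
 using DERIV_cmult[OF der[OF smooth_u t], of s k] by (simp add: right_diff_distrib mult_ac)
 show "((%t. s * flux k (?p t)) has_real_derivative ?alf t * (ka k (?p t) * (s * u k (?p t)) + s * T k (?p t))) (at t)"
 using DERIV_cmult[OF der[OF smooth_flux t], of s k] T(2)[OF tU, of k] by (simp add: distrib_left mult_ac)
 show "c0 <= ?alf t" "?alf t <= C0" using alpha[OF t] by auto
 have as: "\<bar>s\<bar> = 1" using s by auto
 show "\<bar>s * S k (?p t)\<bar> <= B" "\<bar>s * T k (?p t)\<bar> <= B" "\<bar>s * u k (?p t)\<bar> <= M"
 using BS(2)[OF tU, of k] BT(2)[OF tU, of k] M(2)[OF tU, of k] as by (auto simp: abs_mult B_def)
 show "real (idx k) * flat (c0 * t) <= ka k (?p t)" by (rule kap[OF t])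
 next
 show "- H <= s * flux k (?p 0)" using h0[of k] s by (auto simp: abs_le_iff)
 qed
 then show ?thesis by simp
qed
from this[of _ 1] this[of _ "-1"] have "\<forall>k. idx k >= K --> \<bar>u k p\<bar> <= e" by (auto simp: abs_le_iff)
then show ?thesis by blast
qed

section \<open>Solution of the Dirichlet problem\<close>

text \<open>Stated for combinations of sine and cosine because this class reproduces itself under
  differentiation, which makes the bounds on all orders an induction.\<close>

lemma trig_deriv:
fixes i j :: "'n::finite"
shows "(%x::real^'n. a * cos (s * x $ i) + b * sin (s * x $ i)) differentiable (at x)"
 "partial_deriv j (%x::real^'n. a * cos (s * x $ i) + b * sin (s * x $ i)) x =
 (if j = i then b * s else 0) * cos (s * x $ i) + (if j = i then - (a * s) else 0) * sin (s * x $ i)"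
proof -
have d: "(%x::real^'n. s * x $ i) differentiable (at x)" by (intro differentiable_mult) auto
have p: "partial_deriv j (%x::real^'n. s * x $ i) x = s * (if j = i then 1 else 0)"
 using partial_deriv_mult[of "%x. s" x "%x. x $ i" j] by simp
have h: "((%t. a * cos t + b * sin t) has_real_derivative - a * sin t + b * cos t) (at t)" for t
 by (auto intro!: derivative_eq_intros)
show "(%x::real^'n. a * cos (s * x $ i) + b * sin (s * x $ i)) differentiable (at x)"
 by (rule partial_deriv_real_compose(1)[OF h d])
show "partial_deriv j (%x::real^'n. a * cos (s * x $ i) + b * sin (s * x $ i)) x =
 (if j = i then b * s else 0) * cos (s * x $ i) + (if j = i then - (a * s) else 0) * sin (s * x $ i)"
 unfolding partial_deriv_real_compose(2)[OF h d] p by (cases "j = i") (simp_all add: algebra_simps)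
qed

lemma CB_trig: "CB m UNIV (%_::'k. %x::real^'n::finite. a * cos (s * x $ i) + b * sin (s * x $ i))"
proof (induction m arbitrary: a b)
have bd: "CB 0 UNIV (%_::'k. %x::real^'n::finite. a * cos (s * x $ i) + b * sin (s * x $ i))" for a b
proof -
 have "\<bar>a * cos (s * x $ i) + b * sin (s * x $ i)\<bar> <= \<bar>a\<bar> * 1 + \<bar>b\<bar> * 1" for x :: "real^'n"
 by (intro order_trans[OF abs_triangle_ineq] add_mono) (simp_all only: abs_mult mult_left_mono abs_cos_le_one abs_sin_le_one abs_ge_zero)
 then show ?thesis unfolding CB.simps by blast
qed
{ case 0 show ?case by (rule bd) }
{ case (Suc m)
 show ?case by (rule CB_SucI[OF open_UNIV bd trig_deriv Suc]) }
qed

lemma Cb_cos: "Cb UNIV (%_::'k. %x::real^'n::finite. cos (s * x $ i))"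
by (simp add: Cb_def CB_trig[of _ 1 s i 0, simplified])

lemma laplacian_cos: "laplacian (%x::real^'n::finite. cos (s * x $ i)) x = - (s\<^sup>2 * cos (s * x $ i))"
proof -
have "partial_deriv j (%x::real^'n. cos (s * x $ i)) = (%x. 0 * cos (s * x $ i) + (if j = i then - s else 0) * sin (s * x $ i))" for j
 using trig_deriv(2)[of j 1 s i 0] by auto
then show ?thesis unfolding laplacian_def
 by (simp only: trig_deriv(2)) (simp add: power2_eq_square if_distrib[of "%c. c * _"] cong: if_cong)
qed

text \<open>A potential that is periodic in one coordinate and vanishes on a given bounded set makes
$2 + \cos$ a strict supersolution on the whole space.\<close>

lemma background_potential:
assumes "bounded (S :: (real^'n::finite) set)"
shows "\<exists>W0 rh G. open G & S \<subseteq> G & Cb UNIV (%_::unit. W0) & (\<forall>x. W0 x >= 0) & (\<forall>x\<in>G. W0 x = 0) &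
 Cb UNIV (%_::unit. rh) & (\<forall>x::real^'n. rh x >= 0) & (\<forall>x. 2 <= - laplacian rh x + W0 x * rh x)"
proof -
obtain i :: 'n where True by blast
obtain B where B: "B > 0" "!!x. x \<in> S ==> norm x < B" using assms by (meson bounded_pos_less)
\<comment> \<open>\<open>s\<close> keeps the argument of the cosine in [-1, 1] on \<open>G\<close>;
  there the cosine exceeds 1/2 and the potential vanishes. M s^2 = 8 makes - laplacian rh >= 2 where
  the cosine is at least 1/4, and elsewhere \<open>A\<close> is large enough for the potential to
  compensate - M s^2.\<close>
define s where "s = 1 / B"
define M where "M = 8 / s\<^sup>2"
define f4 where "f4 = flat (1 / 4)"
define A where "A = (2 + M * s\<^sup>2) / (M * f4)"
define c where "c x = cos (s * x $ i)" for x :: "real^'n"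
define W0 where "W0 x = A * flat (1 / 2 - c x)" for x
define rh where "rh x = M * 2 + M * c x" for x
define G where "G = {x::real^'n. \<bar>x $ i\<bar> < B}"
have s: "s > 0" using B by (simp add: s_def)
have M: "M > 0" using s by (simp add: M_def)
have f4: "f4 > 0" by (simp add: f4_def flat_pos)
have A: "A > 0" using M f4 s by (simp add: A_def add_pos_pos)
have Cc: "Cb UNIV (%_::unit. c)" unfolding c_def[abs_def] by (rule Cb_cos)
have sc: "smooth_on UNIV c" by (rule Cb_imp_smooth_on[OF open_UNIV Cc])
have c1: "-1 <= c x" "c x <= 1" for x by (simp_all add: c_def)
have "open G" unfolding G_def by (intro open_Collect_less continuous_intros)
moreover have "S \<subseteq> G" using B(2) component_le_norm_cart[of _ i] unfolding G_def by (force intro: order_le_less_trans)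
moreover have "Cb UNIV (%_::unit. W0)" unfolding W0_def[abs_def]
 by (rule Cb_mult[OF open_UNIV Cb_const[OF open_UNIV] Cb_smooth1[OF open_UNIV _ smooth1_flat]])
 (rule Cb_diff[OF open_UNIV Cb_const[OF open_UNIV] Cc])
moreover have "W0 x >= 0" for x using A flat_nonneg by (simp add: W0_def)
moreover have "W0 x = 0" if "x \<in> G" for x
proof -
 have "\<bar>s * x $ i\<bar> <= 1" using that B(1) by (simp add: G_def s_def abs_mult divide_le_eq)
 then have "cos (1::real) <= cos \<bar>s * x $ i\<bar>" using pi_gt3 by (intro cos_monotone_0_pi_le) auto
 moreover have "cos (pi / 3) < cos (1::real)" using pi_gt3 by (intro cos_monotone_0_pi) auto
 ultimately have "1 / 2 < c x" by (simp add: cos_60 c_def)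
 then show ?thesis by (simp add: W0_def flat_zero)
qed
moreover have "Cb UNIV (%_::unit. rh)" unfolding rh_def[abs_def] by (intro Cb_add Cb_mult Cb_const Cc open_UNIV)
moreover have rhM: "M <= rh x" for x using mult_left_mono[OF c1(1)[of x], of M] M by (simp add: rh_def)
moreover have "2 <= - laplacian rh x + W0 x * rh x" for x
proof -
 have "laplacian rh x = M * (- (s\<^sup>2 * c x))"
 unfolding rh_def[abs_def]
 using laplacian_add[OF open_UNIV UNIV_I smooth_on_const[OF open_UNIV] smooth_on_mult[OF open_UNIV smooth_on_const[OF open_UNIV] sc], of "M * 2" M x]
 laplacian_cmult[OF open_UNIV UNIV_I sc, of M x] laplacian_cos[of s i x] unfolding c_def[abs_def] by simp
 then have l: "- laplacian rh x = M * s\<^sup>2 * c x" by simp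
 have Ms: "M * s\<^sup>2 = 8" using s by (simp add: M_def)
 have W0n: "W0 x >= 0" using A flat_nonneg by (simp add: W0_def)
 show ?thesis
 proof (cases "c x >= 1 / 4")
 case True
 have "0 <= W0 x * rh x" using W0n rhM[of x] M by (intro mult_nonneg_nonneg) auto
 then show ?thesis using True unfolding l Ms by linarith
 next
 case False
 have "f4 <= flat (1 / 2 - c x)" unfolding f4_def using False by (intro flat_mono) auto
 then have "A * f4 <= W0 x" unfolding W0_def using A by (intro mult_left_mono) auto
 then have "(A * f4) * M <= W0 x * rh x" using rhM[of x] A f4 M W0n by (intro mult_mono) auto
 moreover have "(A * f4) * M = 2 + M * s\<^sup>2" using M f4 by (simp add: A_def)
 ultimately show ?thesis unfolding l Ms using c1(1)[of x] by linarith
 qed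
qed
moreover have "rh x >= 0" for x using rhM[of x] M by linarith
ultimately show ?thesis by blast
qed

text \<open>Allows the penalty to be exchanged for one that agrees with it on the smaller set, in
  particular for 0 inside the domain.\<close>

lemma penalised_solutions_subset:
assumes "penalised_solutions U fi nu c0 (u :: 'k => real^'n::finite => real) ka F" "open V" "V \<subseteq> U"
 and "!!k x. x \<in> V ==> ka' k x = ka k x"
shows "penalised_solutions V fi nu c0 u ka' F"
proof -
interpret penalised_solutions U fi nu c0 u ka F by (rule assms)
show ?thesis
proof
 show "open V" by (rule assms)
 show "Cb V (%_::unit. fi)" by (rule Cb_subset[OF phi assms(3)])
 show "0 < c0" by (rule c0)
 show "c0 <= \<bar>partial_deriv nu fi x\<bar>" if "x \<in> V" for x using lower that assms(3) by blast
 show "smooth_on V (u k)" for k by (rule smooth_on_subset[OF smooth_u assms(3)])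
 show "smooth_on V (ka' k)" for k
 by (rule smooth_on_cong[OF assms(2) _ smooth_on_subset[OF smooth_kappa assms(3)]]) (simp add: assms(4))
 show "0 <= ka' k x" if "x \<in> V" for k x using kappa_nonneg assms(3,4) that by auto
 show "tangential fi nu a (ka' k) x = 0" if "x \<in> V" for a k x
 proof -
 have "tangential fi nu a (ka' k) x = tangential fi nu a (ka k) x"
 unfolding tangential_def by (rule vfield_cong[OF assms(2) that assms(4)])
 then show ?thesis using X_kappa assms(3) that by auto
 qed
 show "Cb V (%_::'k. F)" by (rule Cb_subset[OF Cb_F assms(3)])
 show "laplacian (u k) x = gradsq fi x * ka' k x * u k x + F x" if "x \<in> V" for x k
 using equation assms(3,4) that by auto
qed
qed

lemma penalised_tangential_bounds:
assumes "penalised_solutions (ball p R) fi nu c0 (u :: 'k => real^'n::finite => real) ka F" "0 < R"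
 and "!!k x. \<bar>u k x\<bar> <= M"
shows "\<exists>C. \<forall>k. \<forall>x\<in>ball p (R / 2). \<bar>tangentials fi nu I (u k) x\<bar> <= C"
proof -
interpret penalised_solutions "ball p R" fi nu c0 u ka F by (rule assms)
show ?thesis using tangential_bounds[OF order_refl assms(3), of "R / 2" "length I"] assms(2) by auto
qed

text \<open>The tangential bounds hold on a full ball, across the boundary. The normal ones are
  confined to the part \<open>D\<close> without penalty, where every point needs a segment of length
  R/4 along \<open>nu\<close> in one of the two directions.\<close>

lemma penalised_local_bounds:
assumes ps: "penalised_solutions (ball p R) fi nu c0 (u :: 'k => real^'n::finite => real) ka F" and R: "0 < R"
 and M: "!!k x. \<bar>u k x\<bar> <= M" and D: "open D" "!!k x. x \<in> D ==> x \<in> ball p R ==> ka k x = 0"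
 and seg: "!!x. x \<in> D ==> x \<in> ball p (R / 4) ==> (\<forall>t. 0 <= t --> t <= R / 4 --> x + t *\<^sub>R axis nu 1 \<in> D) |
 (\<forall>t. 0 <= t --> t <= R / 4 --> x - t *\<^sub>R axis nu 1 \<in> D)"
shows "\<exists>C. \<forall>k. \<forall>x\<in>D \<inter> ball p (R / 4). \<bar>pd I (u k) x\<bar> <= C"
proof -
let ?V = "D \<inter> ball p (R / 2)"
have V: "open ?V" "?V \<subseteq> ball p R" using D(1) R by auto
interpret penalised_solutions ?V fi nu c0 u "%_ _. 0" F
 by (rule penalised_solutions_subset[OF ps V]) (use D(2) V(2) in \<open>simp add: subset_iff\<close>)
show ?thesis
proof (rule normal_bounds)
 show "\<exists>C. \<forall>k. \<forall>x\<in>?V. \<bar>Xs I (u k) x\<bar> <= C" for I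
 using penalised_tangential_bounds[OF ps R M, of I] by blast
 show "D \<inter> ball p (R / 4) \<subseteq> ?V" "0 < R / 4" using R by auto
 fix x assume x: "x \<in> D \<inter> ball p (R / 4)"
 have inb: "x + t *\<^sub>R axis nu 1 \<in> ball p (R / 2)" if "\<bar>t\<bar> <= R / 4" for t
 proof -
 have "dist p (x + t *\<^sub>R axis nu 1) <= dist p x + dist x (x + t *\<^sub>R axis nu 1)" by (rule dist_triangle)
 also have "dist x (x + t *\<^sub>R axis nu 1) = \<bar>t\<bar>" by (simp add: dist_norm)
 finally show ?thesis using x that by simp
 qed
 from seg[of x] x consider "\<forall>t. 0 <= t --> t <= R / 4 --> x + t *\<^sub>R axis nu 1 \<in> D" | "\<forall>t. 0 <= t --> t <= R / 4 --> x - t *\<^sub>R axis nu 1 \<in> D" by blast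
 then show "\<exists>z t0. 0 <= t0 & t0 <= R / 4 & x = z + t0 *\<^sub>R axis nu 1 & (\<forall>t. 0 <= t --> t <= R / 4 --> z + t *\<^sub>R axis nu 1 \<in> ?V)"
 proof cases
 case 1
 then show ?thesis using inb R by (intro exI[of _ x] exI[of _ 0]) auto
 next
 case 2
 \<comment> \<open>\<open>normal_bounds\<close> runs through its segments in the positive direction,
   so a segment extending backwards is described from its far end, with \<open>x\<close> at
   parameter R/4.\<close>
 have "(x - (R / 4) *\<^sub>R axis nu 1) + t *\<^sub>R axis nu 1 \<in> ?V" if t: "0 <= t" "t <= R / 4" for t
 proof -
 have e: "(x - (R / 4) *\<^sub>R axis nu 1) + t *\<^sub>R axis nu 1 = x - (R / 4 - t) *\<^sub>R axis nu 1" by (simp add: algebra_simps)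
 have "x + (- (R / 4 - t)) *\<^sub>R axis nu 1 \<in> ball p (R / 2)" by (rule inb) (use t in auto)
 then have "x - (R / 4 - t) *\<^sub>R axis nu 1 \<in> ball p (R / 2)"
 unfolding scaleR_minus_left add_uminus_conv_diff .
 then show ?thesis unfolding e using 2[rule_format, of "R / 4 - t"] t by simp
 qed
 then show ?thesis using R by (intro exI[of _ "x - (R / 4) *\<^sub>R axis nu 1"] exI[of _ "R / 4"]) auto
 qed
qed simp
qed

section \<open>Passage to the limit in the penalised problem\<close>

locale penalised_problem =
fixes fi :: "real^'n::finite => real" and u :: "nat => real^'n => real" and F :: "real^'n => real"
 and G :: "(real^'n) set" and M :: real
assumes phi: "Cb UNIV (%_::unit. fi)" and bddO: "bounded {x. fi x < 0}"
 and grad: "!!x. x \<in> frontier {x. fi x < 0} ==> gradsq fi x > 0"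
 and CF: "Cb UNIV (%_::unit. F)" and u: "!!k. smooth_on UNIV (u k)" and uM: "!!k x. \<bar>u k x\<bar> <= M"
 and G: "open G" "closure {x. fi x < 0} \<subseteq> G"
 and eq: "!!k x. x \<in> G ==> laplacian (u k) x = gradsq fi x * (real k * flat (fi x)) * u k x + F x"
begin

abbreviation "\<Omega> \<equiv> {x. fi x < 0}"

lemma sphi: "smooth_on UNIV fi" by (rule Cb_imp_smooth_on[OF open_UNIV phi])
lemma cphi: "continuous_on UNIV fi" by (rule smooth_on_imp_continuous_on[OF sphi])
lemma openO: "open \<Omega>" using cphi by (intro open_Collect_less continuous_on_const)

lemma frontier_zero: "p \<in> frontier \<Omega> ==> fi p = 0"
proof -
assume p: "p \<in> frontier \<Omega>"
have "closed {x. fi x <= 0}" using cphi by (intro closed_Collect_le continuous_on_const)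
then have "closure \<Omega> \<subseteq> {x. fi x <= 0}" by (intro closure_minimal) auto
moreover have "p \<notin> \<Omega>" using p openO by (simp add: frontier_def interior_open)
ultimately show ?thesis using p by (force simp: frontier_def)
qed

text \<open>Some partial derivative of \<open>fi\<close> is nonzero at \<open>p\<close> and keeps
  its sign nearby; the penalty is a function of \<open>fi\<close>, so the chain rule makes its
  tangential derivatives vanish.\<close>

lemma frontier_instance:
assumes p: "p \<in> frontier \<Omega>"
shows "\<exists>R nu c0 si. R > 0 & 0 < c0 & (si = 1 | si = -1) & (\<forall>x\<in>ball p R. c0 <= si * partial_deriv nu fi x) &
 penalised_solutions (ball p R) fi nu c0 u (%k x. real k * flat (fi x)) F"
proof -
have "\<exists>nu. partial_deriv nu fi p ~= 0"
proof (rule ccontr)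
 assume "~ ?thesis"
 then show False using grad[OF p] by (simp add: gradsq_def)
qed
then obtain nu where nz: "partial_deriv nu fi p ~= 0" by blast
define si where "si = (if partial_deriv nu fi p > 0 then 1 else - 1 :: real)"
define c0 where "c0 = \<bar>partial_deriv nu fi p\<bar> / 2"
have c0: "c0 > 0" using nz by (simp add: c0_def)
have "continuous_on UNIV (partial_deriv nu fi)" using smooth_on_imp_continuous_on[OF smooth_on_partial_deriv[OF sphi]] .
then have "isCont (partial_deriv nu fi) p" by (simp add: continuous_on_eq_continuous_at)
then obtain d where d: "d > 0" "!!x. dist x p < d ==> \<bar>partial_deriv nu fi x - partial_deriv nu fi p\<bar> < c0"
 using c0 unfolding continuous_at_eps_delta dist_real_def by blast
have "p \<in> G" using p G(2) by (auto simp: frontier_def)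
then obtain e where e: "e > 0" "ball p e \<subseteq> G" using G(1) open_contains_ball by blast
define R where "R = min d e"
have R: "R > 0" using d e by (simp add: R_def)
have low: "c0 <= si * partial_deriv nu fi x" if "x \<in> ball p R" for x
 using d(2)[of x] that nz unfolding c0_def si_def R_def by (auto simp: dist_commute abs_if split: if_splits)
have sg: "si = 1 | si = -1" by (simp add: si_def)
obtain f' where f': "!!t. (flat has_real_derivative f' t) (at t)"
 using smooth1_flat[of "Suc 0"] by auto
interpret adapted_fields "ball p R" fi nu c0
proof
 show "c0 <= \<bar>partial_deriv nu fi x\<bar>" if "x \<in> ball p R" for x
 using low[OF that] sg by (auto simp: abs_if split: if_splits)
qed (use c0 Cb_subset[OF phi] in auto)
have "penalised_solutions (ball p R) fi nu c0 u (%k x. real k * flat (fi x)) F"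
proof
 show "smooth_on (ball p R) (u k)" for k using smooth_on_subset[OF u] by blast
 have "smooth_on UNIV (%x. real k * flat (fi x))" for k
 by (rule smooth_on_mult[OF open_UNIV smooth_on_const[OF open_UNIV] smooth_on_smooth1[OF open_UNIV sphi smooth1_flat]])
 then show "smooth_on (ball p R) (%x. real k * flat (fi x))" for k using smooth_on_subset by blast
 show "0 <= real k * flat (fi x)" for k x using flat_nonneg by simp
 show "tangential fi nu a (%x. real k * flat (fi x)) x = 0" if "x \<in> ball p R" for a k x
 proof -
 have "((%t. real k * flat t) has_real_derivative real k * f' (fi x)) (at (fi x))" by (rule DERIV_cmult[OF f'])
 from partial_deriv_real_compose(2)[OF this smooth_on_imp_differentiable[OF sphi UNIV_I]]
 show ?thesis unfolding tangential_eq using nonzero[OF that] by simp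
 qed
 show "Cb (ball p R) (%_::nat. F)" using Cb_subset[OF Cb_reindex[OF CF]] by blast
 show "laplacian (u k) x = gradsq fi x * (real k * flat (fi x)) * u k x + F x" if "x \<in> ball p R" for x k
 using eq[of x k] that e by (auto simp: R_def)
qed
then show ?thesis using R c0 sg low by blast
qed

text \<open>Moving along \<open>nu\<close> against the sign \<open>si\<close> decreases
  \<open>fi\<close>, so segments in this direction stay inside the domain, where there is no
  penalty.\<close>

lemma local_bounds_frontier:
assumes p: "p \<in> frontier \<Omega>"
shows "\<exists>r>0. \<forall>I. \<exists>C. \<forall>k. \<forall>x\<in>\<Omega> \<inter> ball p r. \<bar>pd I (u k) x\<bar> <= C"
proof -
obtain R nu c0 si where R: "R > 0" "0 < c0" "si = 1 | si = -1" "!!x. x \<in> ball p R ==> c0 <= si * partial_deriv nu fi x"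
 and ps: "penalised_solutions (ball p R) fi nu c0 u (%k x. real k * flat (fi x)) F"
 using frontier_instance[OF p] by blast
have dphi: "fi differentiable (at x)" for x using smooth_on_imp_differentiable[OF sphi] by blast
have inb: "x + t *\<^sub>R axis nu 1 \<in> ball p R" if "x \<in> ball p (R / 4)" "\<bar>t\<bar> <= R / 4" for x t
proof -
 have "dist p (x + t *\<^sub>R axis nu 1) <= dist p x + dist x (x + t *\<^sub>R axis nu 1)" by (rule dist_triangle)
 also have "dist x (x + t *\<^sub>R axis nu 1) = \<bar>t\<bar>" by (simp add: dist_norm)
 finally show ?thesis using that R(1) by simp
qed
have "\<exists>C. \<forall>k. \<forall>x\<in>\<Omega> \<inter> ball p (R / 4). \<bar>pd I (u k) x\<bar> <= C" for I
proof (rule penalised_local_bounds[OF ps R(1) uM openO])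
 show "real k * flat (fi x) = 0" if "x \<in> \<Omega>" for k x using that by (simp add: flat_zero)
 fix x assume x: "x \<in> \<Omega>" "x \<in> ball p (R / 4)"
 show "(\<forall>t. 0 <= t --> t <= R / 4 --> x + t *\<^sub>R axis nu 1 \<in> \<Omega>) | (\<forall>t. 0 <= t --> t <= R / 4 --> x - t *\<^sub>R axis nu 1 \<in> \<Omega>)"
 proof (cases "si = 1")
 case True
 have "x - t *\<^sub>R axis nu 1 \<in> \<Omega>" if t: "0 <= t" "t <= R / 4" for t
 proof (cases "t = 0")
 case False
 let ?z = "x - t *\<^sub>R axis nu 1"
 obtain s where s: "0 < s" "s < t" "fi (?z + t *\<^sub>R axis nu 1) - fi ?z = t * partial_deriv nu fi (?z + s *\<^sub>R axis nu 1)"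
 using mvt_partial_deriv[of t fi ?z nu] dphi t False by force
 have e: "?z + s *\<^sub>R axis nu 1 = x + (s - t) *\<^sub>R axis nu 1" by (simp add: algebra_simps)
 have "?z + s *\<^sub>R axis nu 1 \<in> ball p R" unfolding e by (rule inb[OF x(2)]) (use s t in auto)
 from R(4)[OF this] have "t * partial_deriv nu fi (?z + s *\<^sub>R axis nu 1) >= 0" using True R(2) t by simp
 then show ?thesis using s(3) x by simp
 qed (use x in simp)
 then show ?thesis by blast
 next
 case False
 then have sm: "si = -1" using R(3) by simp
 have "x + t *\<^sub>R axis nu 1 \<in> \<Omega>" if t: "0 <= t" "t <= R / 4" for t
 proof (cases "t = 0")
 case False
 obtain s where s: "0 < s" "s < t" "fi (x + t *\<^sub>R axis nu 1) - fi x = t * partial_deriv nu fi (x + s *\<^sub>R axis nu 1)"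
 using mvt_partial_deriv[of t fi x nu] dphi t False by force
 have "x + s *\<^sub>R axis nu 1 \<in> ball p R" using inb[OF x(2), of s] s t by simp
 from R(4)[OF this] have "t * partial_deriv nu fi (x + s *\<^sub>R axis nu 1) <= 0" using sm R(2) t by (simp add: mult_le_0_iff)
 then show ?thesis using s(3) x by simp
 qed (use x in simp)
 then show ?thesis by blast
 qed
qed
then show ?thesis using R(1) by (intro exI[of _ "R / 4"]) auto
qed

text \<open>Interior estimates come from the same machinery: a coordinate function plays the role of
  \<open>fi\<close>, with gradient of length 1 and penalty 0.\<close>

lemma local_bounds_interior:
assumes p: "p \<in> \<Omega>"
shows "\<exists>r>0. \<forall>I. \<exists>C. \<forall>k. \<forall>x\<in>\<Omega> \<inter> ball p r. \<bar>pd I (u k) x\<bar> <= C"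
proof -
obtain R where R: "R > 0" "ball p R \<subseteq> \<Omega>" using p openO open_contains_ball by blast
obtain nu :: 'n where True by blast
let ?psi = "%x::real^'n. x $ nu"
have gs: "gradsq ?psi x = 1" for x
 unfolding gradsq_def by (simp add: if_distrib[of "%c. c\<^sup>2"] cong: if_cong)
have BG: "ball p R \<subseteq> G" using R(2) G(2) closure_subset by blast
have "penalised_solutions (ball p R) ?psi nu 1 u (%_ _. 0) F"
proof
 show "Cb (ball p R) (%_::unit. ?psi)"
 by (rule smooth_on_imp_Cb[OF smooth_on_component[OF open_UNIV], of "cball p R"]) auto
 show "smooth_on (ball p R) (u k)" for k using smooth_on_subset[OF u] by blast
 show "smooth_on (ball p R) (%x. 0::real)" by (rule smooth_on_const) simp
 show "tangential ?psi nu a (%x. 0) x = 0" for a x unfolding tangential_eq by simp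
 show "Cb (ball p R) (%_::nat. F)" using Cb_subset[OF Cb_reindex[OF CF]] by blast
 show "laplacian (u k) x = gradsq ?psi x * 0 * u k x + F x" if "x \<in> ball p R" for x k
 proof -
 have "fi x < 0" using that R(2) by blast
 then show ?thesis using eq[of x k] that BG by (simp add: flat_zero subset_iff)
 qed
qed auto
then have "\<exists>C. \<forall>k. \<forall>x\<in>UNIV \<inter> ball p (R / 4). \<bar>pd I (u k) x\<bar> <= C" for I
 by (rule penalised_local_bounds[OF _ R(1) uM open_UNIV]) auto
then have "\<exists>C. \<forall>k. \<forall>x\<in>\<Omega> \<inter> ball p (R / 4). \<bar>pd I (u k) x\<bar> <= C" for I
 by (meson IntD2 IntI UNIV_I)
moreover have "R / 4 > 0" using R(1) by simp
ultimately show ?thesis by blast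
qed

lemma global_bounds: "\<exists>C. \<forall>k x. fi x < 0 --> \<bar>pd I (u k) x\<bar> <= C"
proof -
have "\<exists>r>0. \<forall>I. \<exists>C. \<forall>k. \<forall>x\<in>\<Omega> \<inter> ball p r. \<bar>pd I (u k) x\<bar> <= C" if "p \<in> closure \<Omega>" for p
 using that local_bounds_frontier[of p] local_bounds_interior[of p] openO
 by (cases "p \<in> \<Omega>") (auto simp: frontier_def interior_open)
then obtain r where r: "!!p. p \<in> closure \<Omega> ==> r p > 0" "!!p I. p \<in> closure \<Omega> ==> \<exists>C. \<forall>k. \<forall>x\<in>\<Omega> \<inter> ball p (r p). \<bar>pd I (u k) x\<bar> <= C"
 by metis
have "\<forall>p\<in>closure \<Omega>. \<exists>C. \<forall>k. \<forall>x\<in>\<Omega> \<inter> ball p (r p). \<bar>pd I (u k) x\<bar> <= C" using r(2)[where I=I] by blast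
from bchoice[OF this] obtain C where C: "!!p k x. p \<in> closure \<Omega> ==> x \<in> \<Omega> \<inter> ball p (r p) ==> \<bar>pd I (u k) x\<bar> <= C p" by blast
have cmp: "compact (closure \<Omega>)" using bddO by simp
have cov: "closure \<Omega> \<subseteq> (\<Union>p\<in>closure \<Omega>. ball p (r p))" using r(1) by auto
obtain T where T: "T \<subseteq> closure \<Omega>" "finite T" "closure \<Omega> \<subseteq> (\<Union>p\<in>T. ball p (r p))"
 by (rule compactE_image[OF cmp _ cov]) auto
have "\<bar>pd I (u k) x\<bar> <= (\<Sum>p\<in>T. \<bar>C p\<bar>)" if x: "fi x < 0" for k x
proof -
 have "x \<in> closure \<Omega>" using x closure_subset[of \<Omega>] by auto
 then obtain p where p: "p \<in> T" "x \<in> ball p (r p)" using T(3) by blast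
 have "\<bar>pd I (u k) x\<bar> <= C p" using C[of p x k] p x T(1) by blast
 also have "... <= (\<Sum>p\<in>T. \<bar>C p\<bar>)" using member_le_sum[of p T "%p. \<bar>C p\<bar>"] p T(2) by auto
 finally show ?thesis .
qed
then show ?thesis by blast
qed

lemma frontier_decay:
assumes p: "p \<in> frontier \<Omega>" and e: "e > 0"
shows "\<exists>K. \<forall>k\<ge>K. \<bar>u k p\<bar> <= e"
proof -
obtain R nu c0 si where R: "R > 0" "0 < c0" "si = 1 | si = -1" "!!x. x \<in> ball p R ==> c0 <= si * partial_deriv nu fi x"
 and ps: "penalised_solutions (ball p R) fi nu c0 u (%k x. real k * flat (fi x)) F"
 using frontier_instance[OF p] by blast
obtain C where C: "!!k x. fi x < 0 ==> \<bar>pd [nu] (u k) x\<bar> <= C" using global_bounds[of "[nu]"] by blast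
\<comment> \<open>The derivative bound is known inside the domain and reaches the boundary point by
  continuity of each \<open>u k\<close>.\<close>
have Cp: "\<bar>partial_deriv nu (u k) p\<bar> <= C" for k
proof -
 have "continuous_on UNIV (partial_deriv nu (u k))" by (rule smooth_on_imp_continuous_on[OF smooth_on_partial_deriv[OF u]])
 then have "closed {x. \<bar>partial_deriv nu (u k) x\<bar> <= C}" by (intro closed_Collect_le continuous_intros)
 then have "closure \<Omega> \<subseteq> {x. \<bar>partial_deriv nu (u k) x\<bar> <= C}" using C by (intro closure_minimal) auto
 then show ?thesis using p by (auto simp: frontier_def)
qed
let ?U = "ball p (R / 2)"
interpret penalised_solutions ?U fi nu c0 u "%k x. real k * flat (fi x)" F
 by (rule penalised_solutions_subset[OF ps]) (use R(1) in auto)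
have seg: "p + t *\<^sub>R (si *\<^sub>R axis nu 1) \<in> ?U" if "0 <= t" "t <= R / 4" for t
 using that R(1,3) by (auto simp: dist_norm)
have "real k * flat (c0 * t) <= real k * flat (fi (p + t *\<^sub>R (si *\<^sub>R axis nu 1)))" if t: "0 <= t" "t <= R / 4" for k t
proof -
 have d: "((%t. fi (p + t *\<^sub>R (si *\<^sub>R axis nu 1))) has_real_derivative si * partial_deriv nu fi (p + s *\<^sub>R (si *\<^sub>R axis nu 1))) (at s)" for s
 proof -
 have 1: "((%t. fi (p + t *\<^sub>R (si *\<^sub>R axis nu 1))) has_real_derivative
 (\<Sum>i\<in>UNIV. (si *\<^sub>R axis nu 1) $ i * partial_deriv i fi (p + s *\<^sub>R (si *\<^sub>R axis nu 1)))) (at s)"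
 by (rule has_real_derivative_partial_deriv[OF smooth_on_imp_differentiable[OF sphi UNIV_I]])
 have 2: "(\<Sum>i\<in>UNIV. (si *\<^sub>R axis nu 1) $ i * partial_deriv i fi (p + s *\<^sub>R (si *\<^sub>R axis nu 1))) = si * partial_deriv nu fi (p + s *\<^sub>R (si *\<^sub>R axis nu 1))"
 by (simp add: axis_def if_distrib[of "%c. _ * c"] if_distrib[of "%c. c * _"] cong: if_cong)
 show ?thesis using 1 unfolding 2 .
 qed
 \<comment> \<open>Along the outward line \<open>fi\<close> grows from 0 at least like c0 t, and
   \<open>flat\<close> is monotone; this is the lower bound on the penalty that the decay argument
   needs.\<close>
 have "c0 * t <= fi (p + t *\<^sub>R (si *\<^sub>R axis nu 1))"
 proof (cases "t = 0")
 case False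
 then obtain s where s: "0 < s" "s < t" "fi (p + t *\<^sub>R (si *\<^sub>R axis nu 1)) - fi (p + 0 *\<^sub>R (si *\<^sub>R axis nu 1)) = (t - 0) * (si * partial_deriv nu fi (p + s *\<^sub>R (si *\<^sub>R axis nu 1)))"
 using MVT2[of 0 t "%t. fi (p + t *\<^sub>R (si *\<^sub>R axis nu 1))", OF _ d] t by auto
 have "p + s *\<^sub>R (si *\<^sub>R axis nu 1) \<in> ball p R" using seg[of s] s t R(1) by auto
 from mult_right_mono[OF R(4)[OF this] t(1)] show ?thesis using s(3) frontier_zero[OF p] by (simp add: mult_ac)
 qed (use frontier_zero[OF p] in simp)
 then show ?thesis by (intro mult_left_mono flat_mono) auto
qed
note kap = this
have "\<exists>K. \<forall>k. k >= K --> \<bar>u k p\<bar> <= e"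
proof (rule boundary_decay[where l="R / 4" and si=si and idx="%k. k" and Cn=C])
 show "\<exists>C. \<forall>k. \<forall>x\<in>?U. \<bar>Xs I (u k) x\<bar> <= C" for I by (rule penalised_tangential_bounds[OF ps R(1) uM])
 show "c0 <= si * partial_deriv nu fi x" if "x \<in> ?U" for x using R(1,4) that by simp
 show "real k * flat (c0 * t) <= real k * flat (fi (p + t *\<^sub>R (si *\<^sub>R axis nu 1)))" if "0 <= t" "t <= R / 4" for k t
 by (rule kap[OF that])
 show "p + t *\<^sub>R (si *\<^sub>R axis nu 1) \<in> ?U" if "0 <= t" "t <= R / 4" for t by (rule seg[OF that])
qed (use R e Cp in auto)
then show ?thesis by blast
qed

text \<open>On the closed domain the extensions agree with the \<open>u k\<close>, so their limit
  inherits the equation inside, where the penalty is zero, and the vanishing boundary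
  values.\<close>

lemma limit_solution:
"\<exists>W w. open W & closure \<Omega> \<subseteq> W & smooth_on W w & (\<forall>x\<in>\<Omega>. laplacian w x = F x) & (\<forall>x\<in>frontier \<Omega>. w x = 0)"
proof -
obtain W E where W: "open W" "closure \<Omega> \<subseteq> W" "Cb W E" "!!k x. fi x <= 0 ==> E k x = u k x"
 using smooth_extension[OF phi bddO grad u global_bounds] by blast
obtain r v where rv: "strict_mono r" "Cb W (%_::unit. v)" "!!I x. x \<in> W ==> (%k. pd I (E (r k)) x) \<longlonglongrightarrow> pd I v x"
 using Cb_convergent_subsequence[OF W(1,3)] by blast
have "laplacian v x = F x" if x: "x \<in> \<Omega>" for x
proof -
 have xW: "x \<in> W" using subsetD[OF closure_subset x] W(2) by (rule rev_subsetD)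
 have "(%k. laplacian (E (r k)) x) \<longlonglongrightarrow> laplacian v x"
 unfolding laplacian_eq_pd by (rule tendsto_sum) (rule rv(3)[OF xW])
 moreover have "laplacian (E (r k)) x = F x" for k
 proof -
 have "laplacian (E (r k)) x = laplacian (u (r k)) x"
 by (rule laplacian_cong[OF openO x]) (use W(4) in simp)
 also have "... = F x" using eq[of x "r k"] x G(2) closure_subset[of \<Omega>] by (simp add: flat_zero subset_iff)
 finally show ?thesis .
 qed
 ultimately show ?thesis by (simp add: LIMSEQ_const_iff)
qed
moreover have "v x = 0" if x: "x \<in> frontier \<Omega>" for x
proof -
 have xW: "x \<in> W" using x W(2) by (auto simp: frontier_def)
 have 1: "(%k. u (r k) x) \<longlonglongrightarrow> v x" using rv(3)[OF xW, of "[]"] W(4) frontier_zero[OF x] by simp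
 have "(%k. u k x) \<longlonglongrightarrow> 0"
 proof (rule LIMSEQ_I)
 fix e :: real assume "e > 0"
 then obtain K where "\<forall>k\<ge>K. \<bar>u k x\<bar> <= e / 2" using frontier_decay[OF x, of "e / 2"] by auto
 then show "\<exists>K. \<forall>k\<ge>K. norm (u k x - 0) < e" using \<open>e > 0\<close> by (intro exI[of _ K]) force
 qed
 then have "(%k. u (r k) x) \<longlonglongrightarrow> 0" using LIMSEQ_subseq_LIMSEQ[OF _ rv(1)] by (auto simp: o_def)
 then show ?thesis using 1 LIMSEQ_unique by blast
qed
ultimately show ?thesis using W(1,2) Cb_imp_smooth_on[OF W(1) rv(2)] by blast
qed

end

text \<open>The supersolution is a multiple of the one for the background potential alone; adding a
  nonnegative penalty only helps, so one sup bound holds for all \<open>k\<close>.\<close>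

lemma dirichlet_defining_function:
fixes fi F :: "real^'n::finite => real"
assumes phi: "Cb UNIV (%_::unit. fi)" and bddO: "bounded {x. fi x < 0}"
 and grad: "!!x. x \<in> frontier {x. fi x < 0} ==> gradsq fi x > 0" and F: "Cb UNIV (%_::unit. F)"
shows "\<exists>W w. open W & closure {x. fi x < 0} \<subseteq> W & smooth_on W w & (\<forall>x. fi x < 0 --> laplacian w x = F x) &
 (\<forall>x\<in>frontier {x. fi x < 0}. w x = 0)"
proof -
obtain W0 rh G where W0: "open G" "closure {x. fi x < 0} \<subseteq> G" "Cb UNIV (%_::unit. W0)" "!!x. W0 x >= 0" "!!x. x \<in> G ==> W0 x = 0"
 and rh: "Cb UNIV (%_::unit. rh)" "!!x. rh x >= 0" "!!x. 2 <= - laplacian rh x + W0 x * rh x"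
 using background_potential[OF bounded_closure[OF bddO]] by blast
define P where "P k x = W0 x + real k * (gradsq fi x * flat (fi x))" for k :: nat and x
have Cg: "Cb UNIV (%_::unit. gradsq fi)" unfolding gradsq_def[abs_def] power2_eq_square
 by (intro Cb_sum Cb_mult Cb_partial_deriv phi open_UNIV finite)
have Cf: "Cb UNIV (%_::unit. %x. flat (fi x))" by (rule Cb_smooth1[OF open_UNIV phi smooth1_flat])
have CP: "Cb UNIV (%_::unit. P k)" for k unfolding P_def[abs_def]
 by (intro Cb_add Cb_mult Cb_const W0 Cg Cf open_UNIV)
have P0: "P k x >= W0 x" for k x unfolding P_def using gradsq_nonneg[of fi x] flat_nonneg[of "fi x"] by simp
have rhP: "2 <= - laplacian rh x + P k x * rh x" for k x
 using rh(3)[of x] mult_right_mono[OF P0[of x k] rh(2)[of x]] by linarith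
obtain B where B: "B > 0" "!!x. \<bar>F x\<bar> <= B" using Cb_bound[OF F] by auto
define S where "S x = (B + 1) * rh x" for x
have CS: "Cb UNIV (%_::unit. S)" unfolding S_def[abs_def] by (intro Cb_mult Cb_const rh open_UNIV)
have lS: "laplacian S x = (B + 1) * laplacian rh x" for x
 unfolding S_def[abs_def] by (rule laplacian_cmult[OF open_UNIV UNIV_I Cb_imp_smooth_on[OF open_UNIV rh(1)]])
have P0': "P k x >= 0" for k x using P0[of x k] W0(4)[of x] by linarith
have CmF: "Cb UNIV (%_::unit. %x. - F x)" by (rule Cb_minus[OF open_UNIV F])
have "\<exists>u. Cb UNIV (%_::unit. u) & (\<forall>x. - laplacian u x + P k x * u x = - F x) & (\<forall>x. \<bar>u x\<bar> <= S x)" for k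
proof -
 obtain u where u: "Cb UNIV (%_::unit. u)" "!!x. - laplacian u x + P k x * u x = - F x"
 "!!S de. Cb UNIV (%_::unit. S) ==> de > 0 ==> (\<forall>x. S x >= 0) ==>
 (\<forall>x. \<bar>- F x\<bar> + de <= - laplacian S x + P k x * S x) ==> (\<forall>x. \<bar>u x\<bar> <= S x)"
 using helmholtz_solve[OF CP P0' CmF rh(1,2) rhP] by blast
 have "\<bar>- F x\<bar> + 1 <= - laplacian S x + P k x * S x" for x
 proof -
 have "(B + 1) * 1 <= (B + 1) * (- laplacian rh x + P k x * rh x)"
 using rhP[of x k] B(1) by (intro mult_left_mono) auto
 also have "... = - laplacian S x + P k x * S x" unfolding lS by (simp add: S_def algebra_simps)
 finally show ?thesis using B(2)[of x] by simp
 qed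
 then have "\<forall>x. \<bar>u x\<bar> <= S x" using u(3)[OF CS, of 1] rh(2) B(1) by (simp add: S_def)
 then show ?thesis using u by blast
qed
then obtain u where u: "!!k. Cb UNIV (%_::unit. u k)" "!!k x. - laplacian (u k) x + P k x * u k x = - F x" "!!k x. \<bar>u k x\<bar> <= S x"
 by metis
obtain M where M: "!!x. \<bar>S x\<bar> <= M" using Cb_bound[OF CS] by auto
interpret penalised_problem fi u F G M
proof
 show "smooth_on UNIV (u k)" for k by (rule Cb_imp_smooth_on[OF open_UNIV u(1)])
 show "\<bar>u k x\<bar> <= M" for k x using u(3)[of k x] M[of x] by linarith
 show "laplacian (u k) x = gradsq fi x * (real k * flat (fi x)) * u k x + F x" if "x \<in> G" for k x
 using u(2)[of k x] W0(5)[OF that] by (simp add: P_def mult_ac)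
qed (use phi bddO grad F W0 in auto)
show ?thesis using limit_solution by simp
qed

lemma compact_support_Cb:
fixes f :: "real^'n::finite => real"
assumes "smooth_on UNIV f" "!!x. R < norm x ==> f x = 0"
shows "Cb UNIV (%_::unit. f)"
proof (rule CbI_pd)
fix I
have "continuous_on (cball 0 R) (pd I f)"
 using smooth_on_imp_continuous_on[OF smooth_on_pd[OF assms(1)]] continuous_on_subset by blast
then have "bounded (pd I f ` cball 0 R)" using compact_continuous_image compact_imp_bounded compact_cball by blast
then obtain C where C: "!!x. x \<in> cball 0 R ==> \<bar>pd I f x\<bar> <= C" unfolding bounded_iff by fastforce
have out: "pd I f x = 0" if "x \<notin> cball 0 R" for x
proof -
 have "pd I (%x::real^'n. 0::real) = (%x. 0)"
 proof (induction I)
 case (Cons i I)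
 then show ?case by (simp only: pd.simps) (simp add: fun_eq_iff)
 qed simp
 moreover have "pd I f x = pd I (%x. 0) x"
 by (rule pd_cong[of "- cball 0 R"]) (use that assms(2) in \<open>auto simp: open_Compl\<close>)
 ultimately show ?thesis by simp
qed
have "\<bar>pd I f x\<bar> <= \<bar>C\<bar>" for x using C[of x] out[of x] by (cases "x \<in> cball 0 R") auto
then show "\<exists>C. \<forall>k::unit. \<forall>x\<in>UNIV. \<bar>pd I f x\<bar> <= C" by blast
qed (rule assms(1))

section \<open>Defining functions of the domain and exterior balls\<close>

definition bump :: "real^'n::finite => real => real^'n => real" where
"bump p r x = flat (r\<^sup>2 - (norm (x - p))\<^sup>2)"

lemma smooth_bump: "smooth_on UNIV (bump p r)"
unfolding bump_def[abs_def]
by (rule smooth_on_smooth1[OF open_UNIV smooth_on_diff[OF open_UNIV smooth_on_const[OF open_UNIV] smooth_on_norm_sq[OF open_UNIV]] smooth1_flat])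

lemma bump_pos: "0 < r ==> bump p r x > 0 \<longleftrightarrow> x \<in> ball p r"
unfolding bump_def flat_pos by (simp add: dist_norm norm_minus_commute) (metis abs_norm_cancel abs_of_pos real_sqrt_abs real_sqrt_less_iff)

lemma bump_nonneg: "bump p r x >= 0" by (simp add: bump_def flat_nonneg)

lemma bump_zero: "0 < r ==> x \<notin> ball p r ==> bump p r x = 0"
using bump_pos[of r p x] bump_nonneg[of p r x] by linarith

lemma bump_deriv_zero:
assumes "0 < r" "x \<notin> ball p r"
shows "partial_deriv i (bump p r) x = 0"
proof -
have le: "r\<^sup>2 - (norm (x - p))\<^sup>2 <= 0" using assms by (simp add: dist_norm norm_minus_commute power_mono)
have d: "(flat has_real_derivative 0) (at (r\<^sup>2 - (norm (x - p))\<^sup>2))"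
 using flat_exp_derivative[of 1 "r\<^sup>2 - (norm (x - p))\<^sup>2"] le unfolding flat_def by (simp add: flat_exp_def)
have "smooth_on UNIV (%x. r\<^sup>2 - (norm (x - p))\<^sup>2)"
 by (intro smooth_on_diff smooth_on_const smooth_on_norm_sq open_UNIV)
from partial_deriv_real_compose(2)[OF d smooth_on_imp_differentiable[OF this UNIV_I]]
show ?thesis by (simp add: bump_def[abs_def])
qed

text \<open>Leaving \<open>p\<close> against the gradient of \<open>fi\<close> makes
  \<open>fi\<close> negative and hence \<open>psi\<close> negative; a negative inner product of the
  gradients would make \<open>psi\<close> increase along this path.\<close>

lemma gradients_aligned:
fixes fi psi :: "real^'n::finite => real"
assumes "open U" "p \<in> U" "smooth_on U fi" "smooth_on U psi" "fi p = 0" "psi p = 0"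
 and sgn: "!!x. x \<in> U ==> fi x < 0 ==> psi x < 0"
shows "0 <= (\<Sum>i\<in>UNIV. partial_deriv i psi p * partial_deriv i fi p)"
proof (rule ccontr)
assume neg: "~ ?thesis"
define v :: "real^'n" where "v = (\<chi> i. - partial_deriv i fi p)"
have der: "((%t. f (p + t *\<^sub>R v)) has_real_derivative (\<Sum>i\<in>UNIV. (v $ i) * partial_deriv i f p)) (at 0)"
 if "smooth_on U f" for f
 using has_real_derivative_partial_deriv[of f p 0 v] smooth_on_imp_differentiable[OF that assms(2)] by simp
have d1: "(\<Sum>i\<in>UNIV. (v $ i) * partial_deriv i fi p) = - gradsq fi p"
 by (simp add: v_def gradsq_def power2_eq_square sum_negf)
have d2: "(\<Sum>i\<in>UNIV. (v $ i) * partial_deriv i psi p) > 0"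
 using neg by (simp add: v_def sum_negf mult.commute)
have "gradsq fi p ~= 0"
proof
 assume "gradsq fi p = 0"
 then have "partial_deriv i fi p = 0" for i unfolding gradsq_def by (subst (asm) sum_nonneg_eq_0_iff) auto
 then show False using neg by simp
qed
then have d1n: "- gradsq fi p < 0" using gradsq_nonneg[of fi p] by linarith
obtain e1 where e1: "e1 > 0" "!!h. 0 < h ==> h < e1 ==> fi (p + h *\<^sub>R v) < fi p"
 using DERIV_neg_dec_right[OF der[OF assms(3), unfolded d1] d1n] by auto
obtain e2 where e2: "e2 > 0" "!!h. 0 < h ==> h < e2 ==> psi (p + h *\<^sub>R v) > psi p"
 using DERIV_pos_inc_right[OF der[OF assms(4)] d2] by auto
have "((%t. p + t *\<^sub>R v) \<longlongrightarrow> p + 0 *\<^sub>R v) (at_right 0)" by (intro tendsto_intros)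
then have "eventually (%t. p + t *\<^sub>R v \<in> U) (at_right 0)" using assms(1,2) by (auto dest: topological_tendstoD)
then obtain e3 where e3: "e3 > 0" "!!t. 0 < t ==> t < e3 ==> p + t *\<^sub>R v \<in> U"
 unfolding eventually_at_right_field by auto
define h where "h = min e1 (min e2 e3) / 2"
have h: "0 < h" "h < e1" "h < e2" "h < e3" using e1 e2 e3 by (auto simp: h_def)
have "psi (p + h *\<^sub>R v) < 0" using sgn[OF e3(2)[OF h(1,4)]] e1(2)[OF h(1,2)] assms(5) by simp
then show False using e2(2)[OF h(1,3)] assms(6) by simp
qed

text \<open>Local defining functions are glued with bumps near the boundary, and bumps supported in
  the domain are subtracted to cover the rest. Gradients cannot cancel at a boundary point: paired
  with the gradient of one local function whose bump is positive there, all summands are nonnegative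
  and one is positive. Far outside, the result vanishes identically; only its negativity set and its
  gradient on the frontier matter.\<close>

lemma global_defining_function:
fixes \<Omega> :: "(real^'n::finite) set"
assumes bdd: "bounded \<Omega>" and op: "open \<Omega>" and sb: "smooth_boundary \<Omega>"
shows "\<exists>fi. Cb UNIV (%_::unit. fi) & \<Omega> = {x. fi x < 0} & (\<forall>p\<in>frontier \<Omega>. gradsq fi p > 0)"
proof -
let ?F = "frontier \<Omega>"
have FO: "?F \<inter> \<Omega> = {}" using op by (auto simp: frontier_def interior_open)
define Q where "Q p U fi \<longleftrightarrow> open U & p \<in> U & smooth_on U fi & (\<forall>x\<in>U. x \<in> \<Omega> \<longleftrightarrow> fi x < 0) &
 (\<forall>x\<in>U. fi x = 0 --> frechet_derivative fi (at x) ~= (%h. 0))" for p U and fi :: "real^'n => real"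
have "\<forall>p\<in>?F. \<exists>U fi. Q p U fi" using sb unfolding smooth_boundary_def Q_def .
from bchoice[OF this] obtain U where "\<forall>p\<in>?F. \<exists>fi. Q p (U p) fi" ..
from bchoice[OF this] obtain f where Q: "!!p. p \<in> ?F ==> Q p (U p) (f p)" by blast
have Uf: "open (U p)" "p \<in> U p" "smooth_on (U p) (f p)" "x \<in> U p ==> x \<in> \<Omega> \<longleftrightarrow> f p x < 0"
 "x \<in> U p ==> f p x = 0 ==> frechet_derivative (f p) (at x) ~= (%h. 0)" if "p \<in> ?F" for p x
 using Q[OF that] unfolding Q_def by simp_all
have "\<exists>r>0. cball p r \<subseteq> U p" if "p \<in> ?F" for p using Uf(1,2)[OF that] open_contains_cball by blast
then obtain r where r: "!!p. p \<in> ?F ==> r p > 0" "!!p. p \<in> ?F ==> cball p (r p) \<subseteq> U p"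
 using bchoice[of ?F "%p r. r > 0 & cball p r \<subseteq> U p"] by blast
define g where "g p x = (if x \<in> U p then bump p (r p) x * f p x else 0)" for p x
have gout: "g p x = 0" if "p \<in> ?F" "x \<notin> ball p (r p)" for p x
 using bump_zero[OF r(1)[OF that(1)] that(2)] by (simp add: g_def)
have gs: "smooth_on UNIV (g p)" if p: "p \<in> ?F" for p
proof (rule smooth_on_local)
 fix x :: "real^'n"
 show "\<exists>V. open V & x \<in> V & smooth_on V (g p)"
 proof (cases "x \<in> U p")
 case True
 have "smooth_on (U p) (%x. bump p (r p) x * f p x)"
 by (intro smooth_on_mult Uf p smooth_on_subset[OF smooth_bump subset_UNIV])
 then have "smooth_on (U p) (g p)" by (rule smooth_on_cong[OF Uf(1)[OF p], rotated]) (simp add: g_def)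
 then show ?thesis using True Uf(1)[OF p] by blast
 next
 case False
 then have x: "x \<in> - cball p (r p)" using r(2)[OF p] by blast
 have o: "open (- cball p (r p))" by (simp add: open_Compl)
 have "smooth_on (- cball p (r p)) (g p)"
 by (rule smooth_on_cong[OF o _ smooth_on_const[OF o, of 0]]) (use gout[OF p] in auto)
 then show ?thesis using x o by blast
 qed
qed
have cF: "compact ?F" using bdd by (simp add: compact_frontier_bounded)
have cov: "?F \<subseteq> (\<Union>p\<in>?F. ball p (r p))" using r(1) by force
obtain T where T: "T \<subseteq> ?F" "finite T" "?F \<subseteq> (\<Union>p\<in>T. ball p (r p))"
 by (rule compactE_image[OF cF _ cov]) auto
define A where "A = closure \<Omega> - (\<Union>p\<in>T. ball p (r p))"
have cA: "compact A" unfolding A_def using bdd by (intro compact_diff) auto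
have AO: "A \<subseteq> \<Omega>" using T(3) op unfolding A_def by (auto simp: frontier_def interior_open)
have "\<exists>s>0. ball q s \<subseteq> \<Omega>" if "q \<in> A" for q using that AO op open_contains_ball by blast
then obtain s where s: "!!q. q \<in> A ==> s q > 0" "!!q. q \<in> A ==> ball q (s q) \<subseteq> \<Omega>"
 using bchoice[of A "%q s. s > 0 & ball q s \<subseteq> \<Omega>"] by blast
have covA: "A \<subseteq> (\<Union>q\<in>A. ball q (s q))" using s(1) by force
obtain T' where T': "T' \<subseteq> A" "finite T'" "A \<subseteq> (\<Union>q\<in>T'. ball q (s q))"
 by (rule compactE_image[OF cA _ covA]) auto
define fi where "fi x = (\<Sum>p\<in>T. g p x) + (-1) * (\<Sum>q\<in>T'. bump q (s q) x)" for x
have TF: "p \<in> ?F" if "p \<in> T" for p using T(1) that by blast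
have TA: "q \<in> A" if "q \<in> T'" for q using T'(1) that by blast
have s1: "smooth_on UNIV (%x. \<Sum>p\<in>T. g p x)" by (rule smooth_on_sum[OF open_UNIV T(2)]) (rule gs[OF TF])
have s2: "smooth_on UNIV (%x. \<Sum>q\<in>T'. bump q (s q) x)" by (rule smooth_on_sum[OF open_UNIV T'(2) smooth_bump])
have s3: "smooth_on UNIV (%x. (-1) * (\<Sum>q\<in>T'. bump q (s q) x))"
 by (rule smooth_on_mult[OF open_UNIV smooth_on_const[OF open_UNIV] s2])
have sphi: "smooth_on UNIV fi" unfolding fi_def[abs_def] by (rule smooth_on_add[OF open_UNIV s1 s3])
have gneg: "g p x <= 0" if "p \<in> T" "x \<in> \<Omega>" for p x
 using Uf(4)[OF TF[OF that(1)]] that(2) bump_nonneg[of p "r p" x] by (auto simp: g_def mult_nonneg_nonpos)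
have gpos: "g p x >= 0" if "p \<in> T" "x \<notin> \<Omega>" for p x
 using Uf(4)[OF TF[OF that(1)], of x] that(2) bump_nonneg[of p "r p" x] by (auto simp: g_def not_less)
have inside: "fi x < 0" if x: "x \<in> \<Omega>" for x
proof (cases "\<exists>p\<in>T. x \<in> ball p (r p)")
 case True
 then obtain p where p: "p \<in> T" "x \<in> ball p (r p)" by blast
 have xU: "x \<in> U p" using r(2)[OF TF[OF p(1)]] p(2) by (meson ball_subset_cball subsetD)
 have "g p x < 0" using Uf(4)[OF TF[OF p(1)] xU] x bump_pos[OF r(1)[OF TF[OF p(1)]], of p x] p(2) xU
 by (simp add: g_def mult_pos_neg)
 then have "(\<Sum>p\<in>T. g p x) < 0" using sum_strict_mono_ex1[OF T(2), of "%p. g p x" "%_. 0"] gneg[OF _ x] p(1) by auto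
 moreover have "(\<Sum>q\<in>T'. bump q (s q) x) >= 0" by (simp add: sum_nonneg bump_nonneg)
 ultimately show ?thesis by (simp add: fi_def)
next
 case False
 then have "x \<in> A" using x closure_subset[of \<Omega>] by (auto simp: A_def)
 then obtain q where q: "q \<in> T'" "x \<in> ball q (s q)" using T'(3) by blast
 have "bump q (s q) x > 0" using bump_pos[OF s(1)[OF TA[OF q(1)]]] q(2) by blast
 then have "(\<Sum>q\<in>T'. bump q (s q) x) > 0" by (intro sum_pos2[OF T'(2) q(1)]) (auto simp: bump_nonneg)
 moreover have "(\<Sum>p\<in>T. g p x) <= 0" using gneg[OF _ x] by (simp add: sum_nonpos)
 ultimately show ?thesis by (simp add: fi_def)
qed
have bz: "x \<notin> ball q (s q)" if "q \<in> T'" "x \<notin> \<Omega>" for q x using s(2)[OF TA[OF that(1)]] that(2) by blast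
have bq: "bump q (s q) x = 0" "partial_deriv i (bump q (s q)) x = 0" if "q \<in> T'" "x \<notin> \<Omega>" for q x i
 using bump_zero[OF s(1)[OF TA[OF that(1)]] bz[OF that]] bump_deriv_zero[OF s(1)[OF TA[OF that(1)]] bz[OF that]] by simp_all
have outside: "fi x >= 0" if x: "x \<notin> \<Omega>" for x
proof -
 have "(\<Sum>q\<in>T'. bump q (s q) x) = 0" using bq(1)[OF _ x] by simp
 moreover have "(\<Sum>p\<in>T. g p x) >= 0" using gpos[OF _ x] by (simp add: sum_nonneg)
 ultimately show ?thesis by (simp add: fi_def)
qed
have eqO: "\<Omega> = {x. fi x < 0}" using inside outside by force
have fz: "f p x = 0" if pF: "p \<in> ?F" "x \<in> ?F" and xUp: "x \<in> U p" for p x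
proof (rule antisym)
 show "0 <= f p x" using Uf(4)[OF that(1,3)] FO that(2) by (auto simp: not_less)
 show "f p x <= 0"
 proof (rule ccontr)
 assume h: "~ f p x <= 0"
 have c: "continuous_on (U p) (f p)" by (rule smooth_on_imp_continuous_on[OF Uf(3)[OF that(1)]])
 have o: "open (U p \<inter> f p -` {0<..})" by (rule continuous_open_preimage[OF c Uf(1)[OF that(1)]]) simp
 have "x \<in> closure \<Omega>" using that(2) by (simp add: frontier_def)
 then obtain y where "y \<in> \<Omega>" "y \<in> U p \<inter> f p -` {0<..}"
 using open_Int_closure_eq_empty[OF o, of \<Omega>] h xUp by auto
 then show False using Uf(4)[OF that(1)] by force
 qed
qed
have grad: "gradsq fi x > 0" if x: "x \<in> ?F" for x
proof -
 have xO: "x \<notin> \<Omega>" using FO x by blast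
 define G where "G p i = (if x \<in> U p then partial_deriv i (f p) x else 0)" for p i
 have pg: "partial_deriv i (g p) x = bump p (r p) x * G p i" if p: "p \<in> T" for p i
 proof (cases "x \<in> U p")
 case True
 have "partial_deriv i (g p) x = partial_deriv i (%x. bump p (r p) x * f p x) x"
 by (rule partial_deriv_cong[OF Uf(1)[OF TF[OF p]] True]) (simp add: g_def)
 also have "... = bump p (r p) x * partial_deriv i (f p) x"
 using partial_deriv_mult[OF smooth_on_imp_differentiable[OF smooth_bump UNIV_I] smooth_on_imp_differentiable[OF Uf(3)[OF TF[OF p]] True]]
 fz[OF TF[OF p] x True] by simp
 finally show ?thesis using True by (simp add: G_def)
 next
 case False
 then have xc: "x \<in> - cball p (r p)" using r(2)[OF TF[OF p]] by blast
 have "partial_deriv i (g p) x = partial_deriv i (%x. 0) x"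
 by (rule partial_deriv_cong[OF _ xc]) (use gout[OF TF[OF p]] in \<open>auto simp: open_Compl\<close>)
 then show ?thesis using False by (simp add: G_def)
 qed
 have dphi: "partial_deriv i fi x = (\<Sum>p\<in>T. bump p (r p) x * G p i)" for i
 proof -
 have "partial_deriv i (%x. \<Sum>q\<in>T'. bump q (s q) x) x = (\<Sum>q\<in>T'. partial_deriv i (bump q (s q)) x)"
 by (rule partial_deriv_sum[OF T'(2)]) (rule smooth_on_imp_differentiable[OF smooth_bump UNIV_I])
 also have "... = 0" using bq(2)[OF _ xO] by simp
 finally have b0: "partial_deriv i (%x. \<Sum>q\<in>T'. bump q (s q) x) x = 0" .
 have "partial_deriv i (%x. \<Sum>p\<in>T. g p x) x = (\<Sum>p\<in>T. partial_deriv i (g p) x)"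
 by (rule partial_deriv_sum[OF T(2)]) (rule smooth_on_imp_differentiable[OF gs[OF TF] UNIV_I])
 then have g0: "partial_deriv i (%x. \<Sum>p\<in>T. g p x) x = (\<Sum>p\<in>T. bump p (r p) x * G p i)" using pg by simp
 show ?thesis unfolding fi_def[abs_def]
 using partial_deriv_add[OF smooth_on_imp_differentiable[OF s1 UNIV_I] smooth_on_imp_differentiable[OF s3 UNIV_I], of i x]
 partial_deriv_mult[OF differentiable_const smooth_on_imp_differentiable[OF s2 UNIV_I], of i "-1" x] b0 g0 by simp
 qed
 obtain p1 where p1: "p1 \<in> T" "x \<in> ball p1 (r p1)" using T(3) x by blast
 have xU1: "x \<in> U p1" using r(2)[OF TF[OF p1(1)]] p1(2) by (meson ball_subset_cball subsetD)
 have b1: "bump p1 (r p1) x > 0" using bump_pos[OF r(1)[OF TF[OF p1(1)]]] p1(2) by blast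
 let ?a = "%i. partial_deriv i (f p1) x"
 have apos: "(\<Sum>i\<in>UNIV. G p1 i * ?a i) > 0"
 proof -
 have d: "f p1 differentiable (at x)" by (rule smooth_on_imp_differentiable[OF Uf(3)[OF TF[OF p1(1)]] xU1])
 have "\<exists>i. ?a i ~= 0"
 proof (rule ccontr)
 assume "~ ?thesis"
 then have "(f p1 has_derivative (%h. 0)) (at x)" using has_derivative_partial_deriv[OF d] by simp
 then have "frechet_derivative (f p1) (at x) = (%h. 0)" by (metis frechet_derivative_at)
 then show False using Uf(5)[OF TF[OF p1(1)] xU1 fz[OF TF[OF p1(1)] x xU1]] by blast
 qed
 then obtain i where i: "?a i ~= 0" by blast
 have "(\<Sum>i\<in>UNIV. ?a i * ?a i) > 0" by (rule sum_pos2[of _ i]) (use i in \<open>auto simp: zero_less_mult_iff linorder_neq_iff\<close>)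
 then show ?thesis using xU1 by (simp add: G_def)
 qed
 have al: "0 <= (\<Sum>i\<in>UNIV. G p i * ?a i)" if p: "p \<in> T" for p
 proof (cases "x \<in> U p")
 case True
 let ?V = "U p \<inter> U p1"
 have "0 <= (\<Sum>i\<in>UNIV. partial_deriv i (f p) x * ?a i)"
 proof (rule gradients_aligned[of ?V])
 show "open ?V" by (rule open_Int[OF Uf(1)[OF TF[OF p]] Uf(1)[OF TF[OF p1(1)]]])
 show "smooth_on ?V (f p1)" "smooth_on ?V (f p)"
 by (rule smooth_on_subset[OF Uf(3)[OF TF[OF p1(1)]]], simp, rule smooth_on_subset[OF Uf(3)[OF TF[OF p]]], simp)
 show "f p1 x = 0" "f p x = 0" by (rule fz[OF TF[OF p1(1)] x xU1], rule fz[OF TF[OF p] x True])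
 show "f p y < 0" if "y \<in> ?V" "f p1 y < 0" for y using Uf(4)[OF TF[OF p1(1)], of y] Uf(4)[OF TF[OF p], of y] that by simp
 qed (use True xU1 in blast)
 then show ?thesis using True by (simp add: G_def)
 qed (simp add: G_def)
 have "(\<Sum>i\<in>UNIV. partial_deriv i fi x * ?a i) = (\<Sum>p\<in>T. bump p (r p) x * (\<Sum>i\<in>UNIV. G p i * ?a i))"
 unfolding dphi sum_distrib_right sum_distrib_left by (subst sum.swap) (simp add: mult.assoc)
 also have "... > 0"
 by (rule sum_pos2[OF T(2) p1(1)], rule mult_pos_pos[OF b1 apos], rule mult_nonneg_nonneg[OF bump_nonneg al])
 finally have pos: "(\<Sum>i\<in>UNIV. partial_deriv i fi x * ?a i) > 0" .
 show ?thesis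
 proof (rule ccontr)
 assume "~ ?thesis"
 then have "gradsq fi x = 0" using gradsq_nonneg[of fi x] by linarith
 then have "partial_deriv i fi x = 0" for i unfolding gradsq_def by (subst (asm) sum_nonneg_eq_0_iff) auto
 then show False using pos by simp
 qed
qed
obtain R where R: "R > 0" "!!x. x \<in> closure \<Omega> \<union> (\<Union>p\<in>T. cball p (r p)) ==> norm x <= R"
 using bounded_pos[of "closure \<Omega> \<union> (\<Union>p\<in>T. cball p (r p))"] bdd T(2) by (auto simp: bounded_UN)
have "Cb UNIV (%_::unit. fi)"
proof (rule compact_support_Cb[OF sphi])
 fix x :: "real^'n" assume x: "R < norm x"
 then have n: "x \<notin> \<Omega>" "!!p. p \<in> T ==> x \<notin> ball p (r p)" using R(2)[of x] closure_subset[of \<Omega>] by force+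
 have "(\<Sum>p\<in>T. g p x) = 0" using gout[OF TF n(2)] by simp
 moreover have "(\<Sum>q\<in>T'. bump q (s q) x) = 0" using bq(1)[OF _ n(1)] by simp
 ultimately show "fi x = 0" by (simp add: fi_def)
qed
then show ?thesis using eqO grad by blast
qed

lemma dirichlet_problem:
fixes \<Omega> :: "(real^'n::finite) set" and F :: "real^'n => real"
assumes "bounded \<Omega>" "open \<Omega>" "smooth_boundary \<Omega>" "Cb UNIV (%_::unit. F)"
shows "\<exists>w. smooth_up_to_boundary \<Omega> w & (\<forall>x\<in>\<Omega>. laplacian w x = F x) & (\<forall>x\<in>frontier \<Omega>. w x = 0)"
proof -
obtain fi where p: "Cb UNIV (%_::unit. fi)" "\<Omega> = {x. fi x < 0}" "!!p. p \<in> frontier \<Omega> ==> gradsq fi p > 0"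
 using global_defining_function[OF assms(1-3)] by blast
show ?thesis
 using dirichlet_defining_function[OF p(1) assms(1)[unfolded p(2)] p(3)[unfolded p(2)] assms(4)]
 unfolding smooth_up_to_boundary_def p(2) by blast
qed

text \<open>With g the gradient of a defining function at \<open>p\<close>, any other point of the
  closed ball of radius l |g| about p + l g would have a positive value: l = 1/(4 C) lets the linear
  Taylor term exceed the quadratic error.\<close>

lemma exterior_ball:
fixes \<Omega> :: "(real^'n::finite) set"
assumes "bounded \<Omega>" "open \<Omega>" "smooth_boundary \<Omega>" and p: "p \<in> frontier \<Omega>"
shows "\<exists>c s. s > 0 & dist p c = s & (\<forall>x\<in>closure \<Omega>. x ~= p --> s < dist x c)"
proof -
obtain fi where phi: "Cb UNIV (%_::unit. fi)" "\<Omega> = {x. fi x < 0}" "!!p. p \<in> frontier \<Omega> ==> gradsq fi p > 0"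
 using global_defining_function[OF assms(1-3)] by blast
have cfi: "continuous_on UNIV fi" by (rule smooth_on_imp_continuous_on[OF Cb_imp_smooth_on[OF open_UNIV phi(1)]])
have "closed {x. fi x <= 0}" using cfi by (intro closed_Collect_le continuous_on_const)
moreover have "\<Omega> \<subseteq> {x. fi x <= 0}" unfolding phi(2) by auto
ultimately have cl: "fi x <= 0" if "x \<in> closure \<Omega>" for x using closure_minimal[of \<Omega> "{x. fi x <= 0}"] that by blast
have p0: "fi p = 0" using cl[of p] p assms(2) phi(2) by (force simp: frontier_def interior_open)
obtain C where C: "C > 0" "!!x y. \<bar>fi y - fi x - (\<Sum>i\<in>UNIV. (y - x) $ i * partial_deriv i fi x)\<bar> <= C * (norm (y - x))\<^sup>2"
 using Cb_taylor[OF phi(1)] by (metis subset_UNIV)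
define g :: "real^'n" where "g = (\<chi> i. partial_deriv i fi p)"
have ng: "(norm g)\<^sup>2 = gradsq fi p" unfolding g_def power2_norm_eq_inner inner_vec_def gradsq_def by (simp add: power2_eq_square)
then have gp: "norm g > 0" using phi(3)[OF p] by (metis less_irrefl zero_less_norm_iff norm_zero zero_power2)
define l where "l = 1 / (4 * C)"
define c where "c = p + l *\<^sub>R g"
have l: "l > 0" using C by (simp add: l_def)
have d: "dist p c = l * norm g" using l by (simp add: c_def dist_norm)
have "l * norm g < dist x c" if x: "x \<in> closure \<Omega>" "x ~= p" for x
proof (rule ccontr)
 assume "~ ?thesis"
 then have "(norm (x - c))\<^sup>2 <= (l * norm g)\<^sup>2" by (intro power_mono) (auto simp: dist_norm)
 moreover have "(norm (x - c))\<^sup>2 = (norm (x - p))\<^sup>2 - 2 * l * ((x - p) \<bullet> g) + (l * norm g)\<^sup>2"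
 unfolding c_def power_mult_distrib power2_norm_eq_inner
 by (simp add: inner_diff_left inner_diff_right inner_add_left inner_add_right inner_commute power2_eq_square algebra_simps)
 ultimately have "(norm (x - p))\<^sup>2 <= 2 * l * ((x - p) \<bullet> g)" by linarith
 then have k: "2 * C * (norm (x - p))\<^sup>2 <= (x - p) \<bullet> g" using C(1) by (simp add: l_def field_simps)
 have "(\<Sum>i\<in>UNIV. (x - p) $ i * partial_deriv i fi p) = (x - p) \<bullet> g" by (simp add: g_def inner_vec_def)
 then have "fi x >= (x - p) \<bullet> g - C * (norm (x - p))\<^sup>2" using C(2)[of x p] p0 by linarith
 then have "C * (norm (x - p))\<^sup>2 <= 0" using k cl[OF x(1)] by linarith
 then show False using C(1) x(2) by (simp add: mult_le_0_iff)
qed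
then show ?thesis using d l gp by (intro exI[of _ c] exI[of _ "l * norm g"]) auto
qed

section \<open>Harmonic functions vanishing on part of the boundary\<close>

lemma laplacian_bounded_linear:
assumes "bounded_linear h" "open U" "x \<in> U" "smooth_on U f"
shows "laplacian (%x. h (f x)) x = h (laplacian f x)"
proof -
note d = smooth_on_imp_differentiable
have "partial_deriv i (partial_deriv i (%x. h (f x))) x = h (partial_deriv i (partial_deriv i f) x)" for i
proof -
 have "partial_deriv i (partial_deriv i (%x. h (f x))) x = partial_deriv i (%x. h (partial_deriv i f x)) x"
 by (rule partial_deriv_cong[OF assms(2,3)]) (rule partial_deriv_bounded_linear[OF assms(1) d[OF assms(4)]])
 also have "... = h (partial_deriv i (partial_deriv i f) x)"
 by (rule partial_deriv_bounded_linear[OF assms(1) d[OF smooth_on_partial_deriv[OF assms(4)] assms(3)]])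
 finally show ?thesis .
qed
then show ?thesis unfolding laplacian_def by (simp add: linear_sum bounded_linear.linear[OF assms(1)])
qed

text \<open>\<open>g\<close> is cut off so as to vanish on the boundary outside \<open>V\<close>,
  and made harmonic by a Dirichlet solution. Then \<open>u - g\<close> is harmonic with boundary
  values \<open>(cut - 1) * g\<close>, which vanish near \<open>x0\<close> and have norm at most
  \<open>B\<close> elsewhere, so the maximum principle applies. The factor 2 comes from treating
  real and imaginary parts separately.\<close>

lemma harmonic_correction:
fixes \<Omega> V :: "(real^'n::finite) set" and g :: "real^'n => complex"
assumes O: "bounded \<Omega>" "open \<Omega>" "smooth_boundary \<Omega>"
 and U: "open U" "closure \<Omega> \<subseteq> U" "smooth_on U g" "!!x. x \<in> \<Omega> ==> laplacian g x = 0"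
 and rh: "0 < rh" "cball x0 rh \<subseteq> U" "ball x0 rh \<inter> frontier \<Omega> \<subseteq> V"
 and B: "0 <= B" "!!x. x \<in> frontier \<Omega> ==> rh / 2 <= dist x0 x ==> norm (g x) <= B"
shows "\<exists>u. smooth_up_to_boundary \<Omega> u & harmonic_on \<Omega> u & (\<forall>x\<in>frontier \<Omega> - V. u x = 0) &
 (\<forall>x\<in>\<Omega>. norm (u x - g x) <= 2 * B)"
proof -
\<comment> \<open>The argument of \<open>step\<close> is at least 1 up to distance rh/2 and negative
  beyond 3 rh/4, which leaves room inside \<open>cball x0 rh\<close> for extending the product with
  \<open>g\<close> by 0.\<close>
define cut where "cut x = step (2 - 4 / rh\<^sup>2 * (norm (x - x0))\<^sup>2)" for x :: "real^'n"
have cut1: "cut x = 1" if "dist x0 x < rh / 2" for x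
proof -
 have "(norm (x - x0))\<^sup>2 <= (rh / 2)\<^sup>2" using that by (intro power_mono) (auto simp: dist_norm norm_minus_commute)
 then have "4 / rh\<^sup>2 * (norm (x - x0))\<^sup>2 <= 1" using rh(1) by (simp add: field_simps power2_eq_square)
 then show ?thesis unfolding cut_def by (intro step_one) linarith
qed
have cut0: "cut x = 0" if "3 * rh / 4 < dist x0 x" for x
proof -
 have "(3 * rh / 4)\<^sup>2 <= (norm (x - x0))\<^sup>2" using that rh(1) by (intro power_mono) (auto simp: dist_norm norm_minus_commute)
 then have "4 / rh\<^sup>2 * (norm (x - x0))\<^sup>2 >= 4 / rh\<^sup>2 * (3 * rh / 4)\<^sup>2" using rh(1) by (intro mult_left_mono) auto
 moreover have "4 / rh\<^sup>2 * (3 * rh / 4)\<^sup>2 = 9 / 4" using rh(1) by (simp add: power2_eq_square)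
 ultimately show ?thesis unfolding cut_def by (intro step_zero) linarith
qed
have cutb: "0 <= cut x" "cut x <= 1" for x by (simp_all add: cut_def step_nonneg step_le_1)
have scut: "smooth_on UNIV cut"
 unfolding cut_def[abs_def]
 by (rule smooth_on_smooth1[OF open_UNIV smooth_on_diff[OF open_UNIV smooth_on_const[OF open_UNIV] smooth_on_mult[OF open_UNIV smooth_on_const[OF open_UNIV] smooth_on_norm_sq[OF open_UNIV]]] smooth1_step])
define H where "H x = (if x \<in> U then of_real (cut x) * g x else 0)" for x
have Hout: "H x = 0" if "3 * rh / 4 < dist x0 x" for x using cut0[OF that] by (simp add: H_def)
have sH: "smooth_on UNIV H"
proof (rule smooth_on_local)
 fix x :: "real^'n"
 show "\<exists>V. open V & x \<in> V & smooth_on V H"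
 proof (cases "x \<in> U")
 case True
 have "smooth_on U (%x. of_real (cut x) * g x)"
 by (intro smooth_on_mult U smooth_on_bounded_linear[OF U(1) bounded_linear_of_real] smooth_on_subset[OF scut subset_UNIV])
 then have "smooth_on U H" by (rule smooth_on_cong[OF U(1), rotated]) (simp add: H_def)
 then show ?thesis using True U(1) by blast
 next
 case False
 let ?W = "- cball x0 (3 * rh / 4)"
 have x: "x \<in> ?W" using False rh by (auto simp: subset_iff)
 have o: "open ?W" by (simp add: open_Compl)
 have "smooth_on ?W H" by (rule smooth_on_cong[OF o _ smooth_on_const[OF o, of 0]]) (use Hout in auto)
 then show ?thesis using x o by blast
 qed
qed
have out: "norm x0 + rh < norm x ==> H x = 0" for x
proof (rule Hout)
 assume "norm x0 + rh < norm x"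
 then have "rh < dist x0 x" using norm_triangle_ineq2[of x x0] by (simp add: dist_norm norm_minus_commute)
 then show "3 * rh / 4 < dist x0 x" using rh(1) by linarith
qed
have part: "\<exists>w. smooth_up_to_boundary \<Omega> w & (\<forall>x\<in>\<Omega>. laplacian w x = - h (laplacian H x)) & (\<forall>x\<in>frontier \<Omega>. w x = 0)"
 if h: "bounded_linear h" for h :: "complex => real"
proof -
 have h0: "h 0 = 0" using h by (simp add: bounded_linear.linear linear_0)
 have "Cb UNIV (%_::unit. %x. h (H x))"
 by (rule compact_support_Cb[OF smooth_on_bounded_linear[OF open_UNIV h sH], of "norm x0 + rh"]) (simp add: out h0)
 then have "Cb UNIV (%_::unit. %x. - laplacian (%x. h (H x)) x)"
 unfolding laplacian_def by (intro Cb_minus Cb_sum Cb_partial_deriv open_UNIV finite)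
 from dirichlet_problem[OF O this] show ?thesis
 using laplacian_bounded_linear[OF h open_UNIV UNIV_I sH] by simp
qed
obtain w1 where w1: "smooth_up_to_boundary \<Omega> w1" "!!x. x \<in> \<Omega> ==> laplacian w1 x = - Re (laplacian H x)" "!!x. x \<in> frontier \<Omega> ==> w1 x = 0"
 using part[OF bounded_linear_Re] by blast
obtain w2 where w2: "smooth_up_to_boundary \<Omega> w2" "!!x. x \<in> \<Omega> ==> laplacian w2 x = - Im (laplacian H x)" "!!x. x \<in> frontier \<Omega> ==> w2 x = 0"
 using part[OF bounded_linear_Im] by blast
obtain W1 W2 where W: "open W1" "closure \<Omega> \<subseteq> W1" "smooth_on W1 w1" "open W2" "closure \<Omega> \<subseteq> W2" "smooth_on W2 w2"
 using w1(1) w2(1) unfolding smooth_up_to_boundary_def by blast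
define W where "W = W1 \<inter> W2"
have W': "open W" "closure \<Omega> \<subseteq> W" using W by (auto simp: W_def)
define u where "u x = H x + (of_real (w1 x) + \<i> * of_real (w2 x))" for x
have sw: "smooth_on W w1" "smooth_on W w2" using smooth_on_subset[OF W(3)] smooth_on_subset[OF W(6)] by (auto simp: W_def)
have sw1: "smooth_on W (%x. complex_of_real (w1 x))" by (rule smooth_on_bounded_linear[OF W'(1) bounded_linear_of_real sw(1)])
have sw2: "smooth_on W (%x. complex_of_real (w2 x))" by (rule smooth_on_bounded_linear[OF W'(1) bounded_linear_of_real sw(2)])
have sw3: "smooth_on W (%x. \<i> * complex_of_real (w2 x))" by (rule smooth_on_mult[OF W'(1) smooth_on_const[OF W'(1)] sw2])
have sHW: "smooth_on W H" by (rule smooth_on_subset[OF sH subset_UNIV])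
have su: "smooth_on W u" unfolding u_def[abs_def] by (intro smooth_on_add W' sHW sw1 sw3)
have OW: "\<Omega> \<subseteq> W" using W'(2) closure_subset by blast
have OU: "\<Omega> \<subseteq> U" using U(2) closure_subset by blast
have lap: "laplacian u x = 0" if x: "x \<in> \<Omega>" for x
proof -
 have xW: "x \<in> W" using x OW by blast
 have l1: "laplacian (%x. complex_of_real (w1 x)) x = of_real (laplacian w1 x)"
 by (rule laplacian_bounded_linear[OF bounded_linear_of_real W'(1) xW sw(1)])
 have l2: "laplacian (%x. complex_of_real (w2 x)) x = of_real (laplacian w2 x)"
 by (rule laplacian_bounded_linear[OF bounded_linear_of_real W'(1) xW sw(2)])
 have "laplacian u x = laplacian H x + (of_real (laplacian w1 x) + \<i> * of_real (laplacian w2 x))"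
 unfolding u_def[abs_def]
 using laplacian_add[OF W'(1) xW sHW smooth_on_add[OF W'(1) sw1 sw3]] laplacian_add[OF W'(1) xW sw1 sw3]
 laplacian_cmult[OF W'(1) xW sw2, of \<i>] l1 l2 by simp
 also have "... = 0" unfolding w1(2)[OF x] w2(2)[OF x] by (simp add: complex_eq_iff)
 finally show ?thesis .
qed
have fr: "u x = of_real (cut x) * g x" if "x \<in> frontier \<Omega>" for x
 using w1(3)[OF that] w2(3)[OF that] that U(2) by (auto simp: u_def H_def frontier_def)
have "u x = 0" if "x \<in> frontier \<Omega> - V" for x
proof -
 have "x \<notin> ball x0 rh" using that rh(3) by blast
 then have "cut x = 0" using rh(1) by (intro cut0) auto
 then show ?thesis using fr that by simp
qed
moreover have "norm (u x - g x) <= 2 * B" if x: "x \<in> \<Omega>" for x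
proof -
 let ?S = "W \<inter> U"
 have oS: "open ?S" and cS: "closure \<Omega> \<subseteq> ?S" and OS: "\<Omega> \<subseteq> ?S" using W' U OW OU by auto
 have sd: "smooth_on ?S (%x. u x - g x)"
 by (rule smooth_on_diff[OF oS smooth_on_subset[OF su] smooth_on_subset[OF U(3)]]) auto
 have ld: "laplacian (%x. u x - g x) y = 0" if y: "y \<in> \<Omega>" for y
 proof -
 have yS: "y \<in> ?S" using y OS by blast
 have su': "smooth_on ?S u" and sg: "smooth_on ?S g"
 by (rule smooth_on_subset[OF su], simp, rule smooth_on_subset[OF U(3)], simp)
 have sm: "smooth_on ?S (%x. (-1) * g x)" by (rule smooth_on_mult[OF oS smooth_on_const[OF oS] sg])
 show ?thesis
 using laplacian_add[OF oS yS su' sm] laplacian_cmult[OF oS yS sg, of "-1"] lap[OF y] U(4)[OF y] by simp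
 qed
 have mp: "h (u x - g x) <= B" if h: "bounded_linear h" "!!z. h z <= norm z" for h :: "complex => real"
 proof (rule maximum_principle[OF O(1,2), where w="%x. h (u x - g x)"])
 have s: "smooth_on ?S (%x. h (u x - g x))" by (rule smooth_on_bounded_linear[OF oS h(1) sd])
 show "continuous_on (closure \<Omega>) (%x. h (u x - g x))" by (rule continuous_on_subset[OF smooth_on_imp_continuous_on[OF s] cS])
 show "smooth_on \<Omega> (%x. h (u x - g x))" by (rule smooth_on_subset[OF s OS])
 show "laplacian (%x. h (u x - g x)) y = 0" if "y \<in> \<Omega>" for y
 using laplacian_bounded_linear[OF h(1) oS _ sd, of y] ld[OF that] that OS h(1) by (auto simp: bounded_linear.linear linear_0)
 show "h (u y - g y) <= B" if y: "y \<in> frontier \<Omega>" for y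
 proof (cases "dist x0 y < rh / 2")
 case True
 then show ?thesis using fr[OF y] cut1[OF True] B(1) h(1) by (simp add: bounded_linear.linear linear_0)
 next
 case False
 have "u y - g y = of_real (cut y - 1) * g y" unfolding fr[OF y] by (simp add: algebra_simps)
 then have "norm (u y - g y) = \<bar>cut y - 1\<bar> * norm (g y)" by (simp only: norm_mult norm_of_real)
 also have "... <= 1 * B" using cutb[of y] B(2)[OF y] False by (intro mult_mono) auto
 finally show ?thesis using h(2)[of "u y - g y"] by linarith
 qed
 show "x \<in> \<Omega>" by (rule x)
 qed
 have "Re (u x - g x) <= B" by (rule mp[OF bounded_linear_Re complex_Re_le_cmod])
 moreover have "- Re (u x - g x) <= B"
 by (rule mp[OF bounded_linear_minus[OF bounded_linear_Re]]) (metis abs_Re_le_cmod abs_le_D2)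
 moreover have "Im (u x - g x) <= B" by (rule mp[OF bounded_linear_Im]) (metis abs_Im_le_cmod abs_le_D1)
 moreover have "- Im (u x - g x) <= B"
 by (rule mp[OF bounded_linear_minus[OF bounded_linear_Im]]) (metis abs_Im_le_cmod abs_le_D2)
 ultimately have "\<bar>Re (u x - g x)\<bar> + \<bar>Im (u x - g x)\<bar> <= 2 * B" by linarith
 then show ?thesis using cmod_le[of "u x - g x"] by linarith
qed
moreover have "smooth_up_to_boundary \<Omega> u" unfolding smooth_up_to_boundary_def using W' su by blast
moreover have "harmonic_on \<Omega> u" unfolding harmonic_on_def using smooth_on_subset[OF su OW] lap by blast
ultimately show ?thesis by blast
qed

section \<open>Kelvin transforms of exponentials\<close>

text \<open>Bilinear, without conjugation, so that it is holomorphic in \<open>z\<close>.\<close>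

definition cdot :: "complex^'n::finite => real^'n => complex" where
"cdot z y = (\<Sum>i\<in>UNIV. z $ i * of_real (y $ i))"

text \<open>Inversion in the sphere about \<open>c\<close> through \<open>x0\<close>, followed by
  the translation that takes \<open>x0\<close> to 0.\<close>

definition inversion :: "real^'n::finite => real^'n => real^'n => real^'n" where
"inversion c x0 x = ((norm (x0 - c))\<^sup>2 / (norm (x - c))\<^sup>2) *\<^sub>R (x - c) - (x0 - c)"

text \<open>The Kelvin factor |x - c|^(2 - n) is written as a power of the squared norm, whose
  derivatives are polynomial.\<close>

definition kelvin_exp :: "real^'n::finite => real^'n => complex^'n => real^'n => complex" where
"kelvin_exp c x0 z x = of_real ((norm (x - c))\<^sup>2 powr ((2 - real CARD('n)) / 2)) * exp (cdot z (inversion c x0 x))"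

context
fixes c :: "real^'n::finite"
begin

abbreviation "r2 x \<equiv> (norm (x - c))\<^sup>2"

lemma r2_pos: "x \<in> - {c} ==> r2 x > 0" by simp

lemma powr_deriv:
assumes "x \<in> - {c}"
shows "(%x. r2 x powr b) differentiable (at x)"
 "partial_deriv i (%x. r2 x powr b) x = (2 * b) * ((x $ i - c $ i) * r2 x powr (b - 1))"
proof -
have d: "((%t. t powr b) has_real_derivative b * r2 x powr (b - 1)) (at (r2 x))"
 using has_real_derivative_powr[OF r2_pos[OF assms], of b] .
have s: "r2 differentiable (at x)" using smooth_on_imp_differentiable[OF smooth_on_norm_sq[OF open_UNIV]] by blast
show "(%x. r2 x powr b) differentiable (at x)" by (rule partial_deriv_real_compose(1)[OF d s])
show "partial_deriv i (%x. r2 x powr b) x = (2 * b) * ((x $ i - c $ i) * r2 x powr (b - 1))"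
 using partial_deriv_real_compose(2)[OF d s, of i] norm_sq_derivatives(1)[of i c x] by simp
qed

lemma smooth_powr: "smooth_on (- {c}) (%x. r2 x powr b)"
proof -
have op: "open (- {c})" by auto
have "C_k_on k (- {c}) (%x. r2 x powr b)" for k b
proof (induction k arbitrary: b)
 case 0
 show ?case by (auto intro!: continuous_intros)
next
 case (Suc k)
 have "C_k_on k (- {c}) (%x. (2 * b) * ((x $ i - c $ i) * r2 x powr (b - 1)))" for i
 proof -
 have "C_k_on k (- {c}) (%x. x $ i - c $ i)"
 using smooth_on_diff[OF op smooth_on_component[OF op] smooth_on_const[OF op]] by (auto simp: smooth_on_def)
 then show ?thesis by (intro C_k_on_mult C_k_on_const op Suc)
 qed
 then show ?case by (intro C_k_on_SucI[OF op powr_deriv]) auto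
qed
then show ?thesis by (simp add: smooth_on_def)
qed

text \<open>Needed for two exponents: b = (2 - n)/2, the Kelvin factor, where the result is 0, and b
  = -1, which comes from the inversion.\<close>

lemma laplacian_powr:
assumes "x \<in> - {c}"
shows "laplacian (%x. r2 x powr b) x = 2 * b * (real CARD('n) + 2 * b - 2) * r2 x powr (b - 1)"
proof -
have op: "open (- {c})" by auto
have sc: "smooth_on (- {c}) (%x. x $ i - c $ i)" for i by (rule smooth_on_diff[OF op smooth_on_component[OF op] smooth_on_const[OF op]])
have pc: "partial_deriv i (%x. x $ i - c $ i) x = 1" for i
 using partial_deriv_add[of "%x. x $ i" x "%x. - c $ i" i] by simp
have sm: "smooth_on (- {c}) (%x. (x $ i - c $ i) * r2 x powr (b - 1))" for i by (rule smooth_on_mult[OF op sc smooth_powr])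
note d = smooth_on_imp_differentiable[OF _ assms]
have p2: "partial_deriv i (partial_deriv i (%x. r2 x powr b)) x
 = (2 * b) * (r2 x powr (b - 1) + (x $ i - c $ i) * ((2 * (b - 1)) * ((x $ i - c $ i) * r2 x powr (b - 1 - 1))))" for i
proof -
 have "partial_deriv i (partial_deriv i (%x. r2 x powr b)) x = partial_deriv i (%x. (2 * b) * ((x $ i - c $ i) * r2 x powr (b - 1))) x"
 by (rule partial_deriv_cong[OF op assms]) (rule powr_deriv(2))
 also have "... = (2 * b) * partial_deriv i (%x. (x $ i - c $ i) * r2 x powr (b - 1)) x"
 using partial_deriv_mult[OF differentiable_const d[OF sm], of i "2 * b" i] by simp
 also have "partial_deriv i (%x. (x $ i - c $ i) * r2 x powr (b - 1)) x
 = r2 x powr (b - 1) + (x $ i - c $ i) * ((2 * (b - 1)) * ((x $ i - c $ i) * r2 x powr (b - 1 - 1)))"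
 unfolding partial_deriv_mult[OF d[OF sc] d[OF smooth_powr]] pc powr_deriv(2)[OF assms] by simp
 finally show ?thesis .
qed
have rr: "(\<Sum>i\<in>UNIV. (x $ i - c $ i) * (x $ i - c $ i)) = r2 x"
 unfolding power2_norm_eq_inner inner_vec_def by simp
have pw: "r2 x * r2 x powr (b - 1 - 1) = r2 x powr (b - 1)"
 using r2_pos[OF assms] powr_add[of "r2 x" 1 "b - 1 - 1"] by simp
have "laplacian (%x. r2 x powr b) x = (\<Sum>i\<in>UNIV. 2 * b * r2 x powr (b - 1) + (2 * b * (2 * (b - 1)) * r2 x powr (b - 1 - 1)) * ((x $ i - c $ i) * (x $ i - c $ i)))"
 unfolding laplacian_def p2 by (intro sum.cong refl) (simp add: algebra_simps)
also have "... = real CARD('n) * (2 * b * r2 x powr (b - 1)) + 2 * b * (2 * (b - 1)) * (r2 x * r2 x powr (b - 1 - 1))"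
 unfolding sum.distrib sum_distrib_left[symmetric] rr by simp
also have "... = 2 * b * (real CARD('n) + 2 * b - 2) * r2 x powr (b - 1)" unfolding pw by (simp add: algebra_simps)
finally show ?thesis .
qed

end

lemma has_derivative_exp_compose:
fixes f :: "real^'n::finite => complex"
assumes "f differentiable (at x)"
shows "((%x. exp (f x)) has_derivative (%h. exp (f x) * frechet_derivative f (at x) h)) (at x)"
using has_derivative_compose[OF frechet_derivative_worksI[OF assms] DERIV_exp[of "f x", unfolded has_field_derivative_def]] by simp

lemma C_k_on_exp:
fixes f :: "real^'n::finite => complex"
assumes "open U" "C_k_on k U f"
shows "C_k_on k U (%x. exp (f x))"
using assms(2)
proof (induction k)
case 0 then show ?case by (auto intro: continuous_intros)
next
case (Suc k)
have "C_k_on k U (%x. exp (f x))" using Suc C_k_on_SucD by blast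
then have "C_k_on k U (%x. exp (f x) * partial_deriv i f x)" for i using Suc.prems assms(1) by (intro C_k_on_mult) auto
moreover have "((%x. exp (f x)) has_derivative (%h. exp (f x) * frechet_derivative f (at x) h)) (at x)" if "x \<in> U" for x
 using Suc.prems that by (auto intro: has_derivative_exp_compose)
ultimately show ?case
 by (intro C_k_on_SucI[OF assms(1), where g="%i x. exp (f x) * partial_deriv i f x"])
 (auto simp: differentiable_def partial_deriv_def[of _ f] intro!: partial_deriv_eqI)
qed

lemma smooth_on_exp: "open U ==> smooth_on U f ==> smooth_on U (%x. exp (f x :: complex))"
unfolding smooth_on_def using C_k_on_exp by blast

lemma partial_deriv_exp:
fixes f :: "real^'n::finite => complex"
assumes "f differentiable (at x)"
shows "partial_deriv i (%x. exp (f x)) x = exp (f x) * partial_deriv i f x"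
unfolding partial_deriv_eqI[OF has_derivative_exp_compose[OF assms]] by (simp add: partial_deriv_def)

lemma laplacian_exp:
fixes f :: "real^'n::finite => complex"
assumes "open U" "x \<in> U" "smooth_on U f"
shows "laplacian (%x. exp (f x)) x = exp (f x) * (laplacian f x + (\<Sum>i\<in>UNIV. partial_deriv i f x * partial_deriv i f x))"
proof -
note d = smooth_on_imp_differentiable
have "partial_deriv i (partial_deriv i (%x. exp (f x))) x
 = exp (f x) * (partial_deriv i (partial_deriv i f) x + partial_deriv i f x * partial_deriv i f x)" for i
proof -
 have "partial_deriv i (partial_deriv i (%x. exp (f x))) x = partial_deriv i (%x. exp (f x) * partial_deriv i f x) x"
 by (rule partial_deriv_cong[OF assms(1,2)]) (rule partial_deriv_exp[OF d[OF assms(3)]])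
 also have "... = exp (f x) * partial_deriv i f x * partial_deriv i f x + exp (f x) * partial_deriv i (partial_deriv i f) x"
 unfolding partial_deriv_mult[OF d[OF smooth_on_exp[OF assms(1,3)] assms(2)] d[OF smooth_on_partial_deriv[OF assms(3)] assms(2)]]
 partial_deriv_exp[OF d[OF assms(3,2)]] ..
 finally show ?thesis by (simp add: algebra_simps)
qed
then show ?thesis unfolding laplacian_def by (simp add: sum_distrib_left sum.distrib distrib_left)
qed

text \<open>For a Kelvin factor P and exponent Z, harmonicity of P leaves exp(Z) times P (lap Z +
  grad Z . grad Z) + 2 grad P . grad Z. Nullity of \<open>z\<close> kills grad Z . grad Z, and the
  exponent of P is the one for which the other two terms cancel.\<close>

lemma kelvin_exp_harmonic:
fixes z :: "complex^'n::finite"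
assumes null: "(\<Sum>i\<in>UNIV. z $ i * z $ i) = 0"
shows "smooth_on (- {c}) (kelvin_exp c x0 z)" "x ~= c ==> laplacian (kelvin_exp c x0 z) x = 0"
proof -
let ?U = "- {c}" and ?n = "real CARD('n)"
have op: "open ?U" by auto
define S where "S = complex_of_real ((norm (x0 - c))\<^sup>2)"
define R where "R x = complex_of_real ((norm (x - c))\<^sup>2 powr (-1))" for x
define L where "L x = (\<Sum>i\<in>UNIV. z $ i * of_real (x $ i - c $ i))" for x
define k where "k = cdot z (x0 - c)"
define a where "a = (2 - ?n) / 2"
define P where "P x = complex_of_real ((norm (x - c))\<^sup>2 powr a)" for x
have ze: "cdot z (inversion c x0 x) = S * (R x * L x) + (- k)" if "x \<in> ?U" for x
proof -
 have rp: "(norm (x - c))\<^sup>2 powr (-1) = 1 / (norm (x - c))\<^sup>2" using that by (simp add: powr_minus divide_inverse)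
 show ?thesis unfolding cdot_def inversion_def S_def R_def L_def k_def rp sum_distrib_left sum_negf[symmetric] sum.distrib[symmetric]
 by (rule sum.cong) (simp_all add: algebra_simps divide_inverse)
qed
have sR: "smooth_on ?U R" unfolding R_def[abs_def] by (rule smooth_on_bounded_linear[OF op bounded_linear_of_real smooth_powr])
have sP: "smooth_on ?U P" unfolding P_def[abs_def] by (rule smooth_on_bounded_linear[OF op bounded_linear_of_real smooth_powr])
have sy: "smooth_on ?U (%x. x $ i - c $ i)" for i by (rule smooth_on_diff[OF op smooth_on_component[OF op] smooth_on_const[OF op]])
have sy': "smooth_on ?U (%x. complex_of_real (x $ i - c $ i))" for i by (rule smooth_on_bounded_linear[OF op bounded_linear_of_real sy])
have syz: "smooth_on ?U (%x. z $ i * complex_of_real (x $ i - c $ i))" for i by (rule smooth_on_mult[OF op smooth_on_const[OF op] sy'])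
have sL: "smooth_on ?U L" unfolding L_def[abs_def] by (rule smooth_on_sum[OF op finite syz])
have sRL: "smooth_on ?U (%x. R x * L x)" by (rule smooth_on_mult[OF op sR sL])
have sSRL: "smooth_on ?U (%x. S * (R x * L x))" by (rule smooth_on_mult[OF op smooth_on_const[OF op] sRL])
define Z where "Z x = S * (R x * L x) + (- k)" for x
have sZ: "smooth_on ?U Z" unfolding Z_def[abs_def] by (rule smooth_on_add[OF op sSRL smooth_on_const[OF op]])
have K: "kelvin_exp c x0 z x = P x * exp (Z x)" if "x \<in> ?U" for x
 unfolding kelvin_exp_def P_def a_def Z_def ze[OF that] ..
have sPE: "smooth_on ?U (%x. P x * exp (Z x))" by (rule smooth_on_mult[OF op sP smooth_on_exp[OF op sZ]])
show "smooth_on (- {c}) (kelvin_exp c x0 z)" by (rule smooth_on_cong[OF op _ sPE]) (simp add: K)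
assume "x ~= c"
then have x: "x \<in> ?U" by simp
note d = smooth_on_imp_differentiable[OF _ x]
let ?y = "%i. complex_of_real (x $ i - c $ i)"
define r where "r = (norm (x - c))\<^sup>2"
have r: "r > 0" using x by (simp add: r_def)
define q where "q = complex_of_real (r powr (-1))"
have q: "of_real r * q = 1" using r by (simp add: q_def powr_minus)
have qq: "complex_of_real (r powr (- 1 - 1)) = q * q"
 unfolding q_def of_real_mult[symmetric] by (rule arg_cong[OF powr_add[of r "-1" "-1", simplified diff_conv_add_uminus[symmetric]]])
have Rx: "R x = q" by (simp add: R_def q_def r_def)
have pR: "partial_deriv i R x = - 2 * (?y i * (q * q))" for i
proof -
 have "partial_deriv i R x = of_real (partial_deriv i (%x. (norm (x - c))\<^sup>2 powr (-1)) x)"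
 unfolding R_def[abs_def] by (rule partial_deriv_bounded_linear[OF bounded_linear_of_real powr_deriv(1)[OF x]])
 then show ?thesis unfolding powr_deriv(2)[OF x] r_def[symmetric] by (simp only: of_real_mult qq) simp
qed
have lR: "laplacian R x = - 2 * (of_real ?n - 4) * (q * q)"
proof -
 have "laplacian R x = of_real (laplacian (%x. (norm (x - c))\<^sup>2 powr (-1)) x)"
 unfolding R_def[abs_def] by (rule laplacian_bounded_linear[OF bounded_linear_of_real op x smooth_powr])
 then show ?thesis unfolding laplacian_powr[OF x] r_def[symmetric] by (simp only: of_real_mult qq) (simp add: algebra_simps)
qed
have pL1: "partial_deriv i L y = z $ i" if y: "y \<in> ?U" for i y
proof -
 note d = smooth_on_imp_differentiable[OF _ y]
 have p: "partial_deriv i (%x. x $ j - c $ j) y = (if i = j then 1 else 0)" for j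
 using partial_deriv_add[of "%x. x $ j" y "%x. - c $ j" i] by simp
 have p': "partial_deriv i (%x. complex_of_real (x $ j - c $ j)) y = of_real (if i = j then 1 else 0)" for j
 unfolding p[symmetric] by (rule partial_deriv_bounded_linear[OF bounded_linear_of_real d[OF sy]])
 have "partial_deriv i (%x. z $ j * complex_of_real (x $ j - c $ j)) y = z $ j * of_real (if i = j then 1 else 0)" for j
 unfolding partial_deriv_mult[OF differentiable_const d[OF sy']] p' by simp
 then show ?thesis unfolding L_def[abs_def] partial_deriv_sum[OF finite d[OF syz]]
 by (simp add: if_distrib[of "%c. _ * c"] if_distrib[of of_real] cong: if_cong)
qed
have pL: "partial_deriv i L x = z $ i" for i by (rule pL1[OF x])
have lL: "laplacian L x = 0"
proof -
 have "partial_deriv i (partial_deriv i L) x = partial_deriv i (%x. z $ i) x" for i by (rule partial_deriv_cong[OF op x pL1])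
 then show ?thesis unfolding laplacian_def by simp
qed
define l where "l = L x"
have yz: "(\<Sum>i\<in>UNIV. ?y i * z $ i) = l" unfolding l_def L_def by (simp add: mult.commute)
have yy: "(\<Sum>i\<in>UNIV. ?y i * ?y i) = of_real r"
 unfolding r_def power2_norm_eq_inner inner_vec_def by (simp only: of_real_mult[symmetric] of_real_sum[symmetric]) simp
have pZ: "partial_deriv i Z x = S * (- 2 * (?y i * (q * q)) * l + q * z $ i)" for i
proof -
 have "partial_deriv i Z x = partial_deriv i (%x. S * (R x * L x)) x"
 unfolding Z_def[abs_def] using partial_deriv_add[OF d[OF sSRL] differentiable_const, of i "- k"] by simp
 also have "... = S * partial_deriv i (%x. R x * L x) x" using partial_deriv_mult[OF differentiable_const d[OF sRL], of i S] by simp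
 also have "partial_deriv i (%x. R x * L x) x = - 2 * (?y i * (q * q)) * l + q * z $ i"
 unfolding partial_deriv_mult[OF d[OF sR] d[OF sL]] pR pL Rx l_def ..
 finally show ?thesis .
qed
have lZ: "laplacian Z x = S * ((4 - 2 * of_real ?n) * (q * q) * l)"
proof -
 have "laplacian Z x = laplacian (%x. S * (R x * L x)) x"
 unfolding Z_def[abs_def] using laplacian_add[OF op x sSRL smooth_on_const[OF op, of "- k"]] by simp
 also have "... = S * laplacian (%x. R x * L x) x" by (rule laplacian_cmult[OF op x sRL])
 also have "laplacian (%x. R x * L x) x = - 2 * (of_real ?n - 4) * (q * q) * l + (\<Sum>i\<in>UNIV. (- 4 * (q * q)) * (?y i * z $ i))"
 unfolding laplacian_mult[OF op x sR sL] lR lL pR pL l_def[symmetric]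
 by (simp add: algebra_simps)
 also have "... = (4 - 2 * of_real ?n) * (q * q) * l"
 unfolding sum_distrib_left[symmetric] yz by (simp add: algebra_simps)
 finally show ?thesis .
qed
have sq: "(\<Sum>i\<in>UNIV. partial_deriv i Z x * partial_deriv i Z x) = 0"
proof -
 have "(\<Sum>i\<in>UNIV. partial_deriv i Z x * partial_deriv i Z x)
 = (\<Sum>i\<in>UNIV. (4 * S * S * l * l * (q * q) * (q * q)) * (?y i * ?y i) + (- 4 * S * S * l * q * (q * q)) * (?y i * z $ i) + (S * S * q * q) * (z $ i * z $ i))"
 unfolding pZ by (intro sum.cong refl) (simp add: algebra_simps)
 also have "... = (4 * S * S * l * l * (q * q) * (q * q)) * of_real r + (- 4 * S * S * l * q * (q * q)) * l"
 unfolding sum.distrib sum_distrib_left[symmetric] yy yz null by simp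
 also have "... = 4 * S * S * l * l * q * (q * q) * (of_real r * q - 1)" by (simp add: algebra_simps)
 finally show ?thesis using q by simp
qed
define p1 where "p1 = complex_of_real (r powr (a - 1))"
have pP: "partial_deriv i P x = 2 * of_real a * (?y i * p1)" for i
proof -
 have "partial_deriv i P x = of_real (partial_deriv i (%x. (norm (x - c))\<^sup>2 powr a) x)"
 unfolding P_def[abs_def] by (rule partial_deriv_bounded_linear[OF bounded_linear_of_real powr_deriv(1)[OF x]])
 then show ?thesis unfolding powr_deriv(2)[OF x] r_def[symmetric] p1_def by simp
qed
have lP: "laplacian P x = 0"
proof -
 have "laplacian P x = of_real (laplacian (%x. (norm (x - c))\<^sup>2 powr a) x)"
 unfolding P_def[abs_def] by (rule laplacian_bounded_linear[OF bounded_linear_of_real op x smooth_powr])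
 moreover have "?n + 2 * a - 2 = 0" by (simp add: a_def field_simps)
 ultimately show ?thesis unfolding laplacian_powr[OF x] by simp
qed
have Pq: "P x * q = p1"
 unfolding P_def q_def p1_def r_def[symmetric] of_real_mult[symmetric] by (rule arg_cong[OF powr_add[of r a "-1", symmetric, simplified diff_conv_add_uminus[symmetric]]])
let ?E = "%x. exp (Z x)"
have sE: "smooth_on ?U ?E" by (rule smooth_on_exp[OF op sZ])
have "laplacian (%x. P x * ?E x) x = P x * laplacian ?E x + 2 * (\<Sum>i\<in>UNIV. partial_deriv i P x * partial_deriv i ?E x)"
 unfolding laplacian_mult[OF op x sP sE] lP by (simp add: sum_distrib_left)
also have "laplacian ?E x = ?E x * (S * ((4 - 2 * of_real ?n) * (q * q) * l))"
 unfolding laplacian_exp[OF op x sZ] lZ sq by simp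
also have "(\<Sum>i\<in>UNIV. partial_deriv i P x * partial_deriv i ?E x)
 = (\<Sum>i\<in>UNIV. (- 4 * of_real a * p1 * ?E x * S * (q * q) * l) * (?y i * ?y i) + (2 * of_real a * p1 * ?E x * S * q) * (?y i * z $ i))"
 unfolding partial_deriv_exp[OF d[OF sZ]] pP pZ by (intro sum.cong refl) (simp add: algebra_simps)
also have "... = (- 4 * of_real a * p1 * ?E x * S * (q * q) * l) * of_real r + (2 * of_real a * p1 * ?E x * S * q) * l"
 unfolding sum.distrib sum_distrib_left[symmetric] yy yz ..
also have "... = - 2 * of_real a * p1 * ?E x * S * q * l"
proof -
 have "(- 4 * of_real a * p1 * ?E x * S * (q * q) * l) * of_real r = (- 4 * of_real a * p1 * ?E x * S * q * l) * (of_real r * q)"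
 by (simp add: algebra_simps)
 then show ?thesis unfolding q by (simp add: algebra_simps)
qed
also have "P x * (?E x * (S * ((4 - 2 * of_real ?n) * (q * q) * l))) + 2 * (- 2 * of_real a * p1 * ?E x * S * q * l)
 = (4 - 2 * of_real ?n - 4 * of_real a) * (p1 * ?E x * S * q * l)"
 unfolding Pq[symmetric] by (simp add: algebra_simps)
also have "(4 - 2 * of_real ?n - 4 * of_real a) = (0 :: complex)"
 by (simp add: a_def field_simps)
finally have "laplacian (%x. P x * ?E x) x = 0" by simp
then show "laplacian (kelvin_exp c x0 z) x = 0"
 using laplacian_cong[OF op x K] by simp
qed

section \<open>Exponentially small Laplace transforms\<close>

lemma integrable_exp_weight:
fixes F h :: "'a => complex"
assumes F: "integrable M F" and h: "h \<in> borel_measurable M"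
 and B: "!!x. x \<in> space M ==> F x ~= 0 ==> Re (h x) <= B"
shows "integrable M (%x. F x * exp (h x))"
 and "norm (LINT x|M. F x * exp (h x)) <= exp B * (LINT x|M. norm (F x))"
proof -
note [measurable] = borel_measurable_integrable[OF F] h
have i: "integrable M (%x. exp B * norm (F x))" using F by simp
have le: "norm (F x * exp (h x)) <= exp B * norm (F x)" if "x \<in> space M" for x
 using B[OF that] by (cases "F x = 0") (simp_all add: norm_mult mult.commute[of "exp B"])
show 1: "integrable M (%x. F x * exp (h x))"
 by (rule Bochner_Integration.integrable_bound[OF i]) (use le in \<open>auto intro!: AE_I2 intro: order_trans\<close>)
have "norm (LINT x|M. F x * exp (h x)) <= (LINT x|M. norm (F x * exp (h x)))" by (rule integral_norm_bound)
also have "... <= (LINT x|M. exp B * norm (F x))" by (rule integral_mono[OF integrable_norm[OF 1] i le])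
finally show "norm (LINT x|M. F x * exp (h x)) <= exp B * (LINT x|M. norm (F x))" by simp
qed

text \<open>Comparison with the normal density of variance 2: on the tail exp(-x^2/2) <= exp(-a^2/4)
  exp(-x^2/4), and sqrt 2 is the ratio of the normalisations.\<close>

lemma std_normal_tail:
assumes "0 <= a"
shows "(LINT x|std_normal_distribution. (if a < \<bar>x\<bar> then 1 else 0)) <= sqrt 2 * exp (- a\<^sup>2 / 4)"
proof -
have "std_normal_density x * (if a < \<bar>x\<bar> then 1 else 0) <= sqrt 2 * exp (- a\<^sup>2 / 4) * normal_density 0 (sqrt 2) x" for x
proof (cases "a < \<bar>x\<bar>")
 case True
 have "a\<^sup>2 <= x\<^sup>2" using True assms abs_le_square_iff[of a x] by simp
 then have "exp (- x\<^sup>2 / 2) <= exp (- a\<^sup>2 / 4) * exp (- x\<^sup>2 / 4)" unfolding exp_add[symmetric] by simp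
 then have "1 / sqrt (2 * pi) * exp (- x\<^sup>2 / 2) <= 1 / sqrt (2 * pi) * (exp (- a\<^sup>2 / 4) * exp (- x\<^sup>2 / 4))"
 by (intro mult_left_mono) auto
 also have "... = sqrt 2 * exp (- a\<^sup>2 / 4) * (1 / sqrt (2 * pi * 2) * exp (- x\<^sup>2 / 4))"
 by (simp add: real_sqrt_mult field_simps)
 finally show ?thesis using True by (simp add: normal_density_def mult_ac)
qed simp
then have "(LINT x|lborel. std_normal_density x * (if a < \<bar>x\<bar> then 1 else 0))
 <= (LINT x|lborel. sqrt 2 * exp (- a\<^sup>2 / 4) * normal_density 0 (sqrt 2) x)"
 by (intro integral_mono' integrable_mult_right integrable_normal_density) auto
also have "... = sqrt 2 * exp (- a\<^sup>2 / 4)" by simp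
finally show ?thesis by (subst integral_density) auto
qed

lemma gaussian_fourier:
"(LINT t|std_normal_distribution. exp (\<i> * of_real (b * t))) = exp (of_real (- (b\<^sup>2) / 2))"
unfolding exp_of_real using fun_cong[OF char_std_normal_distribution, of b] by (simp add: char_def)

lemma quadratic_bound: "(s::real) > 0 ==> k * b - b\<^sup>2 / (2 * s) <= s * k\<^sup>2 / 2"
using zero_le_power2[of "s * k - b"] by (simp add: field_simps power2_eq_square)

locale half_ball_map = sigma_finite_measure M for M :: "'a measure" +
fixes Y :: "'a => real^'n::finite" and e :: "real^'n" and s :: real
assumes Y: "Y \<in> borel_measurable M" and s: "s > 0" and e: "norm e = 1"
begin

text \<open>The inequality places \<open>Y x\<close> in the closed ball of radius \<open>s\<close>
  about - s e; it is required only where \<open>F\<close> is nonzero.\<close>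

definition adm :: "('a => complex) => bool" where
"adm F \<longleftrightarrow> integrable M F & (\<forall>x\<in>space M. F x ~= 0 --> e \<bullet> Y x <= - (norm (Y x))\<^sup>2 / (2 * s))"

text \<open>The exponent with Gaussian damping in the coordinates from \<open>A\<close>, which are
  added one at a time.\<close>

definition gauss :: "'n set => real => complex^'n => 'a => complex" where
"gauss A ta z x = cdot z (Y x) - of_real (ta * (\<Sum>i\<in>A. (Y x $ i)\<^sup>2))"

text \<open>\<open>C\<close> may depend on \<open>F\<close>, whereas \<open>ep\<close> and
  \<open>k\<close> are parameters; this separation is what makes the final radius independent of
  \<open>F\<close>.\<close>

definition decay :: "'n set => real => real => ('a => complex) => bool" where
"decay A ep k F \<longleftrightarrow> (\<exists>C. \<forall>ta>0. \<forall>z. (\<forall>i. norm (z $ i - of_real (ta * e $ i)) <= ep * ta) -->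
 norm (LINT x|M. F x * exp (gauss A ta z x)) <= C * exp (- k * ta))"

lemma Y_component[measurable]: "(%x. Y x $ i) \<in> borel_measurable M"
by (rule measurable_compose[OF Y borel_measurable_continuous_onI]) (intro continuous_intros)

lemma cdot_measurable[measurable]: "(%x. cdot z (Y x)) \<in> borel_measurable M"
unfolding cdot_def by measurable

lemma gauss_measurable[measurable]: "gauss A ta z \<in> borel_measurable M"
unfolding gauss_def[abs_def] by measurable

text \<open>Only real parts enter. Their deviation from ta e costs a term linear in |Y|, and the
  quadratic gain provided by \<open>adm\<close> bounds it after completing the square.\<close>

lemma Re_cdot_le:
assumes F: "adm F" "x \<in> space M" "F x ~= 0" and ta: "ta > 0" and eta: "eta >= 0"
 and z: "!!i. \<bar>Re (z $ i) - ta * e $ i\<bar> <= eta * ta"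
shows "Re (cdot z (Y x)) <= ta * (s * (real CARD('n) * eta)\<^sup>2 / 2)"
proof -
let ?y = "Y x"
have "Re (cdot z ?y) = ta * (e \<bullet> ?y) + (\<Sum>i\<in>UNIV. (Re (z $ i) - ta * e $ i) * ?y $ i)"
 unfolding cdot_def inner_vec_def by (simp add: sum_distrib_left sum.distrib[symmetric] algebra_simps)
also have "(\<Sum>i\<in>UNIV. (Re (z $ i) - ta * e $ i) * ?y $ i) <= (\<Sum>i\<in>(UNIV::'n set). eta * ta * norm ?y)"
proof (rule sum_mono)
 fix i
 have "(Re (z $ i) - ta * e $ i) * ?y $ i <= \<bar>Re (z $ i) - ta * e $ i\<bar> * \<bar>?y $ i\<bar>" unfolding abs_mult[symmetric] by (rule abs_ge_self)
 also have "... <= (eta * ta) * norm ?y" by (intro mult_mono z component_le_norm_cart) (use ta eta in auto)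
 finally show "(Re (z $ i) - ta * e $ i) * ?y $ i <= eta * ta * norm ?y" .
qed
also have "... = ta * ((real CARD('n) * eta) * norm ?y)" by simp
finally have "Re (cdot z ?y) <= ta * (e \<bullet> ?y + (real CARD('n) * eta) * norm ?y)" by (simp add: distrib_left)
also have "... <= ta * (s * (real CARD('n) * eta)\<^sup>2 / 2)"
 using F quadratic_bound[OF s, of "real CARD('n) * eta" "norm ?y"] ta
 by (intro mult_left_mono) (auto simp: adm_def)
finally show ?thesis .
qed

lemma gauss_bound:
assumes F: "adm F" and ta: "ta > 0" and eta: "eta >= 0" and z: "!!i. \<bar>Re (z $ i) - ta * e $ i\<bar> <= eta * ta"
shows "integrable M (%x. F x * exp (gauss A ta z x))"
 and "norm (LINT x|M. F x * exp (gauss A ta z x)) <= exp (ta * (s * (real CARD('n) * eta)\<^sup>2 / 2)) * (LINT x|M. norm (F x))"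
proof -
have b: "Re (gauss A ta z x) <= ta * (s * (real CARD('n) * eta)\<^sup>2 / 2)" if "x \<in> space M" "F x ~= 0" for x
proof -
 have "0 <= ta * (\<Sum>i\<in>A. (Y x $ i)\<^sup>2)" using ta by (intro mult_nonneg_nonneg sum_nonneg) auto
 then show ?thesis using Re_cdot_le[OF F that ta eta z] by (simp add: gauss_def)
qed
have F': "integrable M F" using F by (simp add: adm_def)
show "integrable M (%x. F x * exp (gauss A ta z x))"
 by (rule integrable_exp_weight(1)[OF F' gauss_measurable]) (rule b)
show "norm (LINT x|M. F x * exp (gauss A ta z x)) <= exp (ta * (s * (real CARD('n) * eta)\<^sup>2 / 2)) * (LINT x|M. norm (F x))"
 by (rule integrable_exp_weight(2)[OF F' gauss_measurable]) (rule b)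
qed

text \<open>The factor \<open>exp (- ta * (Y $ j)\<^sup>2)\<close> is the mean of \<open>exp (\<i> * sqrt (2 * ta) * t * Y $ j)\<close> over a
standard normal \<open>t\<close>, so inserting it only averages the transform over imaginary translates of \<open>z\<close>.\<close>

lemma gauss_insert:
assumes F: "adm F" and ta: "ta > 0" and z: "!!i. \<bar>Re (z $ i) - ta * e $ i\<bar> <= eta * ta" "eta >= 0" and j: "j \<notin> A" "finite A"
defines "w t \<equiv> z + axis j (\<i> * of_real (sqrt (2 * ta) * t))"
shows "(LINT x|M. F x * exp (gauss (insert j A) ta z x))
 = (LINT t|std_normal_distribution. LINT x|M. F x * exp (gauss A ta (w t) x))" (is ?eq)
 and "integrable std_normal_distribution (%t. LINT x|M. F x * exp (gauss A ta (w t) x))" (is ?int)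
proof -
let ?N = std_normal_distribution
interpret N: real_distribution ?N by (rule real_dist_normal_dist)
interpret P: pair_sigma_finite M ?N ..
have g: "gauss A ta (w t) x = gauss A ta z x + \<i> * of_real (sqrt (2 * ta) * Y x $ j * t)" for t x
proof -
 have "cdot (w t) (Y x) = (\<Sum>i\<in>UNIV. z $ i * of_real (Y x $ i) + (if i = j then \<i> * of_real (sqrt (2 * ta) * Y x $ j * t) else 0))"
 unfolding cdot_def w_def by (intro sum.cong) (auto simp: axis_def algebra_simps)
 then show ?thesis by (simp add: gauss_def cdot_def sum.distrib)
qed
note [measurable] = borel_measurable_integrable[OF F[unfolded adm_def, THEN conjunct1]]
let ?f = "%x t. F x * exp (gauss A ta (w t) x)"
have nf: "norm (?f x t) = norm (F x * exp (gauss A ta z x))" for x t unfolding g by (simp add: norm_mult)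
have fm: "(%(x, t). ?f x t) \<in> borel_measurable (M \<Otimes>\<^sub>M ?N)" unfolding g by measurable
have int: "integrable (M \<Otimes>\<^sub>M ?N) (%(x, t). ?f x t)"
proof (rule P.Fubini_integrable[OF fm])
 show "integrable M (%x. LINT t|?N. norm (case (x, t) of (x, t) => ?f x t))"
 unfolding prod.case nf using integrable_norm[OF gauss_bound(1)[OF F ta z(2,1)]] by (simp add: N.prob_space)
 show "AE x in M. integrable ?N (%t. case (x, t) of (x, t) => ?f x t)"
 proof (rule AE_I2)
 fix x
 show "integrable ?N (%t. case (x, t) of (x, t) => ?f x t)"
 unfolding prod.case
 proof (rule N.integrable_const_bound)
 show "AE t in ?N. norm (?f x t) <= norm (F x * exp (gauss A ta z x))" unfolding nf by simp
 show "?f x \<in> borel_measurable ?N" unfolding g by measurable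
 qed
 qed
qed
show ?int using P.integrable_snd[OF int] by simp
have fx: "(LINT t|?N. ?f x t) = F x * exp (gauss (insert j A) ta z x)" for x
proof -
 have "(LINT t|?N. ?f x t) = (LINT t|?N. F x * exp (gauss A ta z x) * exp (\<i> * of_real (sqrt (2 * ta) * Y x $ j * t)))"
 unfolding g exp_add by (simp only: mult.assoc)
 also have "... = F x * exp (gauss A ta z x) * exp (of_real (- ((sqrt (2 * ta) * Y x $ j)\<^sup>2) / 2))"
 unfolding integral_mult_right_zero gaussian_fourier ..
 also have "- ((sqrt (2 * ta) * Y x $ j)\<^sup>2) / 2 = - (ta * (Y x $ j)\<^sup>2)" using ta by (simp add: power_mult_distrib)
 finally show ?thesis using j by (simp add: gauss_def mult.assoc exp_add[symmetric] algebra_simps)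
qed
show ?eq using P.Fubini_integral[OF int, symmetric] by (simp only: fx)
qed

lemma decay_insert:
assumes ep: "ep > 0" and k: "k > 0" and j: "j \<notin> A" "finite A"
shows "\<exists>ep'>0. \<exists>k'>0. \<forall>F. adm F --> decay A ep k F --> decay (insert j A) ep' k' F"
proof -
\<comment> \<open>Translates with |t| <= ka sqrt(ta) move \<open>z\<close> by at most ep ta / 2, so
  the assumed decay applies to them. For larger t only the growth exp(ta ka^2 / 8) is known, which
  is what the second bound in \<open>ep'\<close> ensures, and the normal tail exp(- ta ka^2 / 4)
  beats it.\<close>
define ka where "ka = ep / 4"
define D where "D = s * (real CARD('n))\<^sup>2 / 2"
have D: "D > 0" using s by (simp add: D_def)
define ep' where "ep' = min (ep / 2) (ka / sqrt (8 * D))"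
define k' where "k' = min k (ka\<^sup>2 / 8)"
have ka: "ka > 0" and ep': "ep' > 0" "ep' <= ep / 2" and k': "k' > 0" "k' <= k" "k' <= ka\<^sup>2 / 8"
 using ep k D by (auto simp: ka_def ep'_def k'_def)
have D': "s * (real CARD('n) * ep')\<^sup>2 / 2 <= ka\<^sup>2 / 8"
proof -
 have "ep'\<^sup>2 <= (ka / sqrt (8 * D))\<^sup>2" using ep' by (intro power_mono) (auto simp: ep'_def)
 then have "D * ep'\<^sup>2 <= D * (ka\<^sup>2 / (8 * D))" using D by (intro mult_left_mono) (auto simp: power_divide)
 also have "... = ka\<^sup>2 / 8" using D by simp
 finally show ?thesis by (simp add: D_def power_mult_distrib mult_ac)
qed
have "decay (insert j A) ep' k' F" if F: "adm F" and "decay A ep k F" for F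
proof -
 obtain C where C: "!!ta z. ta > 0 ==> (!!i. norm (z $ i - of_real (ta * e $ i)) <= ep * ta) ==>
 norm (LINT x|M. F x * exp (gauss A ta z x)) <= C * exp (- k * ta)"
 using \<open>decay A ep k F\<close> unfolding decay_def by blast
 have "0 <= C * exp (- k * 1)" by (rule order_trans[OF norm_ge_zero C[of 1 "\<chi> i. of_real (e $ i)"]]) (use ep in auto)
 then have C0: "C >= 0" by (simp add: zero_le_mult_iff)
 let ?L = "LINT x|M. norm (F x)" and ?N = std_normal_distribution
 interpret N: real_distribution ?N by (rule real_dist_normal_dist)
 have L0: "?L >= 0" by simp
 have "norm (LINT x|M. F x * exp (gauss (insert j A) ta z x)) <= (C + ?L * sqrt 2) * exp (- k' * ta)"
 if ta: "ta > 0" and z: "!!i. norm (z $ i - of_real (ta * e $ i)) <= ep' * ta" for ta z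
 proof -
 have zr: "\<bar>Re (z $ i) - ta * e $ i\<bar> <= ep' * ta" for i
 using abs_Re_le_cmod[of "z $ i - of_real (ta * e $ i)"] z[of i] by simp
 define w where "w t = z + axis j (\<i> * of_real (sqrt (2 * ta) * t))" for t
 let ?g = "%t. LINT x|M. F x * exp (gauss A ta (w t) x)"
 define a where "a = ka * sqrt ta"
 define b where "b = exp (ta * (ka\<^sup>2 / 8)) * ?L"
 have a0: "a >= 0" using ka ta by (simp add: a_def)
 have b0: "b >= 0" by (simp add: b_def)
 have gb: "norm (?g t) <= C * exp (- k * ta) + b * (if a < \<bar>t\<bar> then 1 else 0)" for t
 proof (cases "a < \<bar>t\<bar>")
 case True
 have wr: "Re (w t $ i) = Re (z $ i)" for i by (simp add: w_def axis_def)
 have "norm (?g t) <= exp (ta * (s * (real CARD('n) * ep')\<^sup>2 / 2)) * ?L"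
 by (rule gauss_bound(2)[OF F ta less_imp_le[OF ep'(1)]]) (unfold wr, rule zr)
 also have "... <= b" unfolding b_def using D' ta L0 by (intro mult_right_mono) auto
 finally show ?thesis using True C0 by (simp add: add_increasing)
 next
 case False
 have "norm (w t $ i - of_real (ta * e $ i)) <= ep * ta" for i
 proof -
 have "norm (w t $ i - of_real (ta * e $ i)) <= norm (z $ i - of_real (ta * e $ i)) + norm (axis j (\<i> * of_real (sqrt (2 * ta) * t)) $ i :: complex)"
 unfolding w_def using norm_triangle_ineq[of "z $ i - of_real (ta * e $ i)" "axis j (\<i> * of_real (sqrt (2 * ta) * t)) $ i"]
 by (simp add: algebra_simps)
 also have "norm (axis j (\<i> * of_real (sqrt (2 * ta) * t)) $ i :: complex) <= sqrt (2 * ta) * \<bar>t\<bar>"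
 using ta by (simp add: axis_def norm_mult abs_mult)
 also have "... <= sqrt (2 * ta) * a" using False ta by (intro mult_left_mono) auto
 also have "... = sqrt 2 * ka * ta" using ta by (simp add: a_def real_sqrt_mult)
 also have "... <= 2 * ka * ta" using ka ta sqrt2_less_2 by (intro mult_right_mono) auto
 finally have "norm (w t $ i - of_real (ta * e $ i)) <= norm (z $ i - of_real (ta * e $ i)) + ep / 2 * ta" by (simp add: ka_def)
 also have "norm (z $ i - of_real (ta * e $ i)) <= ep / 2 * ta" using z[of i] mult_right_mono[OF ep'(2), of ta] ta by linarith
 finally show ?thesis by simp
 qed
 then show ?thesis using C[OF ta] False by simp
 qed
 have i1: "integrable ?N (%t. C * exp (- k * ta) + b * (if a < \<bar>t\<bar> then 1 else 0))"
 by (rule N.integrable_const_bound[of _ "C * exp (- k * ta) + b"]) (use C0 b0 in auto)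
 have i2: "integrable ?N (%t. if a < \<bar>t\<bar> then 1 else 0 :: real)"
 by (rule N.integrable_const_bound[of _ 1]) auto
 have "norm (LINT x|M. F x * exp (gauss (insert j A) ta z x)) = norm (LINT t|?N. ?g t)"
 unfolding w_def gauss_insert(1)[OF F ta zr less_imp_le[OF ep'(1)] j] ..
 also have "... <= (LINT t|?N. norm (?g t))" by (rule integral_norm_bound)
 also have "... <= (LINT t|?N. C * exp (- k * ta) + b * (if a < \<bar>t\<bar> then 1 else 0))"
 using gauss_insert(2)[OF F ta zr less_imp_le[OF ep'(1)] j] by (intro integral_mono i1 gb) (simp add: w_def integrable_norm)
 also have "... = C * exp (- k * ta) + b * (LINT t|?N. (if a < \<bar>t\<bar> then 1 else 0))"
 using i2 N.prob_space by simp
 also have "... <= C * exp (- k * ta) + b * (sqrt 2 * exp (- a\<^sup>2 / 4))"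
 using std_normal_tail[OF a0] b0 by (intro add_left_mono mult_left_mono) auto
 also have "b * (sqrt 2 * exp (- a\<^sup>2 / 4)) = ?L * sqrt 2 * exp (- (ka\<^sup>2 / 8) * ta)"
 proof -
 have "ta * (ka\<^sup>2 / 8) + - a\<^sup>2 / 4 = - (ka\<^sup>2 / 8) * ta" using ta by (simp add: a_def power_mult_distrib field_simps)
 then have E: "exp (ta * (ka\<^sup>2 / 8)) * exp (- a\<^sup>2 / 4) = exp (- (ka\<^sup>2 / 8) * ta)" unfolding exp_add[symmetric] by simp
 show ?thesis unfolding b_def E[symmetric] by (simp only: mult_ac)
 qed
 also have "C * exp (- k * ta) + ?L * sqrt 2 * exp (- (ka\<^sup>2 / 8) * ta) <= C * exp (- k' * ta) + ?L * sqrt 2 * exp (- k' * ta)"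
 using C0 L0 k' ta by (intro add_mono mult_left_mono) auto
 finally show ?thesis by (simp add: distrib_right)
 qed
 then show ?thesis unfolding decay_def by blast
qed
then show ?thesis using ep'(1) k'(1) by blast
qed

lemma decay_gaussian:
assumes "ep > 0" "k > 0"
shows "\<exists>ep'>0. \<exists>k'>0. \<forall>F. adm F --> decay {} ep k F --> decay UNIV ep' k' F"
proof -
have "\<exists>ep'>0. \<exists>k'>0. \<forall>F. adm F --> decay {} ep k F --> decay A ep' k' F" if "finite A" for A
 using that
proof induction
 case empty
 show ?case using assms by blast
next
 case (insert j A)
 then obtain ep' k' where "ep' > 0" "k' > 0" and 1: "!!F. adm F ==> decay {} ep k F ==> decay A ep' k' F" by blast
 with decay_insert[of ep' k' j A] insert.hyps obtain ep'' k'' where "ep'' > 0" "k'' > 0"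
 "!!F. adm F ==> decay A ep' k' F ==> decay (insert j A) ep'' k'' F" by blast
 then show ?case using 1 by blast
qed
from this[OF finite] show ?thesis .
qed

end

text \<open>The exponential is expanded and integrated termwise; \<open>w\<close> is bounded where
  \<open>H\<close> is nonzero, so the series of integrals converges absolutely for every
  \<open>l\<close>.\<close>

lemma exp_integral_holomorphic:
fixes H w :: "'a => complex"
assumes H: "integrable M H" and w: "w \<in> borel_measurable M" and B: "!!x. x \<in> space M ==> H x ~= 0 ==> norm (w x) <= B"
shows "(%l. LINT x|M. H x * exp (l * w x)) holomorphic_on ball 0 R"
proof (rule power_series_holomorphic)
fix l :: complex
note [measurable] = borel_measurable_integrable[OF H] w
let ?f = "%n x. H x * ((l * w x) ^ n /\<^sub>R fact n)"
have nf: "norm (?f n x) <= ((norm l * B) ^ n / fact n) * norm (H x)" if "x \<in> space M" for n x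
proof (cases "H x = 0")
 case False
 have "norm (l * w x) ^ n <= (norm l * B) ^ n" using B[OF that False] by (intro power_mono) (auto simp: norm_mult intro: mult_left_mono)
 then have "norm (H x) * (norm (l * w x) ^ n / fact n) <= norm (H x) * ((norm l * B) ^ n / fact n)"
 by (intro mult_left_mono divide_right_mono) auto
 then show ?thesis by (simp add: norm_mult norm_power divide_inverse mult_ac)
qed simp
have ig: "integrable M (%x. ((norm l * B) ^ n / fact n) * norm (H x))" for n using H by simp
have i: "integrable M (?f n)" for n
 by (rule Bochner_Integration.integrable_bound[OF ig[of n]], measurable, rule AE_I2, rule order_trans[OF nf], assumption) (simp only: real_norm_def abs_ge_self)
have s1: "AE x in M. summable (%n. norm (?f n x))"
proof (rule AE_I2)
 fix x
 show "summable (%n. norm (?f n x))" unfolding norm_mult[of "H x"] by (intro summable_mult summable_norm_exp)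
qed
have s2: "summable (%n. LINT x|M. norm (?f n x))"
proof (rule summable_comparison_test')
 show "summable (%n. (norm l * B) ^ n /\<^sub>R fact n * (LINT x|M. norm (H x)))"
 by (intro summable_mult2 summable_exp_generic)
 show "norm (LINT x|M. norm (?f n x)) <= (norm l * B) ^ n /\<^sub>R fact n * (LINT x|M. norm (H x))" for n
 using integral_mono[OF integrable_norm[OF i[of n]] ig[of n] nf[of _ n]] by (simp add: divide_inverse mult_ac)
qed
have "(\<Sum>n. ?f n x) = H x * exp (l * w x)" for x
 using sums_mult[OF exp_converges[of "l * w x"], of "H x"] by (rule sums_unique[symmetric])
then have "(%n. LINT x|M. ?f n x) sums (LINT x|M. H x * exp (l * w x))"
 using sums_integral[OF i s1 s2] by simp
moreover have "(LINT x|M. ?f n x) = (LINT x|M. H x * (w x ^ n /\<^sub>R fact n)) * (l - 0) ^ n" for n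
 unfolding integral_mult_left_zero[symmetric] by (intro Bochner_Integration.integral_cong) (auto simp: power_mult_distrib)
ultimately show "(%n. (LINT x|M. H x * (w x ^ n /\<^sub>R fact n)) * (l - 0) ^ n) sums (LINT x|M. H x * exp (l * w x))" by simp
qed

text \<open>Maximum principle for g(l) / l^m on the annulus. The integer power replaces the
  logarithmic interpolation of Hadamard's theorem; in the application \<open>m\<close> is tied to
  the large parameter.\<close>

lemma three_circles:
fixes g :: "complex => complex"
assumes g: "g holomorphic_on ball 0 R" and r: "0 < r" "r < 1" "1 < R'" "R' < R"
 and A: "!!l. norm l <= r ==> norm (g l) <= A" and B: "!!l. norm l <= R' ==> norm (g l) <= B"
shows "norm (g 1) <= max (A / r ^ m) (B / R' ^ m)"
proof -
let ?S = "cball 0 R' - ball (0::complex) r"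
have cl: "closed ?S" by (intro closed_Diff) auto
have sub: "?S \<subseteq> ball 0 R - {0}" using r by auto
have h: "(%l. g l / l ^ m) holomorphic_on ball 0 R - {0}"
 by (intro holomorphic_intros holomorphic_on_subset[OF g]) auto
have "norm (g 1 / 1 ^ m) <= max (A / r ^ m) (B / R' ^ m)"
proof (rule maximum_modulus_frontier[where f="%l. g l / l ^ m" and S="?S"])
 show "(%l. g l / l ^ m) holomorphic_on interior ?S"
 by (rule holomorphic_on_subset[OF h order_trans[OF interior_subset sub]])
 show "continuous_on (closure ?S) (%l. g l / l ^ m)"
 unfolding closure_closed[OF cl] by (rule continuous_on_subset[OF holomorphic_on_imp_continuous_on[OF h] sub])
 show "bounded ?S" by (rule bounded_subset[OF bounded_cball]) blast
 show "1 \<in> ?S" using r by simp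
 fix z assume z: "z \<in> frontier ?S"
 then have zS: "z \<in> ?S" using frontier_subset_closed[OF cl] by blast
 have "z \<notin> ball 0 R' - cball 0 r"
 proof
 assume "z \<in> ball 0 R' - cball 0 r"
 moreover have "ball 0 R' - cball 0 r \<subseteq> interior ?S" by (rule interior_maximal) (auto intro: open_Diff)
 ultimately show False using z by (auto simp: frontier_def)
 qed
 then consider "norm z = r" | "norm z = R'" using zS by fastforce
 then show "norm (g z / z ^ m) <= max (A / r ^ m) (B / R' ^ m)"
 proof cases
 case 1
 then have "norm (g z / z ^ m) <= A / r ^ m" using A[of z] r by (simp add: norm_divide norm_power divide_right_mono)
 then show ?thesis by simp
 next
 case 2
 then have "norm (g z / z ^ m) <= B / R' ^ m" using B[of z] r by (simp add: norm_divide norm_power divide_right_mono)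
 then show ?thesis by simp
 qed
qed
then show ?thesis by simp
qed

context half_ball_map
begin

lemma adm_bounded: "adm F ==> x \<in> space M ==> F x ~= 0 ==> norm (Y x) <= 2 * s & e \<bullet> Y x <= 0"
proof -
assume F: "adm F" "x \<in> space M" "F x ~= 0"
then have b: "e \<bullet> Y x <= - (norm (Y x))\<^sup>2 / (2 * s)" by (simp add: adm_def)
have "- norm (Y x) <= e \<bullet> Y x" using Cauchy_Schwarz_ineq2[of e "Y x"] e by simp
then have "(norm (Y x))\<^sup>2 / (2 * s) <= norm (Y x)" using b by simp
then have "norm (Y x) * norm (Y x) <= norm (Y x) * (2 * s)" using s by (simp add: field_simps power2_eq_square)
then have "norm (Y x) <= 2 * s" using s by (cases "Y x = 0") auto
moreover have "0 <= (norm (Y x))\<^sup>2 / (2 * s)" using s by simp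
ultimately show ?thesis using b by simp
qed

text \<open>Three circles for the family with \<open>z\<close> on the complex line through \<open>ta e\<close> and \<open>2 ta p\<close>: the
decay near \<open>ta e\<close> beats the growth \<open>exp (ta rh\<^sup>2)\<close> on a disc reaching slightly beyond \<open>2 ta p\<close>.\<close>

lemma localized_decay:
assumes ep: "ep > 0" and k: "k > 0"
shows "\<exists>de>0. \<exists>be>0. \<exists>th. 0 < th & th < 1 & (\<forall>F. adm F --> decay UNIV ep k F -->
 (\<exists>C. \<forall>p m. norm p <= de --> m > 0 -->
 norm (LINT x|M. F x * of_real (exp (- (be * real m * (norm (Y x - p))\<^sup>2)))) <= C * th ^ m))"
proof -
\<comment> \<open>The coordinates of q - e are at most 2 in size, so 2 r <= ep keeps the small disc
  inside the region of decay.\<close>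
define r where "r = min (1 / 2) (ep / 2)"
have r: "0 < r" "r < 1" "2 * r <= ep" using ep by (auto simp: r_def)
\<comment> \<open>Chosen so that the decay exp(- k be m) equals r^(2 m): after the division by r^m
  in the three circles lemma a factor r^m is still left.\<close>
define be where "be = 2 * ln (1 / r) / k"
have be: "be > 0" using r k by (simp add: be_def)
\<comment> \<open>From (be + 1) rh < 1 follows be rh^2 < rh - rh^2 <= ln (1 + rh), so the growth
  factor exp(be rh^2) on the large circle stays below its radius 1 + rh.\<close>
define rh where "rh = 1 / (be + 2)"
have rh: "0 < rh" "rh <= 1" "(be + 1) * rh < 1" using be by (auto simp: rh_def field_simps)
define th where "th = max r (exp (be * rh\<^sup>2) / (1 + rh))"
define de where "de = rh / 4"
have "be * rh\<^sup>2 < rh - rh\<^sup>2" using mult_strict_right_mono[OF rh(3,1)] by (simp add: algebra_simps power2_eq_square)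
also have "... <= ln (1 + rh)" using rh by (intro ln_one_plus_pos_lower_bound) auto
finally have "exp (be * rh\<^sup>2) < 1 + rh" using rh by (metis exp_less_mono exp_ln add_pos_pos zero_less_one)
then have th: "0 < th" "th < 1" using r rh by (auto simp: th_def)
have "\<exists>C. \<forall>p m. norm p <= de --> m > 0 -->
 norm (LINT x|M. F x * of_real (exp (- (be * real m * (norm (Y x - p))\<^sup>2)))) <= C * th ^ m"
 if F: "adm F" and "decay UNIV ep k F" for F
proof -
 obtain C where C: "!!ta z. ta > 0 ==> (!!i. norm (z $ i - of_real (ta * e $ i)) <= ep * ta) ==>
 norm (LINT x|M. F x * exp (gauss UNIV ta z x)) <= C * exp (- k * ta)"
 using \<open>decay UNIV ep k F\<close> unfolding decay_def by blast
 have "0 <= C * exp (- k * 1)" by (rule order_trans[OF norm_ge_zero C[of 1 "\<chi> i. of_real (e $ i)"]]) (use ep in auto)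
 then have C0: "C >= 0" by (simp add: zero_le_mult_iff)
 let ?L = "LINT x|M. norm (F x)"
 have F': "integrable M F" using F by (simp add: adm_def)
 have L0: "?L >= 0" by simp
 have "norm (LINT x|M. F x * of_real (exp (- (be * real m * (norm (Y x - p))\<^sup>2)))) <= (C + ?L) * th ^ m"
 if p: "norm p <= de" and m: "m > 0" for p m
 proof -
 define ta where "ta = be * real m"
 have ta: "ta > 0" using be m by (simp add: ta_def)
 define q where "q = 2 *\<^sub>R p"
 have q: "norm q <= rh / 2" using p by (simp add: q_def de_def)
 \<comment> \<open>l = 0 gives ta e. At l = 1 the parameter is 2 ta p, and the exponent becomes ta
   |p|^2 - ta |Y - p|^2, a Gaussian centred at \<open>p\<close>.\<close>
 define z where "z l = (\<chi> i. of_real (ta * e $ i) + l * of_real (ta * (q $ i - e $ i)))" for l :: complex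
 define a where "a x = ta * (e \<bullet> Y x - (norm (Y x))\<^sup>2)" for x
 define b where "b x = ta * ((q - e) \<bullet> Y x)" for x
 have ab: "gauss UNIV ta (z l) x = of_real (a x) + l * of_real (b x)" for l x
 unfolding gauss_def cdot_def z_def a_def b_def power2_norm_eq_inner inner_vec_def
 by (simp add: algebra_simps sum.distrib sum_distrib_left sum_subtractf power2_eq_square)
 have [measurable]: "a \<in> borel_measurable M" "b \<in> borel_measurable M"
 unfolding a_def[abs_def] b_def[abs_def] using Y by measurable
 define g where "g l = (LINT x|M. F x * exp (gauss UNIV ta (z l) x))" for l
 \<comment> \<open>The linear terms are at most 2 rh |Y|: for Re l <= 1 the term with e . Y has the
   favourable sign, and beyond 1 it is at most rh |Y|. The Gaussian contributes - |Y|^2, and 2 rh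
   |Y| - |Y|^2 <= rh^2.\<close>
 have Re_le: "Re (gauss UNIV ta (z l) x) <= ta * rh\<^sup>2" if l: "norm l <= 1 + rh" and x: "x \<in> space M" "F x ~= 0" for l x
 proof -
 let ?t = "Re l" and ?n = "norm (Y x)"
 have t: "\<bar>?t\<bar> <= 1 + rh" using l abs_Re_le_cmod[of l] by simp
 have e0: "e \<bullet> Y x <= 0" and en: "\<bar>e \<bullet> Y x\<bar> <= ?n" using adm_bounded[OF F x] Cauchy_Schwarz_ineq2[of e "Y x"] e by auto
 have 1: "(1 - ?t) * (e \<bullet> Y x) <= rh * ?n"
 proof (cases "?t <= 1")
 case True
 then have "(1 - ?t) * (e \<bullet> Y x) <= 0" using e0 by (intro mult_nonneg_nonpos) auto
 then show ?thesis by (rule order_trans) (use rh(1) in simp)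
 next
 case False
 have "(1 - ?t) * (e \<bullet> Y x) = (?t - 1) * - (e \<bullet> Y x)" by (simp add: algebra_simps)
 also have "... <= rh * ?n" using False t en e0 rh(1) by (intro mult_mono) auto
 finally show ?thesis .
 qed
 have "?t * (q \<bullet> Y x) <= \<bar>?t\<bar> * \<bar>q \<bullet> Y x\<bar>" unfolding abs_mult[symmetric] by (rule abs_ge_self)
 also have "... <= 2 * (rh / 2 * ?n)"
 proof (intro mult_mono)
 show "\<bar>q \<bullet> Y x\<bar> <= rh / 2 * ?n" by (rule order_trans[OF Cauchy_Schwarz_ineq2 mult_right_mono[OF q]]) simp
 qed (use t rh in auto)
 finally have 2: "?t * (q \<bullet> Y x) <= rh * ?n" by simp
 have 3: "2 * (rh * ?n) <= ?n\<^sup>2 + rh\<^sup>2" using zero_le_power2[of "?n - rh"] by (simp add: power2_diff mult_ac)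
 have "Re (gauss UNIV ta (z l) x) = ta * ((1 - ?t) * (e \<bullet> Y x) + ?t * (q \<bullet> Y x) - ?n\<^sup>2)"
 unfolding ab by (simp add: a_def b_def inner_diff_left algebra_simps)
 also have "... <= ta * rh\<^sup>2" using 1 2 3 ta by (intro mult_left_mono) auto
 finally show ?thesis .
 qed
 have gB: "norm (g l) <= exp (ta * rh\<^sup>2) * ?L" if "norm l <= 1 + rh" for l
 unfolding g_def by (rule integrable_exp_weight(2)[OF F' gauss_measurable]) (rule Re_le[OF that])
 have gA: "norm (g l) <= C * exp (- k * ta)" if l: "norm l <= r" for l
 unfolding g_def
 proof (rule C[OF ta])
 fix i
 have "\<bar>q $ i - e $ i\<bar> <= 2" using component_le_norm_cart[of q i] component_le_norm_cart[of e i] q rh e by linarith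
 then have "norm l * (ta * \<bar>q $ i - e $ i\<bar>) <= r * (ta * 2)" using l ta r by (intro mult_mono) auto
 also have "... <= ep * ta" using r(3) ta mult_right_mono[OF r(3), of ta] by (simp add: mult_ac)
 finally show "norm (z l $ i - of_real (ta * e $ i)) <= ep * ta"
 using ta by (simp add: z_def norm_mult abs_mult del: of_real_mult of_real_diff)
 qed
 \<comment> \<open>The radius 3 only has to exceed that of the large circle, 1 + rh <= 2.\<close>
 have hol: "g holomorphic_on ball 0 3"
 proof -
 have "integrable M (%x. F x * exp (gauss UNIV ta (z 0) x))"
 by (rule integrable_exp_weight(1)[OF F' gauss_measurable]) (rule Re_le, use rh in auto)
 then have H: "integrable M (%x. F x * exp (of_real (a x)))" unfolding ab by simp
 have "norm (complex_of_real (b x)) <= ta * (norm (q - e) * (2 * s))" if x: "x \<in> space M" "F x * exp (of_real (a x)) ~= 0" for x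
 proof -
 have "\<bar>(q - e) \<bullet> Y x\<bar> <= norm (q - e) * norm (Y x)" by (rule Cauchy_Schwarz_ineq2)
 also have "... <= norm (q - e) * (2 * s)" using adm_bounded[OF F x(1)] x(2) by (intro mult_left_mono) auto
 finally show ?thesis using ta unfolding b_def norm_of_real abs_mult by simp
 qed
 from exp_integral_holomorphic[OF H _ this] show ?thesis
 unfolding g_def[abs_def] ab exp_add by (simp add: mult.assoc)
 qed
 have kt: "exp (- k * ta) = r ^ m * r ^ m"
 proof -
 have "- k * ta = real (m + m) * ln r" using k r by (simp add: ta_def be_def ln_div)
 then show ?thesis using r exp_of_nat_mult[of "m + m" "ln r"] by (simp add: power_add)
 qed
 have er: "exp (ta * rh\<^sup>2) = exp (be * rh\<^sup>2) ^ m" unfolding ta_def by (simp add: exp_of_nat_mult[symmetric] mult_ac)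
 have g1: "norm (g 1) <= max (C * (r ^ m * r ^ m) / r ^ m) (exp (be * rh\<^sup>2) ^ m * ?L / (1 + rh) ^ m)"
 unfolding kt[symmetric] er[symmetric] by (rule three_circles[OF hol r(1,2) _ _ gA gB]) (use rh in auto)
 have "r ^ m <= th ^ m" using r by (intro power_mono) (auto simp: th_def)
 then have "C * (r ^ m * r ^ m) / r ^ m <= C * th ^ m" using r C0 by (simp add: mult_left_mono)
 moreover have "exp (be * rh\<^sup>2) ^ m * ?L / (1 + rh) ^ m <= ?L * th ^ m"
 proof -
 have "(exp (be * rh\<^sup>2) / (1 + rh)) ^ m <= th ^ m" using rh by (intro power_mono) (auto simp: th_def)
 then have "?L * (exp (be * rh\<^sup>2) / (1 + rh)) ^ m <= ?L * th ^ m" by (intro mult_left_mono) auto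
 then show ?thesis by (simp add: power_divide mult_ac)
 qed
 moreover have "0 <= C * th ^ m" "0 <= ?L * th ^ m" using C0 th by auto
 ultimately have g2: "norm (g 1) <= (C + ?L) * th ^ m" using g1 by (simp add: distrib_right)
 have g3: "gauss UNIV ta (z 1) x = of_real (ta * (norm p)\<^sup>2) + of_real (- (ta * (norm (Y x - p))\<^sup>2))" for x
 unfolding ab a_def b_def q_def power2_norm_eq_inner
 by (simp add: inner_diff_left inner_diff_right inner_commute algebra_simps)
 have "g 1 = of_real (exp (ta * (norm p)\<^sup>2)) * (LINT x|M. F x * of_real (exp (- (ta * (norm (Y x - p))\<^sup>2))))"
 unfolding g_def g3 exp_add exp_of_real integral_mult_right_zero[symmetric] by (simp only: mult_ac)
 then have "norm (g 1) = exp (ta * (norm p)\<^sup>2) * norm (LINT x|M. F x * of_real (exp (- (ta * (norm (Y x - p))\<^sup>2))))"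
 by (simp add: norm_mult)
 moreover have "1 <= exp (ta * (norm p)\<^sup>2)" using ta by simp
 ultimately have "norm (LINT x|M. F x * of_real (exp (- (ta * (norm (Y x - p))\<^sup>2)))) <= norm (g 1)"
 using mult_right_mono[of 1 "exp (ta * (norm p)\<^sup>2)" "norm (LINT x|M. F x * of_real (exp (- (ta * (norm (Y x - p))\<^sup>2))))"] by simp
 then show ?thesis using g2 unfolding ta_def by linarith
 qed
 then show ?thesis by blast
qed
moreover have "de > 0" using rh by (simp add: de_def)
ultimately show ?thesis using be th by blast
qed

end

section \<open>From Gaussian averages to integrals over compact sets\<close>

lemma integrable_gaussian: "integrable lborel (%q::real^'n::finite. exp (- (norm q)\<^sup>2))"
proof (rule integrableI_nonneg)
have p: "exp (- (norm q)\<^sup>2) = (\<Prod>b\<in>Basis. exp (- (q \<bullet> b)\<^sup>2))" for q :: "real^'n"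
 by (subst euclidean_inner[of q q, folded power2_norm_eq_inner]) (simp add: exp_sum[symmetric] sum_negf power2_eq_square)
have "integrable lborel (%x::real. exp (- x\<^sup>2))"
 using integrable_mult_right[OF integrable_normal_density[of "1 / sqrt 2" 0], of "sqrt pi"] by (simp add: normal_density_def power_divide)
then have f: "(\<integral>\<^sup>+x. ennreal (exp (- x\<^sup>2)) \<partial>(lborel :: real measure)) < \<infinity>" by (subst nn_integral_eq_integral) auto
have "(\<integral>\<^sup>+q. ennreal (exp (- (norm q)\<^sup>2)) \<partial>(lborel :: (real^'n) measure)) = (\<integral>\<^sup>+q. (\<Prod>b\<in>Basis. ennreal (exp (- (q \<bullet> b)\<^sup>2))) \<partial>(lborel :: (real^'n) measure))"
 unfolding p by (simp add: prod_ennreal)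
also have "... = (\<Prod>b\<in>(Basis :: (real^'n) set). \<integral>\<^sup>+x. ennreal (exp (- x\<^sup>2)) \<partial>lborel)" by (rule nn_integral_lborel_prod) auto
also have "... < \<infinity>" using f by (simp add: power_less_top_ennreal)
finally show "(\<integral>\<^sup>+q. ennreal (exp (- (norm q)\<^sup>2)) \<partial>(lborel :: (real^'n) measure)) < \<infinity>" .
qed auto

lemma lborel_integral_affine:
fixes f :: "real^'n::finite => real"
assumes c: "c > 0" and f[measurable]: "f \<in> borel_measurable borel"
shows "(LINT p|lborel. f p) = c ^ CARD('n) * (LINT q|lborel. f (y + c *\<^sub>R q))"
proof -
have "(LINT p|lborel. f p) = (LINT p|density (distr lborel borel (%x. y + c *\<^sub>R x)) (%_. ennreal (c ^ CARD('n))). f p)"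
 using c by (subst lborel_affine[of c y]) (simp_all add: ennreal_power)
also have "... = (LINT p|distr lborel borel (%x. y + c *\<^sub>R x). c ^ CARD('n) *\<^sub>R f p)"
 using c by (intro integral_density) auto
also have "... = (LINT q|lborel. c ^ CARD('n) *\<^sub>R f (y + c *\<^sub>R q))" by (intro integral_distr) auto
finally show ?thesis by simp
qed

lemma gaussian_average_tendsto:
fixes fi :: "real^'n::finite => real"
assumes fi: "continuous_on UNIV fi" and B: "!!p. \<bar>fi p\<bar> <= B" and si: "si \<longlonglongrightarrow> 0"
shows "(%k. LINT q|lborel. fi (y + si k *\<^sub>R q) * exp (- (norm q)\<^sup>2))
 \<longlonglongrightarrow> fi y * (LINT q|(lborel :: (real^'n) measure). exp (- (norm q)\<^sup>2))"
proof -
have [measurable]: "fi \<in> borel_measurable borel" by (rule borel_measurable_continuous_onI[OF fi])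
have "(%k. LINT q|lborel. fi (y + si k *\<^sub>R q) * exp (- (norm q)\<^sup>2))
 \<longlonglongrightarrow> (LINT q|(lborel :: (real^'n) measure). fi y * exp (- (norm q)\<^sup>2))"
proof (rule integral_dominated_convergence[where w="%q::real^'n. B * exp (- (norm q)\<^sup>2)"])
 show "integrable lborel (%q::real^'n. B * exp (- (norm q)\<^sup>2))" by (intro integrable_mult_right integrable_gaussian)
 have "(%k. fi (y + si k *\<^sub>R q) * exp (- (norm q)\<^sup>2)) \<longlonglongrightarrow> fi (y + 0 *\<^sub>R q) * exp (- (norm q)\<^sup>2)" for q
 by (intro tendsto_mult continuous_on_tendsto_compose[OF fi] tendsto_intros si) auto
 then show "AE q in lborel. (%k. fi (y + si k *\<^sub>R q) * exp (- (norm q)\<^sup>2)) \<longlonglongrightarrow> fi y * exp (- (norm q)\<^sup>2)" by simp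
 show "AE q in lborel. norm (fi (y + si k *\<^sub>R q) * exp (- (norm q)\<^sup>2)) <= B * exp (- (norm q)\<^sup>2)" for k
 using B by (auto simp: abs_mult intro!: mult_right_mono)
qed measurable
then show ?thesis by simp
qed

context half_ball_map
begin

text \<open>Averages of \<open>fi\<close> against Gaussians of width 1 / sqrt(be m) converge to a
  positive multiple of \<open>fi\<close>. By Fubini their integrals against \<open>F\<close> are
  averages of the localized integrals, hence bounded by th^m times a power of m, and tend to
  0.\<close>

lemma test_function_vanishes:
fixes F :: "'a => complex" and fi :: "real^'n => real"
assumes F: "integrable M F" and fi: "continuous_on UNIV fi" "!!p. \<bar>fi p\<bar> <= B" "!!p. fi p ~= 0 ==> norm p <= de"
 and be: "be > 0" and th: "0 < th" "th < 1"
 and est: "!!p m. norm p <= de ==> m > 0 ==>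
 norm (LINT x|M. F x * of_real (exp (- (be * real m * (norm (Y x - p))\<^sup>2)))) <= C * th ^ m"
shows "(LINT x|M. F x * of_real (fi (Y x))) = 0"
proof -
note [measurable] = borel_measurable_integrable[OF F] Y
have [measurable]: "fi \<in> borel_measurable borel" by (rule borel_measurable_continuous_onI[OF fi(1)])
define K where "K = (LINT q|(lborel :: (real^'n) measure). exp (- (norm q)\<^sup>2))"
\<comment> \<open>Only squares are used, so that sqrt(m) is the integer k + 1 and the widths have a
  closed form.\<close>
define m where "m k = (Suc k)\<^sup>2" for k
define si where "si k = 1 / (sqrt be * real (Suc k))" for k
have si0: "si k > 0" for k using be by (simp add: si_def)
have sim: "be * real (m k) * (si k)\<^sup>2 = 1" for k using be by (simp add: si_def m_def power_divide power_mult_distrib)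
have si: "si \<longlonglongrightarrow> 0"
 using tendsto_mult_right_zero[OF LIMSEQ_inverse_real_of_nat, of "1 / sqrt be"] by (simp add: si_def[abs_def] divide_inverse mult_ac)
define I where "I k y = (LINT q|lborel. fi (y + si k *\<^sub>R q) * exp (- (norm q)\<^sup>2))" for k y
have Im[measurable]: "I k \<in> borel_measurable borel" for k unfolding I_def[abs_def] by measurable
have iq: "integrable lborel (%q. fi (y + c *\<^sub>R q) * exp (- (norm q)\<^sup>2))" for y c
 by (rule Bochner_Integration.integrable_bound[OF integrable_mult_right[OF integrable_gaussian, of B]], measurable, rule AE_I2)
 (use fi(2) in \<open>auto simp: abs_mult intro!: mult_right_mono intro: order_trans[OF _ abs_ge_self]\<close>)
have Ib: "\<bar>I k y\<bar> <= B * K" for k y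
proof -
 have "norm (I k y) <= (LINT q|lborel. norm (fi (y + si k *\<^sub>R q) * exp (- (norm q)\<^sup>2)))" unfolding I_def by (rule integral_norm_bound)
 also have "... <= (LINT q|(lborel :: (real^'n) measure). B * exp (- (norm q)\<^sup>2))"
 using fi(2) by (intro integral_mono integrable_norm iq integrable_mult_right integrable_gaussian) (auto simp: abs_mult intro!: mult_right_mono)
 finally show ?thesis by (simp add: K_def)
qed
have lim: "(%k. LINT x|M. F x * of_real (I k (Y x))) \<longlonglongrightarrow> (LINT x|M. F x * of_real (fi (Y x) * K))"
proof (rule integral_dominated_convergence[where w="%x. norm (F x) * (B * K)"])
 show "integrable M (%x. norm (F x) * (B * K))" using F by simp
 have "(%k. F x * of_real (I k (Y x))) \<longlonglongrightarrow> F x * of_real (fi (Y x) * K)" for x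
 unfolding I_def K_def by (intro tendsto_intros gaussian_average_tendsto[OF fi(1,2) si])
 then show "AE x in M. (%k. F x * of_real (I k (Y x))) \<longlonglongrightarrow> F x * of_real (fi (Y x) * K)" by simp
 show "AE x in M. norm (F x * of_real (I k (Y x))) <= norm (F x) * (B * K)" for k
 using Ib by (auto simp: norm_mult intro!: mult_left_mono)
qed measurable
have fii: "integrable lborel fi"
proof -
 have "integrable lborel (%p. indicator (cball 0 de) p *\<^sub>R fi p)"
 by (rule borel_integrable_compact[OF compact_cball continuous_on_subset[OF fi(1)]]) simp
 moreover have "indicator (cball 0 de) p *\<^sub>R fi p = fi p" for p using fi(3)[of p] by (auto simp: indicator_def)
 ultimately show ?thesis by (simp only:)
qed
interpret P: pair_sigma_finite M "lborel :: (real^'n) measure" ..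
let ?L = "LINT p|lborel. \<bar>fi p\<bar>"
have bound: "norm (LINT x|M. F x * of_real (I k (Y x))) <= (sqrt be * real (Suc k)) ^ CARD('n) * (C * th ^ m k * ?L)" for k
proof -
 let ?e = "%x p. exp (- (be * real (m k) * (norm (Y x - p))\<^sup>2))"
 let ?f = "%x p. F x * of_real (fi p * ?e x p)"
 have eb: "\<bar>fi p * ?e x p\<bar> <= \<bar>fi p\<bar>" for x p using be by (simp add: abs_mult mult_left_le)
 have pe: "integrable lborel (%p. fi p * ?e x p)" for x
 by (rule Bochner_Integration.integrable_bound[OF fii], measurable, rule AE_I2) (simp only: real_norm_def eb)
 have nf: "(LINT p|lborel. norm (?f x p)) <= norm (F x) * ?L" for x
 unfolding norm_mult norm_of_real integral_mult_right_zero
 by (intro mult_left_mono integral_mono eb integrable_abs pe fii) auto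
 have fm[measurable]: "(%(x, p). ?f x p) \<in> borel_measurable (M \<Otimes>\<^sub>M lborel)" by measurable
 have int: "integrable (M \<Otimes>\<^sub>M lborel) (%(x, p). ?f x p)"
 proof (rule P.Fubini_integrable[OF fm])
 show "integrable M (%x. LINT p|lborel. norm (case (x, p) of (x, p) => ?f x p))"
 unfolding prod.case
 proof (rule Bochner_Integration.integrable_bound)
 show "integrable M (%x. norm (F x) * ?L)" using F by simp
 show "AE x in M. norm (LINT p|lborel. norm (?f x p)) <= norm (norm (F x) * ?L)"
 using nf by (intro AE_I2) (simp add: abs_mult)
 qed measurable
 show "AE x in M. integrable lborel (%p. case (x, p) of (x, p) => ?f x p)"
 unfolding prod.case by (intro AE_I2 integrable_mult_right integrable_of_real pe)
 qed
 have I: "of_real (I k (Y x)) = of_real ((sqrt be * real (Suc k)) ^ CARD('n)) * (LINT p|lborel. complex_of_real (fi p * ?e x p))" for x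
 proof -
 have "(be * real (m k)) * (si k * norm q)\<^sup>2 = (norm q)\<^sup>2" for q :: "real^'n"
 using sim[of k] by (simp add: power_mult_distrib mult.assoc[symmetric])
 then have "(LINT p|lborel. fi p * ?e x p) = si k ^ CARD('n) * I k (Y x)"
 using lborel_integral_affine[OF si0, of "%p. fi p * ?e x p" k "Y x"] si0[of k] by (simp add: I_def)
 moreover have "(sqrt be * real (Suc k)) ^ CARD('n) * si k ^ CARD('n) = 1"
 using be unfolding power_mult_distrib[symmetric] by (simp add: si_def)
 ultimately have "I k (Y x) = (sqrt be * real (Suc k)) ^ CARD('n) * (LINT p|lborel. fi p * ?e x p)" by (simp add: mult.assoc[symmetric])
 then show ?thesis unfolding integral_complex_of_real by (simp only: of_real_mult)
 qed
 have "(LINT x|M. F x * of_real (I k (Y x))) = of_real ((sqrt be * real (Suc k)) ^ CARD('n)) * (LINT x|M. LINT p|lborel. ?f x p)"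
 unfolding I integral_mult_right_zero[symmetric] by (simp only: mult_ac)
 also have "(LINT x|M. LINT p|lborel. ?f x p) = (LINT p|lborel. LINT x|M. ?f x p)" by (rule P.Fubini_integral[OF int, symmetric])
 also have "... = (LINT p|lborel. of_real (fi p) * (LINT x|M. F x * of_real (?e x p)))"
 unfolding integral_mult_right_zero[symmetric] of_real_mult by (simp only: mult_ac)
 finally have eq: "(LINT x|M. F x * of_real (I k (Y x)))
 = of_real ((sqrt be * real (Suc k)) ^ CARD('n)) * (LINT p|lborel. of_real (fi p) * (LINT x|M. F x * of_real (?e x p)))" .
 have "norm (LINT p|lborel. of_real (fi p) * (LINT x|M. F x * of_real (?e x p))) <= (LINT p|lborel. C * th ^ m k * \<bar>fi p\<bar>)"
 proof (rule order_trans[OF integral_norm_bound integral_mono'])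
 show "integrable lborel (%p. C * th ^ m k * \<bar>fi p\<bar>)" using fii by simp
 have "C * th ^ m k >= 0" if "norm p <= de" for p :: "real^'n" using order_trans[OF norm_ge_zero est[OF that, of "m k"]] by (simp add: m_def)
 then show "0 <= C * th ^ m k * \<bar>fi p\<bar>" for p using fi(3)[of p] by (cases "fi p = 0") auto
 show "norm (of_real (fi p) * (LINT x|M. F x * of_real (?e x p))) <= C * th ^ m k * \<bar>fi p\<bar>" for p
 proof (cases "fi p = 0")
 case False
 have "m k > 0" by (simp add: m_def)
 from mult_left_mono[OF est[OF fi(3)[OF False] this], of "\<bar>fi p\<bar>"] show ?thesis by (simp add: norm_mult mult_ac)
 qed simp
 qed
 then have "norm (LINT p|lborel. of_real (fi p) * (LINT x|M. F x * of_real (?e x p))) <= C * th ^ m k * ?L" by simp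
 from mult_left_mono[OF this, of "(sqrt be * real (Suc k)) ^ CARD('n)"] show ?thesis
 using be by (simp only: eq norm_mult norm_of_real) (simp add: abs_mult)
qed
have "(%k. (sqrt be * real (Suc k)) ^ CARD('n) * (C * th ^ m k * ?L)) \<longlonglongrightarrow> 0"
proof (rule Lim_null_comparison)
 have "th ^ m k <= th ^ Suc k" for k using th by (intro power_decreasing) (auto simp: m_def power2_eq_square)
 then have "norm ((sqrt be * real (Suc k)) ^ CARD('n) * (C * th ^ m k * ?L)) <= (sqrt be ^ CARD('n) * \<bar>C\<bar> * ?L) * (real (Suc k) ^ CARD('n) * th ^ Suc k)" for k
 unfolding power_mult_distrib real_norm_def abs_mult
 using be th mult_left_mono[of "th ^ m k" "th ^ Suc k" "sqrt be ^ CARD('n) * real (Suc k) ^ CARD('n) * \<bar>C\<bar> * ?L"] by (simp add: mult_ac)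
 then show "\<forall>\<^sub>F k in sequentially. norm ((sqrt be * real (Suc k)) ^ CARD('n) * (C * th ^ m k * ?L)) <= (sqrt be ^ CARD('n) * \<bar>C\<bar> * ?L) * (real (Suc k) ^ CARD('n) * th ^ Suc k)" by simp
 have "(%k. real k ^ CARD('n) * th ^ k) \<longlonglongrightarrow> 0" using th by real_asymp
 from tendsto_mult_right_zero[OF LIMSEQ_Suc[OF this]]
 show "(%k. (sqrt be ^ CARD('n) * \<bar>C\<bar> * ?L) * (real (Suc k) ^ CARD('n) * th ^ Suc k)) \<longlonglongrightarrow> 0" .
qed
then have "(%k. LINT x|M. F x * of_real (I k (Y x))) \<longlonglongrightarrow> 0"
 by (rule Lim_null_comparison[rotated]) (use bound in auto)
with lim have "(LINT x|M. F x * of_real (fi (Y x) * K)) = 0" by (rule LIMSEQ_unique)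
then have "(LINT x|M. F x * of_real (fi (Y x))) * of_real K = 0" unfolding integral_mult_left_zero[symmetric] by (simp add: mult.assoc)
moreover have "K ~= 0"
proof
 assume "K = 0"
 moreover have "K = 0 \<longleftrightarrow> (AE q in (lborel :: (real^'n) measure). exp (- (norm q)\<^sup>2) = 0)"
 unfolding K_def by (rule integral_nonneg_eq_0_iff_AE[OF integrable_gaussian]) simp
 ultimately have "AE q in (lborel :: (real^'n) measure). False" by simp
 then show False by (simp add: trivial_limit_def[symmetric] ae_filter_eq_bot_iff)
qed
ultimately show ?thesis by simp
qed

text \<open>The indicator of a compact subset of the open ball is the bounded pointwise limit of
  continuous tent functions supported in the closed ball, to which
  \<open>test_function_vanishes\<close> applies.\<close>

lemma vanishing_on_compact:
assumes "ep > 0" "k > 0"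
shows "\<exists>de>0. \<forall>F. adm F --> decay {} ep k F -->
 (\<forall>L. compact L --> L \<subseteq> ball 0 de --> (LINT x|M. F x * indicator L (Y x)) = 0)"
proof -
obtain ep' k' where 1: "ep' > 0" "k' > 0" "!!F. adm F ==> decay {} ep k F ==> decay UNIV ep' k' F"
 using decay_gaussian[OF assms] by blast
obtain de be th where 2: "de > 0" "be > 0" "0 < th" "th < 1" "!!F. adm F ==> decay UNIV ep' k' F ==> \<exists>C. \<forall>p m. norm p <= de --> m > 0 -->
 norm (LINT x|M. F x * of_real (exp (- (be * real m * (norm (Y x - p))\<^sup>2)))) <= C * th ^ m"
 using localized_decay[OF 1(1,2)] by blast
have "(LINT x|M. F x * indicator L (Y x)) = 0"
 if F: "adm F" "decay {} ep k F" and L: "compact L" "L \<subseteq> ball 0 de" for F L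
proof (cases "L = {}")
 case False
 obtain C where C: "!!p m. norm p <= de ==> m > 0 ==>
 norm (LINT x|M. F x * of_real (exp (- (be * real m * (norm (Y x - p))\<^sup>2)))) <= C * th ^ m"
 using 2(5)[OF F(1) 1(3)[OF F]] by blast
 have F': "integrable M F" using F by (simp add: adm_def)
 note [measurable] = borel_measurable_integrable[OF F'] Y borel_closed[OF compact_imp_closed[OF L(1)]]
 obtain p0 where p0: "p0 \<in> L" "!!p. p \<in> L ==> norm p <= norm p0"
 using continuous_attains_sup[OF L(1) False continuous_on_norm_id] by blast
 define h where "h = de - norm p0"
 have h: "h > 0" using p0(1) L(2) by (auto simp: h_def)
 \<comment> \<open>The slope 1 / h is present already for m = 0, so each tent vanishes at distance
   \<open>h\<close> from \<open>L\<close> and beyond, hence outside the ball of radius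
   \<open>de\<close>.\<close>
 define fi where "fi m p = max 0 (1 - (real m + 1 / h) * infdist p L)" for m :: nat and p
 have c: "continuous_on UNIV (fi m)" for m unfolding fi_def[abs_def] by (intro continuous_intros)
 have b: "\<bar>fi m p\<bar> <= 1" for m p using h infdist_nonneg[of p L] by (simp add: fi_def)
 have sup: "norm p <= de" if "fi m p ~= 0" for m p
 proof -
 have "(real m + 1 / h) * infdist p L < 1" using that by (auto simp: fi_def max_def split: if_splits)
 then have "1 / h * infdist p L < 1" using mult_right_mono[of "1 / h" "real m + 1 / h" "infdist p L"] infdist_nonneg[of p L] by simp
 then have "infdist p L < h" using h by (simp add: field_simps)
 moreover obtain l where "l \<in> L" "infdist p L = dist p l" using infdist_attains_inf[OF compact_imp_closed[OF L(1)] False] by blast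
 ultimately show ?thesis using p0(2)[of l] norm_triangle_ineq2[of p l] by (simp add: h_def dist_norm)
 qed
 have z: "(LINT x|M. F x * of_real (fi m (Y x))) = 0" for m
 by (rule test_function_vanishes[OF F' c b sup 2(2-4) C])
 have "(%m. LINT x|M. F x * of_real (fi m (Y x))) \<longlonglongrightarrow> (LINT x|M. F x * indicator L (Y x))"
 proof (rule integral_dominated_convergence[where w="%x. norm (F x)"])
 show "integrable M (%x. norm (F x))" using F' by simp
 have [measurable]: "fi m \<in> borel_measurable borel" for m by (rule borel_measurable_continuous_onI[OF c])
 show "(%x. F x * of_real (fi m (Y x))) \<in> borel_measurable M" for m by measurable
 have "(%m. fi m p) \<longlonglongrightarrow> indicator L p" for p
 proof (cases "p \<in> L")
 case True
 then show ?thesis by (simp add: fi_def)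
 next
 case False
 then have d: "infdist p L > 0" using in_closed_iff_infdist_zero[OF compact_imp_closed[OF L(1)] \<open>L ~= {}\<close>, of p] infdist_nonneg[of p L] by linarith
 obtain m0 :: nat where m0: "1 / infdist p L < real m0" using reals_Archimedean2 by blast
 have "fi m p = 0" if "m >= m0" for m
 proof -
 have "1 / infdist p L <= real m + 1 / h" using m0 that h by (smt (verit) of_nat_mono zero_less_divide_1_iff)
 then show ?thesis using d by (simp add: fi_def field_simps)
 qed
 then have "eventually (%m. fi m p = 0) sequentially" by (auto simp: eventually_sequentially)
 then show ?thesis using False by (simp add: tendsto_eventually)
 qed
 then have "(%m. F x * of_real (fi m (Y x))) \<longlonglongrightarrow> F x * of_real (indicator L (Y x))" for x by (intro tendsto_intros)
 moreover have "of_real (indicator L p) = (indicator L p :: complex)" for p by (simp add: indicator_def)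
 ultimately show "AE x in M. (%m. F x * of_real (fi m (Y x))) \<longlonglongrightarrow> F x * indicator L (Y x)"
 by (intro AE_I2) (simp only:)
 show "AE x in M. norm (F x * of_real (fi m (Y x))) <= norm (F x)" for m
 using b by (auto simp: norm_mult mult_left_le)
 qed measurable
 then show ?thesis unfolding z using LIMSEQ_unique[OF tendsto_const] by metis
qed simp
then show ?thesis using 2(1) by blast
qed

end

section \<open>Products of harmonic functions near a boundary point\<close>

lemma sigma_finite_lebesgue: "sigma_finite_measure (lebesgue :: 'a::euclidean_space measure)"
proof (rule sigma_finite_measure.intro, intro exI conjI ballI)
show "countable (range (%n. cball (0::'a) (real n)))" by simp
show "range (%n. cball (0::'a) (real n)) \<subseteq> sets lebesgue" by auto
show "\<Union> (range (%n. cball (0::'a) (real n))) = space lebesgue"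
 using real_arch_simple by (auto simp: mem_cball)
show "emeasure lebesgue A ~= \<infinity>" if "A \<in> range (%n. cball (0::'a) (real n))" for A
 using that emeasure_compact_finite[of A] by (auto simp: less_top)
qed

text \<open>Up to a null set, the part of \<open>S\<close> where a real linear functional of
  \<open>F\<close> is positive is a countable union of compact sets, and on each of these a positive
  function has integral 0. The functionals used are plus and minus the real and imaginary
  parts.\<close>

lemma AE_zero_if_compact_integrals_zero:
fixes F :: "'a::euclidean_space => complex"
assumes F: "integrable lebesgue F" and S: "S \<in> sets lebesgue"
 and K: "!!K. compact K ==> K \<subseteq> S ==> (LINT x|lebesgue. F x * indicator K x) = 0"
shows "AE x in lebesgue. x \<in> S --> F x = 0"
proof -
have pos: "AE x in lebesgue. x \<in> S --> h (F x) <= 0" if h: "bounded_linear h" for h :: "complex => real"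
proof -
 have hF: "integrable lebesgue (%x. h (F x))" by (rule integrable_bounded_linear[OF h F])
 note [measurable] = borel_measurable_integrable[OF hF]
 have "{x. h (F x) > 0} \<in> sets lebesgue" using measurable_sets[OF borel_measurable_integrable[OF hF], of "{0<..}"] by (simp add: vimage_def)
 then have E: "S \<inter> {x. h (F x) > 0} \<in> sets lebesgue" using S by blast
 obtain C T where CT: "fsigma C" "T \<in> null_sets lebesgue" "C \<union> T = S \<inter> {x. h (F x) > 0}" by (rule lebesgue_set_almost_fsigma[OF E]) (rule that)
 obtain K where K': "range K \<subseteq> Collect compact" "C = \<Union> (range (K :: nat => 'a set))" using CT(1) unfolding fsigma_Union_compact by (elim exE conjE) (rule that)
 have "AE x in lebesgue. x \<notin> K i" for i
 proof -
 have Ki: "compact (K i)" "K i \<subseteq> S" "!!x. x \<in> K i ==> h (F x) > 0" using K' CT(3) by auto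
 have ms: "K i \<in> sets lebesgue" using Ki(1) by (intro sets_completionI_sets) (simp add: borel_compact)
 have ri: "F x * indicator (K i) x = indicator (K i) x *\<^sub>R F x" for x by (simp add: indicator_def)
 have i: "integrable lebesgue (%x. F x * indicator (K i) x)"
 unfolding ri by (rule integrable_mult_indicator[OF ms F])
 have hi: "h (F x * indicator (K i) x) = h (F x) * indicator (K i) x" for x
 by (simp add: indicator_def linear_0[OF bounded_linear.linear[OF h]])
 have "(LINT x|lebesgue. h (F x * indicator (K i) x)) = 0"
 using integral_bounded_linear[OF h i] K[OF Ki(1,2)] linear_0[OF bounded_linear.linear[OF h]] by simp
 moreover have "(LINT x|lebesgue. h (F x * indicator (K i) x)) = 0 \<longleftrightarrow> (AE x in lebesgue. h (F x * indicator (K i) x) = 0)"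
 by (rule integral_nonneg_eq_0_iff_AE[OF integrable_bounded_linear[OF h i]], unfold hi, rule AE_I2)
 (use Ki(3) in \<open>auto simp: indicator_def less_imp_le\<close>)
 ultimately have "AE x in lebesgue. h (F x * indicator (K i) x) = 0" by (simp only: simp_thms)
 then have "AE x in lebesgue. h (F x) * indicator (K i) x = 0" unfolding hi .
 then show ?thesis by (rule eventually_mono) (auto simp: indicator_def dest: Ki(3))
 qed
 then have "AE x in lebesgue. \<forall>i. x \<notin> K i" by (simp add: AE_all_countable)
 moreover have "AE x in lebesgue. x \<notin> T" by (rule AE_not_in[OF CT(2)])
 ultimately show ?thesis
 proof eventually_elim
 case (elim x)
 then have "x \<notin> C \<union> T" using K'(2) by auto
 then show ?case unfolding CT(3) by (auto simp: not_less)
 qed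
qed
show ?thesis
 using pos[OF bounded_linear_Re] pos[OF bounded_linear_minus[OF bounded_linear_Re]]
 pos[OF bounded_linear_Im] pos[OF bounded_linear_minus[OF bounded_linear_Im]]
 by eventually_elim (auto simp: complex_eq_iff)
qed

text \<open>A vector near \<open>ta e\<close> is the sum of the two null vectors \<open>z / 2 \<plusminus> m\<close>, where \<open>m\<close> is the multiple of
\<open>- (z \<bullet> e2) e + (z \<bullet> e) e2\<close>, orthogonal to \<open>z\<close>, normalised by \<open>m \<bullet> m = - (z \<bullet> z) / 4\<close>.\<close>

lemma null_split:
fixes e e2 :: "real^'n::finite"
assumes e: "norm e = 1" "norm e2 = 1" "e \<bullet> e2 = 0" and eta: "eta > 0"
shows "\<exists>ep>0. \<forall>ta>0. \<forall>z::complex^'n. (\<forall>i. norm (z $ i - of_real (ta * e $ i)) <= ep * ta) -->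
 (\<exists>p q. (\<Sum>i\<in>UNIV. p $ i * p $ i) = 0 & (\<Sum>i\<in>UNIV. q $ i * q $ i) = 0 & z = p + q &
 (\<forall>i. \<bar>Re (p $ i) - ta / 2 * e $ i\<bar> <= eta * ta) & (\<forall>i. \<bar>Re (q $ i) - ta / 2 * e $ i\<bar> <= eta * ta))"
proof -
define E where "E = (\<chi> i. complex_of_real (e $ i))"
define A B Q where "A w = cdot w e" and "B w = cdot w e2" and "Q w = (\<Sum>i\<in>UNIV. w $ i * w $ i)" for w :: "complex^'n"
\<comment> \<open>At \<open>E\<close> the quotient under the root is 1, away from the branch cut, so
  \<open>S\<close> is continuous there with value i/2. Hence \<open>m w\<close> tends to (i/2) e2,
  which is purely imaginary: the splitting hardly changes real parts.\<close>
define S where "S w = \<i> / 2 * csqrt (Q w / ((A w)\<^sup>2 + (B w)\<^sup>2))" for w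
define m where "m w i = S w * (- B w * of_real (e $ i) + A w * of_real (e2 $ i))" for w i
have ee: "(\<Sum>i\<in>UNIV. complex_of_real (e $ i) * of_real (e $ i)) = 1"
 "(\<Sum>i\<in>UNIV. complex_of_real (e2 $ i) * of_real (e2 $ i)) = 1"
 "(\<Sum>i\<in>UNIV. complex_of_real (e $ i) * of_real (e2 $ i)) = 0"
 using e unfolding norm_eq_1 inner_vec_def by (simp_all only: of_real_mult[symmetric] of_real_sum[symmetric] inner_real_def of_real_eq_1_iff of_real_eq_0_iff)
have AE: "A E = 1" "B E = 0" "Q E = 1" using ee by (simp_all add: A_def B_def Q_def E_def cdot_def)
have id: "((%w. w $ i) \<longlongrightarrow> E $ i) (nhds E)" for i by (rule tendsto_vec_nth[OF filterlim_ident])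
have tA': "(A \<longlongrightarrow> A E) (nhds E)" and tB': "(B \<longlongrightarrow> B E) (nhds E)" and tQ': "(Q \<longlongrightarrow> Q E) (nhds E)"
 unfolding A_def[abs_def] B_def[abs_def] Q_def[abs_def] cdot_def by (rule tendsto_sum tendsto_mult id tendsto_const)+
note tA = tA'[unfolded AE] and tB = tB'[unfolded AE] and tQ = tQ'[unfolded AE]
have tD: "((%w. (A w)\<^sup>2 + (B w)\<^sup>2) \<longlongrightarrow> 1\<^sup>2 + 0\<^sup>2) (nhds E)" by (intro tendsto_intros tA tB)
have "((%w. csqrt (Q w / ((A w)\<^sup>2 + (B w)\<^sup>2))) \<longlongrightarrow> csqrt (1 / (1\<^sup>2 + 0\<^sup>2))) (nhds E)"
 by (rule isCont_tendsto_compose[OF _ tendsto_divide[OF tQ tD]]) (auto intro!: continuous_at_csqrt simp: complex_nonpos_Reals_iff)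
then have tS: "(S \<longlongrightarrow> \<i> / 2 * 1) (nhds E)" unfolding S_def[abs_def] by (intro tendsto_mult tendsto_const) simp
have "((%w. Re (m w i)) \<longlongrightarrow> Re (\<i> / 2 * 1 * (- 0 * of_real (e $ i) + 1 * of_real (e2 $ i)))) (nhds E)" for i
 unfolding m_def by (intro tendsto_intros tS tA tB)
then have "((%w. Re (m w i)) \<longlongrightarrow> 0) (nhds E)" for i by simp
then have "eventually (%w. dist (Re (m w i)) 0 < eta / 2) (nhds E)" for i by (rule tendstoD) (use eta in simp)
then have "eventually (%w. \<forall>i. \<bar>Re (m w i)\<bar> < eta / 2) (nhds E)" by (simp add: eventually_all_finite)
moreover have "eventually (%w. (A w)\<^sup>2 + (B w)\<^sup>2 ~= 0) (nhds E)" by (rule tendsto_imp_eventually_ne[OF tD]) simp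
ultimately have "eventually (%w. (\<forall>i. \<bar>Re (m w i)\<bar> < eta / 2) & (A w)\<^sup>2 + (B w)\<^sup>2 ~= 0) (nhds E)" by (rule eventually_conj)
then obtain d where d: "d > 0" "!!w. dist w E < d ==> (\<forall>i. \<bar>Re (m w i)\<bar> < eta / 2) & (A w)\<^sup>2 + (B w)\<^sup>2 ~= 0"
 unfolding eventually_nhds_metric by blast
\<comment> \<open>Coordinatewise closeness ep gives Euclidean distance at most n ep < d, as required
  by the neighbourhood of \<open>E\<close>.\<close>
define ep where "ep = min eta (d / (2 * real CARD('n)))"
have ep: "ep > 0" "ep <= eta" "real CARD('n) * ep < d"
proof -
 have "real CARD('n) * ep <= real CARD('n) * (d / (2 * real CARD('n)))" by (intro mult_left_mono) (auto simp: ep_def)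
 also have "... < d" using d by simp
 finally show "real CARD('n) * ep < d" .
qed (use d eta in \<open>auto simp: ep_def\<close>)
have "\<exists>p q. (\<Sum>i\<in>UNIV. p $ i * p $ i) = 0 & (\<Sum>i\<in>UNIV. q $ i * q $ i) = 0 & z = p + q &
 (\<forall>i. \<bar>Re (p $ i) - ta / 2 * e $ i\<bar> <= eta * ta) & (\<forall>i. \<bar>Re (q $ i) - ta / 2 * e $ i\<bar> <= eta * ta)"
 if ta: "ta > 0" and z: "!!i. norm (z $ i - of_real (ta * e $ i)) <= ep * ta" for ta and z :: "complex^'n"
proof -
 define w where "w = (\<chi> i. z $ i / of_real ta)"
 have zw: "z $ i = of_real ta * w $ i" for i using ta by (simp add: w_def)
 have wE: "norm (w $ i - E $ i) <= ep" for i
 proof -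
 have "norm (z $ i - of_real (ta * e $ i)) = ta * norm (w $ i - E $ i)"
 unfolding zw E_def using ta by (simp add: right_diff_distrib[symmetric] norm_mult)
 then show ?thesis using z[of i] ta by (simp add: mult.commute[of ep])
 qed
 have "dist w E <= (\<Sum>i\<in>UNIV. norm ((w - E) $ i))" unfolding dist_norm norm_vec_def by (rule L2_set_le_sum) simp
 also have "... <= (\<Sum>i\<in>(UNIV::'n set). ep)" using wE by (intro sum_mono) simp
 finally have dw: "(\<forall>i. \<bar>Re (m w i)\<bar> < eta / 2)" "(A w)\<^sup>2 + (B w)\<^sup>2 ~= 0" using d(2)[of w] ep(3) by auto
 have S2: "S w * S w * ((A w)\<^sup>2 + (B w)\<^sup>2) = - Q w / 4"
 proof -
 have 1: "S w * S w = - 1 / 4 * (csqrt (Q w / ((A w)\<^sup>2 + (B w)\<^sup>2)))\<^sup>2"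
 unfolding power2_eq_square[of "S w", symmetric] unfolding S_def power_mult_distrib power_divide by simp
 have "S w * S w * ((A w)\<^sup>2 + (B w)\<^sup>2) = - 1 / 4 * (Q w / ((A w)\<^sup>2 + (B w)\<^sup>2) * ((A w)\<^sup>2 + (B w)\<^sup>2))"
 unfolding 1 power2_csqrt by (rule mult.assoc)
 moreover have "Q w / ((A w)\<^sup>2 + (B w)\<^sup>2) * ((A w)\<^sup>2 + (B w)\<^sup>2) = Q w" using dw(2) by simp
 ultimately show ?thesis by (simp only:) simp
 qed
 have wm: "(\<Sum>i\<in>UNIV. w $ i * m w i) = 0"
 proof -
 have "(\<Sum>i\<in>UNIV. w $ i * m w i) = (\<Sum>i\<in>UNIV. (- S w * B w) * (w $ i * of_real (e $ i)) + (S w * A w) * (w $ i * of_real (e2 $ i)))"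
 unfolding m_def by (intro sum.cong) (simp_all add: algebra_simps)
 also have "... = (- S w * B w) * A w + (S w * A w) * B w"
 unfolding sum.distrib sum_distrib_left[symmetric] A_def B_def cdot_def ..
 finally show ?thesis by simp
 qed
 have mm: "(\<Sum>i\<in>UNIV. m w i * m w i) = - Q w / 4"
 proof -
 have "(\<Sum>i\<in>UNIV. m w i * m w i) = (\<Sum>i\<in>UNIV. (S w * S w * (B w)\<^sup>2) * (of_real (e $ i) * of_real (e $ i))
 + (- 2 * S w * S w * A w * B w) * (of_real (e $ i) * of_real (e2 $ i)) + (S w * S w * (A w)\<^sup>2) * (of_real (e2 $ i) * of_real (e2 $ i)))"
 unfolding m_def by (intro sum.cong) (simp_all add: algebra_simps power2_eq_square)
 also have "... = S w * S w * ((A w)\<^sup>2 + (B w)\<^sup>2)"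
 unfolding sum.distrib sum_distrib_left[symmetric] ee by (simp add: algebra_simps)
 finally show ?thesis using S2 by simp
 qed
 have null: "(\<Sum>i\<in>UNIV. (of_real ta * (w $ i / 2 + t * m w i)) * (of_real ta * (w $ i / 2 + t * m w i))) = 0" if "t * t = 1" for t :: complex
 proof -
 have "(\<Sum>i\<in>UNIV. (of_real ta * (w $ i / 2 + t * m w i)) * (of_real ta * (w $ i / 2 + t * m w i)))
 = (\<Sum>i\<in>UNIV. (of_real ta * of_real ta / 4) * (w $ i * w $ i) + (of_real ta * of_real ta * t) * (w $ i * m w i) + (of_real ta * of_real ta * (t * t)) * (m w i * m w i))"
 by (intro sum.cong) (simp_all add: field_simps)
 also have "... = (of_real ta * of_real ta / 4) * Q w + (of_real ta * of_real ta) * (- Q w / 4)"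
 unfolding sum.distrib sum_distrib_left[symmetric] wm mm that by (simp add: Q_def)
 finally show ?thesis by simp
 qed
 have close: "\<bar>Re (of_real ta * (w $ i / 2 + of_real t * m w i)) - ta / 2 * e $ i\<bar> <= eta * ta" if "\<bar>t\<bar> = 1" for i t
 proof -
 have "Re (of_real ta * (w $ i / 2 + of_real t * m w i)) - ta / 2 * e $ i = ta * ((Re (w $ i - E $ i)) / 2 + t * Re (m w i))"
 by (simp add: E_def field_simps)
 also have "\<bar>...\<bar> <= ta * (ep / 2 + eta / 2)"
 proof -
 have "\<bar>Re (w $ i - E $ i)\<bar> <= ep" using abs_Re_le_cmod wE order_trans by blast
 moreover have "\<bar>t * Re (m w i)\<bar> <= eta / 2" using spec[OF dw(1), of i] that by (simp add: abs_mult)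
 ultimately have "\<bar>(Re (w $ i - E $ i)) / 2 + t * Re (m w i)\<bar> <= ep / 2 + eta / 2" by linarith
 then show ?thesis using ta by (simp add: abs_mult)
 qed
 also have "... <= ta * eta" using ep(2) ta by (intro mult_left_mono) auto
 finally show ?thesis by (simp add: mult.commute)
 qed
 show ?thesis
 proof (intro exI conjI allI)
 show "(\<Sum>i\<in>UNIV. (\<chi> i. of_real ta * (w $ i / 2 + of_real 1 * m w i)) $ i * (\<chi> i. of_real ta * (w $ i / 2 + of_real 1 * m w i)) $ i) = (0::complex)"
 using null[of 1] by simp
 show "(\<Sum>i\<in>UNIV. (\<chi> i. of_real ta * (w $ i / 2 + of_real (-1) * m w i)) $ i * (\<chi> i. of_real ta * (w $ i / 2 + of_real (-1) * m w i)) $ i) = (0::complex)"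
 using null[of "-1"] by simp
 show "z = (\<chi> i. of_real ta * (w $ i / 2 + of_real 1 * m w i)) + (\<chi> i. of_real ta * (w $ i / 2 + of_real (-1) * m w i))"
 by (simp add: vec_eq_iff zw algebra_simps)
 qed (unfold vec_lambda_beta, rule close, simp, rule close, simp)
qed
then show ?thesis using ep(1) by blast
qed

text \<open>Expanding |Y|^2 with t = s^4 / |x - c|^2 reduces the second claim to t <= s^2: the
  inversion sends the exterior of the sphere into the ball that it bounds, which is then
  translated.\<close>

lemma inversion_estimates:
fixes c x0 x :: "real^'n::finite"
assumes s: "norm (x0 - c) = s" "s > 0" and x: "s <= norm (x - c)"
shows "norm (inversion c x0 x) = s * norm (x - x0) / norm (x - c)"
 and "((1 / s) *\<^sub>R (x0 - c)) \<bullet> inversion c x0 x <= - (norm (inversion c x0 x))\<^sup>2 / (2 * s)"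
proof -
let ?r = "norm (x - c)" and ?Y = "inversion c x0 x" and ?d = "(x - c) \<bullet> (x0 - c)"
have r: "?r > 0" using s x by linarith
have Y: "?Y = (s\<^sup>2 / ?r\<^sup>2) *\<^sub>R (x - c) - (x0 - c)" using s by (simp add: inversion_def)
have xx: "(norm (x - x0))\<^sup>2 = ?r\<^sup>2 - 2 * ?d + s\<^sup>2"
proof -
 have "x - x0 = (x - c) - (x0 - c)" by simp
 then have "(norm (x - x0))\<^sup>2 = (norm ((x - c) - (x0 - c)))\<^sup>2" by simp
 then show ?thesis unfolding s(1)[symmetric] power2_norm_eq_inner by (simp add: inner_diff_left inner_diff_right inner_commute algebra_simps)
qed
have "(norm ?Y)\<^sup>2 = (s\<^sup>2 / ?r\<^sup>2)\<^sup>2 * ?r\<^sup>2 - 2 * (s\<^sup>2 / ?r\<^sup>2) * ?d + s\<^sup>2"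
 unfolding Y s(1)[symmetric] power2_norm_eq_inner
 by (simp add: inner_diff_left inner_diff_right inner_commute power2_eq_square)
then have Y2: "(norm ?Y)\<^sup>2 = s ^ 4 / ?r\<^sup>2 - 2 * (s\<^sup>2 / ?r\<^sup>2) * ?d + s\<^sup>2" using r by (simp add: power2_eq_square power4_eq_xxxx)
have "(norm ?Y)\<^sup>2 = (s * norm (x - x0) / ?r)\<^sup>2"
 unfolding power_divide power_mult_distrib xx Y2 using r by (simp add: field_simps power2_eq_square power4_eq_xxxx)
then show "norm ?Y = s * norm (x - x0) / ?r" using s r power2_eq_iff_nonneg[of "norm ?Y" "s * norm (x - x0) / ?r"] by simp
define q t where "q = s\<^sup>2 / ?r\<^sup>2 * ?d" and "t = s ^ 4 / ?r\<^sup>2"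
have Yq: "(norm ?Y)\<^sup>2 = t - 2 * q + s\<^sup>2" unfolding Y2 q_def t_def by simp
have eY: "((1 / s) *\<^sub>R (x0 - c)) \<bullet> ?Y = (q - s\<^sup>2) / s"
 unfolding Y q_def by (simp add: inner_diff_right inner_commute s(1)[symmetric] power2_norm_eq_inner[symmetric] right_diff_distrib diff_divide_distrib)
have "t <= s\<^sup>2"
proof -
 have "s\<^sup>2 <= ?r\<^sup>2" using s x by (intro power_mono) auto
 then have "s\<^sup>2 * s\<^sup>2 <= s\<^sup>2 * ?r\<^sup>2" by (intro mult_left_mono) auto
 then show ?thesis unfolding t_def using r by (simp add: divide_le_eq power4_eq_xxxx power2_eq_square mult.assoc)
qed
then have "2 * (q - s\<^sup>2) <= - (norm ?Y)\<^sup>2" unfolding Yq by (linarith | simp add: algebra_simps | simp add: field_simps)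
then have d: "2 * (q - s\<^sup>2) / (2 * s) <= - (norm ?Y)\<^sup>2 / (2 * s)" using s(2) by (intro divide_right_mono) auto
then show "((1 / s) *\<^sub>R (x0 - c)) \<bullet> ?Y <= - (norm ?Y)\<^sup>2 / (2 * s)" unfolding eY
proof -
 have "(q - s\<^sup>2) / s = 2 * (q - s\<^sup>2) / (2 * s)" using s(2) by (simp add: field_simps)
 then show "(q - s\<^sup>2) / s <= - (norm ?Y)\<^sup>2 / (2 * s)" using d by (simp only:)
qed
qed

lemma inversion_inj:
fixes c x0 :: "real^'n::finite"
assumes "x0 ~= c" "x ~= c" "x' ~= c" "inversion c x0 x = inversion c x0 x'"
shows "x = x'"
proof -
let ?S = "(norm (x0 - c))\<^sup>2"
have eq: "(?S / (norm (x - c))\<^sup>2) *\<^sub>R (x - c) = (?S / (norm (x' - c))\<^sup>2) *\<^sub>R (x' - c)" using assms(4) by (simp add: inversion_def)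
have n: "norm ((?S / (norm (y - c))\<^sup>2) *\<^sub>R (y - c)) = ?S / norm (y - c)" for y by (simp add: power2_eq_square)
have "?S / norm (x - c) = ?S / norm (x' - c)" using arg_cong[OF eq, of norm] unfolding n .
then have "norm (x - c) = norm (x' - c)" using assms by (simp add: field_simps)
then show ?thesis using eq assms by simp
qed

text \<open>Each half of the null splitting has real part near (ta/2) e. Its Kelvin exponential is
  of size exp(- a ta) on the boundary away from \<open>x0\<close> and at most of size exp(a ta / 8)
  in the domain, so after correction the product is right up to cross terms of size exp(- 7 a ta /
  8).\<close>

lemma exponential_products:
fixes \<Omega> V :: "(real^'n::finite) set"
assumes card: "CARD('n) >= 2" and O: "bounded \<Omega>" "open \<Omega>" "smooth_boundary \<Omega>"
 and V: "openin (top_of_set (frontier \<Omega>)) V" "x0 \<in> V"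
 and s: "norm (x0 - c) = s" "s > 0" and far: "\<forall>x\<in>closure \<Omega>. s <= norm (x - c)"
defines "e \<equiv> (1 / s) *\<^sub>R (x0 - c)"
shows "\<exists>ep>0. \<exists>k>0. \<exists>P. \<forall>ta>0. \<forall>z. (\<forall>i. norm (z $ i - of_real (ta * e $ i)) <= ep * ta) -->
 (\<exists>u v. smooth_up_to_boundary \<Omega> u & harmonic_on \<Omega> u & (\<forall>x\<in>frontier \<Omega> - V. u x = 0) &
 smooth_up_to_boundary \<Omega> v & harmonic_on \<Omega> v & (\<forall>x\<in>frontier \<Omega> - V. v x = 0) &
 (\<forall>x\<in>\<Omega>. norm (u x * v x - of_real ((norm (x - c))\<^sup>2 powr (2 - real CARD('n))) * exp (cdot z (inversion c x0 x))) <= P * exp (- k * ta)))"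
proof -
let ?n = "real CARD('n)" and ?U = "- {c}" and ?Y = "inversion c x0"
note s = s far[rule_format]
have n0: "?n > 0" by simp
have e1: "norm e = 1" using s by (simp add: e_def)
obtain y where y: "y ~= 0" "orthogonal e y" using orthogonal_to_vector_exists[of e] card by auto
define e2 where "e2 = (1 / norm y) *\<^sub>R y"
have e2: "norm e2 = 1" "e \<bullet> e2 = 0" using y by (auto simp: e2_def orthogonal_def)
obtain T where T: "open T" "V = frontier \<Omega> \<inter> T" using V(1) by (auto simp: openin_open)
have x0: "x0 \<in> closure \<Omega>" using V(2) T(2) by (auto simp: frontier_def)
obtain rh0 where rh0: "rh0 > 0" "ball x0 rh0 \<subseteq> T" using T V(2) openE by blast
define rh where "rh = min rh0 (s / 2)"
have rh: "0 < rh" "rh < s" "ball x0 rh \<inter> frontier \<Omega> \<subseteq> V" using rh0 s(2) T(2) by (auto simp: rh_def)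
have cb: "cball x0 rh \<subseteq> ?U" using rh(2) s(1) by (auto simp: dist_norm)
have cU: "closure \<Omega> \<subseteq> ?U" using s by fastforce
obtain R0 where R0: "!!x. x \<in> closure \<Omega> ==> norm x <= R0" using bounded_closure[OF O(1)] by (auto simp: bounded_iff)
define R where "R = R0 + norm c"
have R: "norm (x - c) <= R" if "x \<in> closure \<Omega>" for x using R0[OF that] norm_triangle_ineq4[of x c] by (simp add: R_def)
have R_pos: "R > 0" using R[OF x0] s by linarith
\<comment> \<open>Lower bound for |Y| at boundary points whose distance from \<open>x0\<close> is at
  least rh/2.\<close>
define y0 where "y0 = s * (rh / 2) / R"
have y0: "y0 > 0" using s rh R_pos by (simp add: y0_def)
\<comment> \<open>Makes the linear error n eta |Y| at most half of the gain |Y|^2 / (4 s) once |Y|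
  >= y0; the other half is then at least \<open>a\<close>, defined next.\<close>
define eta where "eta = y0 / (8 * s * ?n)"
have eta: "eta > 0" "?n * eta = y0 / (8 * s)" using y0 s by (simp_all add: eta_def)
define a where "a = y0\<^sup>2 / (8 * s)"
have a: "a > 0" using y0 s by (simp add: a_def)
obtain ep where ep: "ep > 0" and split: "!!ta z. ta > 0 ==> (!!i. norm (z $ i - of_real (ta * e $ i)) <= ep * ta) ==>
 \<exists>p q. (\<Sum>i\<in>UNIV. p $ i * p $ i) = 0 & (\<Sum>i\<in>UNIV. q $ i * q $ i) = 0 & z = p + q &
 (\<forall>i. \<bar>Re (p $ i) - ta / 2 * e $ i\<bar> <= eta * ta) & (\<forall>i. \<bar>Re (q $ i) - ta / 2 * e $ i\<bar> <= eta * ta)"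
 using null_split[OF e1 e2 eta(1)] by meson
define p0 where "p0 = (s\<^sup>2) powr ((2 - ?n) / 2)"
have p0: "p0 > 0" using s by (simp add: p0_def)
have corr: "\<exists>u. smooth_up_to_boundary \<Omega> u & harmonic_on \<Omega> u & (\<forall>x\<in>frontier \<Omega> - V. u x = 0) &
 (\<forall>x\<in>\<Omega>. norm (u x - kelvin_exp c x0 p x) <= 2 * (p0 * exp (- a * ta)) & norm (kelvin_exp c x0 p x) <= p0 * exp (a / 8 * ta))"
 if ta: "ta > 0" and null: "(\<Sum>i\<in>UNIV. p $ i * p $ i) = 0" and p: "!!i. \<bar>Re (p $ i) - ta / 2 * e $ i\<bar> <= eta * ta" for ta p
proof -
 let ?G = "kelvin_exp c x0 p"
 have Re_le: "Re (cdot p (?Y x)) <= ta * (?n * eta * norm (?Y x) - (norm (?Y x))\<^sup>2 / (2 * (2 * s)))" if x: "x \<in> closure \<Omega>" for x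
 proof -
 have "Re (cdot p (?Y x)) = ta / 2 * (e \<bullet> ?Y x) + (\<Sum>i\<in>UNIV. (Re (p $ i) - ta / 2 * e $ i) * ?Y x $ i)"
 unfolding cdot_def inner_vec_def by (simp add: sum_distrib_left sum.distrib[symmetric] algebra_simps)
 also have "... <= ta / 2 * (- (norm (?Y x))\<^sup>2 / (2 * s)) + (\<Sum>i\<in>(UNIV::'n set). eta * ta * norm (?Y x))"
 proof (intro add_mono mult_left_mono sum_mono)
 show "e \<bullet> ?Y x <= - (norm (?Y x))\<^sup>2 / (2 * s)" unfolding e_def by (rule inversion_estimates(2)[OF s(1,2) s(3)[OF x]])
 fix i
 have "(Re (p $ i) - ta / 2 * e $ i) * ?Y x $ i <= \<bar>Re (p $ i) - ta / 2 * e $ i\<bar> * \<bar>?Y x $ i\<bar>" unfolding abs_mult[symmetric] by (rule abs_ge_self)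
 also have "... <= (eta * ta) * norm (?Y x)" by (intro mult_mono p component_le_norm_cart) (use ta eta in auto)
 finally show "(Re (p $ i) - ta / 2 * e $ i) * ?Y x $ i <= eta * ta * norm (?Y x)" .
 qed (use ta in auto)
 finally show ?thesis by (simp add: algebra_simps)
 qed
 have nG: "norm (?G x) <= p0 * exp b" if x: "x \<in> closure \<Omega>" and b: "Re (cdot p (?Y x)) <= b" for x b
 proof -
 have "(norm (x - c))\<^sup>2 powr ((2 - ?n) / 2) <= p0"
 unfolding p0_def using s(2) s(3)[OF x] card by (intro powr_mono2' power_mono) auto
 then show ?thesis unfolding kelvin_exp_def norm_mult norm_of_real norm_exp_eq_Re using b p0 by (intro mult_mono) auto
 qed
 have far: "norm (?G x) <= p0 * exp (- a * ta)" if x: "x \<in> frontier \<Omega>" "rh / 2 <= dist x0 x" for x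
 proof -
 have xc: "x \<in> closure \<Omega>" using x(1) by (simp add: frontier_def)
 have r: "norm (x - c) > 0" using s(2) s(3)[OF xc] by linarith
 have "y0 <= s * norm (x - x0) / norm (x - c)"
 unfolding y0_def using x(2) R[OF xc] r s(2) by (intro frac_le mult_left_mono) (auto simp: dist_norm norm_minus_commute)
 then have y: "y0 <= norm (?Y x)" unfolding inversion_estimates(1)[OF s(1,2) s(3)[OF xc]] .
 have "?n * eta * norm (?Y x) <= (norm (?Y x))\<^sup>2 / (8 * s)"
 unfolding eta(2) using mult_right_mono[OF y, of "norm (?Y x)"] s(2) by (simp add: field_simps power2_eq_square)
 moreover have "y0\<^sup>2 <= (norm (?Y x))\<^sup>2" using y y0 by (intro power_mono) auto
 then have "a <= (norm (?Y x))\<^sup>2 / (8 * s)" unfolding a_def using s(2) by (intro divide_right_mono) auto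
 ultimately have le: "?n * eta * norm (?Y x) - (norm (?Y x))\<^sup>2 / (2 * (2 * s)) <= - a" using s(2) by (simp add: field_simps)
 then have "Re (cdot p (?Y x)) <= - a * ta" using order_trans[OF Re_le[OF xc] mult_left_mono[OF le less_imp_le[OF ta]]] by (simp add: mult.commute)
 then show ?thesis by (rule nG[OF xc])
 qed
 have near: "norm (?G x) <= p0 * exp (a / 8 * ta)" if x: "x \<in> \<Omega>" for x
 proof (rule nG)
 show xc: "x \<in> closure \<Omega>" using x closure_subset by blast
 have "?n * eta * norm (?Y x) - (norm (?Y x))\<^sup>2 / (2 * (2 * s)) <= 2 * s * (?n * eta)\<^sup>2 / 2" using s(2) by (intro quadratic_bound) simp
 also have "... = a / 8" unfolding eta(2) a_def using s(2) by (simp add: power_divide field_simps power2_eq_square)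
 finally have le: "?n * eta * norm (?Y x) - (norm (?Y x))\<^sup>2 / (2 * (2 * s)) <= a / 8" .
 show "Re (cdot p (?Y x)) <= a / 8 * ta"
 using order_trans[OF Re_le[OF xc] mult_left_mono[OF le less_imp_le[OF ta]]] by (simp add: mult.commute)
 qed
 have "\<exists>u. smooth_up_to_boundary \<Omega> u & harmonic_on \<Omega> u & (\<forall>x\<in>frontier \<Omega> - V. u x = 0) &
 (\<forall>x\<in>\<Omega>. norm (u x - ?G x) <= 2 * (p0 * exp (- a * ta)))"
 proof (rule harmonic_correction[OF O _ cU kelvin_exp_harmonic(1)[OF null] _ rh(1) cb rh(3)])
 show "open ?U" by auto
 show "laplacian ?G x = 0" if "x \<in> \<Omega>" for x
 using kelvin_exp_harmonic(2)[OF null] that cU closure_subset by blast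
 show "0 <= p0 * exp (- a * ta)" using p0 by simp
 show "norm (?G x) <= p0 * exp (- a * ta)" if "x \<in> frontier \<Omega>" "rh / 2 <= dist x0 x" for x by (rule far[OF that])
 qed
 then show ?thesis using near by blast
qed
have "\<exists>u v. smooth_up_to_boundary \<Omega> u & harmonic_on \<Omega> u & (\<forall>x\<in>frontier \<Omega> - V. u x = 0) &
 smooth_up_to_boundary \<Omega> v & harmonic_on \<Omega> v & (\<forall>x\<in>frontier \<Omega> - V. v x = 0) &
 (\<forall>x\<in>\<Omega>. norm (u x * v x - of_real ((norm (x - c))\<^sup>2 powr (2 - ?n)) * exp (cdot z (?Y x))) <= 8 * p0\<^sup>2 * exp (- (a / 2) * ta))"
 if ta: "ta > 0" and z: "!!i. norm (z $ i - of_real (ta * e $ i)) <= ep * ta" for ta z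
proof -
 obtain p q where pq: "(\<Sum>i\<in>UNIV. p $ i * p $ i) = 0" "(\<Sum>i\<in>UNIV. q $ i * q $ i) = 0" "z = p + q"
 "!!i. \<bar>Re (p $ i) - ta / 2 * e $ i\<bar> <= eta * ta" "!!i. \<bar>Re (q $ i) - ta / 2 * e $ i\<bar> <= eta * ta"
 using split[OF ta z] by blast
 obtain u where u: "smooth_up_to_boundary \<Omega> u" "harmonic_on \<Omega> u" "\<forall>x\<in>frontier \<Omega> - V. u x = 0"
 "!!x. x \<in> \<Omega> ==> norm (u x - kelvin_exp c x0 p x) <= 2 * (p0 * exp (- a * ta))" "!!x. x \<in> \<Omega> ==> norm (kelvin_exp c x0 p x) <= p0 * exp (a / 8 * ta)"
 using corr[OF ta pq(1,4)] by blast
 obtain v where v: "smooth_up_to_boundary \<Omega> v" "harmonic_on \<Omega> v" "\<forall>x\<in>frontier \<Omega> - V. v x = 0"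
 "!!x. x \<in> \<Omega> ==> norm (v x - kelvin_exp c x0 q x) <= 2 * (p0 * exp (- a * ta))" "!!x. x \<in> \<Omega> ==> norm (kelvin_exp c x0 q x) <= p0 * exp (a / 8 * ta)"
 using corr[OF ta pq(2,5)] by blast
 have "norm (u x * v x - of_real ((norm (x - c))\<^sup>2 powr (2 - ?n)) * exp (cdot z (?Y x))) <= 8 * p0\<^sup>2 * exp (- (a / 2) * ta)" if x: "x \<in> \<Omega>" for x
 proof -
 let ?G = "kelvin_exp c x0 p x" and ?H = "kelvin_exp c x0 q x" and ?B = "p0 * exp (- a * ta)" and ?E = "p0 * exp (a / 8 * ta)"
 have cz: "cdot z (?Y x) = cdot p (?Y x) + cdot q (?Y x)" unfolding pq(3) cdot_def by (simp add: distrib_right sum.distrib)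
 have "(norm (x - c))\<^sup>2 powr (2 - ?n) = (norm (x - c))\<^sup>2 powr ((2 - ?n) / 2) * (norm (x - c))\<^sup>2 powr ((2 - ?n) / 2)"
 unfolding powr_add[symmetric] by simp
 then have GH: "of_real ((norm (x - c))\<^sup>2 powr (2 - ?n)) * exp (cdot z (?Y x)) = ?G * ?H"
 unfolding kelvin_exp_def cz exp_add by (simp only: of_real_mult mult_ac)
 have eq: "u x * v x - ?G * ?H = (u x - ?G) * (v x - ?H) + ((u x - ?G) * ?H + ?G * (v x - ?H))" by (simp add: algebra_simps)
 have "norm (u x * v x - ?G * ?H) <= norm (u x - ?G) * norm (v x - ?H) + (norm (u x - ?G) * norm ?H + norm ?G * norm (v x - ?H))"
 unfolding norm_mult[symmetric] by (subst eq) (rule order_trans[OF norm_triangle_ineq add_left_mono[OF norm_triangle_ineq]])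
 also have "... <= (2 * ?B) * (2 * ?B) + ((2 * ?B) * ?E + ?E * (2 * ?B))"
 using p0 by (intro add_mono mult_mono u(4,5)[OF x] v(4,5)[OF x]) auto
 also have "... = 4 * p0\<^sup>2 * exp (- 2 * a * ta) + 4 * p0\<^sup>2 * exp (- (7 / 8) * a * ta)"
 proof -
 have "exp (- a * ta) * exp (- a * ta) = exp (- 2 * a * ta)" "exp (- a * ta) * exp (a / 8 * ta) = exp (- (7 / 8) * a * ta)"
 unfolding exp_add[symmetric] by (simp_all add: field_simps)
 then show ?thesis by (simp add: power2_eq_square)
 qed
 also have "... <= 4 * p0\<^sup>2 * exp (- (a / 2) * ta) + 4 * p0\<^sup>2 * exp (- (a / 2) * ta)"
 using a ta by (intro add_mono mult_left_mono) (auto simp: field_simps)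
 finally show ?thesis unfolding GH by simp
 qed
 then show ?thesis using u(1-3) v(1-3) by blast
qed
moreover have "a / 2 > 0" using a by simp
ultimately show ?thesis using ep by blast
qed

theorem theorem2p1:
  fixes \<Omega> V :: "(real^'n::finite) set" and x0 :: "real^'n"
  assumes "CARD('n) \<ge> 2"
    and "bounded \<Omega>" and "open \<Omega>" and "smooth_boundary \<Omega>"
    and "x0 \<in> frontier \<Omega>"
    and "openin (top_of_set (frontier \<Omega>)) V" and "x0 \<in> V"
  shows "\<exists>\<delta>>0. \<forall>f. Linfty_on \<Omega> f \<and>
      (\<forall>u v :: real^'n \<Rightarrow> complex.
         smooth_up_to_boundary \<Omega> u \<and> harmonic_on \<Omega> u \<and> (\<forall>x\<in>frontier \<Omega> - V. u x = 0) \<and>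
         smooth_up_to_boundary \<Omega> v \<and> harmonic_on \<Omega> v \<and> (\<forall>x\<in>frontier \<Omega> - V. v x = 0) \<longrightarrow>
         (LINT x:\<Omega>|lebesgue. f x * u x * v x) = 0)
      \<longrightarrow> (AE x in lebesgue. x \<in> ball x0 \<delta> \<inter> \<Omega> \<longrightarrow> f x = 0)"
proof -
obtain c s where cs: "s > 0" "dist x0 c = s" "\<forall>x\<in>closure \<Omega>. x ~= x0 --> s < dist x c"
 using exterior_ball[OF assms(2-5)] by blast
have s12: "norm (x0 - c) = s" "s > 0" using cs by (auto simp: dist_norm)
have far: "\<forall>x\<in>closure \<Omega>. s <= norm (x - c)"
proof
 fix x assume "x \<in> closure \<Omega>"
 then show "s <= norm (x - c)" using cs(3) s12 by (cases "x = x0") (auto simp: dist_norm intro: less_imp_le)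
qed
note s = s12 far[rule_format]
define e where "e = (1 / s) *\<^sub>R (x0 - c)"
define Y where "Y = inversion c x0"
define w where "w x = (norm (x - c))\<^sup>2 powr (2 - real CARD('n))" for x
have Yb: "Y \<in> borel_measurable borel" unfolding Y_def inversion_def[abs_def] by measurable
have wb: "w \<in> borel_measurable borel" unfolding w_def[abs_def] by measurable
have Ym: "Y \<in> borel_measurable lebesgue" and wm[measurable]: "w \<in> borel_measurable lebesgue"
 by (rule measurable_completion, use Yb in simp, rule measurable_completion, use wb in simp)
interpret H: half_ball_map lebesgue Y e s
 by (intro half_ball_map.intro half_ball_map_axioms.intro sigma_finite_lebesgue Ym s(2)) (use s in \<open>simp add: e_def\<close>)
obtain \<epsilon> k P where \<epsilon>k: "\<epsilon> > 0" "k > 0" and prods: "\<forall>\<tau>>0. \<forall>z. (\<forall>i. norm (z $ i - of_real (\<tau> * e $ i)) <= \<epsilon> * \<tau>) -->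
 (\<exists>u v. smooth_up_to_boundary \<Omega> u & harmonic_on \<Omega> u & (\<forall>x\<in>frontier \<Omega> - V. u x = 0) &
 smooth_up_to_boundary \<Omega> v & harmonic_on \<Omega> v & (\<forall>x\<in>frontier \<Omega> - V. v x = 0) &
 (\<forall>x\<in>\<Omega>. norm (u x * v x - of_real (w x) * exp (cdot z (Y x))) <= P * exp (- k * \<tau>)))"
 using exponential_products[OF assms(1-4,6,7) s12 far, folded e_def Y_def w_def]
 by ((elim exE conjE, rule that, assumption+) | blast)
\<comment> \<open>The radius is fixed here from the geometric data alone, before any
  \<open>f\<close> is considered.\<close>
obtain \<delta> where \<delta>: "\<delta> > 0" and van: "\<forall>F. H.adm F --> H.decay {} \<epsilon> k F -->
 (\<forall>L. compact L --> L \<subseteq> ball 0 \<delta> --> (LINT x|lebesgue. F x * indicator L (Y x)) = 0)"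
 using H.vanishing_on_compact[OF \<epsilon>k] by ((elim exE conjE, rule that, assumption+) | blast)
have OC: "x \<in> closure \<Omega>" if "x \<in> \<Omega>" for x using that closure_subset by blast
have Om: "\<Omega> \<in> sets lebesgue" using assms(3) by (intro sets_completionI_sets) simp
have zero: "AE x in lebesgue. x \<in> ball x0 \<delta> \<inter> \<Omega> --> f x = 0"
 if f: "Linfty_on \<Omega> f" and orth: "\<forall>u v :: real^'n => complex.
 smooth_up_to_boundary \<Omega> u & harmonic_on \<Omega> u & (\<forall>x\<in>frontier \<Omega> - V. u x = 0) &
 smooth_up_to_boundary \<Omega> v & harmonic_on \<Omega> v & (\<forall>x\<in>frontier \<Omega> - V. v x = 0) -->
 (LINT x:\<Omega>|lebesgue. f x * u x * v x) = 0" for f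
proof -
 define f0 where "f0 x = indicator \<Omega> x *\<^sub>R f x" for x
 \<comment> \<open>The weight \<open>w\<close> is |x - c|^(4 - 2 n), the product of the two Kelvin
   factors; it is positive on the domain, so \<open>F\<close> and \<open>f\<close> vanish together
   there.\<close>
 define F where "F x = f0 x * of_real (w x)" for x
 have f0m[measurable]: "f0 \<in> borel_measurable lebesgue" using f by (simp add: Linfty_on_def set_borel_measurable_def f0_def[abs_def])
 obtain C0 where C0: "AE x in lebesgue. x \<in> \<Omega> --> norm (f x) <= C0" using f unfolding Linfty_on_def by blast
 have "\<Omega> \<in> lmeasurable" using assms(2,3) by (rule lmeasurable_open)
 then have "integrable lebesgue (indicator \<Omega> :: _ => real)" by (intro integrable_real_indicator) (auto simp: fmeasurable_def)
 then have iO: "integrable lebesgue (%x. indicator \<Omega> x * C0)" by simp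
 have f0i: "integrable lebesgue f0"
 by (rule Bochner_Integration.integrable_bound[OF iO f0m]) (use C0 in eventually_elim, auto simp: f0_def indicator_def)
 have w_pos: "0 < w x" and w_le: "w x <= (s\<^sup>2) powr (2 - real CARD('n))" if "x \<in> \<Omega>" for x
 proof -
 have "s <= norm (x - c)" by (rule s(3)[OF OC[OF that]])
 then show "0 < w x" "w x <= (s\<^sup>2) powr (2 - real CARD('n))"
 unfolding w_def using s(2) assms(1) by (auto intro!: powr_mono2' power_mono)
 qed
 have f0_out: "f0 x = 0" if "x \<notin> \<Omega>" for x using that by (simp add: f0_def)
 have Fi: "integrable lebesgue F"
 proof (rule Bochner_Integration.integrable_bound)
 show "integrable lebesgue (%x. norm (f0 x) * (s\<^sup>2) powr (2 - real CARD('n)))" using f0i by simp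
 show "F \<in> borel_measurable lebesgue" unfolding F_def[abs_def] by measurable
 have nF: "norm (F x) <= norm (f0 x) * (s\<^sup>2) powr (2 - real CARD('n))" for x
 proof (cases "x \<in> \<Omega>")
 case True
 then show ?thesis using w_pos[OF True] w_le[OF True] by (simp add: F_def norm_mult mult_left_mono)
 qed (simp add: F_def f0_out)
 show "AE x in lebesgue. norm (F x) <= norm (norm (f0 x) * (s\<^sup>2) powr (2 - real CARD('n)))"
 by (rule AE_I2, rule order_trans[OF nF]) (simp only: real_norm_def abs_ge_self)
 qed
 have adm: "H.adm F"
 unfolding H.adm_def
 proof (intro conjI ballI impI)
 fix x assume "F x ~= 0"
 then have "x \<in> \<Omega>" using f0_out[of x] by (auto simp: F_def)
 then show "e \<bullet> Y x <= - (norm (Y x))\<^sup>2 / (2 * s)"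
 unfolding e_def Y_def by (intro inversion_estimates(2)[OF s(1,2)] s(3) OC)
 qed (rule Fi)
 have "norm (LINT x|lebesgue. F x * exp (H.gauss {} \<tau> z x)) <= (P * (LINT x|lebesgue. norm (f0 x))) * exp (- k * \<tau>)"
 if \<tau>: "\<tau> > 0" and z: "!!i. norm (z $ i - of_real (\<tau> * e $ i)) <= \<epsilon> * \<tau>" for \<tau> z
 proof -
 obtain u v where u: "smooth_up_to_boundary \<Omega> u" "harmonic_on \<Omega> u" "\<forall>x\<in>frontier \<Omega> - V. u x = 0"
 and v: "smooth_up_to_boundary \<Omega> v" "harmonic_on \<Omega> v" "\<forall>x\<in>frontier \<Omega> - V. v x = 0"
 and uv: "!!x. x \<in> \<Omega> ==> norm (u x * v x - of_real (w x) * exp (cdot z (Y x))) <= P * exp (- k * \<tau>)"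
 using prods[rule_format, OF \<tau> z] by blast
 define g where "g x = indicator \<Omega> x *\<^sub>R (u x * v x)" for x
 \<comment> \<open>The error made in replacing the weighted exponential by an admissible product;
   the integral of that product against \<open>f\<close> is zero, so the whole transform equals the
   integral of \<open>D\<close>.\<close>
 define D where "D x = F x * exp (H.gauss {} \<tau> z x) - f0 x * g x" for x
 have su: "smooth_on \<Omega> u" and sv: "smooth_on \<Omega> v" using u(2) v(2) by (simp_all add: harmonic_on_def)
 have "continuous_on \<Omega> (%x. u x * v x)"
 by (rule continuous_on_mult[OF smooth_on_imp_continuous_on[OF su] smooth_on_imp_continuous_on[OF sv]])
 then have "g \<in> borel_measurable borel"
 unfolding g_def[abs_def] by (intro borel_measurable_continuous_on_indicator) (use assms(3) in auto)
 then have [measurable]: "g \<in> borel_measurable lebesgue" by (intro measurable_completion) simp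
 have zr: "\<bar>Re (z $ i) - \<tau> * e $ i\<bar> <= \<epsilon> * \<tau>" for i
 using abs_Re_le_cmod[of "z $ i - of_real (\<tau> * e $ i)"] z[of i] by simp
 have Ei: "integrable lebesgue (%x. F x * exp (H.gauss {} \<tau> z x))"
 by (rule H.gauss_bound(1)[OF adm \<tau> less_imp_le[OF \<epsilon>k(1)] zr])
 have Dm: "D \<in> borel_measurable lebesgue"
 unfolding D_def[abs_def] using borel_measurable_integrable[OF Ei] by measurable
 have nD: "norm (D x) <= norm (f0 x) * (P * exp (- k * \<tau>))" for x
 proof (cases "x \<in> \<Omega>")
 case True
 have "D x = - (f0 x * (u x * v x - of_real (w x) * exp (cdot z (Y x))))"
 using True by (simp add: D_def F_def g_def H.gauss_def algebra_simps)
 then show ?thesis using mult_left_mono[OF uv[OF True], of "norm (f0 x)"] by (simp add: norm_mult)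
 qed (simp add: D_def F_def f0_out)
 have bi: "integrable lebesgue (%x. norm (f0 x) * (P * exp (- k * \<tau>)))" using f0i by simp
 have Di: "integrable lebesgue D"
 by (rule Bochner_Integration.integrable_bound[OF bi Dm], rule AE_I2, rule order_trans[OF nD]) (simp only: real_norm_def abs_ge_self)
 have "(LINT x|lebesgue. f0 x * g x) = (LINT x:\<Omega>|lebesgue. f x * u x * v x)"
 unfolding set_lebesgue_integral_def by (intro Bochner_Integration.integral_cong) (auto simp: f0_def g_def indicator_def)
 also have "... = 0" by (rule orth[THEN spec, THEN spec, THEN mp]) (intro conjI u v)
 finally have "(LINT x|lebesgue. F x * exp (H.gauss {} \<tau> z x) - D x) = 0" by (simp add: D_def)
 then have "(LINT x|lebesgue. F x * exp (H.gauss {} \<tau> z x)) = (LINT x|lebesgue. D x)"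
 unfolding Bochner_Integration.integral_diff[OF Ei Di] by simp
 also have "norm ... <= (LINT x|lebesgue. norm (D x))" by (rule integral_norm_bound)
 also have "... <= (LINT x|lebesgue. norm (f0 x) * (P * exp (- k * \<tau>)))" by (rule integral_mono[OF integrable_norm[OF Di] bi nD])
 finally show ?thesis by (simp add: mult_ac)
 qed
 then have dec: "H.decay {} \<epsilon> k F" unfolding H.decay_def by blast
 have AEF: "AE x in lebesgue. x \<in> ball x0 \<delta> \<inter> \<Omega> --> F x = 0"
 proof (rule AE_zero_if_compact_integrals_zero[OF Fi])
 show "ball x0 \<delta> \<inter> \<Omega> \<in> sets lebesgue" using Om by (intro sets.Int) auto
 fix K assume K: "compact K" "K \<subseteq> ball x0 \<delta> \<inter> \<Omega>"
 have nc: "x ~= c" if "x \<in> \<Omega>" for x using s(2) s(3)[OF OC[OF that]] by auto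
 have "continuous_on K Y" unfolding Y_def inversion_def[abs_def] using K(2) nc by (intro continuous_intros) auto
 then have cY: "compact (Y ` K)" by (rule compact_continuous_image[OF _ K(1)])
 \<comment> \<open>Points of the domain are at distance at least \<open>s\<close> from
   \<open>c\<close>, so |Y x| <= |x - x0| and the same radius serves before and after the
   inversion.\<close>
 have "norm (Y x) < \<delta>" if x: "x \<in> K" for x
 proof -
 have xO: "x \<in> \<Omega>" and d: "norm (x - x0) < \<delta>" using x K(2) by (auto simp: dist_norm norm_minus_commute subset_iff)
 have xs: "s <= norm (x - c)" by (rule s(3)[OF OC[OF xO]])
 have "s * norm (x - x0) <= norm (x - c) * norm (x - x0)" using xs by (intro mult_right_mono) auto
 then have "norm (Y x) <= norm (x - x0)"
 unfolding Y_def inversion_estimates(1)[OF s(1,2) xs] using s(2) xs by (subst pos_divide_le_eq) (auto simp: mult.commute)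
 then show ?thesis using d by simp
 qed
 then have sub: "Y ` K \<subseteq> ball 0 \<delta>" by auto
 \<comment> \<open>On the domain the inversion is injective, so testing \<open>Y x\<close> against
   the image of \<open>K\<close> is the same as testing \<open>x\<close> against \<open>K\<close>;
   off the domain \<open>F\<close> is zero.\<close>
 have ind: "F x * indicator (Y ` K) (Y x) = F x * indicator K x" for x
 proof (cases "x \<in> \<Omega>")
 case True
 have "x \<in> K" if y: "y \<in> K" "Y x = Y y" for y
 proof -
 have yO: "y \<in> \<Omega>" using y K(2) by blast
 have "x0 ~= c" using s12 by auto
 from inversion_inj[OF this nc[OF True] nc[OF yO]] have "x = y" using y(2) by (simp add: Y_def)
 then show ?thesis using y by simp
 qed
 then show ?thesis by (auto simp: indicator_def)
 qed (simp add: F_def f0_out)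
 show "(LINT x|lebesgue. F x * indicator K x) = 0" using van[rule_format, OF adm dec cY sub] by (simp only: ind)
 qed
 have "w x ~= 0" if "x \<in> \<Omega>" for x using w_pos[OF that] by simp
 then show ?thesis by (intro eventually_mono[OF AEF]) (auto simp: F_def f0_def)
qed
show ?thesis
proof (intro exI conjI allI impI)
 show "\<delta> > 0" by (rule \<delta>)
qed (erule conjE, rule zero, assumption, assumption)
qed

end
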